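(* Let $G:=W^{k,\Lambda}(\mu)$ with $\Lambda=(\lambda_0,\ldots,\lambda_k)$, and assume that $\lambda_0>1$, or that $\lambda_0=1$, $t\in(1,2]$ and $\lambda_1=\lambda_0$. Let $(M,G,\phi)$ be the manifold of finite measures and $(M_0,G_0,\phi_0)$ the manifold of probability measures defined in the context. Let $$N:=\begin{cases}\lfloor\lambda_0\rfloor & \text{if } t\in(1,2]\text{ and }\lambda_1=\lambda_0,\\ \lceil\lambda_0\rceil-1 & \text{otherwise.}\end{cases}$$ Then $(M_0,G_0,\phi_0)$ is a $C^N$-embedded submanifold of $(M,G,\phi)$.
   Context: $\mathbb{N}=\{1,2,\ldots\}$. Reference measure: fix $t\in(0,2]$ and a strictly increasing function $\theta:[0,\infty)\to[0,\infty)$, twice continuously differentiable on $(0,\infty)$, with $\lim_{z\downarrow0}\theta'(z)<\infty$, $\theta(0)=0$, and $\theta(z)=c+z^t$ for all $z\ge z_t$ (with $z>0$), where $z_t\ge0$ and $c\in\mathbb{R}$ are constants; if $t\in(1,2]$, both $\theta$ and $-\sqrt{\theta}$ are also required to be convex. For $d\in\mathbb{N}$, $\mu$ is the probability measure on $(\mathbb{R}^d,\mathcal{X})$, with $\mathcal{X}$ the Lebesgue measurable subsets of $\mathbb{R}^d$, given by $\mu(dx)=r(x)\,dx$, $r=\exp(l)$, $l(x)=\sum_{i=1}^d(C-\theta(|x_i|))$, where $C\in\mathbb{R}$ is such that $\int_{\mathbb{R}}\exp(C-\theta(|z|))\,dz=1$. $\mathbf{E}_\mu$ denotes integration with respect to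 $\mu$. Sobolev spaces: for $k\in\mathbb{N}$ and $\Lambda=(\lambda_0,\ldots,\lambda_k)$ with $1\le\lambda_k\le\lambda_{k-1}\le\cdots\le\lambda_0<\infty$, $W^{k,\Lambda}(\mu)$ is the Banach space of real-valued functions $a\in L^{\lambda_0}(\mu)$ having weak partial derivatives $D^sa\in L^{\lambda_{|s|}}(\mu)$ for all multi-indices $s$ with $1\le|s|\le k$, with norm $\|a\|_{W^{k,\Lambda}(\mu)}=\big(\sum_{0\le|s|\le k}\|D^sa\|_{L^{\lambda_{|s|}}(\mu)}^{\lambda_0}\big)^{1/\lambda_0}$. Manifolds: $\log_d y:=y-1+\log y$ for $y>0$. $M$ is the set of finite measures $P$ on $(\mathbb{R}^d,\mathcal{X})$ that are mutually absolutely continuous with respect to $\mu$ and whose density $p=dP/d\mu$ satisfies $\log_d p\in G$; it is a manifold modelled on $G$ with the single global chart $\phi:M\to G$, $\phi(P)=\log_d p$ (a bijection). $M_0:=\{P\in M:\mathbf{E}_\mu p=1\}$, $G_0:=\{a\in G:\mathbf{E}_\mu a=0\}$, and $M_0$ is a manifold modelled on $G_0$ with the single global chart $\phi_0:M_0\to G_0$, $\phi_0(P)=\log_d p-\mathbf{E}_\mu\log_d p$ (a bijection). That $(M_0,G_0,\phi_0)$ is a $C^N$-embedded submanifold of $(M,G,\phi)$ means that the inclusion map $M_0\to M$, which in charts is $\rho:=\phi\circ\phi_0^{-1}:G_0\to G$, is of class $C^N$, is a homeomorphism onto its image (with the relative topology), and is an immersion: at every $a\in G_0$ the derivative $\rho^{(1)}_a$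 is a toplinear isomorphism onto a closed subspace of $G$ that splits $G$ (i.e. has a closed complement in $G$). *)

theory Defs
  imports "HOL-Analysis.Analysis"
begin

section \<open>Calculus on normed spaces given by a carrier and a norm\<close>

text \<open>
  A Sobolev space depends on term parameters (the measure, the order, the exponents), so it is not
  a type. Normed spaces are therefore given by a linear subspace \<open>E\<close> of a real vector space together
  with a function \<open>nE\<close> that is a norm on \<open>E\<close>.
\<close>

text \<open>
  The case distinction is there because \<^const>\<open>Metric_space\<close> demands symmetry and nonnegativity
  outside the carrier as well.
\<close>

definition norm_topology :: "'v::real_vector set \<Rightarrow> ('v \<Rightarrow> real) \<Rightarrow> 'v topology" where
  "norm_topology E nE =
     Metric_space.mtopology E (\<lambda>x y. if x \<in> E \<and> y \<in> E then nE (x - y) else 0)"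

definition linear_between ::
  "'v::real_vector set \<Rightarrow> 'w::real_vector set \<Rightarrow> ('v \<Rightarrow> 'w) \<Rightarrow> bool" where
  "linear_between E F A \<longleftrightarrow> A ` E \<subseteq> F \<and>
     (\<forall>x\<in>E. \<forall>y\<in>E. A (x + y) = A x + A y) \<and> (\<forall>c. \<forall>x\<in>E. A (c *\<^sub>R x) = c *\<^sub>R A x)"

text \<open>A \<open>j\<close>-linear map \<open>E \<times> \<dots> \<times> E \<rightarrow> F\<close> takes its arguments as a list of length \<open>j\<close>.\<close>

definition mlin_bounds ::
  "nat \<Rightarrow> 'v set \<Rightarrow> ('v \<Rightarrow> real) \<Rightarrow> ('w \<Rightarrow> real) \<Rightarrow> ('v list \<Rightarrow> 'w) \<Rightarrow> real set" where
  "mlin_bounds j E nE nF L =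
     {K. 0 \<le> K \<and> (\<forall>hs. length hs = j \<and> set hs \<subseteq> E \<longrightarrow> nF (L hs) \<le> K * prod_list (map nE hs))}"

definition bounded_mlin ::
  "nat \<Rightarrow> 'v::real_vector set \<Rightarrow> ('v \<Rightarrow> real) \<Rightarrow> 'w::real_vector set \<Rightarrow> ('w \<Rightarrow> real) \<Rightarrow>
   ('v list \<Rightarrow> 'w) \<Rightarrow> bool" where
  "bounded_mlin j E nE F nF L \<longleftrightarrow>
     (\<forall>hs. length hs = j \<and> set hs \<subseteq> E \<longrightarrow>
        L hs \<in> F \<and> (\<forall>i<j. linear_between E F (\<lambda>x. L (hs[i := x])))) \<and>
     mlin_bounds j E nE nF L \<noteq> {}"

definition mlin_norm ::
  "nat \<Rightarrow> 'v set \<Rightarrow> ('v \<Rightarrow> real) \<Rightarrow> ('w \<Rightarrow> real) \<Rightarrow> ('v list \<Rightarrow> 'w) \<Rightarrow> real" where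
  "mlin_norm j E nE nF L = Inf (mlin_bounds j E nE nF L)"

text \<open>
  Frechet derivative of \<open>f\<close> at \<open>a\<close>, where \<open>n\<close> is the norm on the target. The target type is
  only required to have a subtraction so that spaces of multilinear maps, with pointwise
  subtraction, are admitted.
\<close>

definition has_frechet_derivative ::
  "'v::real_vector set \<Rightarrow> ('v \<Rightarrow> real) \<Rightarrow> ('x::minus \<Rightarrow> real) \<Rightarrow> ('v \<Rightarrow> 'x) \<Rightarrow> ('v \<Rightarrow> 'x) \<Rightarrow> 'v \<Rightarrow> bool"
  where
  "has_frechet_derivative E nE n f A a \<longleftrightarrow>
     (\<forall>\<epsilon>>0. \<exists>\<delta>>0. \<forall>h\<in>E. nE h < \<delta> \<longrightarrow> n (f (a + h) - f a - A h) \<le> \<epsilon> * nE h)"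

text \<open>
  \<open>f : E \<rightarrow> F\<close> is of class \<open>C\<^sup>N\<close>. The \<open>j\<close>-th derivative \<open>D j a\<close> is a bounded \<open>j\<close>-linear map, by the
  isometry of \<open>L(E, L(E, \<dots>))\<close> with the space of bounded multilinear maps under the operator norm.
\<close>

definition C_map ::
  "nat \<Rightarrow> 'v::real_vector set \<Rightarrow> ('v \<Rightarrow> real) \<Rightarrow> 'w::real_vector set \<Rightarrow> ('w \<Rightarrow> real) \<Rightarrow> ('v \<Rightarrow> 'w) \<Rightarrow> bool"
  where
  "C_map N E nE F nF f \<longleftrightarrow> (\<exists>D :: nat \<Rightarrow> 'v \<Rightarrow> 'v list \<Rightarrow> 'w.
     (\<forall>a\<in>E. D 0 a [] = f a) \<and>
     (\<forall>j\<le>N. \<forall>a\<in>E. bounded_mlin j E nE F nF (D j a)) \<and>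
     (\<forall>j<N. \<forall>a\<in>E. has_frechet_derivative E nE (mlin_norm j E nE nF)
        (D j) (\<lambda>h hs. D (Suc j) a (h # hs)) a) \<and>
     (\<forall>a\<in>E. \<forall>\<epsilon>>0. \<exists>\<delta>>0. \<forall>b\<in>E. nE (b - a) < \<delta> \<longrightarrow> mlin_norm N E nE nF (D N b - D N a) < \<epsilon>))"

definition toplinear_iso_onto_image ::
  "'v::real_vector set \<Rightarrow> ('v \<Rightarrow> real) \<Rightarrow> 'w::real_vector set \<Rightarrow> ('w \<Rightarrow> real) \<Rightarrow> ('v \<Rightarrow> 'w) \<Rightarrow> bool" where
  "toplinear_iso_onto_image E nE F nF A \<longleftrightarrow>
     linear_between E F A \<and> embedding_map (norm_topology E nE) (norm_topology F nF) A"

definition closed_subspace_in :: "'w::real_vector set \<Rightarrow> ('w \<Rightarrow> real) \<Rightarrow> 'w set \<Rightarrow> bool" where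
  "closed_subspace_in F nF S \<longleftrightarrow> subspace S \<and> closedin (norm_topology F nF) S"

definition splits :: "'w::real_vector set \<Rightarrow> ('w \<Rightarrow> real) \<Rightarrow> 'w set \<Rightarrow> bool" where
  "splits F nF S \<longleftrightarrow> (\<exists>S'. closed_subspace_in F nF S' \<and> S \<inter> S' = {0} \<and> {x + y |x y. x \<in> S \<and> y \<in> S'} = F)"

definition immersion ::
  "'v::real_vector set \<Rightarrow> ('v \<Rightarrow> real) \<Rightarrow> 'w::real_vector set \<Rightarrow> ('w \<Rightarrow> real) \<Rightarrow> ('v \<Rightarrow> 'w) \<Rightarrow> bool" where
  "immersion E nE F nF f \<longleftrightarrow> (\<forall>a\<in>E. \<exists>A. has_frechet_derivative E nE nF f A a \<and>
     toplinear_iso_onto_image E nE F nF A \<and> closed_subspace_in F nF (A ` E) \<and> splits F nF (A ` E))"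

text \<open>
  Manifolds \<open>(M\<^sub>0, G\<^sub>0, \<phi>\<^sub>0)\<close> and \<open>(M, G, \<phi>)\<close> with one global chart each. Since \<open>\<phi>\<^sub>0\<close> is a bijection
  onto \<open>G\<^sub>0\<close>, the function \<open>\<phi> \<circ> inv_into M\<^sub>0 \<phi>\<^sub>0\<close> is the inclusion \<open>M\<^sub>0 \<rightarrow> M\<close> in charts.
\<close>

definition embedded_submanifold ::
  "nat \<Rightarrow> 'm set \<Rightarrow> 'v::real_vector set \<Rightarrow> ('v \<Rightarrow> real) \<Rightarrow> ('m \<Rightarrow> 'v) \<Rightarrow>
   'm set \<Rightarrow> 'w::real_vector set \<Rightarrow> ('w \<Rightarrow> real) \<Rightarrow> ('m \<Rightarrow> 'w) \<Rightarrow> bool" where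
  "embedded_submanifold N M\<^sub>0 G\<^sub>0 n\<^sub>0 \<phi>\<^sub>0 M G n \<phi> \<longleftrightarrow>
     M\<^sub>0 \<subseteq> M \<and> bij_betw \<phi>\<^sub>0 M\<^sub>0 G\<^sub>0 \<and> bij_betw \<phi> M G \<and>
     (let \<rho> = \<phi> \<circ> inv_into M\<^sub>0 \<phi>\<^sub>0 in
        C_map N G\<^sub>0 n\<^sub>0 G n \<rho> \<and>
        embedding_map (norm_topology G\<^sub>0 n\<^sub>0) (norm_topology G n) \<rho> \<and>
        immersion G\<^sub>0 n\<^sub>0 G n \<rho>)"

section \<open>Functions on \<open>\<real>\<^sup>d\<close> modulo equality almost everywhere\<close>

text \<open>
  The reference measure below has a strictly positive density, so its null sets are those of
  Lebesgue measure and one quotient serves for all its Lebesgue and Sobolev spaces.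
  Measurability is imposed in these spaces; as \<^const>\<open>lebesgue\<close> is complete, it does not depend
  on the representative.
\<close>

quotient_type (overloaded) 'd ae_fun =
  "(real^'d::finite) \<Rightarrow> real" / "\<lambda>f g. AE x in lebesgue. f x = g x"
proof (rule equivpI)
  show "reflp (\<lambda>f g :: (real^'d) \<Rightarrow> real. AE x in lebesgue. f x = g x)"
    by (rule reflpI) simp
  show "symp (\<lambda>f g :: (real^'d) \<Rightarrow> real. AE x in lebesgue. f x = g x)"
    by (rule sympI) (auto elim: AE_mp)
  show "transp (\<lambda>f g :: (real^'d) \<Rightarrow> real. AE x in lebesgue. f x = g x)"
    by (rule transpI) (auto elim: AE_mp)
qed

instantiation ae_fun :: (finite) real_vector
begin

lift_definition zero_ae_fun :: "'a ae_fun" is "\<lambda>_. 0" .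
lift_definition plus_ae_fun :: "'a ae_fun \<Rightarrow> 'a ae_fun \<Rightarrow> 'a ae_fun" is "\<lambda>f g x. f x + g x"
  by (auto elim: AE_mp)
lift_definition minus_ae_fun :: "'a ae_fun \<Rightarrow> 'a ae_fun \<Rightarrow> 'a ae_fun" is "\<lambda>f g x. f x - g x"
  by (auto elim: AE_mp)
lift_definition uminus_ae_fun :: "'a ae_fun \<Rightarrow> 'a ae_fun" is "\<lambda>f x. - f x"
  by (auto elim: AE_mp)
lift_definition scaleR_ae_fun :: "real \<Rightarrow> 'a ae_fun \<Rightarrow> 'a ae_fun" is "\<lambda>c f x. c * f x"
  by (auto elim: AE_mp)

instance
  by standard (transfer; simp add: algebra_simps)+

end

text \<open>
  The following notions are used for measures \<open>\<nu>\<close> with the null sets of Lebesgue measure; then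
  they do not depend on the representative.
\<close>

definition Lp_space :: "(real^'d::finite) measure \<Rightarrow> real \<Rightarrow> 'd ae_fun set" where
  "Lp_space \<nu> p = {u. rep_ae_fun u \<in> borel_measurable \<nu> \<and> integrable \<nu> (\<lambda>x. \<bar>rep_ae_fun u x\<bar> powr p)}"

definition Lp_norm :: "(real^'d::finite) measure \<Rightarrow> real \<Rightarrow> 'd ae_fun \<Rightarrow> real" where
  "Lp_norm \<nu> p u = (LINT x|\<nu>. \<bar>rep_ae_fun u x\<bar> powr p) powr (1 / p)"

definition mean :: "(real^'d::finite) measure \<Rightarrow> 'd ae_fun \<Rightarrow> real" where
  "mean \<nu> u = (LINT x|\<nu>. rep_ae_fun u x)"

section \<open>Weak derivatives and weighted Sobolev spaces\<close>

definition partial_deriv :: "'d::finite \<Rightarrow> (real^'d \<Rightarrow> real) \<Rightarrow> real^'d \<Rightarrow> real" where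
  "partial_deriv i f x = deriv (\<lambda>h. f (x + h *\<^sub>R axis i 1)) 0"

primrec C_fun :: "nat \<Rightarrow> (real^'d::finite \<Rightarrow> real) \<Rightarrow> bool" where
  "C_fun 0 f \<longleftrightarrow> continuous_on UNIV f"
| "C_fun (Suc n) f \<longleftrightarrow> (\<forall>x. f differentiable (at x)) \<and> (\<forall>i. C_fun n (partial_deriv i f))"

definition test_functions :: "(real^'d::finite \<Rightarrow> real) set" where
  "test_functions = {f. (\<forall>n. C_fun n f) \<and> compact (closure {x. f x \<noteq> 0})}"

type_synonym 'd multi_index = "'d \<Rightarrow> nat"

definition order_of :: "'d::finite multi_index \<Rightarrow> nat" where
  "order_of s = (\<Sum>i\<in>UNIV. s i)"

text \<open>
  An index type carries no order, so one enumeration of the coordinates is chosen. The choice is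
  irrelevant for the smooth functions to which this is applied.
\<close>

definition coordinates :: "'d::finite list" where
  "coordinates = (SOME is. distinct is \<and> set is = UNIV)"

definition multi_deriv :: "'d::finite multi_index \<Rightarrow> (real^'d \<Rightarrow> real) \<Rightarrow> real^'d \<Rightarrow> real" where
  "multi_deriv s f = foldr (\<lambda>i. partial_deriv i ^^ s i) coordinates f"

definition locally_integrable :: "(real^'d::finite \<Rightarrow> real) \<Rightarrow> bool" where
  "locally_integrable f \<longleftrightarrow> (\<forall>K. compact K \<longrightarrow> set_integrable lebesgue K f)"

definition has_weak_derivative :: "'d::finite multi_index \<Rightarrow> 'd ae_fun \<Rightarrow> 'd ae_fun \<Rightarrow> bool" where
  "has_weak_derivative s u v \<longleftrightarrow>
     locally_integrable (rep_ae_fun u) \<and> locally_integrable (rep_ae_fun v) \<and>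
     (\<forall>f\<in>test_functions. (LINT x|lebesgue. rep_ae_fun u x * multi_deriv s f x) =
        (-1) ^ order_of s * (LINT x|lebesgue. rep_ae_fun v x * f x))"

definition weak_deriv :: "'d::finite multi_index \<Rightarrow> 'd ae_fun \<Rightarrow> 'd ae_fun" where
  "weak_deriv s u = (THE v. has_weak_derivative s u v)"

definition sobolev_space ::
  "(real^'d::finite) measure \<Rightarrow> nat \<Rightarrow> (nat \<Rightarrow> real) \<Rightarrow> 'd ae_fun set" where
  "sobolev_space \<nu> k \<Lambda> = {u \<in> Lp_space \<nu> (\<Lambda> 0). \<forall>s. 1 \<le> order_of s \<and> order_of s \<le> k \<longrightarrow>
     (\<exists>v \<in> Lp_space \<nu> (\<Lambda> (order_of s)). has_weak_derivative s u v)}"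

definition sobolev_norm ::
  "(real^'d::finite) measure \<Rightarrow> nat \<Rightarrow> (nat \<Rightarrow> real) \<Rightarrow> 'd ae_fun \<Rightarrow> real" where
  "sobolev_norm \<nu> k \<Lambda> u =
     (\<Sum>s | order_of s \<le> k. Lp_norm \<nu> (\<Lambda> (order_of s)) (weak_deriv s u) powr \<Lambda> 0) powr (1 / \<Lambda> 0)"

section \<open>The reference measure and the statistical manifolds\<close>

text \<open>The values of \<open>\<theta>\<close> on the negative half-line are irrelevant.\<close>

definition admissible_potential :: "real \<Rightarrow> (real \<Rightarrow> real) \<Rightarrow> bool" where
  "admissible_potential t \<theta> \<longleftrightarrow>
     \<theta> ` {0..} \<subseteq> {0..} \<and> strict_mono_on {0..} \<theta> \<and> \<theta> 0 = 0 \<and>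
     (\<exists>\<theta>' \<theta>''. (\<forall>z>0. (\<theta> has_real_derivative \<theta>' z) (at z) \<and> (\<theta>' has_real_derivative \<theta>'' z) (at z)) \<and>
        continuous_on {0<..} \<theta>'' \<and> (\<exists>L. (\<theta>' \<longlongrightarrow> L) (at_right 0))) \<and>
     (\<exists>z\<^sub>t\<ge>0. \<exists>c. \<forall>z\<ge>z\<^sub>t. 0 < z \<longrightarrow> \<theta> z = c + z powr t) \<and>
     (1 < t \<longrightarrow> convex_on {0..} \<theta> \<and> convex_on {0..} (\<lambda>z. - sqrt (\<theta> z)))"

definition reference_measure :: "real \<Rightarrow> (real \<Rightarrow> real) \<Rightarrow> (real^'d::finite) measure" where
  "reference_measure C \<theta> = density lebesgue (\<lambda>x. ennreal (exp (\<Sum>i\<in>UNIV. C - \<theta> \<bar>x $ i\<bar>)))"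

definition log_d :: "real \<Rightarrow> real" where
  "log_d y = y - 1 + ln y"

definition real_density :: "'a measure \<Rightarrow> 'a measure \<Rightarrow> 'a \<Rightarrow> real" where
  "real_density \<nu> P x = enn2real (RN_deriv \<nu> P x)"

definition chart :: "(real^'d::finite) measure \<Rightarrow> (real^'d) measure \<Rightarrow> 'd ae_fun" where
  "chart \<nu> P = abs_ae_fun (\<lambda>x. log_d (real_density \<nu> P x))"

definition finite_measures ::
  "(real^'d::finite) measure \<Rightarrow> 'd ae_fun set \<Rightarrow> (real^'d) measure set" where
  "finite_measures \<nu> G = {P. sets P = sets \<nu> \<and> finite_measure P \<and>
     absolutely_continuous \<nu> P \<and> absolutely_continuous P \<nu> \<and> chart \<nu> P \<in> G}"

definition prob_measures ::
  "(real^'d::finite) measure \<Rightarrow> 'd ae_fun set \<Rightarrow> (real^'d) measure set" where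
  "prob_measures \<nu> G = {P \<in> finite_measures \<nu> G. (LINT x|\<nu>. real_density \<nu> P x) = 1}"

definition centred :: "(real^'d::finite) measure \<Rightarrow> 'd ae_fun set \<Rightarrow> 'd ae_fun set" where
  "centred \<nu> G = {u \<in> G. mean \<nu> u = 0}"

definition chart\<^sub>0 :: "(real^'d::finite) measure \<Rightarrow> (real^'d) measure \<Rightarrow> 'd ae_fun" where
  "chart\<^sub>0 \<nu> P = chart \<nu> P - abs_ae_fun (\<lambda>_. mean \<nu> (chart \<nu> P))"

definition smoothness_order :: "real \<Rightarrow> (nat \<Rightarrow> real) \<Rightarrow> nat" where
  "smoothness_order t \<Lambda> =
     (if 1 < t \<and> t \<le> 2 \<and> \<Lambda> 1 = \<Lambda> 0 then nat \<lfloor>\<Lambda> 0\<rfloor> else nat (\<lceil>\<Lambda> 0\<rceil> - 1))"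

end

theory Submission
  imports Defs "HOL-Computational_Algebra.Polynomial" "HOL-Probability.Probability_Measure"
begin

text \<open>
  A density \<open>p\<close> is recovered from its chart \<open>a = log_d p\<close> by \<open>p = exp_d a\<close>, where \<open>exp_d\<close> inverts \<open>log_d\<close>
  and has bounded derivatives of all positive orders. In charts the inclusion is \<open>a \<mapsto> a + Z a\<close>, where
  the constant \<open>Z a\<close> is determined by \<open>E (exp_d (a + Z a)) = 1\<close>; it is inverted by subtracting the mean.
  Implicit differentiation gives \<open>Z' h = - E (exp_d' h) / E exp_d'\<close>, and all higher derivatives of \<open>Z\<close>
  are polynomials in \<open>1 / E exp_d'\<close> and moments \<open>E (exp_d\<^sup>(\<^sup>m\<^sup>) h\<^sub>1 \<dots> h\<^sub>j)\<close>. These moments are bounded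
  for \<open>j \<le> \<lambda>\<^sub>0\<close>. For \<open>j < \<lambda>\<^sub>0\<close> they depend continuously on \<open>a\<close> by truncation. In the critical case
  \<open>j = \<lambda>\<^sub>0 = \<lambda>\<^sub>1\<close> with \<open>t > 1\<close>, continuity follows from uniform integrability of \<open>\<bar>h\<bar>\<^sup>j\<close> over the unit
  ball: differences of \<open>h\<close> are controlled by its weak derivatives, and the density of the reference
  measure decays by an arbitrarily large factor over a step of fixed length far from the origin.
\<close>

section \<open>The inverse of \<open>log_d\<close>\<close>

text \<open>In charts the inclusion differs from the identity only by a multiple of the constant
  function 1, so smoothness, embedding and splitting all come down to the real function
  \<open>Z\<close>. The obstacle is uniformity over directions. A derivative of order j pairs j
  directions with a bounded weight, and its operator norm is governed by the integrals of the weight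
  against N-th powers of single directions in the unit ball. When the base point moves by a small h,
  the weights change by functions that stay bounded and are small in L1, but not small in the
  supremum norm. Hence what the space has to provide is that bounded weights with small L1 norm have
  small integrals against N-th powers, uniformly on the unit ball; this requirement fixes N. The
  function \<open>exp_d\<close> itself is unbounded and never occurs as a weight. It enters only
  through the equation that defines \<open>Z\<close>: the expectation there is constant, so its
  first-order expansion yields the derivative of \<open>Z\<close>.\<close>

definition exp_d :: "real \<Rightarrow> real" where
  "exp_d x = (THE y. 0 < y \<and> log_d y = x)"

text \<open>The summand y has slope one and \<open>ln\<close> is increasing. Injectivity of
  \<open>log_d\<close>, monotonicity of its inverse and the Lipschitz constant 1 all rest on
  this.\<close>

lemma log_d_diff_ge:
  assumes "0 < u" "u \<le> v"
  shows "v - u \<le> log_d v - log_d u"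
  using assms ln_le_cancel_iff[of u v] by (simp add: log_d_def)

lemma log_d_inject:
  assumes "0 < u" "0 < v" "log_d u = log_d v"
  shows "u = v"
  using log_d_diff_ge[of u v] log_d_diff_ge[of v u] assms by linarith

lemma log_d_surj: "\<exists>y>0. log_d y = x"
proof -
  \<comment> \<open>With y = exp u the equation is continuous on the whole line. The end points lie
    one beyond \<open>min x 0\<close> and \<open>max x 0\<close>, where exp u - 1 is at most,
    respectively at least, zero.\<close>
  have "\<exists>u\<ge>min x 0 - 1. u \<le> max x 0 + 1 \<and> exp u - 1 + u = x"
  proof (rule IVT')
    have "exp (min x 0 - 1) \<le> 1" by simp
    then show "exp (min x 0 - 1) - 1 + (min x 0 - 1) \<le> x" by linarith
    have "exp (max x 0 + 1) \<ge> 1" by simp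
    then show "x \<le> exp (max x 0 + 1) - 1 + (max x 0 + 1)" by linarith
  qed (auto intro!: continuous_intros)
  then obtain u where "exp u - 1 + u = x" by blast
  then show ?thesis by (intro exI[of _ "exp u"]) (simp add: log_d_def)
qed

lemma exp_d: "0 < exp_d x" "log_d (exp_d x) = x"
proof -
  have "\<exists>!y. 0 < y \<and> log_d y = x" using log_d_surj log_d_inject by blast
  then have "0 < exp_d x \<and> log_d (exp_d x) = x" unfolding exp_d_def by (rule theI')
  then show "0 < exp_d x" "log_d (exp_d x) = x" by auto
qed

lemma exp_d_log_d: "0 < y \<Longrightarrow> exp_d (log_d y) = y"
  using exp_d log_d_inject by blast

lemma exp_d_0: "exp_d 0 = 1"
  using exp_d_log_d[of 1] by (simp add: log_d_def)

lemma exp_d_mono: "x \<le> y \<Longrightarrow> exp_d x \<le> exp_d y"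
  using log_d_diff_ge[of "exp_d y" "exp_d x"] exp_d[of x] exp_d[of y] by fastforce

lemma exp_d_lipschitz: "\<bar>exp_d x - exp_d y\<bar> \<le> \<bar>x - y\<bar>"
proof -
  have *: "\<bar>exp_d x - exp_d y\<bar> \<le> \<bar>x - y\<bar>" if "x \<le> y" for x y
    using log_d_diff_ge[of "exp_d x" "exp_d y"] exp_d[of x] exp_d[of y] exp_d_mono[OF that] by auto
  show ?thesis using *[of x y] *[of y x] by linarith
qed

text \<open>Drops the term -y from ln y = x + 1 - y. The bound supplies the decay at minus infinity
  that the normalising constant needs.\<close>

lemma exp_d_le_exp: "exp_d x \<le> exp (x + 1)"
proof -
  have "ln (exp_d x) \<le> x + 1" using exp_d[of x] by (simp add: log_d_def)
  then show ?thesis using exp_d(1)[of x] ln_le_cancel_iff[of "exp_d x" "exp (x+1)"] by simp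
qed

section \<open>Derivatives of \<open>exp_d\<close> and their first-order remainders\<close>

lemma isCont_exp_d: "isCont exp_d x"
  unfolding continuous_at_eps_delta
  using exp_d_lipschitz by (metis dist_real_def order_le_less_trans)

text \<open>The derivative of \<open>exp_d\<close>: it is 1 / (1 + 1 / y) at y =
  \<open>exp_d x\<close>, because \<open>log_d\<close> has slope 1 + 1 / y.\<close>

definition logit_d :: "real \<Rightarrow> real" where
  "logit_d x = exp_d x / (1 + exp_d x)"

lemma logit_d_bounds: "0 < logit_d x" "logit_d x < 1"
  using exp_d(1)[of x] by (auto simp: logit_d_def field_simps)

lemma logit_d_mono: "x \<le> y \<Longrightarrow> logit_d x \<le> logit_d y"
  using exp_d(1)[of x] exp_d(1)[of y] exp_d_mono[of x y] by (simp add: logit_d_def field_simps)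

lemma exp_d_has_derivative: "(exp_d has_real_derivative logit_d x) (at x)"
proof -
  have "(log_d has_real_derivative (1 + 1 / exp_d x)) (at (exp_d x))"
    unfolding log_d_def[abs_def] using exp_d(1)[of x]
    by (auto intro!: derivative_eq_intros simp: field_simps)
  then have "(exp_d has_real_derivative inverse (1 + 1 / exp_d x)) (at x)"
    by (rule DERIV_inverse_function[of log_d _ _ _ "x - 1" "x + 1"])
      (use exp_d[of x] exp_d isCont_exp_d add_pos_pos[of 1 "1 / exp_d x"] in \<open>auto simp: field_simps\<close>)
  moreover have "inverse (1 + 1 / exp_d x) = logit_d x"
    using exp_d(1)[of x] by (simp add: logit_d_def field_simps)
  ultimately show ?thesis by simp
qed

lemma logit_d_has_derivative:
  "(logit_d has_real_derivative logit_d x * (1 - logit_d x)\<^sup>2) (at x)"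
proof -
  have "0 < 1 + exp_d x" using exp_d(1)[of x] by simp
  then show ?thesis
    unfolding logit_d_def[abs_def]
    by (auto intro!: derivative_eq_intros exp_d_has_derivative
      simp: logit_d_def divide_simps power2_eq_square power3_eq_cube) (simp add: algebra_simps)?
qed

text \<open>With L = \<open>logit_d x\<close> one has L' = L (1 - L)^2, so the derivative of p(L) is
  p'(L) L (1 - L)^2. The recursion records this.\<close>

primrec exp_d_poly :: "nat \<Rightarrow> real poly" where
  "exp_d_poly 0 = [:0, 1:]"
| "exp_d_poly (Suc m) = pderiv (exp_d_poly m) * [:0, 1:] * [:1, -1:]\<^sup>2"

text \<open>All derivatives of \<open>exp_d\<close> of positive order are polynomials in the first one, which takes
  values in \<open>(0, 1)\<close>; hence they are bounded.\<close>

primrec exp_d_deriv :: "nat \<Rightarrow> real \<Rightarrow> real" where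
  "exp_d_deriv 0 x = exp_d x"
| "exp_d_deriv (Suc m) x = poly (exp_d_poly m) (logit_d x)"

lemma exp_d_deriv_1 [simp]: "exp_d_deriv (Suc 0) x = logit_d x"
  by simp

lemma exp_d_deriv_has_derivative:
  "(exp_d_deriv m has_real_derivative exp_d_deriv (Suc m) x) (at x)"
proof (cases m)
  case 0
  moreover have "exp_d_deriv 0 = exp_d" by (rule ext) simp
  ultimately show ?thesis using exp_d_has_derivative[of x] by simp
next
  case (Suc k)
  have "((\<lambda>x. poly (exp_d_poly k) (logit_d x)) has_real_derivative
    poly (pderiv (exp_d_poly k)) (logit_d x) * (logit_d x * (1 - logit_d x)\<^sup>2)) (at x)"
    by (rule DERIV_chain2[OF poly_DERIV logit_d_has_derivative])
  moreover have "exp_d_deriv m = (\<lambda>x. poly (exp_d_poly k) (logit_d x))" by (rule ext) (simp add: Suc)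
  ultimately show ?thesis using Suc by (simp add: ac_simps)
qed

lemma exp_d_deriv_bounded: "\<exists>K\<ge>0. \<forall>x. \<bar>exp_d_deriv (Suc m) x\<bar> \<le> K"
proof -
  have "compact (poly (exp_d_poly m) ` {0..1})"
    by (intro compact_continuous_image continuous_intros) auto
  then obtain K where K: "\<And>y. y \<in> {0..1} \<Longrightarrow> \<bar>poly (exp_d_poly m) y\<bar> \<le> K"
    unfolding bounded_iff[THEN iffD1, OF compact_imp_bounded] 
    using compact_imp_bounded bounded_iff by (metis image_eqI real_norm_def)
  have "\<bar>exp_d_deriv (Suc m) x\<bar> \<le> K" for x
    using K[of "logit_d x"] logit_d_bounds[of x] by simp
  moreover from this[of 0] have "0 \<le> K" by linarith
  ultimately show ?thesis by blast
qed

lemma isCont_exp_d_deriv: "isCont (exp_d_deriv m) x"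
  using exp_d_deriv_has_derivative DERIV_isCont by blast

lemma borel_measurable_exp_d_deriv [measurable]: "exp_d_deriv m \<in> borel_measurable borel"
  by (intro borel_measurable_continuous_onI continuous_at_imp_continuous_on ballI isCont_exp_d_deriv)

lemma borel_measurable_exp_d [measurable]: "exp_d \<in> borel_measurable borel"
  by (intro borel_measurable_continuous_onI continuous_at_imp_continuous_on ballI isCont_exp_d)

lemma exp_d_deriv_mvt:
  "\<exists>\<xi>. exp_d_deriv m (x + w) - exp_d_deriv m x = exp_d_deriv (Suc m) \<xi> * w \<and> \<bar>\<xi> - x\<bar> \<le> \<bar>w\<bar>"
proof -
  have *: "\<exists>\<xi>. exp_d_deriv m b - exp_d_deriv m a = (b - a) * exp_d_deriv (Suc m) \<xi> \<and> a < \<xi> \<and> \<xi> < b"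
    if "a < b" for a b
    using MVT2[OF that, of "exp_d_deriv m" "exp_d_deriv (Suc m)"] exp_d_deriv_has_derivative by blast
  consider "w = 0" | "w > 0" | "w < 0" by linarith
  then show ?thesis
  proof cases
    case 1
    then show ?thesis by auto
  next
    case 2
    then show ?thesis using *[of x "x + w"] by (force simp: mult.commute)
  next
    case 3
    then obtain \<xi> where "exp_d_deriv m x - exp_d_deriv m (x + w) = (- w) * exp_d_deriv (Suc m) \<xi>"
      "x + w < \<xi>" "\<xi> < x"
      using *[of "x + w" x] by auto
    then show ?thesis by (intro exI[of _ \<xi>]) (auto simp: algebra_simps)
  qed
qed

text \<open>The remainder of the first-order expansion divided by the increment. The factor
  \<open>w\<close> is kept apart because it will be an unbounded direction plus a constant, while
  the quotient is bounded and can serve as a weight.\<close>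

definition slope_error :: "nat \<Rightarrow> real \<Rightarrow> real \<Rightarrow> real" where
  "slope_error m x w = (if w = 0 then 0
     else (exp_d_deriv m (x + w) - exp_d_deriv m x) / w - exp_d_deriv (Suc m) x)"

lemma borel_measurable_slope_error [measurable]:
  assumes [measurable]: "f \<in> borel_measurable M" "g \<in> borel_measurable M"
  shows "(\<lambda>x. slope_error m (f x) (g x)) \<in> borel_measurable M"
  unfolding slope_error_def by measurable

lemma exp_d_deriv_expand:
  "exp_d_deriv m (x + w) = exp_d_deriv m x + exp_d_deriv (Suc m) x * w + slope_error m x w * w"
  by (simp add: slope_error_def field_simps del: exp_d_deriv.simps)

lemma exp_d_deriv_lipschitz:
  "\<exists>K\<ge>0. \<forall>x w. \<bar>exp_d_deriv m (x + w) - exp_d_deriv m x\<bar> \<le> K * \<bar>w\<bar>"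
proof -
  obtain K where K: "K \<ge> 0" "\<And>x. \<bar>exp_d_deriv (Suc m) x\<bar> \<le> K"
    using exp_d_deriv_bounded[of m] by blast
  have "\<bar>exp_d_deriv m (x + w) - exp_d_deriv m x\<bar> \<le> K * \<bar>w\<bar>" for x w
    using exp_d_deriv_mvt[of m x w] K(2) by (metis abs_ge_zero abs_mult mult_right_mono)
  then show ?thesis using K(1) by blast
qed

text \<open>By the mean value theorem the quotient is a difference f'(\<xi>) - f'(x) with |\<xi> -
  x| \<le> |w|. The first bound makes it an admissible weight, the second makes it small in L1 for
  small increments; one constant serves for both.\<close>

lemma slope_error_bound:
  "\<exists>K\<ge>0. \<forall>x w. \<bar>slope_error m x w\<bar> \<le> K \<and> \<bar>slope_error m x w\<bar> \<le> K * \<bar>w\<bar>"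
proof -
  obtain K1 where K1: "K1 \<ge> 0" "\<And>x. \<bar>exp_d_deriv (Suc m) x\<bar> \<le> K1"
    using exp_d_deriv_bounded[of m] by blast
  obtain K2 where K2: "K2 \<ge> 0"
    "\<And>x w. \<bar>exp_d_deriv (Suc m) (x + w) - exp_d_deriv (Suc m) x\<bar> \<le> K2 * \<bar>w\<bar>"
    using exp_d_deriv_lipschitz[of "Suc m"] by blast
  have "\<bar>slope_error m x w\<bar> \<le> 2 * K1 + K2 \<and> \<bar>slope_error m x w\<bar> \<le> (2 * K1 + K2) * \<bar>w\<bar>" for x w
  proof (cases "w = 0")
    case False
    obtain \<xi> where \<xi>: "exp_d_deriv m (x + w) - exp_d_deriv m x = exp_d_deriv (Suc m) \<xi> * w"
      "\<bar>\<xi> - x\<bar> \<le> \<bar>w\<bar>" using exp_d_deriv_mvt by blast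
    have eq: "slope_error m x w = exp_d_deriv (Suc m) \<xi> - exp_d_deriv (Suc m) x"
      using False \<xi>(1) by (simp add: slope_error_def del: exp_d_deriv.simps)
    have "\<bar>slope_error m x w\<bar> \<le> K2 * \<bar>\<xi> - x\<bar>" using K2(2)[of x "\<xi> - x"] unfolding eq by simp
    also have "\<dots> \<le> K2 * \<bar>w\<bar>" using \<xi>(2) K2(1) by (rule mult_left_mono)
    also have "\<dots> \<le> (2 * K1 + K2) * \<bar>w\<bar>" using K1(1) by (intro mult_right_mono) auto
    finally have "\<bar>slope_error m x w\<bar> \<le> (2 * K1 + K2) * \<bar>w\<bar>" .
    moreover have "\<bar>slope_error m x w\<bar> \<le> 2 * K1 + K2"
      unfolding eq using K1(2)[of \<xi>] K1(2)[of x] K2(1) by linarith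
    ultimately show ?thesis by blast
  qed (use K1 K2 in \<open>auto simp: slope_error_def\<close>)
  then show ?thesis using K1 K2 by (intro exI[of _ "2 * K1 + K2"]) auto
qed

text \<open>Convexity: the slope \<open>logit_d\<close> is increasing.\<close>

lemma exp_d_tangent: "logit_d x * (y - x) \<le> exp_d y - exp_d x"
proof -
  have *: "\<exists>\<xi>. exp_d b - exp_d a = (b - a) * logit_d \<xi> \<and> a < \<xi> \<and> \<xi> < b" if "a < b" for a b
    using MVT2[OF that, of exp_d logit_d] exp_d_has_derivative by blast
  consider "x = y" | "x < y" | "y < x" by linarith
  then show ?thesis
  proof cases
    case 2
    then obtain \<xi> where "exp_d y - exp_d x = (y - x) * logit_d \<xi>" "x < \<xi>" using * by blast
    then show ?thesis using logit_d_mono[of x \<xi>] 2 by (simp add: mult.commute mult_left_mono)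
  next
    case 3
    then obtain \<xi> where \<xi>: "exp_d x - exp_d y = (x - y) * logit_d \<xi>" "\<xi> < x" using * by blast
    then have "(x - y) * logit_d \<xi> \<le> (x - y) * logit_d x"
      using logit_d_mono[of \<xi> x] 3 by (intro mult_left_mono) auto
    then show ?thesis using \<xi> by (simp add: algebra_simps)
  qed auto
qed

section \<open>The normalising constant\<close>

text \<open>If some factor exceeds 1, then all factors are at most the largest one, which is at
  least 1, so the product is at most its N-th power. This takes the place of a Holder inequality and
  treats all numbers of factors up to N at once.\<close>

lemma prod_le_one_plus_sum_power:
  fixes x :: "'i \<Rightarrow> real"
  assumes "finite S" "card S \<le> N" "\<And>i. i \<in> S \<Longrightarrow> 0 \<le> x i"
  shows "prod x S \<le> 1 + (\<Sum>i\<in>S. x i ^ N)"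
proof (cases "\<forall>i\<in>S. x i \<le> 1")
  case True
  then have "prod x S \<le> 1" using assms(3) by (intro prod_le_1) auto
  moreover have "0 \<le> (\<Sum>i\<in>S. x i ^ N)" using assms(3) by (intro sum_nonneg) auto
  ultimately show ?thesis by linarith
next
  case False
  then have ne: "x ` S \<noteq> {}" by auto
  define m where "m = Max (x ` S)"
  have le: "x i \<le> m" if "i \<in> S" for i using that assms(1) by (auto simp: m_def)
  have "m \<in> x ` S" using ne assms(1) unfolding m_def by (intro Max_in) auto
  then obtain j where j: "j \<in> S" "x j = m" by auto
  have m1: "1 \<le> m" using False le by fastforce
  have "prod x S \<le> (\<Prod>i\<in>S. m)" using le assms(3) by (intro prod_mono) auto
  also have "\<dots> = m ^ card S" by simp
  also have "\<dots> \<le> m ^ N" using m1 assms(2) by (rule power_increasing[rotated])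
  also have "\<dots> \<le> (\<Sum>i\<in>S. x i ^ N)"
    using member_le_sum[of j S "\<lambda>i. x i ^ N"] j assms by auto
  finally show ?thesis by simp
qed

context prob_space
begin

lemma expectation_pos:
  fixes f :: "'a \<Rightarrow> real"
  assumes "integrable M f" "\<And>x. 0 < f x"
  shows "0 < expectation f"
proof -
  have "0 \<le> expectation f" using assms(2) by (intro integral_nonneg_AE AE_I2 less_imp_le)
  moreover have "expectation f \<noteq> 0"
  proof
    assume "expectation f = 0"
    then have "AE x in M. f x = 0"
      using integral_nonneg_eq_0_iff_AE[OF assms(1)] assms(2) by (auto intro: less_imp_le)
    then have "AE x in M. False" by (rule AE_mp) (use assms(2) in \<open>auto simp: less_le\<close>)
    then show False by (simp add: AE_False)
  qed
  ultimately show ?thesis by linarith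
qed

lemma integrable_exp_d:
  assumes f: "integrable M f"
  shows "integrable M (\<lambda>x. exp_d (f x))"
proof (rule Bochner_Integration.integrable_bound[of M "\<lambda>x. 1 + \<bar>f x\<bar>"])
  show "AE x in M. norm (exp_d (f x)) \<le> norm (1 + \<bar>f x\<bar>)"
  proof (rule AE_I2)
    fix x
    show "norm (exp_d (f x)) \<le> norm (1 + \<bar>f x\<bar>)"
      using exp_d_lipschitz[of "f x" 0] exp_d(1)[of "f x"] exp_d_0 by simp
  qed
qed (use f in auto)

lemma integrable_logit_d:
  assumes f[measurable]: "f \<in> borel_measurable M"
  shows "integrable M (\<lambda>x. logit_d (f x))"
proof (rule integrable_const_bound[of _ 1])
  show "(\<lambda>x. logit_d (f x)) \<in> borel_measurable M" unfolding logit_d_def by measurable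
  show "AE x in M. norm (logit_d (f x)) \<le> 1"
    using logit_d_bounds by (auto simp: less_imp_le abs_of_pos)
qed

text \<open>The convexity inequality, integrated. It yields strict growth in the additive constant
  together with a quantitative lower bound for the increments.\<close>

lemma expectation_exp_d_tangent:
  assumes f: "integrable M f" and d: "c \<le> d"
  shows "(d - c) * expectation (\<lambda>x. logit_d (f x + c))
    \<le> expectation (\<lambda>x. exp_d (f x + d)) - expectation (\<lambda>x. exp_d (f x + c))"
proof -
  have [measurable]: "f \<in> borel_measurable M" using f by auto
  have i: "integrable M (\<lambda>x. exp_d (f x + e))" for e using f by (intro integrable_exp_d) auto
  have "(d - c) * expectation (\<lambda>x. logit_d (f x + c)) = expectation (\<lambda>x. (d - c) * logit_d (f x + c))"
    by simp
  also have "\<dots> \<le> expectation (\<lambda>x. exp_d (f x + d) - exp_d (f x + c))"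
  proof (rule integral_mono)
    show "integrable M (\<lambda>x. (d - c) * logit_d (f x + c))"
      by (intro integrable_mult_right integrable_logit_d) measurable
    show "integrable M (\<lambda>x. exp_d (f x + d) - exp_d (f x + c))" using i by auto
    show "(d - c) * logit_d (f x + c) \<le> exp_d (f x + d) - exp_d (f x + c)" for x
      using exp_d_tangent[of "f x + c" "f x + d"] by (simp add: mult.commute)
  qed
  also have "\<dots> = expectation (\<lambda>x. exp_d (f x + d)) - expectation (\<lambda>x. exp_d (f x + c))"
    using i by simp
  finally show ?thesis .
qed

text \<open>The expectation is Lipschitz and strictly increasing in c, tends to 0 at minus infinity,
  and grows at least linearly by convexity, so it takes the value 1 exactly once.\<close>

lemma ex1_normalising_constant:
  assumes f: "integrable M f"
  shows "\<exists>!c. expectation (\<lambda>x. exp_d (f x + c)) = 1"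
proof -
  have [measurable]: "f \<in> borel_measurable M" using f by auto
  define F where "F c = expectation (\<lambda>x. exp_d (f x + c))" for c
  have i: "integrable M (\<lambda>x. exp_d (f x + e))" for e using f by (intro integrable_exp_d) auto
  have l: "0 < expectation (\<lambda>x. logit_d (f x + c))" for c
    using logit_d_bounds by (intro expectation_pos integrable_logit_d) auto
  have F_tangent: "(d - c) * expectation (\<lambda>x. logit_d (f x + c)) \<le> F d - F c" if "c \<le> d" for c d
    unfolding F_def by (rule expectation_exp_d_tangent[OF f that])
  have F_less: "F c < F d" if "c < d" for c d
    using F_tangent[of c d] l[of c] that mult_pos_pos[of "d - c" "expectation (\<lambda>x. logit_d (f x + c))"] by linarith
  have F_lip: "\<bar>F d - F c\<bar> \<le> \<bar>d - c\<bar>" for c d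
  proof -
    have "\<bar>F d - F c\<bar> = \<bar>expectation (\<lambda>x. exp_d (f x + d) - exp_d (f x + c))\<bar>"
      unfolding F_def using i by simp
    also have "\<dots> \<le> expectation (\<lambda>x. \<bar>exp_d (f x + d) - exp_d (f x + c)\<bar>)"
      by (rule integral_abs_bound)
    also have "\<dots> \<le> expectation (\<lambda>x. \<bar>d - c\<bar>)"
    proof (rule integral_mono)
      show "\<bar>exp_d (f x + d) - exp_d (f x + c)\<bar> \<le> \<bar>d - c\<bar>" for x
        using exp_d_lipschitz[of "f x + d" "f x + c"] by simp
    qed (use i in auto)
    finally show ?thesis by (simp add: prob_space)
  qed
  have cont: "isCont F c" for c
    unfolding continuous_at_eps_delta using F_lip by (metis dist_real_def order_le_less_trans)
  \<comment> \<open>The integrand at k = 0 dominates, since \<open>exp_d\<close> is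
    increasing.\<close>
  have "(\<lambda>k. F (- real k)) \<longlonglongrightarrow> expectation (\<lambda>x. 0)"
    unfolding F_def
  proof (rule integral_dominated_convergence[where w = "\<lambda>x. exp_d (f x)"])
    show "integrable M (\<lambda>x. exp_d (f x))" using i[of 0] by simp
    show "AE x in M. (\<lambda>k. exp_d (f x + - real k)) \<longlonglongrightarrow> 0"
    proof (rule AE_I2)
      fix x
      have "(\<lambda>k. exp (f x + 1 - real k)) \<longlonglongrightarrow> 0"
        by (rule filterlim_compose[OF exp_at_bot]) (real_asymp)
      then show "(\<lambda>k. exp_d (f x + - real k)) \<longlonglongrightarrow> 0"
      proof (rule tendsto_sandwich[rotated -1])
        show "\<forall>\<^sub>F k in sequentially. exp_d (f x + - real k) \<le> exp (f x + 1 - real k)"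
          using exp_d_le_exp[of "f x + - real _"] by (intro always_eventually allI) (simp add: algebra_simps)
        show "\<forall>\<^sub>F k in sequentially. 0 \<le> exp_d (f x + - real k)"
          by (intro always_eventually allI less_imp_le exp_d(1))
      qed auto
    qed
    show "AE x in M. norm (exp_d (f x + - real k)) \<le> exp_d (f x)" for k
      using exp_d(1) exp_d_mono by (auto simp: abs_of_pos)
  qed auto
  then have "eventually (\<lambda>k. F (- real k) < 1) sequentially" by (intro order_tendstoD) auto
  then obtain k where k: "F (- real k) < 1" by (auto simp: eventually_sequentially)
  \<comment> \<open>Chosen so that the tangent at c = 0 has risen by 1; as \<open>F 0\<close> is
    nonnegative, \<open>F d\<close> is at least 1.\<close>
  define d where "d = 1 / expectation (\<lambda>x. logit_d (f x + 0))"
  have d: "0 \<le> d" using l[of 0] by (simp add: d_def)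
  have "0 \<le> F 0" unfolding F_def by (intro integral_nonneg_AE AE_I2 less_imp_le exp_d(1))
  then have "1 \<le> F d" using F_tangent[OF d] l[of 0] by (simp add: d_def)
  then have "\<exists>c\<ge>- real k. c \<le> d \<and> F c = 1"
    using k d cont by (intro IVT') (auto intro!: continuous_at_imp_continuous_on)
  then obtain c where "F c = 1" by blast
  moreover have "c' = d'" if "F c' = 1" "F d' = 1" for c' d'
    using F_less[of c' d'] F_less[of d' c'] that by (metis less_irrefl linorder_neqE)
  ultimately show ?thesis unfolding F_def[symmetric] by blast
qed

lemma normalising_constant_stable:
  assumes f: "integrable M f" and h: "integrable M h"
    and "expectation (\<lambda>x. exp_d (f x)) = 1" "expectation (\<lambda>x. exp_d (f x + h x + \<Delta>)) = 1"
    and W: "W = expectation (\<lambda>x. logit_d (f x - 1))" and less: "expectation (\<lambda>x. \<bar>h x\<bar>) < W"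
  shows "\<bar>\<Delta>\<bar> * W \<le> expectation (\<lambda>x. \<bar>h x\<bar>)"
proof -
  have [measurable]: "f \<in> borel_measurable M" "h \<in> borel_measurable M" using f h by auto
  have i: "integrable M (\<lambda>x. exp_d (f x + e))" for e using f by (intro integrable_exp_d) auto
  have i2: "integrable M (\<lambda>x. exp_d (f x + h x + \<Delta>))" using f h by (intro integrable_exp_d) auto
  have l: "integrable M (\<lambda>x. logit_d (f x + c))" for c by (intro integrable_logit_d) measurable
  have W0: "0 < W" using logit_d_bounds l[of "-1"] unfolding W by (intro expectation_pos) auto
  have "\<bar>1 - expectation (\<lambda>x. exp_d (f x + \<Delta>))\<bar>
    = \<bar>expectation (\<lambda>x. exp_d (f x + h x + \<Delta>) - exp_d (f x + \<Delta>))\<bar>"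
    using assms(4) i i2 by simp
  also have "\<dots> \<le> expectation (\<lambda>x. \<bar>exp_d (f x + h x + \<Delta>) - exp_d (f x + \<Delta>)\<bar>)"
    by (rule integral_abs_bound)
  also have "\<dots> \<le> expectation (\<lambda>x. \<bar>h x\<bar>)"
  proof (rule integral_mono)
    show "\<bar>exp_d (f x + h x + \<Delta>) - exp_d (f x + \<Delta>)\<bar> \<le> \<bar>h x\<bar>" for x
      using exp_d_lipschitz[of "f x + h x + \<Delta>" "f x + \<Delta>"] by simp
  qed (use i i2 h in auto)
  finally have *: "\<bar>1 - expectation (\<lambda>x. exp_d (f x + \<Delta>))\<bar> \<le> expectation (\<lambda>x. \<bar>h x\<bar>)" .
  have mono: "expectation (\<lambda>x. logit_d (f x - 1)) \<le> expectation (\<lambda>x. logit_d (f x + c))" if "-1 \<le> c" for c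
    using that l[of "-1"] l[of c] by (intro integral_mono logit_d_mono) auto
  show ?thesis
  proof (cases "0 \<le> \<Delta>")
    case True
    have "\<bar>\<Delta>\<bar> * W \<le> \<Delta> * expectation (\<lambda>x. logit_d (f x + 0))"
      using True mono[of 0] unfolding W by (simp add: mult_left_mono)
    also have "\<dots> \<le> expectation (\<lambda>x. exp_d (f x + \<Delta>)) - 1"
      using expectation_exp_d_tangent[OF f True] assms(3) by simp
    finally show ?thesis using * by linarith
  next
    case False
    \<comment> \<open>The shift is cut off at -1, where the slope bound ends. The inequality s < 1
      obtained below shows that the cut-off was inactive.\<close>
    define s where "s = min (- \<Delta>) 1"
    have s: "0 < s" "s \<le> 1" "\<Delta> \<le> - s" using False by (auto simp: s_def)
    have "s * W \<le> s * expectation (\<lambda>x. logit_d (f x + - s))"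
      using s mono[of "- s"] unfolding W by (intro mult_left_mono) auto
    also have "\<dots> \<le> 1 - expectation (\<lambda>x. exp_d (f x + - s))"
      using expectation_exp_d_tangent[OF f, of "- s" 0] s assms(3) by simp
    also have "\<dots> \<le> 1 - expectation (\<lambda>x. exp_d (f x + \<Delta>))"
    proof -
      have "expectation (\<lambda>x. exp_d (f x + \<Delta>)) \<le> expectation (\<lambda>x. exp_d (f x + - s))"
        using i[of \<Delta>] i[of "- s"] s by (intro integral_mono exp_d_mono) (simp_all only: add_le_cancel_left)
      then show ?thesis by simp
    qed
    finally have **: "s * W \<le> expectation (\<lambda>x. \<bar>h x\<bar>)" using * by linarith
    then have "s * W < 1 * W" using less by simp
    then have "s < 1" using W0 by (simp only: mult_less_cancel_right_pos)
    then have "s = \<bar>\<Delta>\<bar>" using False by (simp add: s_def min_def split: if_splits)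
    then show ?thesis using ** by simp
  qed
qed

end

text \<open>The derivatives of order at most \<open>N\<close> of the normalising constant involve products of at most \<open>N\<close>
  increments, which the last two assumptions control. If \<open>N\<close> is smaller than the integrability
  exponent, \<open>uniformly_integrable\<close> follows by truncation; if they agree, it needs the first weak
  derivatives and the decay of the weight.\<close>

locale moment_space = prob_space M for M :: "'b measure" +
  fixes G :: "'v::real_vector set" and n :: "'v \<Rightarrow> real" and rep :: "'v \<Rightarrow> 'b \<Rightarrow> real"
    and one :: 'v and N :: nat
  assumes subspace_G: "subspace G"
    and n_nonneg: "u \<in> G \<Longrightarrow> 0 \<le> n u"
    and n_eq_0: "u \<in> G \<Longrightarrow> n u = 0 \<Longrightarrow> u = 0"
    and n_add: "u \<in> G \<Longrightarrow> v \<in> G \<Longrightarrow> n (u + v) \<le> n u + n v"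
    and n_scale: "u \<in> G \<Longrightarrow> n (c *\<^sub>R u) = \<bar>c\<bar> * n u"
    and rep_measurable: "u \<in> G \<Longrightarrow> rep u \<in> borel_measurable M"
    and rep_add: "u \<in> G \<Longrightarrow> v \<in> G \<Longrightarrow> AE x in M. rep (u + v) x = rep u x + rep v x"
    and rep_scale: "u \<in> G \<Longrightarrow> AE x in M. rep (c *\<^sub>R u) x = c * rep u x"
    and one_in: "one \<in> G" and rep_one: "AE x in M. rep one x = 1"
    and N: "1 \<le> N"
    and moments: "\<exists>C. \<forall>u\<in>G. n u \<le> 1 \<longrightarrow>
      integrable M (\<lambda>x. \<bar>rep u x\<bar> ^ N) \<and> (LINT x|M. \<bar>rep u x\<bar> ^ N) \<le> C"
    and uniformly_integrable: "0 < \<epsilon> \<Longrightarrow> \<exists>\<delta>>0. \<forall>g\<in>borel_measurable M.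
      (\<forall>x. \<bar>g x\<bar> \<le> K) \<and> (LINT x|M. \<bar>g x\<bar>) \<le> \<delta> \<longrightarrow>
      (\<forall>u\<in>G. n u \<le> 1 \<longrightarrow> (LINT x|M. \<bar>g x\<bar> * \<bar>rep u x\<bar> ^ N) \<le> \<epsilon>)"
begin

text \<open>The size of g as a functional on products of directions, given as an upper bound instead
  of a supremum. The pointwise bound secures integrability, while \<open>W\<close> measures the
  size.\<close>

definition weight_bound :: "('b \<Rightarrow> real) \<Rightarrow> real \<Rightarrow> bool" where
  "weight_bound g W \<longleftrightarrow> g \<in> borel_measurable M \<and> (\<exists>K. \<forall>x. \<bar>g x\<bar> \<le> K) \<and> (LINT x|M. \<bar>g x\<bar>) \<le> W \<and>
    (\<forall>u\<in>G. n u \<le> 1 \<longrightarrow> (LINT x|M. \<bar>g x\<bar> * \<bar>rep u x\<bar> ^ N) \<le> W)"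

lemmas G_simps = subspace_add[OF subspace_G] subspace_scale[OF subspace_G] subspace_0[OF subspace_G]
  subspace_diff[OF subspace_G]

lemma n_0: "n 0 = 0"
  using n_scale[of one 0] one_in by simp

lemma rep_0: "AE x in M. rep 0 x = 0"
  using rep_scale[of one 0] one_in by simp

lemma n_minus: "u \<in> G \<Longrightarrow> n (- u) = n u"
  using n_scale[of u "-1"] by simp

lemma weight_bound_nonneg: "weight_bound g W \<Longrightarrow> 0 \<le> W"
proof -
  assume "weight_bound g W"
  moreover have "0 \<le> (LINT x|M. \<bar>g x\<bar>)" by (rule Bochner_Integration.integral_nonneg) simp
  ultimately show "0 \<le> W" unfolding weight_bound_def by linarith
qed

lemma weight_bound_of_bounded:
  "\<exists>C\<ge>0. \<forall>g K. g \<in> borel_measurable M \<longrightarrow> (\<forall>x. \<bar>g x\<bar> \<le> K) \<longrightarrow> weight_bound g (K * C)"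
proof -
  obtain C where C: "\<And>u. u \<in> G \<Longrightarrow> n u \<le> 1 \<Longrightarrow>
      integrable M (\<lambda>x. \<bar>rep u x\<bar> ^ N) \<and> (LINT x|M. \<bar>rep u x\<bar> ^ N) \<le> C"
    using moments by blast
  have "weight_bound g (K * max 1 C)"
    if g[measurable]: "g \<in> borel_measurable M" and K: "\<forall>x. \<bar>g x\<bar> \<le> K" for g K
  proof -
    have K0: "0 \<le> K" using K by (meson abs_ge_zero order_trans)
    have i: "integrable M g" using K by (intro integrable_const_bound[of _ K]) auto
    have "(LINT x|M. \<bar>g x\<bar>) \<le> (LINT x|M. K)" using K i by (intro integral_mono) auto
    then have 1: "(LINT x|M. \<bar>g x\<bar>) \<le> K" by (simp add: prob_space)
    have 2: "(LINT x|M. \<bar>g x\<bar> * \<bar>rep u x\<bar> ^ N) \<le> K * C" if u: "u \<in> G" "n u \<le> 1" for u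
    proof -
      have [measurable]: "rep u \<in> borel_measurable M" using u rep_measurable by blast
      have le: "\<bar>g x\<bar> * \<bar>rep u x\<bar> ^ N \<le> K * \<bar>rep u x\<bar> ^ N" for x
        using K by (intro mult_right_mono) auto
      have "(LINT x|M. \<bar>g x\<bar> * \<bar>rep u x\<bar> ^ N) \<le> (LINT x|M. K * \<bar>rep u x\<bar> ^ N)"
        using C[OF u] le
        by (intro integral_mono Bochner_Integration.integrable_bound[of M "\<lambda>x. K * \<bar>rep u x\<bar> ^ N"
           "\<lambda>x. \<bar>g x\<bar> * \<bar>rep u x\<bar> ^ N"]) (auto simp: abs_mult abs_of_nonneg K0)
      also have "\<dots> \<le> K * C" using C[OF u] K0 by (auto intro: mult_left_mono)
      finally show ?thesis .
    qed
    have "K \<le> K * max 1 C" "K * C \<le> K * max 1 C"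
      using K0 mult_left_mono[of 1 "max 1 C" K] by (auto intro: mult_left_mono)
    then show ?thesis using K 1 2 unfolding weight_bound_def by (meson g order_trans)
  qed
  then show ?thesis by (intro exI[of _ "max 1 C"]) auto
qed

lemma weight_bound_small:
  assumes "0 < \<epsilon>"
  shows "\<exists>\<delta>>0. \<forall>g\<in>borel_measurable M. (\<forall>x. \<bar>g x\<bar> \<le> K) \<longrightarrow> (LINT x|M. \<bar>g x\<bar>) \<le> \<delta> \<longrightarrow> weight_bound g \<epsilon>"
proof -
  obtain \<delta> where \<delta>: "\<delta> > 0" "\<And>g u. g \<in> borel_measurable M \<Longrightarrow> (\<forall>x. \<bar>g x\<bar> \<le> K) \<Longrightarrow> (LINT x|M. \<bar>g x\<bar>) \<le> \<delta>
      \<Longrightarrow> u \<in> G \<Longrightarrow> n u \<le> 1 \<Longrightarrow> (LINT x|M. \<bar>g x\<bar> * \<bar>rep u x\<bar> ^ N) \<le> \<epsilon>"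
    using uniformly_integrable[OF assms, of K] by blast
  show ?thesis
  proof (intro exI[of _ "min \<delta> \<epsilon>"] conjI ballI impI)
    fix g assume "g \<in> borel_measurable M" "\<forall>x. \<bar>g x\<bar> \<le> K" "(LINT x|M. \<bar>g x\<bar>) \<le> min \<delta> \<epsilon>"
    then show "weight_bound g \<epsilon>" unfolding weight_bound_def using \<delta>(2)[of g] by auto
  qed (use \<delta> assms in auto)
qed

text \<open>Directions are families over \<open>nat\<close> and products run over a finite index
  set, because the terms of a higher derivative distribute subsets of the directions over several
  factors.\<close>

definition nprod :: "nat set \<Rightarrow> (nat \<Rightarrow> 'v) \<Rightarrow> real" where
  "nprod S hs = (\<Prod>i\<in>S. n (hs i))"

definition rprod :: "nat set \<Rightarrow> (nat \<Rightarrow> 'v) \<Rightarrow> 'b \<Rightarrow> real" where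
  "rprod S hs x = (\<Prod>i\<in>S. rep (hs i) x)"

lemma nprod_nonneg: "hs ` S \<subseteq> G \<Longrightarrow> 0 \<le> nprod S hs"
  unfolding nprod_def using n_nonneg by (auto intro: prod_nonneg)

lemma rprod_measurable: "hs ` S \<subseteq> G \<Longrightarrow> rprod S hs \<in> borel_measurable M"
  unfolding rprod_def[abs_def] by (intro borel_measurable_prod) (auto intro: rep_measurable)

text \<open>Once each direction is normalised, the product is at most 1 plus a sum of at most N
  powers of order N. Each of these at most N + 1 terms integrates against |g| to at most W.\<close>

lemma weighted_product_bound:
  assumes g: "weight_bound g W" and S: "finite S" "card S \<le> N" "hs ` S \<subseteq> G"
  shows "integrable M (\<lambda>x. g x * rprod S hs x)"
    and "(LINT x|M. \<bar>g x * rprod S hs x\<bar>) \<le> (real N + 1) * W * nprod S hs"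
proof -
  obtain K where K: "\<And>x. \<bar>g x\<bar> \<le> K" and [measurable]: "g \<in> borel_measurable M"
    and W1: "(LINT x|M. \<bar>g x\<bar>) \<le> W"
    and W2: "\<And>u. u \<in> G \<Longrightarrow> n u \<le> 1 \<Longrightarrow> (LINT x|M. \<bar>g x\<bar> * \<bar>rep u x\<bar> ^ N) \<le> W"
    using g unfolding weight_bound_def by blast
  have W0: "0 \<le> W" using g by (rule weight_bound_nonneg)
  have [measurable]: "rprod S hs \<in> borel_measurable M" using S by (intro rprod_measurable) auto
  have hs: "hs i \<in> G" if "i \<in> S" for i using that S by auto
  have "integrable M (\<lambda>x. g x * rprod S hs x) \<and>
    (LINT x|M. \<bar>g x * rprod S hs x\<bar>) \<le> (real N + 1) * W * nprod S hs"
  proof (cases "\<exists>j\<in>S. n (hs j) = 0")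
    \<comment> \<open>A direction of norm zero cannot be normalised, but it is the zero vector, so
      the product vanishes almost everywhere.\<close>
    case True
    then obtain j where j: "j \<in> S" "n (hs j) = 0" by blast
    then have "hs j = 0" using n_eq_0 hs by blast
    then have "AE x in M. rprod S hs x = 0"
      using rep_0 by (elim AE_mp) (use j S in \<open>auto simp: rprod_def intro!: AE_I2 bexI[of _ j]\<close>)
    then have "AE x in M. g x * rprod S hs x = 0" "AE x in M. \<bar>g x * rprod S hs x\<bar> = 0" by auto
    then show ?thesis
      using W0 nprod_nonneg[of hs S] S
      by (auto simp: integral_eq_zero_AE intro!: integrable_cong_AE[where g = "\<lambda>_. 0", THEN iffD2])
  next
    case False
    then have pos: "0 < n (hs j)" if "j \<in> S" for j using that n_nonneg[OF hs[OF that]] by force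
    define us where "us i = (1 / n (hs i)) *\<^sub>R hs i" for i
    have us: "us i \<in> G" "n (us i) \<le> 1" if "i \<in> S" for i
      using hs[OF that] pos[OF that] by (auto simp: us_def G_simps n_scale)
    have ui: "integrable M (\<lambda>x. \<bar>rep (us i) x\<bar> ^ N)" if "i \<in> S" for i
      using moments us[OF that] by blast
    have [measurable]: "rep (us i) \<in> borel_measurable M" if "i \<in> S" for i
      using us[OF that] rep_measurable by blast
    have gi: "integrable M (\<lambda>x. \<bar>g x\<bar>)" using K by (intro integrable_const_bound[of _ K]) auto
    have gu: "integrable M (\<lambda>x. \<bar>g x\<bar> * \<bar>rep (us i) x\<bar> ^ N)" if i: "i \<in> S" for i
    proof (rule Bochner_Integration.integrable_bound)
      show "integrable M (\<lambda>x. K * \<bar>rep (us i) x\<bar> ^ N)" using ui[OF i] by auto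
      show "(\<lambda>x. \<bar>g x\<bar> * \<bar>rep (us i) x\<bar> ^ N) \<in> borel_measurable M" using i by measurable
      show "AE x in M. norm (\<bar>g x\<bar> * \<bar>rep (us i) x\<bar> ^ N) \<le> norm (K * \<bar>rep (us i) x\<bar> ^ N)"
        using order_trans[OF K abs_ge_self] by (intro AE_I2) (auto simp: abs_mult intro!: mult_right_mono)
    qed
    define B where "B x = nprod S hs * (\<bar>g x\<bar> + (\<Sum>i\<in>S. \<bar>g x\<bar> * \<bar>rep (us i) x\<bar> ^ N))" for x
    have Bi: "integrable M B" unfolding B_def
      using gi gu by (intro integrable_mult_right Bochner_Integration.integrable_add
        Bochner_Integration.integrable_sum) auto
    have "AE x in M. \<forall>i\<in>S. rep (us i) x = (1 / n (hs i)) * rep (hs i) x"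
      unfolding us_def AE_finite_all[OF S(1)] by (intro ballI rep_scale hs)
    then have AE: "AE x in M. \<bar>g x * rprod S hs x\<bar> \<le> B x"
    proof (rule AE_mp, intro AE_I2 impI)
      fix x assume "\<forall>i\<in>S. rep (us i) x = (1 / n (hs i)) * rep (hs i) x"
      then have "rep (hs i) x = n (hs i) * rep (us i) x" if "i \<in> S" for i
        using that pos[OF that] by (auto simp: field_simps)
      then have "rprod S hs x = nprod S hs * (\<Prod>i\<in>S. rep (us i) x)"
        by (simp add: rprod_def nprod_def prod.distrib)
      then have "\<bar>g x * rprod S hs x\<bar> = nprod S hs * (\<bar>g x\<bar> * (\<Prod>i\<in>S. \<bar>rep (us i) x\<bar>))"
        using nprod_nonneg[OF S(3)] by (simp add: abs_mult abs_prod)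
      also have "\<dots> \<le> nprod S hs * (\<bar>g x\<bar> * (1 + (\<Sum>i\<in>S. \<bar>rep (us i) x\<bar> ^ N)))"
        using S nprod_nonneg[OF S(3)] by (intro mult_left_mono prod_le_one_plus_sum_power) auto
      also have "\<dots> = B x" by (simp add: B_def distrib_left sum_distrib_left)
      finally show "\<bar>g x * rprod S hs x\<bar> \<le> B x" .
    qed
    have "AE x in M. norm (g x * rprod S hs x) \<le> norm (B x)" using AE by eventually_elim auto
    then have int: "integrable M (\<lambda>x. g x * rprod S hs x)"
      by (intro Bochner_Integration.integrable_bound[OF Bi]) auto
    have "(LINT x|M. \<bar>g x * rprod S hs x\<bar>) \<le> (LINT x|M. B x)"
      using int AE Bi by (intro integral_mono_AE) auto
    also have "\<dots> = nprod S hs * ((LINT x|M. \<bar>g x\<bar>) + (\<Sum>i\<in>S. LINT x|M. \<bar>g x\<bar> * \<bar>rep (us i) x\<bar> ^ N))"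
      unfolding B_def using gi gu by (simp add: Bochner_Integration.integral_sum)
    also have "\<dots> \<le> nprod S hs * (W + (\<Sum>i\<in>S. W))"
      using W1 W2 us nprod_nonneg[OF S(3)] by (intro mult_left_mono add_mono sum_mono) auto
    also have "\<dots> \<le> nprod S hs * ((real N + 1) * W)"
    proof (intro mult_left_mono nprod_nonneg[OF S(3)])
      have "real (card S) * W \<le> real N * W" using S W0 by (intro mult_right_mono) auto
      then show "W + (\<Sum>i\<in>S. W) \<le> (real N + 1) * W" by (simp add: distrib_right)
    qed
    finally show ?thesis using int by (simp add: mult.commute)
  qed
  then show "integrable M (\<lambda>x. g x * rprod S hs x)"
    and "(LINT x|M. \<bar>g x * rprod S hs x\<bar>) \<le> (real N + 1) * W * nprod S hs" by auto
qed

lemma integral_weighted_product_bound: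
  assumes "weight_bound g W" "finite S" "card S \<le> N" "hs ` S \<subseteq> G"
  shows "\<bar>LINT x|M. g x * rprod S hs x\<bar> \<le> (real N + 1) * W * nprod S hs"
  by (rule order_trans[OF integral_abs_bound weighted_product_bound(2)[OF assms]])

text \<open>The case of a single direction and the constant weight 1; it is available because N
  \<ge> 1.\<close>

lemma integrable_rep: "u \<in> G \<Longrightarrow> integrable M (rep u)"
  and L1_bound: "\<exists>C\<ge>0. \<forall>u\<in>G. (LINT x|M. \<bar>rep u x\<bar>) \<le> C * n u"
proof -
  obtain C where C: "C \<ge> 0" "\<And>g K. g \<in> borel_measurable M \<Longrightarrow> (\<forall>x. \<bar>g x\<bar> \<le> K) \<Longrightarrow> weight_bound g (K * C)"
    using weight_bound_of_bounded by blast
  have w: "weight_bound (\<lambda>_. 1) C" using C(2)[of "\<lambda>_. 1" 1] by simp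
  note * = weighted_product_bound[OF w, of "{0}" "\<lambda>_. u" for u, simplified rprod_def nprod_def, simplified]
  show "integrable M (rep u)" if "u \<in> G" using *(1)[of u] that N by simp
  show "\<exists>C\<ge>0. \<forall>u\<in>G. (LINT x|M. \<bar>rep u x\<bar>) \<le> C * n u"
    using *(2) N C(1) by (intro exI[of _ "(real N + 1) * C"]) auto
qed

section \<open>The normalising constant as a function on \<open>G\<close>, and the moments\<close>

definition Z :: "'v \<Rightarrow> real" where
  "Z a = (THE c. expectation (\<lambda>x. exp_d (rep a x + c)) = 1)"

lemma Z: "a \<in> G \<Longrightarrow> expectation (\<lambda>x. exp_d (rep a x + Z a)) = 1"
  unfolding Z_def by (rule theI'[OF ex1_normalising_constant[OF integrable_rep]])

lemma Z_unique: "a \<in> G \<Longrightarrow> expectation (\<lambda>x. exp_d (rep a x + c)) = 1 \<Longrightarrow> Z a = c"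
  unfolding Z_def using ex1_normalising_constant[OF integrable_rep] by blast

text \<open>Only local, because \<open>normalising_constant_stable\<close> needs E|h| < W. The
  radius W / (C + 1) ensures this, as E|h| is at most C times the norm of h.\<close>

lemma Z_lipschitz:
  assumes a: "a \<in> G"
  shows "\<exists>L\<ge>0. \<exists>\<delta>>0. \<forall>h\<in>G. n h < \<delta> \<longrightarrow> \<bar>Z (a + h) - Z a\<bar> \<le> L * n h"
proof -
  obtain C where C: "C \<ge> 0" "\<And>u. u \<in> G \<Longrightarrow> (LINT x|M. \<bar>rep u x\<bar>) \<le> C * n u" using L1_bound by blast
  define W where "W = expectation (\<lambda>x. logit_d ((rep a x + Z a) - 1))"
  have ia: "integrable M (\<lambda>x. rep a x + Z a)" using integrable_rep[OF a] by auto
  have W0: "0 < W" unfolding W_def using ia logit_d_bounds by (intro expectation_pos integrable_logit_d) auto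
  have "\<bar>Z (a + h) - Z a\<bar> \<le> (C / W) * n h" if h: "h \<in> G" "n h < W / (C + 1)" for h
  proof -
    have "(LINT x|M. \<bar>rep h x\<bar>) \<le> C * n h" using C h by auto
    also have "\<dots> \<le> (C + 1) * n h" using n_nonneg[OF h(1)] by (simp add: mult_right_mono)
    also have "\<dots> < W" using h C(1) by (simp add: field_simps)
    finally have less: "(LINT x|M. \<bar>rep h x\<bar>) < W" .
    have ah: "a + h \<in> G" using a h by (simp add: G_simps)
    have "AE x in M. rep (a + h) x = rep a x + rep h x" using a h rep_add by blast
    then have "AE x in M. exp_d (rep (a + h) x + Z (a + h)) = exp_d ((rep a x + Z a) + rep h x + (Z (a + h) - Z a))"
      by eventually_elim (simp add: algebra_simps)
    then have "expectation (\<lambda>x. exp_d ((rep a x + Z a) + rep h x + (Z (a + h) - Z a))) = 1"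
      using Z[OF ah] rep_measurable[OF a] rep_measurable[OF h(1)] rep_measurable[OF ah]
      by (subst integral_cong_AE[where g = "\<lambda>x. exp_d (rep (a + h) x + Z (a + h))"]) auto
    then have "\<bar>Z (a + h) - Z a\<bar> * W \<le> (LINT x|M. \<bar>rep h x\<bar>)"
      by (intro normalising_constant_stable[OF ia integrable_rep[OF h(1)] Z[OF a] _ W_def less])
    also have "\<dots> \<le> C * n h" using C h by auto
    finally show ?thesis using W0 by (simp add: field_simps)
  qed
  then show ?thesis using W0 C by (intro exI[of _ "C / W"] conjI exI[of _ "W / (C + 1)"]) auto
qed

definition base :: "'v \<Rightarrow> 'b \<Rightarrow> real" where
  "base a x = rep a x + Z a"

lemma base_measurable: "a \<in> G \<Longrightarrow> base a \<in> borel_measurable M"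
  unfolding base_def[abs_def] using rep_measurable[of a] by measurable

text \<open>The order m and the number of directions are independent parameters: moving the base
  point along h changes it by h and by the constant increment of \<open>Z\<close>. Both raise m
  under differentiation, but only the first adds a direction.\<close>

definition X :: "nat \<Rightarrow> nat set \<Rightarrow> 'v \<Rightarrow> (nat \<Rightarrow> 'v) \<Rightarrow> real" where
  "X m S a hs = (LINT x|M. exp_d_deriv m (base a x) * rprod S hs x)"

text \<open>A new direction is prepended with \<open>case_nat\<close>; it gets index 0, and the old
  indices move up by one.\<close>

lemma rprod_insert: "finite S \<Longrightarrow>
    rprod (insert 0 (Suc ` S)) (case_nat h hs) x = rep h x * rprod S hs x"
  unfolding rprod_def by (subst prod.insert) (auto simp: prod.reindex)

lemma nprod_insert: "finite S \<Longrightarrow>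
    nprod (insert 0 (Suc ` S)) (case_nat h hs) = n h * nprod S hs"
  unfolding nprod_def by (subst prod.insert) (auto simp: prod.reindex)

lemma rprod_Suc: "rprod (Suc ` S) (case_nat h hs) = rprod S hs"
  unfolding rprod_def by (auto simp: prod.reindex fun_eq_iff)

lemma X_Suc: "X m (Suc ` S) a (case_nat h hs) = X m S a hs"
  by (simp add: X_def rprod_Suc)

lemma image_case_nat: "h \<in> G \<Longrightarrow> hs ` S \<subseteq> G \<Longrightarrow> case_nat h hs ` insert 0 (Suc ` S) \<subseteq> G"
  by auto

lemma weight_bound_exp_d_deriv:
  "\<exists>W\<ge>0. \<forall>a\<in>G. weight_bound (\<lambda>x. exp_d_deriv (Suc m) (base a x)) W"
proof -
  obtain C where C: "C \<ge> 0" "\<And>g K. g \<in> borel_measurable M \<Longrightarrow> (\<forall>x. \<bar>g x\<bar> \<le> K) \<Longrightarrow> weight_bound g (K * C)"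
    using weight_bound_of_bounded by blast
  obtain K where K: "K \<ge> 0" "\<forall>x. \<bar>exp_d_deriv (Suc m) x\<bar> \<le> K" using exp_d_deriv_bounded by blast
  show ?thesis
  proof (intro exI[of _ "K * C"] conjI ballI)
    fix a assume "a \<in> G"
    then have [measurable]: "base a \<in> borel_measurable M" by (rule base_measurable)
    have "(\<lambda>x. exp_d_deriv (Suc m) (base a x)) \<in> borel_measurable M"
      using measurable_compose[OF _ borel_measurable_exp_d_deriv[of "Suc m"]] by measurable
    then show "weight_bound (\<lambda>x. exp_d_deriv (Suc m) (base a x)) (K * C)"
      using C(2) K by blast
  qed (use K C in auto)
qed

lemma X_bounded:
  "\<exists>K\<ge>0. \<forall>a\<in>G. \<forall>S hs. finite S \<longrightarrow> card S \<le> N \<longrightarrow> hs ` S \<subseteq> G \<longrightarrow> \<bar>X (Suc m) S a hs\<bar> \<le> K * nprod S hs"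
proof -
  obtain W where W: "W \<ge> 0" "\<And>a. a \<in> G \<Longrightarrow> weight_bound (\<lambda>x. exp_d_deriv (Suc m) (base a x)) W"
    using weight_bound_exp_d_deriv by blast
  show ?thesis unfolding X_def
    using integral_weighted_product_bound[OF W(2)] W(1) by (intro exI[of _ "(real N + 1) * W"]) auto
qed

lemma X_integrable:
  assumes "a \<in> G" "finite S" "card S \<le> N" "hs ` S \<subseteq> G"
  shows "integrable M (\<lambda>x. exp_d_deriv (Suc m) (base a x) * rprod S hs x)"
proof -
  obtain W where "weight_bound (\<lambda>x. exp_d_deriv (Suc m) (base a x)) W"
    using weight_bound_exp_d_deriv assms(1) by blast
  then show ?thesis using weighted_product_bound(1) assms by blast
qed

lemma AE_base_add:
  assumes "a \<in> G" "h \<in> G"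
  shows "AE x in M. base (a + h) x = base a x + (rep h x + (Z (a + h) - Z a))"
  using rep_add[OF assms] by eventually_elim (simp add: base_def)

text \<open>\<open>exp_d_deriv_expand\<close> with the increment rep h + \<Delta>, integrated. The
  order m may be 0, where the weight is unbounded; hence integrability of the two leading integrands
  is a hypothesis. The linear term and the remainder carry one direction more, which explains
  \<open>card S + 1 \<le> N\<close>.\<close>

lemma increment_expansion:
  assumes a: "a \<in> G" and h: "h \<in> G" and S: "finite S" "card S + 1 \<le> N" "hs ` S \<subseteq> G"
    and \<Delta>: "\<Delta> = Z (a + h) - Z a"
    and i0: "integrable M (\<lambda>x. exp_d_deriv m (base a x) * rprod S hs x)"
    and i1: "integrable M (\<lambda>x. exp_d_deriv m (base (a + h) x) * rprod S hs x)"
    and g: "weight_bound (\<lambda>x. slope_error m (base a x) (rep h x + \<Delta>)) W"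
  shows "\<bar>X m S (a + h) hs - X m S a hs - X (Suc m) (insert 0 (Suc ` S)) a (case_nat h hs)
    - \<Delta> * X (Suc m) S a hs\<bar> \<le> (real N + 1) * W * (n h + \<bar>\<Delta>\<bar>) * nprod S hs"
proof -
  define g where "g x = slope_error m (base a x) (rep h x + \<Delta>)" for x
  have wg: "weight_bound g W" unfolding g_def by (rule assms)
  let ?S = "insert 0 (Suc ` S)" and ?hs = "case_nat h hs"
  have S': "finite ?S" "card ?S \<le> N" "?hs ` ?S \<subseteq> G" "card S \<le> N"
    using S h by (auto simp: card_image)
  note rI = rprod_insert[OF S(1), of h hs]
  have j1: "integrable M (\<lambda>x. exp_d_deriv (Suc m) (base a x) * rprod ?S ?hs x)"
    and j2: "integrable M (\<lambda>x. exp_d_deriv (Suc m) (base a x) * rprod S hs x)"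
    using X_integrable[OF a] S S' by blast+
  have j3: "integrable M (\<lambda>x. g x * rprod ?S ?hs x)" and j4: "integrable M (\<lambda>x. g x * rprod S hs x)"
    using weighted_product_bound(1)[OF wg] S S' by blast+
  have "X m S (a + h) hs - X m S a hs
    = (LINT x|M. exp_d_deriv m (base (a + h) x) * rprod S hs x - exp_d_deriv m (base a x) * rprod S hs x)"
    unfolding X_def using i0 i1 by simp
  also have "\<dots> = (LINT x|M. (exp_d_deriv (Suc m) (base a x) * rprod ?S ?hs x
      + \<Delta> * (exp_d_deriv (Suc m) (base a x) * rprod S hs x))
      + (g x * rprod ?S ?hs x + \<Delta> * (g x * rprod S hs x)))"
  proof (rule integral_cong_AE)
    show "AE x in M. exp_d_deriv m (base (a + h) x) * rprod S hs x - exp_d_deriv m (base a x) * rprod S hs x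
      = (exp_d_deriv (Suc m) (base a x) * rprod ?S ?hs x
      + \<Delta> * (exp_d_deriv (Suc m) (base a x) * rprod S hs x))
      + (g x * rprod ?S ?hs x + \<Delta> * (g x * rprod S hs x))"
      using AE_base_add[OF a h]
    proof eventually_elim
      case (elim x)
      show ?case unfolding elim rI \<Delta>[symmetric] exp_d_deriv_expand[of m "base a x"] g_def
        by (simp add: algebra_simps del: exp_d_deriv.simps)
    qed
    show "(\<lambda>x. exp_d_deriv m (base (a + h) x) * rprod S hs x - exp_d_deriv m (base a x) * rprod S hs x) \<in> borel_measurable M"
      using i0 i1 by (auto simp del: exp_d_deriv.simps)
    show "(\<lambda>x. (exp_d_deriv (Suc m) (base a x) * rprod ?S ?hs x
      + \<Delta> * (exp_d_deriv (Suc m) (base a x) * rprod S hs x))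
      + (g x * rprod ?S ?hs x + \<Delta> * (g x * rprod S hs x))) \<in> borel_measurable M"
      using j1 j2 j3 j4
      by (intro borel_measurable_integrable Bochner_Integration.integrable_add integrable_mult_right)
  qed
  also have "\<dots> = X (Suc m) ?S a ?hs + \<Delta> * X (Suc m) S a hs
     + ((LINT x|M. g x * rprod ?S ?hs x) + \<Delta> * (LINT x|M. g x * rprod S hs x))"
    unfolding X_def using j1 j2 j3 j4 
    by (simp only: Bochner_Integration.integral_add Bochner_Integration.integrable_add 
      integrable_mult_right integral_mult_right_zero)
  finally have eq: "X m S (a + h) hs - X m S a hs - X (Suc m) ?S a ?hs - \<Delta> * X (Suc m) S a hs
    = (LINT x|M. g x * rprod ?S ?hs x) + \<Delta> * (LINT x|M. g x * rprod S hs x)" by simp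
  have "\<bar>(LINT x|M. g x * rprod ?S ?hs x) + \<Delta> * (LINT x|M. g x * rprod S hs x)\<bar>
    \<le> \<bar>LINT x|M. g x * rprod ?S ?hs x\<bar> + \<bar>\<Delta>\<bar> * \<bar>LINT x|M. g x * rprod S hs x\<bar>"
    by (rule order_trans[OF abs_triangle_ineq]) (simp add: abs_mult)
  also have "\<dots> \<le> (real N + 1) * W * nprod ?S ?hs + \<bar>\<Delta>\<bar> * ((real N + 1) * W * nprod S hs)"
    using integral_weighted_product_bound[OF wg S'(1,2,3)] integral_weighted_product_bound[OF wg S(1) S'(4) S(3)]
    by (intro add_mono mult_left_mono) auto
  also have "\<dots> = (real N + 1) * W * (n h + \<bar>\<Delta>\<bar>) * nprod S hs"
    unfolding nprod_insert[OF S(1)] by (simp add: algebra_simps)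
  finally show ?thesis unfolding eq .
qed

text \<open>The weight is bounded by K, and its L1 norm is at most K (C + L) times the norm of h, by
  the Lipschitz bounds for the L1 norm and for \<open>Z\<close>. \<open>F\<close> is abstract
  because slope errors and plain differences of derivatives are both treated this way.\<close>

lemma small_increment_weight:
  assumes a: "a \<in> G" and \<epsilon>: "0 < \<epsilon>"
    and F: "\<And>x w. \<bar>F x w\<bar> \<le> K" "\<And>x w. \<bar>F x w\<bar> \<le> K * \<bar>w\<bar>"
      "\<And>f g. f \<in> borel_measurable M \<Longrightarrow> g \<in> borel_measurable M \<Longrightarrow> (\<lambda>x. F (f x) (g x)) \<in> borel_measurable M"
  shows "\<exists>\<delta>>0. \<forall>h\<in>G. n h < \<delta> \<longrightarrow>
    weight_bound (\<lambda>x. F (base a x) (rep h x + (Z (a + h) - Z a))) \<epsilon>"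
proof -
  obtain C where C: "C \<ge> 0" "\<And>u. u \<in> G \<Longrightarrow> (LINT x|M. \<bar>rep u x\<bar>) \<le> C * n u" using L1_bound by blast
  obtain L \<delta>1 where L: "L \<ge> 0" "\<delta>1 > 0" "\<And>h. h \<in> G \<Longrightarrow> n h < \<delta>1 \<Longrightarrow> \<bar>Z (a + h) - Z a\<bar> \<le> L * n h"
    using Z_lipschitz[OF a] by blast
  obtain \<delta>2 where \<delta>2: "\<delta>2 > 0" "\<And>g. g \<in> borel_measurable M \<Longrightarrow> (\<forall>x. \<bar>g x\<bar> \<le> K) \<Longrightarrow> (LINT x|M. \<bar>g x\<bar>) \<le> \<delta>2 \<Longrightarrow>
      weight_bound g \<epsilon>"
    using weight_bound_small[OF \<epsilon>, of K] by blast
  have K: "0 \<le> K" using F(1)[of undefined undefined] by linarith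
  define \<delta> where "\<delta> = min \<delta>1 (\<delta>2 / (K * (C + L) + 1))"
  have pos: "0 < K * (C + L) + 1" using K C L by (simp add: add_nonneg_pos)
  show ?thesis
  proof (intro exI[of _ \<delta>] conjI ballI impI)
    show "0 < \<delta>" using L \<delta>2 pos by (simp add: \<delta>_def)
    fix h assume h: "h \<in> G" "n h < \<delta>"
    define D where "D = Z (a + h) - Z a"
    have D: "\<bar>D\<bar> \<le> L * n h" using L h by (auto simp: D_def \<delta>_def)
    have [measurable]: "base a \<in> borel_measurable M" "rep h \<in> borel_measurable M"
      using base_measurable[OF a] rep_measurable h by auto
    have meas: "(\<lambda>x. F (base a x) (rep h x + D)) \<in> borel_measurable M" by (intro F(3)) measurable
    have ih: "integrable M (\<lambda>x. \<bar>rep h x\<bar>)" using integrable_rep[OF h(1)] by auto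
    have "(LINT x|M. \<bar>F (base a x) (rep h x + D)\<bar>) \<le> (LINT x|M. K * \<bar>rep h x\<bar> + K * \<bar>D\<bar>)"
    proof (rule integral_mono)
      show "integrable M (\<lambda>x. \<bar>F (base a x) (rep h x + D)\<bar>)"
        using meas F(1) by (intro integrable_abs integrable_const_bound[of _ K]) auto
      show "\<bar>F (base a x) (rep h x + D)\<bar> \<le> K * \<bar>rep h x\<bar> + K * \<bar>D\<bar>" for x
      proof -
        have "\<bar>F (base a x) (rep h x + D)\<bar> \<le> K * \<bar>rep h x + D\<bar>" by (rule F(2))
        also have "\<dots> \<le> K * (\<bar>rep h x\<bar> + \<bar>D\<bar>)" using K by (intro mult_left_mono) auto
        finally show ?thesis by (simp add: distrib_left)
      qed
    qed (use ih in auto)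
    also have "\<dots> = K * (LINT x|M. \<bar>rep h x\<bar>) + K * \<bar>D\<bar>" using ih by (simp add: prob_space)
    also have "\<dots> \<le> K * (C * n h) + K * (L * n h)"
      using C(2)[OF h(1)] D K by (intro add_mono mult_left_mono) auto
    also have "\<dots> = (K * (C + L)) * n h" by (simp add: algebra_simps)
    also have "\<dots> \<le> (K * (C + L) + 1) * n h" using n_nonneg[OF h(1)] by (intro mult_right_mono) auto
    also have "\<dots> \<le> \<delta>2" using h pos by (simp add: \<delta>_def field_simps)
    finally show "weight_bound (\<lambda>x. F (base a x) (rep h x + (Z (a + h) - Z a))) \<epsilon>"
      using \<delta>2(2)[OF meas] F(1) unfolding D_def by auto
  qed
qed

section \<open>First derivatives of \<open>Z\<close> and of the moments\<close>

definition dZ :: "'v \<Rightarrow> 'v \<Rightarrow> real" where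
  "dZ a h = - (X 1 {0} a (\<lambda>_. h) / X 1 {} a (\<lambda>_. 0))"

lemma X_1_pos: "a \<in> G \<Longrightarrow> 0 < X 1 {} a hs"
  unfolding X_def rprod_def using logit_d_bounds base_measurable[of a]
  by (auto intro!: expectation_pos integrable_logit_d)

lemma X_empty: "X m {} a hs = X m {} a hs'"
  by (simp add: X_def rprod_def)

lemma X_singleton: "X m {0} a (case_nat h hs) = X m {0} a (\<lambda>_. h)"
  by (simp add: X_def rprod_def)

text \<open>Expands the moment of order 0 without directions. By the choice of \<open>Z\<close> it
  is the constant 1, so its increment vanishes and the two linear terms, the moment of order 1 along
  h and the increment of \<open>Z\<close> times \<open>X 1 {}\<close>, cancel up to smaller
  order.\<close>

lemma Z_differentiable:
  assumes a: "a \<in> G" and \<epsilon>: "0 < \<epsilon>"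
  shows "\<exists>\<delta>>0. \<forall>h\<in>G. n h < \<delta> \<longrightarrow> \<bar>Z (a + h) - Z a - dZ a h\<bar> \<le> \<epsilon> * n h"
proof -
  define q where "q = X 1 {} a (\<lambda>_. 0)"
  have q: "0 < q" unfolding q_def by (rule X_1_pos[OF a])
  obtain L \<delta>1 where L: "L \<ge> 0" "\<delta>1 > 0" "\<And>h. h \<in> G \<Longrightarrow> n h < \<delta>1 \<Longrightarrow> \<bar>Z (a + h) - Z a\<bar> \<le> L * n h"
    using Z_lipschitz[OF a] by blast
  \<comment> \<open>The factor 1 + L absorbs the increment of \<open>Z\<close>, and q the final
    division, so that the error becomes \<epsilon> * n h.\<close>
  define W where "W = \<epsilon> * q / ((real N + 1) * (1 + L))"
  have W: "0 < W" using \<epsilon> q L by (simp add: W_def)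
  obtain K where K: "\<And>x w. \<bar>slope_error 0 x w\<bar> \<le> K" "\<And>x w. \<bar>slope_error 0 x w\<bar> \<le> K * \<bar>w\<bar>"
    using slope_error_bound[of 0] by blast
  obtain \<delta>2 where \<delta>2: "\<delta>2 > 0" "\<And>h. h \<in> G \<Longrightarrow> n h < \<delta>2 \<Longrightarrow>
    weight_bound (\<lambda>x. slope_error 0 (base a x) (rep h x + (Z (a + h) - Z a))) W"
    using small_increment_weight[OF a W, of "slope_error 0", OF K borel_measurable_slope_error] by blast
  have X0: "X 0 {} u hs = 1" "integrable M (\<lambda>x. exp_d_deriv 0 (base u x) * rprod {} hs x)" if "u \<in> G" for u hs
    using Z[OF that] integrable_exp_d[of "base u"] integrable_rep[OF that]
    by (auto simp: X_def rprod_def base_def[abs_def])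
  show ?thesis
  proof (intro exI[of _ "min \<delta>1 \<delta>2"] conjI ballI impI)
    fix h assume h: "h \<in> G" "n h < min \<delta>1 \<delta>2"
    define D where "D = Z (a + h) - Z a"
    have D: "\<bar>D\<bar> \<le> L * n h" using L h by (auto simp: D_def)
    have ah: "a + h \<in> G" using a h by (simp add: G_simps)
    have "\<bar>X 0 {} (a + h) (\<lambda>_. 0) - X 0 {} a (\<lambda>_. 0) - X (Suc 0) (insert 0 (Suc ` {})) a (case_nat h (\<lambda>_. 0))
      - D * X (Suc 0) {} a (\<lambda>_. 0)\<bar> \<le> (real N + 1) * W * (n h + \<bar>D\<bar>) * nprod {} (\<lambda>_. 0)"
      using X0 N a ah h \<delta>2 by (intro increment_expansion) (auto simp: D_def simp del: exp_d_deriv.simps)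
    then have "\<bar>X 1 {0} a (\<lambda>_. h) + D * q\<bar> \<le> (real N + 1) * W * (n h + \<bar>D\<bar>)"
      by (simp add: X0 a ah X_singleton nprod_def q_def)
    also have "\<dots> \<le> (real N + 1) * W * ((1 + L) * n h)"
      using D W by (intro mult_left_mono) (auto simp: distrib_right)
    also have "\<dots> = \<epsilon> * q * n h"
    proof -
      have "(real N + 1) * (1 + L) \<noteq> 0" using L(1) by simp
      then show ?thesis by (simp add: W_def)
    qed
    finally have "\<bar>X 1 {0} a (\<lambda>_. h) + D * q\<bar> \<le> \<epsilon> * n h * q" by (simp add: ac_simps)
    moreover have "X 1 {0} a (\<lambda>_. h) + D * q = (D - dZ a h) * q"
    proof -
      have "dZ a h = - (X 1 {0} a (\<lambda>_. h) / q)" unfolding dZ_def q_def ..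
      then show ?thesis using q by (simp add: left_diff_distrib distrib_right)
    qed
    ultimately show "\<bar>Z (a + h) - Z a - dZ a h\<bar> \<le> \<epsilon> * n h"
      using q by (simp add: abs_mult D_def)
  qed (use L \<delta>2 in auto)
qed

text \<open>\<open>increment_expansion\<close> still contains the increment of \<open>Z\<close>.
  Replacing it by \<open>dZ a h\<close> costs its first-order error times a bounded moment; half of
  \<epsilon> goes to each source of error. The radius is chosen before S and hs, so the estimate
  holds in operator norm.\<close>

lemma X_differentiable:
  assumes a: "a \<in> G" and \<epsilon>: "0 < \<epsilon>"
  shows "\<exists>\<delta>>0. \<forall>h\<in>G. n h < \<delta> \<longrightarrow> (\<forall>S hs. finite S \<longrightarrow> card S + 1 \<le> N \<longrightarrow> hs ` S \<subseteq> G \<longrightarrow>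
    \<bar>X (Suc m) S (a + h) hs - X (Suc m) S a hs
      - (X (Suc (Suc m)) (insert 0 (Suc ` S)) a (case_nat h hs) + dZ a h * X (Suc (Suc m)) S a hs)\<bar>
    \<le> \<epsilon> * n h * nprod S hs)"
proof -
  obtain L \<delta>1 where L: "L \<ge> 0" "\<delta>1 > 0" "\<And>h. h \<in> G \<Longrightarrow> n h < \<delta>1 \<Longrightarrow> \<bar>Z (a + h) - Z a\<bar> \<le> L * n h"
    using Z_lipschitz[OF a] by blast
  from X_bounded[of "Suc m"] obtain K' where "0 \<le> K' \<and> (\<forall>a\<in>G. \<forall>S hs. finite S \<longrightarrow> card S \<le> N \<longrightarrow>
      hs ` S \<subseteq> G \<longrightarrow> \<bar>X (Suc (Suc m)) S a hs\<bar> \<le> K' * nprod S hs)" ..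
  then have K': "K' \<ge> 0" "\<And>a S hs. a \<in> G \<Longrightarrow> finite S \<Longrightarrow> card S \<le> N \<Longrightarrow> hs ` S \<subseteq> G \<Longrightarrow>
      \<bar>X (Suc (Suc m)) S a hs\<bar> \<le> K' * nprod S hs"
    by simp_all
  define W where "W = \<epsilon> / 2 / ((real N + 1) * (1 + L))"
  have W: "0 < W" using \<epsilon> L by (simp add: W_def)
  obtain K where K: "\<And>x w. \<bar>slope_error (Suc m) x w\<bar> \<le> K" "\<And>x w. \<bar>slope_error (Suc m) x w\<bar> \<le> K * \<bar>w\<bar>"
    using slope_error_bound[of "Suc m"] by blast
  obtain \<delta>2 where \<delta>2: "\<delta>2 > 0" "\<And>h. h \<in> G \<Longrightarrow> n h < \<delta>2 \<Longrightarrow>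
    weight_bound (\<lambda>x. slope_error (Suc m) (base a x) (rep h x + (Z (a + h) - Z a))) W"
    using small_increment_weight[OF a W, of "slope_error (Suc m)", OF K borel_measurable_slope_error] by blast
  have \<epsilon>': "0 < \<epsilon> / 2 / (K' + 1)" using \<epsilon> K' by simp
  obtain \<delta>3 where \<delta>3: "\<delta>3 > 0" "\<And>h. h \<in> G \<Longrightarrow> n h < \<delta>3 \<Longrightarrow>
     \<bar>Z (a + h) - Z a - dZ a h\<bar> \<le> \<epsilon> / 2 / (K' + 1) * n h"
    using Z_differentiable[OF a \<epsilon>'] by blast
  show ?thesis
  proof (intro exI[of _ "min \<delta>1 (min \<delta>2 \<delta>3)"] conjI ballI impI allI)
    fix h and S :: "nat set" and hs
    assume h: "h \<in> G" "n h < min \<delta>1 (min \<delta>2 \<delta>3)" and S: "finite S" "card S + 1 \<le> N" "hs ` S \<subseteq> G"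
    define D where "D = Z (a + h) - Z a"
    have D: "\<bar>D\<bar> \<le> L * n h" using L h by (auto simp: D_def)
    have ah: "a + h \<in> G" using a h by (simp add: G_simps)
    have S0: "0 \<le> nprod S hs" "0 \<le> n h" using S nprod_nonneg n_nonneg h by auto
    let ?A = "X (Suc m) S (a + h) hs" and ?B = "X (Suc m) S a hs"
      and ?C = "X (Suc (Suc m)) (insert 0 (Suc ` S)) a (case_nat h hs)" and ?E = "X (Suc (Suc m)) S a hs"
    have "\<bar>?A - ?B - ?C - D * ?E\<bar> \<le> (real N + 1) * W * (n h + \<bar>D\<bar>) * nprod S hs"
      using N a ah h \<delta>2 S by (intro increment_expansion X_integrable) (auto simp: D_def simp del: exp_d_deriv.simps)
    also have "\<dots> \<le> (real N + 1) * W * ((1 + L) * n h) * nprod S hs"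
      using D W S0 by (intro mult_left_mono mult_right_mono) (auto simp: distrib_right)
    also have "\<dots> = W * ((real N + 1) * (1 + L)) * n h * nprod S hs" by (simp only: ac_simps)
    also have "W * ((real N + 1) * (1 + L)) = \<epsilon> / 2"
    proof -
      have "(real N + 1) * (1 + L) \<noteq> 0" using L(1) by simp
      then show ?thesis by (rule iffD1[OF nonzero_eq_divide_eq W_def])
    qed
    finally have 1: "\<bar>?A - ?B - ?C - D * ?E\<bar> \<le> \<epsilon> / 2 * n h * nprod S hs" .
    have "\<bar>(D - dZ a h) * ?E\<bar> \<le> (\<epsilon> / 2 / (K' + 1) * n h) * (K' * nprod S hs)"
      unfolding abs_mult using \<delta>3(2)[of h] h K'(2)[OF a S(1) _ S(3)] S \<epsilon>' S0
      by (intro mult_mono) (auto simp: D_def)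
    also have "\<dots> \<le> (\<epsilon> / 2 / (K' + 1) * n h) * ((K' + 1) * nprod S hs)"
      using S0 \<epsilon> K'(1) by (intro mult_left_mono mult_right_mono) auto
    also have "\<dots> = \<epsilon> / 2 / (K' + 1) * (K' + 1) * n h * nprod S hs" by (simp only: ac_simps)
    also have "\<epsilon> / 2 / (K' + 1) * (K' + 1) = \<epsilon> / 2"
      using K'(1) by (intro iffD1[OF nonzero_eq_divide_eq refl]) auto
    finally have 2: "\<bar>(D - dZ a h) * ?E\<bar> \<le> \<epsilon> / 2 * n h * nprod S hs" .
    have "?A - ?B - (?C + dZ a h * ?E) = (?A - ?B - ?C - D * ?E) + (D - dZ a h) * ?E"
      by (simp add: algebra_simps)
    then show "\<bar>?A - ?B - (?C + dZ a h * ?E)\<bar> \<le> \<epsilon> * n h * nprod S hs"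
      using 1 2 by linarith
  qed (use L \<delta>2 \<delta>3 in auto)
qed

text \<open>No direction is added, so products of the full length N are allowed. Continuity of the
  highest derivative comes from here.\<close>

lemma X_continuous:
  assumes a: "a \<in> G" and \<epsilon>: "0 < \<epsilon>"
  shows "\<exists>\<delta>>0. \<forall>h\<in>G. n h < \<delta> \<longrightarrow> (\<forall>S hs. finite S \<longrightarrow> card S \<le> N \<longrightarrow> hs ` S \<subseteq> G \<longrightarrow>
    \<bar>X (Suc m) S (a + h) hs - X (Suc m) S a hs\<bar> \<le> \<epsilon> * nprod S hs)"
proof -
  define F where "F x w = exp_d_deriv (Suc m) (x + w) - exp_d_deriv (Suc m) x" for x w
  obtain K1 where K1: "K1 \<ge> 0" "\<And>x. \<bar>exp_d_deriv (Suc m) x\<bar> \<le> K1" using exp_d_deriv_bounded by blast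
  obtain K2 where K2: "K2 \<ge> 0" "\<And>x w. \<bar>F x w\<bar> \<le> K2 * \<bar>w\<bar>"
    using exp_d_deriv_lipschitz[of "Suc m"] unfolding F_def by blast
  have F1: "\<bar>F x w\<bar> \<le> 2 * K1 + K2" for x w
    unfolding F_def using K1(2)[of x] K1(2)[of "x + w"] K2(1) by linarith
  have F2: "\<bar>F x w\<bar> \<le> (2 * K1 + K2) * \<bar>w\<bar>" for x w
    using K2(2)[of x w] mult_right_mono[of K2 "2 * K1 + K2" "\<bar>w\<bar>"] K1 by linarith
  have F3: "(\<lambda>x. F (f x) (g x)) \<in> borel_measurable M"
    if [measurable]: "f \<in> borel_measurable M" "g \<in> borel_measurable M" for f g
  proof -
    have "(\<lambda>x. exp_d_deriv (Suc m) (f x + g x)) \<in> borel_measurable M"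
      "(\<lambda>x. exp_d_deriv (Suc m) (f x)) \<in> borel_measurable M"
      using measurable_compose[OF _ borel_measurable_exp_d_deriv[of "Suc m"]] by measurable
    then show ?thesis unfolding F_def by (rule borel_measurable_diff)
  qed
  have \<epsilon>': "0 < \<epsilon> / (real N + 1)" using \<epsilon> by simp
  obtain \<delta> where \<delta>: "\<delta> > 0" "\<And>h. h \<in> G \<Longrightarrow> n h < \<delta> \<Longrightarrow>
    weight_bound (\<lambda>x. F (base a x) (rep h x + (Z (a + h) - Z a))) (\<epsilon> / (real N + 1))"
    using small_increment_weight[OF a \<epsilon>', of F, OF F1 F2 F3] by blast
  show ?thesis
  proof (intro exI[of _ \<delta>] conjI ballI impI allI)
    fix h and S :: "nat set" and hs
    assume h: "h \<in> G" "n h < \<delta>" and S: "finite S" "card S \<le> N" "hs ` S \<subseteq> G"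
    define g where "g x = F (base a x) (rep h x + (Z (a + h) - Z a))" for x
    have g: "weight_bound g (\<epsilon> / (real N + 1))" unfolding g_def using \<delta> h by blast
    have ah: "a + h \<in> G" using a h by (simp add: G_simps)
    note i = X_integrable[OF a S, of m] X_integrable[OF ah S, of m]
    have "X (Suc m) S (a + h) hs - X (Suc m) S a hs
      = (LINT x|M. exp_d_deriv (Suc m) (base (a + h) x) * rprod S hs x - exp_d_deriv (Suc m) (base a x) * rprod S hs x)"
      unfolding X_def using i by (simp del: exp_d_deriv.simps)
    also have "\<dots> = (LINT x|M. g x * rprod S hs x)"
    proof (rule integral_cong_AE)
      show "AE x in M. exp_d_deriv (Suc m) (base (a + h) x) * rprod S hs x
          - exp_d_deriv (Suc m) (base a x) * rprod S hs x = g x * rprod S hs x"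
        using AE_base_add[OF a h(1)]
        by eventually_elim (simp add: g_def F_def left_diff_distrib del: exp_d_deriv.simps)
      show "(\<lambda>x. exp_d_deriv (Suc m) (base (a + h) x) * rprod S hs x
          - exp_d_deriv (Suc m) (base a x) * rprod S hs x) \<in> borel_measurable M"
        using i by (intro borel_measurable_integrable Bochner_Integration.integrable_diff)
      show "(\<lambda>x. g x * rprod S hs x) \<in> borel_measurable M"
        by (rule borel_measurable_integrable[OF weighted_product_bound(1)[OF g S]])
    qed
    finally show "\<bar>X (Suc m) S (a + h) hs - X (Suc m) S a hs\<bar> \<le> \<epsilon> * nprod S hs"
      using integral_weighted_product_bound[OF g S] by simp
  qed (use \<delta> in auto)
qed

end

section \<open>Higher derivatives\<close>

text \<open>The derivatives of the normalising constant \<open>Z\<close> are polynomials in \<open>1 / X 1 {}\<close> and the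
  moments \<open>X m S\<close>; this is their syntax, with \<open>tm_deriv\<close> for differentiation. The new direction
  receives index \<open>0\<close>, so the old indices are shifted.\<close>

datatype tm = ZT | ET | XT nat "nat set" | Add tm tm | Mul tm tm | Neg tm

text \<open>Every monomial contains each direction of S exactly once, which gives linearity in each
  direction and a bound by the product of the norms. Hence sums need equal index sets and products
  need disjoint ones.\<close>

inductive multilinear_tm :: "tm \<Rightarrow> nat set \<Rightarrow> bool" where
  "multilinear_tm ZT {}"
| "multilinear_tm ET {}"
| "finite S \<Longrightarrow> multilinear_tm (XT m S) S"
| "multilinear_tm s S \<Longrightarrow> multilinear_tm t S \<Longrightarrow> multilinear_tm (Add s t) S"
| "multilinear_tm s S \<Longrightarrow> multilinear_tm t T \<Longrightarrow> S \<inter> T = {} \<Longrightarrow> multilinear_tm (Mul s t) (S \<union> T)"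
| "multilinear_tm s S \<Longrightarrow> multilinear_tm (Neg s) S"

primrec tm_shift :: "tm \<Rightarrow> tm" where
  "tm_shift ZT = ZT"
| "tm_shift ET = ET"
| "tm_shift (XT m S) = XT m (Suc ` S)"
| "tm_shift (Add s t) = Add (tm_shift s) (tm_shift t)"
| "tm_shift (Mul s t) = Mul (tm_shift s) (tm_shift t)"
| "tm_shift (Neg s) = Neg (tm_shift s)"

text \<open>Chain rule for the base point a + Z a: the first summand differentiates along h, the
  second along the constant \<open>dZ a h\<close>, which is spelled out as the negated product of
  \<open>ET\<close> and \<open>XT 0 {0}\<close>.\<close>

definition tm_deriv_X :: "nat \<Rightarrow> nat set \<Rightarrow> tm" where
  "tm_deriv_X m S = Add (XT (Suc m) (insert 0 (Suc ` S)))
     (Neg (Mul (Mul ET (XT 0 {0})) (XT (Suc m) (Suc ` S))))"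

primrec tm_deriv :: "tm \<Rightarrow> tm" where
  "tm_deriv ZT = Neg (Mul ET (XT 0 {0}))"
| "tm_deriv ET = Neg (Mul (Mul ET ET) (tm_deriv_X 0 {}))"
| "tm_deriv (XT m S) = tm_deriv_X m S"
| "tm_deriv (Add s t) = Add (tm_deriv s) (tm_deriv t)"
| "tm_deriv (Mul s t) = Add (Mul (tm_deriv s) (tm_shift t)) (Mul (tm_shift s) (tm_deriv t))"
| "tm_deriv (Neg s) = Neg (tm_deriv s)"

lemma multilinear_tm_finite: "multilinear_tm t S \<Longrightarrow> finite S"
  by (induction rule: multilinear_tm.induct) auto

lemma multilinear_tm_shift: "multilinear_tm t S \<Longrightarrow> multilinear_tm (tm_shift t) (Suc ` S)"
  by (induction rule: multilinear_tm.induct) (auto simp: image_Un intro!: multilinear_tm.intros)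

lemma multilinear_tm_deriv_X:
  assumes "finite S"
  shows "multilinear_tm (tm_deriv_X m S) (insert 0 (Suc ` S))"
proof -
  have "multilinear_tm (Mul (Mul ET (XT 0 {0})) (XT (Suc m) (Suc ` S))) (({} \<union> {0}) \<union> Suc ` S)"
    using assms by (intro multilinear_tm.intros) auto
  then show ?thesis
    using assms unfolding tm_deriv_X_def by (intro multilinear_tm.intros) auto
qed

lemma multilinear_tm_deriv:
  "multilinear_tm t S \<Longrightarrow> multilinear_tm (tm_deriv t) (insert 0 (Suc ` S))"
proof (induction rule: multilinear_tm.induct)
  case 1
  have "multilinear_tm (Mul ET (XT 0 {0})) ({} \<union> {0})" by (intro multilinear_tm.intros) auto
  then show ?case by (auto intro: multilinear_tm.intros)
next
  case 2
  have "multilinear_tm (Mul (Mul ET ET) (tm_deriv_X 0 {})) (({} \<union> {}) \<union> insert 0 (Suc ` {}))"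
    by (intro multilinear_tm.intros multilinear_tm_deriv_X) auto
  then show ?case by (auto intro: multilinear_tm.intros)
next
  case (3 S m)
  then show ?case by (simp add: multilinear_tm_deriv_X)
next
  case (5 s S t T)
  have "multilinear_tm (Mul (tm_deriv s) (tm_shift t)) (insert 0 (Suc ` S) \<union> Suc ` T)"
    "multilinear_tm (Mul (tm_shift s) (tm_deriv t)) (Suc ` S \<union> insert 0 (Suc ` T))"
    using 5 multilinear_tm_shift by (intro multilinear_tm.intros; auto)+
  then show ?case by (auto simp: image_Un intro!: multilinear_tm.intros)
qed (auto intro: multilinear_tm.intros)

context moment_space
begin

text \<open>\<open>XT m S\<close> means \<open>X (Suc m) S\<close>: the shift leaves out order 0 and
  with it the unbounded weight. \<open>ET\<close> evaluates a moment without directions, so the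
  family passed to it is a dummy.\<close>

primrec tm_sem :: "tm \<Rightarrow> 'v \<Rightarrow> (nat \<Rightarrow> 'v) \<Rightarrow> real" where
  "tm_sem ZT a hs = Z a"
| "tm_sem ET a hs = 1 / X 1 {} a (\<lambda>_. 0)"
| "tm_sem (XT m S) a hs = X (Suc m) S a hs"
| "tm_sem (Add s t) a hs = tm_sem s a hs + tm_sem t a hs"
| "tm_sem (Mul s t) a hs = tm_sem s a hs * tm_sem t a hs"
| "tm_sem (Neg s) a hs = - tm_sem s a hs"

lemma tm_sem_shift: "tm_sem (tm_shift t) a (case_nat h hs) = tm_sem t a hs"
  by (induction t) (auto simp: X_Suc)

lemma tm_sem_deriv_X: "tm_sem (tm_deriv_X m S) a (case_nat h hs) =
    X (Suc (Suc m)) (insert 0 (Suc ` S)) a (case_nat h hs) + dZ a h * X (Suc (Suc m)) S a hs"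
  by (simp add: tm_deriv_X_def X_Suc X_singleton dZ_def)

section \<open>A calculus of remainders that are uniform in the directions\<close>

definition dominated :: "nat set \<Rightarrow> ((nat \<Rightarrow> 'v) \<Rightarrow> real) \<Rightarrow> real \<Rightarrow> bool" where
  "dominated S F K \<longleftrightarrow> (\<forall>hs. hs ` S \<subseteq> G \<longrightarrow> \<bar>F hs\<bar> \<le> K * nprod S hs)"

lemma dominated_add: "dominated S F K \<Longrightarrow> dominated S F' K' \<Longrightarrow> dominated S (\<lambda>hs. F hs + F' hs) (K + K')"
  unfolding dominated_def distrib_right by (meson abs_triangle_ineq add_mono order_trans)

lemma dominated_minus: "dominated S F K \<Longrightarrow> dominated S (\<lambda>hs. - F hs) K"
  unfolding dominated_def by simp

lemma dominated_mono: "dominated S F K \<Longrightarrow> K \<le> K' \<Longrightarrow> dominated S F K'"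
  unfolding dominated_def by (meson mult_right_mono nprod_nonneg order_trans)

lemma nprod_Un:
  "finite S \<Longrightarrow> finite T \<Longrightarrow> S \<inter> T = {} \<Longrightarrow> nprod (S \<union> T) hs = nprod S hs * nprod T hs"
  unfolding nprod_def by (rule prod.union_disjoint)

lemma dominated_mult:
  assumes "dominated S F K" "dominated T F' K'" "finite S" "finite T" "S \<inter> T = {}" "0 \<le> K"
  shows "dominated (S \<union> T) (\<lambda>hs. F hs * F' hs) (K * K')"
  unfolding dominated_def
proof (intro allI impI)
  fix hs assume hs: "hs ` (S \<union> T) \<subseteq> G"
  have "\<bar>F hs * F' hs\<bar> \<le> (K * nprod S hs) * (K' * nprod T hs)"
    unfolding abs_mult using assms(1,2,6) hs
    by (intro mult_mono) (auto simp: dominated_def nprod_nonneg image_Un)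
  then show "\<bar>F hs * F' hs\<bar> \<le> K * K' * nprod (S \<union> T) hs"
    using assms by (simp add: nprod_Un ac_simps)
qed

text \<open>The spaces are carriers with a norm rather than types, so the neighbourhoods of 0 in
  \<open>G\<close> get a filter of their own.\<close>

definition near0 :: "'v filter" where
  "near0 = (INF \<delta>\<in>{0<..}. principal {h \<in> G. n h < \<delta>})"

lemma eventually_near0: "eventually P near0 \<longleftrightarrow> (\<exists>\<delta>>0. \<forall>h\<in>G. n h < \<delta> \<longrightarrow> P h)"
  unfolding near0_def
  by (subst eventually_INF_base) (auto simp: eventually_principal intro!: bexI[of _ "min _ _"])

text \<open>As \<open>dominated\<close> quantifies over all directions, this is smallness in the
  operator norm: with \<phi> = n it is the remainder condition of a Frechet derivative, with \<phi>
  = 1 it is continuity.\<close>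

definition little_o :: "('v \<Rightarrow> real) \<Rightarrow> nat set \<Rightarrow> ('v \<Rightarrow> (nat \<Rightarrow> 'v) \<Rightarrow> real) \<Rightarrow> bool" where
  "little_o \<phi> S F \<longleftrightarrow> (\<forall>\<epsilon>>0. \<forall>\<^sub>F h in near0. dominated S (F h) (\<epsilon> * \<phi> h))"

definition big_O :: "('v \<Rightarrow> real) \<Rightarrow> nat set \<Rightarrow> ('v \<Rightarrow> (nat \<Rightarrow> 'v) \<Rightarrow> real) \<Rightarrow> bool" where
  "big_O \<phi> S F \<longleftrightarrow> (\<exists>K\<ge>0. \<forall>\<^sub>F h in near0. dominated S (F h) (K * \<phi> h))"

lemma eventually_near0_G: "\<forall>\<^sub>F h in near0. h \<in> G \<and> 0 \<le> n h"
  unfolding eventually_near0 using n_nonneg by (auto intro!: exI[of _ 1])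

lemma little_o_add:
  assumes "little_o \<phi> S F" "little_o \<phi> S F'"
  shows "little_o \<phi> S (\<lambda>h hs. F h hs + F' h hs)"
  unfolding little_o_def
proof (intro allI impI)
  fix \<epsilon> :: real assume "0 < \<epsilon>"
  then have "\<forall>\<^sub>F h in near0. dominated S (F h) (\<epsilon> / 2 * \<phi> h)" "\<forall>\<^sub>F h in near0. dominated S (F' h) (\<epsilon> / 2 * \<phi> h)"
    using assms unfolding little_o_def by (auto simp del: times_divide_eq_left)
  then show "\<forall>\<^sub>F h in near0. dominated S (\<lambda>hs. F h hs + F' h hs) (\<epsilon> * \<phi> h)"
  proof eventually_elim
    case (elim h)
    show ?case using dominated_add[OF elim] by (simp add: field_simps)
  qed
qed

lemma little_o_minus: "little_o \<phi> S F \<Longrightarrow> little_o \<phi> S (\<lambda>h hs. - F h hs)"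
  unfolding little_o_def by (auto elim!: eventually_mono intro: dominated_minus)

lemma little_o_imp_big_O: "little_o \<phi> S F \<Longrightarrow> big_O \<phi> S F"
  unfolding little_o_def big_O_def by (metis zero_less_one zero_le_one)

lemma big_O_add:
  assumes "big_O \<phi> S F" "big_O \<phi> S F'"
  shows "big_O \<phi> S (\<lambda>h hs. F h hs + F' h hs)"
proof -
  from assms obtain K K' where "K \<ge> 0" "K' \<ge> 0"
    and K: "\<forall>\<^sub>F h in near0. dominated S (F h) (K * \<phi> h)" "\<forall>\<^sub>F h in near0. dominated S (F' h) (K' * \<phi> h)"
    unfolding big_O_def by blast
  from K have "\<forall>\<^sub>F h in near0. dominated S (\<lambda>hs. F h hs + F' h hs) ((K + K') * \<phi> h)"
    by eventually_elim (simp add: distrib_right dominated_add)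
  then show ?thesis unfolding big_O_def using \<open>K \<ge> 0\<close> \<open>K' \<ge> 0\<close> by (intro exI[of _ "K + K'"]) auto
qed

lemma little_o_mult:
  assumes F: "little_o \<phi> S F" and F': "big_O \<psi> T F'"
    and S: "finite S" "finite T" "S \<inter> T = {}" and \<phi>: "\<And>h. h \<in> G \<Longrightarrow> 0 \<le> \<phi> h" "\<And>h. h \<in> G \<Longrightarrow> 0 \<le> \<psi> h"
  shows "little_o (\<lambda>h. \<phi> h * \<psi> h) (S \<union> T) (\<lambda>h hs. F h hs * F' h hs)"
  unfolding little_o_def
proof (intro allI impI)
  fix \<epsilon> :: real assume \<epsilon>: "0 < \<epsilon>"
  obtain K where K: "K \<ge> 0" "\<forall>\<^sub>F h in near0. dominated T (F' h) (K * \<psi> h)" using F' unfolding big_O_def by blast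
  \<comment> \<open>K + 1 instead of K, because K may be zero.\<close>
  have pos: "0 < \<epsilon> / (K + 1)" using \<epsilon> K by simp
  have "\<forall>\<^sub>F h in near0. dominated S (F h) (\<epsilon> / (K + 1) * \<phi> h)"
    using F pos unfolding little_o_def by blast
  with K(2) eventually_near0_G show "\<forall>\<^sub>F h in near0. dominated (S \<union> T) (\<lambda>hs. F h hs * F' h hs) (\<epsilon> * (\<phi> h * \<psi> h))"
  proof eventually_elim
    case (elim h)
    have "\<epsilon> / (K + 1) * \<phi> h * (K * \<psi> h) = K / (K + 1) * (\<epsilon> * (\<phi> h * \<psi> h))" by simp
    also have "\<dots> \<le> 1 * (\<epsilon> * (\<phi> h * \<psi> h))"
      using K \<epsilon> \<phi> elim by (intro mult_right_mono) auto
    finally have le: "\<epsilon> / (K + 1) * \<phi> h * (K * \<psi> h) \<le> \<epsilon> * (\<phi> h * \<psi> h)" by simp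
    have "dominated (S \<union> T) (\<lambda>hs. F h hs * F' h hs) (\<epsilon> / (K + 1) * \<phi> h * (K * \<psi> h))"
      using pos \<phi>(1) elim by (intro dominated_mult S elim mult_nonneg_nonneg) auto
    then show ?case using le by (rule dominated_mono)
  qed
qed

lemma little_o_mult':
  assumes "big_O \<phi> S F" "little_o \<psi> T F'"
    and "finite S" "finite T" "S \<inter> T = {}" "\<And>h. h \<in> G \<Longrightarrow> 0 \<le> \<phi> h" "\<And>h. h \<in> G \<Longrightarrow> 0 \<le> \<psi> h"
  shows "little_o (\<lambda>h. \<phi> h * \<psi> h) (S \<union> T) (\<lambda>h hs. F h hs * F' h hs)"
  using little_o_mult[of \<psi> T F' \<phi> S F] assms by (simp add: ac_simps Un_commute Int_commute)

lemma big_O_n_imp_little_o: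
  assumes "big_O n S F"
  shows "little_o (\<lambda>_. 1) S F"
  unfolding little_o_def
proof (intro allI impI)
  fix \<epsilon> :: real assume \<epsilon>: "0 < \<epsilon>"
  obtain K where K: "K \<ge> 0" "\<forall>\<^sub>F h in near0. dominated S (F h) (K * n h)" using assms unfolding big_O_def by blast
  have "\<forall>\<^sub>F h in near0. n h < \<epsilon> / (K + 1)"
    unfolding eventually_near0 using \<epsilon> K by (intro exI[of _ "\<epsilon> / (K + 1)"]) auto
  with K(2) eventually_near0_G show "\<forall>\<^sub>F h in near0. dominated S (F h) (\<epsilon> * 1)"
  proof eventually_elim
    case (elim h)
    have "K * n h \<le> (K + 1) * n h" using elim by (simp add: mult_right_mono)
    also have "\<dots> \<le> \<epsilon>" using elim K by (simp add: field_simps)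
    finally show ?case using dominated_mono elim by simp
  qed
qed

abbreviation "tm_diff t a \<equiv> (\<lambda>h hs. tm_sem t (a + h) hs - tm_sem t a hs)"
abbreviation "tm_rem t a \<equiv> (\<lambda>h hs. tm_sem t (a + h) hs - tm_sem t a hs - tm_sem (tm_deriv t) a (case_nat h hs))"

lemma dominated_X:
  assumes "a \<in> G" "finite S" "card S \<le> N"
  shows "\<exists>K\<ge>0. dominated S (X (Suc m) S a) K"
  using X_bounded[of m] assms unfolding dominated_def by metis

lemma tm_sem_bounded:
  assumes a: "a \<in> G"
  shows "multilinear_tm t S \<Longrightarrow> card S \<le> N \<Longrightarrow> \<exists>K\<ge>0. dominated S (tm_sem t a) K"
proof (induction rule: multilinear_tm.induct)
  case 1
  then show ?case by (intro exI[of _ "\<bar>Z a\<bar>"]) (auto simp: dominated_def nprod_def)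
next
  case 2
  then show ?case by (intro exI[of _ "\<bar>1 / X 1 {} a (\<lambda>_. 0)\<bar>"]) (auto simp: dominated_def nprod_def)
next
  case (3 S m)
  then show ?case using dominated_X[OF a, of S m] by (simp add: fun_eq_iff)
next
  case (4 s S t)
  then obtain K K' where K: "K \<ge> 0" "dominated S (tm_sem s a) K" "K' \<ge> 0" "dominated S (tm_sem t a) K'" by blast
  have "dominated S (tm_sem (Add s t) a) (K + K')"
    using dominated_add[OF K(2,4)] by (simp add: dominated_def)
  then show ?case using K by (intro exI[of _ "K + K'"]) (auto simp: dominated_def)
next
  case (5 s S t T)
  have f: "finite S" "finite T" using 5 multilinear_tm_finite by auto
  then have "card S \<le> N" "card T \<le> N" using 5 by (auto simp: card_Un_disjoint)
  then obtain K K' where K: "K \<ge> 0" "dominated S (tm_sem s a) K" "K' \<ge> 0" "dominated T (tm_sem t a) K'"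
    using 5 by blast
  have "dominated (S \<union> T) (tm_sem (Mul s t) a) (K * K')"
    using dominated_mult[OF K(2,4) f 5(3) K(1)] by (simp add: dominated_def)
  then show ?case using K by (intro exI[of _ "K * K'"]) (auto simp: dominated_def)
next
  case (6 s S)
  then obtain K where "K \<ge> 0" "dominated S (tm_sem s a) K" by blast
  then show ?case by (intro exI[of _ K]) (simp add: dominated_def)
qed

lemma big_O_tm_sem:
  assumes "a \<in> G" "multilinear_tm t S" "card S \<le> N"
  shows "big_O (\<lambda>_. 1) S (\<lambda>h. tm_sem t a)"
  using tm_sem_bounded[OF assms] unfolding big_O_def by auto

text \<open>The new direction at index 0 contributes the factor n h to the product of norms.\<close>

lemma big_O_tm_deriv:
  assumes a: "a \<in> G" and t: "multilinear_tm t S" "card S + 1 \<le> N"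
  shows "big_O n S (\<lambda>h hs. tm_sem (tm_deriv t) a (case_nat h hs))"
proof -
  have f: "finite S" using t multilinear_tm_finite by blast
  have c: "card (insert 0 (Suc ` S)) \<le> N" using t f by (simp add: card_image)
  obtain K where K: "K \<ge> 0" "dominated (insert 0 (Suc ` S)) (tm_sem (tm_deriv t) a) K"
    using tm_sem_bounded[OF a multilinear_tm_deriv[OF t(1)] c] by blast
  have "\<forall>\<^sub>F h in near0. dominated S (\<lambda>hs. tm_sem (tm_deriv t) a (case_nat h hs)) (K * n h)"
    using eventually_near0_G
  proof eventually_elim
    case (elim h)
    then show ?case using K(2) image_case_nat[of h] nprod_insert[OF f]
      unfolding dominated_def by (metis mult.assoc)
  qed
  then show ?thesis unfolding big_O_def using K by blast
qed

lemma little_o_X_continuous: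
  assumes "a \<in> G" "finite S" "card S \<le> N"
  shows "little_o (\<lambda>_. 1) S (\<lambda>h hs. X (Suc m) S (a + h) hs - X (Suc m) S a hs)"
  unfolding little_o_def eventually_near0 dominated_def
  using X_continuous[OF assms(1), of _ m] assms by (metis mult.right_neutral)

lemma little_o_X_differentiable:
  assumes "a \<in> G" "finite S" "card S + 1 \<le> N"
  shows "little_o n S (tm_rem (XT m S) a)"
  unfolding little_o_def eventually_near0 dominated_def tm_deriv.simps tm_sem_deriv_X tm_sem.simps
  using X_differentiable[OF assms(1), of _ m] assms by metis

text \<open>\<open>X 1 {}\<close> is continuous and positive at a, so nearby it stays above half its
  value.\<close>

lemma inverse_X_eventually:
  assumes a: "a \<in> G"
  shows "big_O (\<lambda>_. 1) {} (\<lambda>h. tm_sem ET (a + h))"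
proof -
  define q where "q = X 1 {} a (\<lambda>_. 0)"
  have q: "0 < q" unfolding q_def by (rule X_1_pos[OF a])
  have "\<forall>\<^sub>F h in near0. dominated {} (\<lambda>hs. X (Suc 0) {} (a + h) hs - X (Suc 0) {} a hs) (q / 2 * 1)"
    using little_o_X_continuous[OF a, of "{}" 0] q unfolding little_o_def by auto
  then have "\<forall>\<^sub>F h in near0. dominated {} (tm_sem ET (a + h)) (2 / q * 1)"
  proof eventually_elim
    case (elim h)
    then have "\<bar>X 1 {} (a + h) (\<lambda>_. 0) - q\<bar> \<le> q / 2" by (simp add: dominated_def nprod_def q_def)
    then have "q / 2 \<le> X 1 {} (a + h) (\<lambda>_. 0)" by linarith
    then show ?case using q by (auto simp: dominated_def nprod_def field_simps)
  qed
  then show ?thesis unfolding big_O_def using q by (intro exI[of _ "2 / q"]) auto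
qed

lemma little_o_cong:
  assumes "\<And>h hs. h \<in> G \<Longrightarrow> F h hs = F' h hs"
  shows "little_o \<phi> S F \<longleftrightarrow> little_o \<phi> S F'"
proof -
  have "eventually (\<lambda>h. dominated S (F h) (\<epsilon> * \<phi> h)) near0 \<longleftrightarrow> eventually (\<lambda>h. dominated S (F' h) (\<epsilon> * \<phi> h)) near0" for \<epsilon>
    unfolding eventually_near0 dominated_def using assms by auto
  then show ?thesis unfolding little_o_def by simp
qed

text \<open>From 1 / y - 1 / x = - (y - x) / (x y), where the new reciprocal 1 / y stays
  bounded.\<close>

lemma tm_sem_ET_diff:
  assumes a: "a \<in> G"
  shows "little_o (\<lambda>_. 1) {} (tm_diff ET a)"
proof -
  let ?r = "\<lambda>h hs. X (Suc 0) {} (a + h) hs - X (Suc 0) {} a hs"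
  have "little_o (\<lambda>h. 1 * 1) ({} \<union> {}) (\<lambda>h hs. ?r h hs * tm_sem ET (a + h) hs)"
    by (rule little_o_mult[OF little_o_X_continuous[OF a] inverse_X_eventually[OF a]]) auto
  then have "little_o (\<lambda>h. (1 * 1) * 1) (({} \<union> {}) \<union> {}) (\<lambda>h hs. (?r h hs * tm_sem ET (a + h) hs) * tm_sem ET a hs)"
    by (rule little_o_mult[OF _ big_O_tm_sem[OF a multilinear_tm.intros(2)]]) auto
  then have lo: "little_o (\<lambda>_. 1) {} (\<lambda>h hs. - ((?r h hs * tm_sem ET (a + h) hs) * tm_sem ET a hs))"
    by (intro little_o_minus) simp
  have eq: "tm_diff ET a h hs = - ((?r h hs * tm_sem ET (a + h) hs) * tm_sem ET a hs)"
    if "h \<in> G" for h hs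
  proof -
    have "a + h \<in> G" using a that by (simp add: G_simps)
    then have p: "X (Suc 0) {} (a + h) (\<lambda>_. 0) > 0" "X (Suc 0) {} a (\<lambda>_. 0) > 0"
      using X_1_pos[of "a + h"] X_1_pos[of a] a by auto
    have q: "X (Suc 0) {} (a + h) hs = X (Suc 0) {} (a + h) (\<lambda>_. 0)"
      "X (Suc 0) {} a hs = X (Suc 0) {} a (\<lambda>_. 0)"
      by (rule X_empty)+
    have alg: "1 / y - 1 / x = - ((y - x) * (1 / y) * (1 / x))" if "x > 0" "y > 0" for x y :: real
      using that by (simp add: field_simps)
    show ?thesis unfolding tm_sem.simps One_nat_def q by (rule alg[OF p(2,1)])
  qed
  show ?thesis using lo by (subst little_o_cong[OF eq])
qed

lemma tm_sem_ET_rem: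
  assumes a: "a \<in> G"
  shows "little_o n {} (tm_rem ET a)"
proof -
  let ?e = "tm_sem ET a" and ?r = "tm_diff (XT 0 {}) a" and ?d = "tm_rem (XT 0 {}) a" and ?f = "tm_diff ET a"
  have O1: "big_O (\<lambda>_. 1) {} (\<lambda>h. ?e)" using big_O_tm_sem[OF a multilinear_tm.intros(2)] by simp
  have d: "little_o n {} ?d" using little_o_X_differentiable[OF a, of "{}" 0] N by simp
  have r: "big_O n {} ?r"
    using big_O_add[OF little_o_imp_big_O[OF d] big_O_tm_deriv[OF a multilinear_tm.intros(3)[of "{}" 0]]] N by simp
  have "little_o (\<lambda>h. n h * 1) ({} \<union> {}) (\<lambda>h hs. ?d h hs * ?e hs)"
    by (rule little_o_mult[OF d O1]) (auto simp: n_nonneg)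
  then have "little_o (\<lambda>h. (n h * 1) * 1) (({} \<union> {}) \<union> {}) (\<lambda>h hs. (?d h hs * ?e hs) * ?e hs)"
    by (rule little_o_mult[OF _ O1]) (auto simp: n_nonneg)
  moreover have "little_o (\<lambda>h. 1 * 1) ({} \<union> {}) (\<lambda>h hs. ?f h hs * ?e hs)"
    by (rule little_o_mult[OF tm_sem_ET_diff[OF a] O1]) (auto simp: n_nonneg)
  then have "little_o (\<lambda>h. (1 * 1) * n h) (({} \<union> {}) \<union> {}) (\<lambda>h hs. (?f h hs * ?e hs) * ?r h hs)"
    by (rule little_o_mult[OF _ r]) (auto simp: n_nonneg)
  ultimately have lo: "little_o n {} (\<lambda>h hs. - ((?d h hs * ?e hs) * ?e hs + (?f h hs * ?e hs) * ?r h hs))"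
    by (intro little_o_minus little_o_add) simp_all
  have eq: "tm_rem ET a h hs = - ((?d h hs * ?e hs) * ?e hs + (?f h hs * ?e hs) * ?r h hs)"
    if "h \<in> G" for h hs
  proof -
    have "a + h \<in> G" using a that by (simp add: G_simps)
    then have p: "X (Suc 0) {} (a + h) (\<lambda>_. 0) > 0" "X (Suc 0) {} a (\<lambda>_. 0) > 0"
      using X_1_pos[of "a + h"] X_1_pos[of a] a by auto
    have q: "X (Suc 0) {} (a + h) hs = X (Suc 0) {} (a + h) (\<lambda>_. 0)"
      "X (Suc 0) {} a hs = X (Suc 0) {} a (\<lambda>_. 0)"
      by (rule X_empty)+
    \<comment> \<open>The remainder of the reciprocal splits into the remainder of the denominator
      and a product of two differences, one tending to 0 and the other of order n h.\<close>
    have alg: "1 / y - 1 / x - - (1 / x * (1 / x) * D)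
      = - ((y - x - D) * (1 / x) * (1 / x) + (1 / y - 1 / x) * (1 / x) * (y - x))"
      if "x > 0" "y > 0" for x y D :: real
      using that by (simp add: field_simps) (simp add: algebra_simps)?
    show ?thesis unfolding tm_deriv.simps tm_sem.simps One_nat_def q by (rule alg[OF p(2,1)])
  qed
  show ?thesis using lo by (subst little_o_cong[OF eq])
qed

lemma tm_sem_continuous:
  assumes a: "a \<in> G"
  shows "multilinear_tm t S \<Longrightarrow> card S \<le> N \<Longrightarrow> little_o (\<lambda>_. 1) S (tm_diff t a)"
proof (induction rule: multilinear_tm.induct)
  case 1
  obtain L \<delta>1 where L: "L \<ge> 0" "\<delta>1 > 0" "\<And>h. h \<in> G \<Longrightarrow> n h < \<delta>1 \<Longrightarrow> \<bar>Z (a + h) - Z a\<bar> \<le> L * n h"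
    using Z_lipschitz[OF a] by blast
  have "big_O n {} (tm_diff ZT a)"
    unfolding big_O_def eventually_near0 using L by (auto simp: dominated_def nprod_def)
  then show ?case by (rule big_O_n_imp_little_o)
next
  case 2
  then show ?case using tm_sem_ET_diff[OF a] by simp
next
  case (3 S m)
  then show ?case using little_o_X_continuous[OF a, of S m] by simp
next
  case (4 s S t)
  then have "little_o (\<lambda>_. 1) S (\<lambda>h hs. tm_diff s a h hs + tm_diff t a h hs)" by (intro little_o_add) auto
  then show ?case by (simp add: algebra_simps)
next
  case (5 s S t T)
  have f: "finite S" "finite T" using 5 multilinear_tm_finite by auto
  have c: "card S \<le> N" "card T \<le> N" using 5 f by (auto simp: card_Un_disjoint)
  note ds = 5(4)[OF c(1)] and dt = 5(5)[OF c(2)]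
  note bs = big_O_tm_sem[OF a 5(1) c(1)] and bt = big_O_tm_sem[OF a 5(2) c(2)]
  have bt': "big_O (\<lambda>_. 1) T (\<lambda>h. tm_sem t (a + h))"
    using big_O_add[OF little_o_imp_big_O[OF dt] bt] by simp
  have 1: "little_o (\<lambda>_. 1 * 1) (S \<union> T) (\<lambda>h hs. tm_diff s a h hs * tm_sem t (a + h) hs)"
    using 5(3) f by (intro little_o_mult ds bt') auto
  have 2: "little_o (\<lambda>_. 1 * 1) (S \<union> T) (\<lambda>h hs. tm_sem s a hs * tm_diff t a h hs)"
    using 5(3) f by (intro little_o_mult' dt bs) auto
  show ?case using little_o_add[OF 1 2] by (simp add: algebra_simps)
next
  case (6 s S)
  then have "little_o (\<lambda>_. 1) S (\<lambda>h hs. - tm_diff s a h hs)" by (intro little_o_minus) auto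
  then show ?case by (simp add: algebra_simps)
qed

text \<open>The derivative has one direction more than the term, so differentiability is available
  one order below the bound N, while continuity reaches N itself.\<close>

lemma tm_sem_differentiable:
  assumes a: "a \<in> G"
  shows "multilinear_tm t S \<Longrightarrow> card S + 1 \<le> N \<Longrightarrow> little_o n S (tm_rem t a)"
proof (induction rule: multilinear_tm.induct)
  case 1
  have eq: "tm_rem ZT a h hs = Z (a + h) - Z a - dZ a h" for h hs
    by (simp add: dZ_def X_singleton)
  show ?case
    unfolding little_o_def eq eventually_near0 dominated_def using Z_differentiable[OF a]
    by (simp add: nprod_def)
next
  case 2
  then show ?case using tm_sem_ET_rem[OF a] by simp
next
  case (3 S m)
  then show ?case using little_o_X_differentiable[OF a, of S m] by simp
next
  case (4 s S t)
  then have "little_o n S (\<lambda>h hs. tm_rem s a h hs + tm_rem t a h hs)" by (intro little_o_add) auto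
  then show ?case by (simp add: algebra_simps)
next
  case (5 s S t T)
  have f: "finite S" "finite T" using 5 multilinear_tm_finite by auto
  have c1: "card S + 1 \<le> N" "card T + 1 \<le> N" using 5 f by (auto simp: card_Un_disjoint)
  then have c: "card S \<le> N" "card T \<le> N" by auto
  note ds = 5(4)[OF c1(1)] and dt = 5(5)[OF c1(2)]
  note bs = big_O_tm_sem[OF a 5(1) c(1)] and bt = big_O_tm_sem[OF a 5(2) c(2)]
  note ct = tm_sem_continuous[OF a 5(2) c(2)]
  note bds = big_O_tm_deriv[OF a 5(1) c1(1)]
  have bt': "big_O (\<lambda>_. 1) T (\<lambda>h. tm_sem t (a + h))"
    using big_O_add[OF little_o_imp_big_O[OF ct] bt] by simp
  \<comment> \<open>The remainder of a product is R(s) t(a + h) + s' (t(a + h) - t(a)) + s(a) R(t).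
    Relative to n h, each summand is a small factor times a bounded one.\<close>
  have 1: "little_o (\<lambda>h. n h * 1) (S \<union> T) (\<lambda>h hs. tm_rem s a h hs * tm_sem t (a + h) hs)"
    using 5(3) f n_nonneg by (intro little_o_mult ds bt') auto
  have 2: "little_o (\<lambda>h. n h * 1) (S \<union> T) (\<lambda>h hs. tm_sem (tm_deriv s) a (case_nat h hs) * tm_diff t a h hs)"
    using 5(3) f n_nonneg by (intro little_o_mult' bds ct) auto
  have "little_o (\<lambda>h. 1 * n h) (S \<union> T) (\<lambda>h hs. tm_sem s a hs * tm_rem t a h hs)"
    using 5(3) f n_nonneg by (intro little_o_mult' dt bs) auto
  then have 3: "little_o (\<lambda>h. n h * 1) (S \<union> T) (\<lambda>h hs. tm_sem s a hs * tm_rem t a h hs)"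
    by simp
  show ?case using little_o_add[OF little_o_add[OF 1 2] 3]
    by (simp add: algebra_simps tm_sem_shift)
next
  case (6 s S)
  then have "little_o n S (\<lambda>h hs. - tm_rem s a h hs)" by (intro little_o_minus) auto
  then show ?case by (simp add: algebra_simps)
qed

lemma tm_sem_cong:
  "multilinear_tm t S \<Longrightarrow> (\<And>i. i \<in> S \<Longrightarrow> hs i = hs' i) \<Longrightarrow> tm_sem t a hs = tm_sem t a hs'"
  by (induction rule: multilinear_tm.induct) (auto simp: X_def rprod_def)

lemma X_linear:
  assumes a: "a \<in> G" and S: "finite S" "card S \<le> N" "i \<in> S" "hs ` (S - {i}) \<subseteq> G"
    and xy: "x \<in> G" "y \<in> G"
  shows "X (Suc m) S a (hs(i := x + y)) = X (Suc m) S a (hs(i := x)) + X (Suc m) S a (hs(i := y))"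
    and "X (Suc m) S a (hs(i := c *\<^sub>R x)) = c * X (Suc m) S a (hs(i := x))"
proof -
  have r: "rprod S (hs(i := v)) z = rep v z * (\<Prod>j\<in>S - {i}. rep (hs j) z)" for v z
    unfolding rprod_def using S by (subst prod.remove[of _ i]) (auto intro!: prod.cong)
  have im: "(hs(i := v)) ` S \<subseteq> G" if "v \<in> G" for v using S that by auto
  note int = X_integrable[OF a S(1,2) im, of _ m]
  have "X (Suc m) S a (hs(i := x + y)) = (LINT z|M. exp_d_deriv (Suc m) (base a z) * rprod S (hs(i := x)) z
     + exp_d_deriv (Suc m) (base a z) * rprod S (hs(i := y)) z)"
    unfolding X_def
  proof (rule integral_cong_AE)
    show "AE z in M. exp_d_deriv (Suc m) (base a z) * rprod S (hs(i := x + y)) z =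
      exp_d_deriv (Suc m) (base a z) * rprod S (hs(i := x)) z
      + exp_d_deriv (Suc m) (base a z) * rprod S (hs(i := y)) z"
      using rep_add[OF xy] by eventually_elim (simp add: r algebra_simps del: exp_d_deriv.simps)
    show "(\<lambda>z. exp_d_deriv (Suc m) (base a z) * rprod S (hs(i := x + y)) z) \<in> borel_measurable M"
      using int[of "x + y"] xy by (auto simp: G_simps simp del: exp_d_deriv.simps)
    show "(\<lambda>z. exp_d_deriv (Suc m) (base a z) * rprod S (hs(i := x)) z
      + exp_d_deriv (Suc m) (base a z) * rprod S (hs(i := y)) z) \<in> borel_measurable M"
      using int xy by (intro borel_measurable_integrable Bochner_Integration.integrable_add)
  qed
  also have "\<dots> = X (Suc m) S a (hs(i := x)) + X (Suc m) S a (hs(i := y))"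
    unfolding X_def using int xy by (intro Bochner_Integration.integral_add)
  finally show "X (Suc m) S a (hs(i := x + y)) = X (Suc m) S a (hs(i := x)) + X (Suc m) S a (hs(i := y))" .
  have "X (Suc m) S a (hs(i := c *\<^sub>R x)) = (LINT z|M. c * (exp_d_deriv (Suc m) (base a z) * rprod S (hs(i := x)) z))"
    unfolding X_def
  proof (rule integral_cong_AE)
    show "AE z in M. exp_d_deriv (Suc m) (base a z) * rprod S (hs(i := c *\<^sub>R x)) z =
      c * (exp_d_deriv (Suc m) (base a z) * rprod S (hs(i := x)) z)"
      using rep_scale[OF xy(1), of c] by eventually_elim (simp add: r algebra_simps del: exp_d_deriv.simps)
    show "(\<lambda>z. exp_d_deriv (Suc m) (base a z) * rprod S (hs(i := c *\<^sub>R x)) z) \<in> borel_measurable M"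
      using int[of "c *\<^sub>R x"] xy by (auto simp: G_simps simp del: exp_d_deriv.simps)
    show "(\<lambda>z. c * (exp_d_deriv (Suc m) (base a z) * rprod S (hs(i := x)) z)) \<in> borel_measurable M"
      using int xy by (intro borel_measurable_integrable integrable_mult_right)
  qed
  then show "X (Suc m) S a (hs(i := c *\<^sub>R x)) = c * X (Suc m) S a (hs(i := x))"
    unfolding X_def by simp
qed

text \<open>In a product the index i belongs to exactly one factor, and the other factor does not
  depend on that direction.\<close>

lemma tm_sem_linear:
  assumes a: "a \<in> G" and xy: "x \<in> G" "y \<in> G"
  shows "multilinear_tm t S \<Longrightarrow> card S \<le> N \<Longrightarrow> i \<in> S \<Longrightarrow> hs ` (S - {i}) \<subseteq> G \<Longrightarrow>
    tm_sem t a (hs(i := x + y)) = tm_sem t a (hs(i := x)) + tm_sem t a (hs(i := y)) \<and>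
    tm_sem t a (hs(i := c *\<^sub>R x)) = c * tm_sem t a (hs(i := x))"
proof (induction rule: multilinear_tm.induct)
  case (3 S m)
  then show ?case unfolding tm_sem.simps using X_linear[OF a 3(1) 3(2) 3(3) 3(4) xy] by blast
next
  case (5 s S t T)
  have f: "finite S" "finite T" using 5 multilinear_tm_finite by auto
  have c: "card S \<le> N" "card T \<le> N" using 5 f by (auto simp: card_Un_disjoint)
  show ?case
  proof (cases "i \<in> S")
    case True
    then have "i \<notin> T" using 5 by auto
    then have t: "tm_sem t a (hs(i := v)) = tm_sem t a hs" for v
      using 5 by (intro tm_sem_cong) auto
    have "hs ` (S - {i}) \<subseteq> G" using 5 by auto
    note 5(4)[OF c(1) True this]
    then show ?thesis unfolding tm_sem.simps t by (auto simp only: distrib_right mult.assoc)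
  next
    case False
    then have s: "tm_sem s a (hs(i := v)) = tm_sem s a hs" for v
      using 5 by (intro tm_sem_cong) auto
    have i: "i \<in> T" using 5 False by auto
    have "hs ` (T - {i}) \<subseteq> G" using 5 by auto
    note 5(5)[OF c(2) i this]
    then show ?thesis unfolding tm_sem.simps s by (auto simp only: distrib_left mult.left_commute)
  qed
qed (auto simp: distrib_left)

end

section \<open>The inclusion in charts\<close>

lemma mlin_norm_le: "K \<in> mlin_bounds j E nE nF L \<Longrightarrow> mlin_norm j E nE nF L \<le> K"
  unfolding mlin_norm_def by (rule cInf_lower) (auto simp: mlin_bounds_def bdd_below_def)

context moment_space
begin

definition G0 :: "'v set" where
  "G0 = {u \<in> G. expectation (rep u) = 0}"

definition inclusion :: "'v \<Rightarrow> 'v" where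
  "inclusion a = a + Z a *\<^sub>R one"

definition centring :: "'v \<Rightarrow> 'v" where
  "centring u = u - expectation (rep u) *\<^sub>R one"

lemma G0_subset: "G0 \<subseteq> G" by (auto simp: G0_def)

lemma expectation_add:
  assumes "u \<in> G" "v \<in> G"
  shows "expectation (rep (u + v)) = expectation (rep u) + expectation (rep v)"
proof -
  have "expectation (rep (u + v)) = expectation (\<lambda>x. rep u x + rep v x)"
    using rep_add[OF assms] assms rep_measurable by (intro integral_cong_AE) (auto simp: G_simps)
  then show ?thesis using integrable_rep assms by simp
qed

lemma expectation_scale:
  assumes "u \<in> G"
  shows "expectation (rep (c *\<^sub>R u)) = c * expectation (rep u)"
proof -
  have "expectation (rep (c *\<^sub>R u)) = expectation (\<lambda>x. c * rep u x)"
    using rep_scale[OF assms] assms rep_measurable by (intro integral_cong_AE) (auto simp: G_simps)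
  then show ?thesis by simp
qed

lemma expectation_one: "expectation (rep one) = 1"
proof -
  have "expectation (rep one) = expectation (\<lambda>x. 1)"
    using rep_one rep_measurable[OF one_in] by (intro integral_cong_AE) auto
  then show ?thesis by (simp add: prob_space)
qed

lemma scaled_one_in: "c *\<^sub>R one \<in> G"
  by (simp add: one_in G_simps)

lemma subspace_G0: "subspace G0"
  unfolding G0_def subspace_def
  using expectation_add expectation_scale expectation_scale[of one 0] one_in by (auto simp: G_simps)

lemmas G0_simps = subspace_add[OF subspace_G0] subspace_scale[OF subspace_G0] subspace_0[OF subspace_G0]
  subspace_diff[OF subspace_G0]

lemma inclusion_in: "a \<in> G \<Longrightarrow> inclusion a \<in> G"
  by (simp add: inclusion_def G_simps one_in)

lemma centring_in: "u \<in> G \<Longrightarrow> centring u \<in> G0"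
  using expectation_add[of u "(- expectation (rep u)) *\<^sub>R one"] scaled_one_in
    expectation_scale[OF one_in, of "- expectation (rep u)"] expectation_one
  by (auto simp: G0_def centring_def G_simps subspace_neg[OF subspace_G] one_in)

lemma centring_add_one: "u \<in> G \<Longrightarrow> centring (u + c *\<^sub>R one) = centring u"
  using expectation_add[OF _ scaled_one_in, of u c] expectation_scale[OF one_in] expectation_one
  by (simp add: centring_def algebra_simps)

lemma centring_G0: "u \<in> G0 \<Longrightarrow> centring u = u"
  by (simp add: centring_def G0_def)

lemma n_scaled_one: "n (c *\<^sub>R one) = \<bar>c\<bar> * n one"
  by (rule n_scale[OF one_in])

definition tm_Z :: "nat \<Rightarrow> tm" where
  "tm_Z j = (tm_deriv ^^ j) ZT"

lemma multilinear_tm_Z: "multilinear_tm (tm_Z j) {..<j}"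
proof (induction j)
  case 0
  then show ?case by (simp add: tm_Z_def multilinear_tm.intros)
next
  case (Suc j)
  then show ?case using multilinear_tm_deriv[OF Suc] by (simp add: tm_Z_def lessThan_Suc_eq_insert_0)
qed

text \<open>The derivatives of the identity: the point, then the direction, then zero.\<close>

definition incl_lin :: "nat \<Rightarrow> 'v \<Rightarrow> 'v list \<Rightarrow> 'v" where
  "incl_lin j a hs = (if j = 0 then a else if j = 1 then hs ! 0 else 0)"

definition incl_deriv :: "nat \<Rightarrow> 'v \<Rightarrow> 'v list \<Rightarrow> 'v" where
  "incl_deriv j a hs = incl_lin j a hs + tm_sem (tm_Z j) a (nth hs) *\<^sub>R one"

lemma nprod_nth: "length hs = j \<Longrightarrow> nprod {..<j} (nth hs) = prod_list (map n hs)"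
  unfolding nprod_def by (auto simp: prod.list_conv_set_nth atLeast0LessThan)

lemma nth_image: "length hs = j \<Longrightarrow> set hs \<subseteq> G \<Longrightarrow> nth hs ` {..<j} \<subseteq> G"
  by auto

lemma nth_Cons_case_nat: "nth (h # hs) = case_nat h (nth hs)"
  by (auto simp: fun_eq_iff split: nat.split)

text \<open>In the differences and remainders of \<open>incl_deriv\<close> the part of the identity
  cancels and a multiple of \<open>one\<close> is left, so operator norms reduce to bounds on
  real-valued multilinear maps.\<close>

lemma mlin_norm_scaled_one_le:
  assumes "dominated {..<j} F K" "0 \<le> K"
    and L: "\<And>hs. length hs = j \<Longrightarrow> set hs \<subseteq> G0 \<Longrightarrow> L hs = F (nth hs) *\<^sub>R one"
  shows "mlin_norm j G0 n n L \<le> K * n one"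
proof (rule mlin_norm_le, unfold mlin_bounds_def, intro CollectI conjI allI impI)
  show "0 \<le> K * n one" using assms n_nonneg[OF one_in] by simp
  fix hs assume "length hs = j \<and> set hs \<subseteq> G0"
  then have hs: "length hs = j" "set hs \<subseteq> G0" "set hs \<subseteq> G" using G0_subset by auto
  have "n (L hs) = \<bar>F (nth hs)\<bar> * n one" using L hs n_scaled_one by simp
  also have "\<dots> \<le> (K * nprod {..<j} (nth hs)) * n one"
    using assms(1) nth_image[OF hs(1,3)] n_nonneg[OF one_in]
    by (intro mult_right_mono) (auto simp: dominated_def)
  finally show "n (L hs) \<le> K * n one * prod_list (map n hs)"
    using hs by (simp add: nprod_nth ac_simps)
qed

lemma bounded_mlin_incl_deriv:
  assumes j: "j \<le> N" and a: "a \<in> G"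
  shows "bounded_mlin j G0 n G n (incl_deriv j a)"
  unfolding bounded_mlin_def
proof (intro conjI allI impI)
  fix hs assume "length hs = j \<and> set hs \<subseteq> G0"
  then have hs: "length hs = j" "set hs \<subseteq> G" using G0_subset by auto
  have "incl_lin j a hs \<in> G" using hs a by (auto simp: incl_lin_def G_simps)
  then show "incl_deriv j a hs \<in> G"
    unfolding incl_deriv_def by (intro G_simps scaled_one_in)
  fix i assume i: "i < j"
  have upd: "nth (hs[i := x]) k = ((nth hs)(i := x)) k" if "k \<in> {..<j}" for x k
    using i hs that by (simp add: nth_list_update)
  have sem: "tm_sem (tm_Z j) a (nth (hs[i := x])) = tm_sem (tm_Z j) a ((nth hs)(i := x))" for x
    by (rule tm_sem_cong[OF multilinear_tm_Z upd])
  have eq: "incl_deriv j a (hs[i := x]) = (if j = 1 then x else 0) + tm_sem (tm_Z j) a ((nth hs)(i := x)) *\<^sub>R one" for x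
    unfolding incl_deriv_def incl_lin_def sem using i hs by auto
  have im: "nth hs ` ({..<j} - {i}) \<subseteq> G" using nth_image[OF hs] by blast
  show "linear_between G0 G (\<lambda>x. incl_deriv j a (hs[i := x]))"
    unfolding linear_between_def
  proof (intro conjI ballI allI subsetI)
    fix y assume "y \<in> (\<lambda>x. incl_deriv j a (hs[i := x])) ` G0"
    then show "y \<in> G" unfolding eq using G0_subset by (auto simp: G_simps one_in)
  next
    fix x y assume "x \<in> G0" "y \<in> G0"
    then have xy: "x \<in> G" "y \<in> G" using G0_subset by auto
    show "incl_deriv j a (hs[i := x + y]) = incl_deriv j a (hs[i := x]) + incl_deriv j a (hs[i := y])"
      unfolding eq using tm_sem_linear[OF a xy multilinear_tm_Z _ _ im] i j
      by (auto simp: scaleR_add_left)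
  next
    fix x :: 'v and c :: real assume "x \<in> G0"
    then have x: "x \<in> G" using G0_subset by auto
    show "incl_deriv j a (hs[i := c *\<^sub>R x]) = c *\<^sub>R incl_deriv j a (hs[i := x])"
      unfolding eq using tm_sem_linear[OF a x x multilinear_tm_Z _ _ im] i j
      by (auto simp: scaleR_add_right)
  qed
next
  obtain K where K: "K \<ge> 0" "dominated {..<j} (tm_sem (tm_Z j) a) K"
    using tm_sem_bounded[OF a multilinear_tm_Z] j by auto
  \<comment> \<open>The summand n a serves order 0, where the identity contributes the point itself,
    and 1 serves order 1.\<close>
  define K' where "K' = (n a + 1) + K * n one"
  have "K' \<in> mlin_bounds j G0 n n (incl_deriv j a)"
    unfolding mlin_bounds_def
  proof (intro CollectI conjI allI impI)
    show "0 \<le> K'" using K n_nonneg a one_in by (simp add: K'_def)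
    fix hs assume "length hs = j \<and> set hs \<subseteq> G0"
    then have hs: "length hs = j" "set hs \<subseteq> G" using G0_subset by auto
    have P: "0 \<le> prod_list (map n hs)"
      using nprod_nonneg[OF nth_image[OF hs]] nprod_nth[OF hs(1)] by simp
    have lin: "incl_lin j a hs \<in> G" "n (incl_lin j a hs) \<le> (n a + 1) * prod_list (map n hs)"
    proof -
      show "incl_lin j a hs \<in> G" using hs a by (auto simp: incl_lin_def G_simps)
      consider "j = 0" | "j = 1" | "j > 1" by linarith
      then show "n (incl_lin j a hs) \<le> (n a + 1) * prod_list (map n hs)"
      proof cases
        case 2
        then obtain h where h: "hs = [h]" using hs by (auto simp: length_Suc_conv)
        then have "n h * 1 \<le> n h * (n a + 1)" using hs n_nonneg[OF a] n_nonneg[of h] by (intro mult_left_mono) auto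
        then show ?thesis using 2 h by (simp add: incl_lin_def mult.commute)
      qed (use hs P n_nonneg[OF a] in \<open>auto simp: incl_lin_def n_0\<close>)
    qed
    have "\<bar>tm_sem (tm_Z j) a (nth hs)\<bar> \<le> K * prod_list (map n hs)"
      using K(2) nth_image[OF hs] nprod_nth[OF hs(1)] unfolding dominated_def by metis
    then have "\<bar>tm_sem (tm_Z j) a (nth hs)\<bar> * n one \<le> K * prod_list (map n hs) * n one"
      using n_nonneg[OF one_in] by (rule mult_right_mono)
    moreover have "n (incl_deriv j a hs) \<le> n (incl_lin j a hs) + \<bar>tm_sem (tm_Z j) a (nth hs)\<bar> * n one"
      using n_add[OF lin(1) scaled_one_in, of "tm_sem (tm_Z j) a (nth hs)"]
      by (simp add: incl_deriv_def n_scaled_one)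
    ultimately show "n (incl_deriv j a hs) \<le> K' * prod_list (map n hs)"
      using lin(2) by (simp add: K'_def algebra_simps)
  qed
  then show "mlin_bounds j G0 n n (incl_deriv j a) \<noteq> {}" by blast
qed

lemma little_o_rescaled:
  assumes "little_o \<phi> S F" "0 < \<epsilon>" "\<And>h. h \<in> G \<Longrightarrow> 0 \<le> \<phi> h"
  shows "\<exists>\<delta>>0. \<forall>h\<in>G. n h < \<delta> \<longrightarrow> (\<exists>K\<ge>0. dominated S (F h) K \<and> K * n one \<le> \<epsilon> * \<phi> h)"
proof -
  have pos: "0 < \<epsilon> / (n one + 1)" using assms(2) n_nonneg[OF one_in] by simp
  then obtain \<delta> where \<delta>: "\<delta> > 0" "\<And>h. h \<in> G \<Longrightarrow> n h < \<delta> \<Longrightarrow> dominated S (F h) (\<epsilon> / (n one + 1) * \<phi> h)"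
    using assms(1) unfolding little_o_def eventually_near0 by meson
  have "\<epsilon> / (n one + 1) * n one \<le> \<epsilon>" using assms(2) n_nonneg[OF one_in] by (simp add: field_simps)
  then have "\<epsilon> / (n one + 1) * \<phi> h * n one \<le> \<epsilon> * \<phi> h" if "h \<in> G" for h
    using mult_right_mono[OF _ assms(3)[OF that]] by (metis mult.assoc mult.commute)
  moreover have "0 \<le> \<epsilon> / (n one + 1) * \<phi> h" if "h \<in> G" for h
    using pos assms(3)[OF that] by (intro mult_nonneg_nonneg) auto
  ultimately show ?thesis using \<delta> by meson
qed

lemma C_map_inclusion: "C_map N G0 n G n inclusion"
  unfolding C_map_def
proof (intro exI[of _ incl_deriv] conjI ballI allI impI)
  fix a assume "a \<in> G0"
  show "incl_deriv 0 a [] = inclusion a"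
    by (simp add: incl_deriv_def incl_lin_def inclusion_def tm_Z_def)
next
  fix j a assume "j \<le> N" "a \<in> G0"
  then show "bounded_mlin j G0 n G n (incl_deriv j a)" using bounded_mlin_incl_deriv G0_subset by auto
next
  fix j a assume j: "j < N" and a0: "a \<in> G0"
  then have a: "a \<in> G" using G0_subset by auto
  show "has_frechet_derivative G0 n (mlin_norm j G0 n n) (incl_deriv j)
     (\<lambda>h hs. incl_deriv (Suc j) a (h # hs)) a"
    unfolding has_frechet_derivative_def
  proof (intro allI impI)
    fix \<epsilon> :: real assume \<epsilon>: "0 < \<epsilon>"
    have "little_o n {..<j} (tm_rem (tm_Z j) a)"
      using tm_sem_differentiable[OF a multilinear_tm_Z] j by auto
    from little_o_rescaled[OF this \<epsilon> n_nonneg] obtain \<delta> where \<delta>: "\<delta> > 0" "\<And>h. h \<in> G \<Longrightarrow> n h < \<delta> \<Longrightarrow>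
       \<exists>K\<ge>0. dominated {..<j} (tm_rem (tm_Z j) a h) K \<and> K * n one \<le> \<epsilon> * n h"
      by auto
    show "\<exists>\<delta>>0. \<forall>h\<in>G0. n h < \<delta> \<longrightarrow> mlin_norm j G0 n n
      (incl_deriv j (a + h) - incl_deriv j a - (\<lambda>hs. incl_deriv (Suc j) a (h # hs))) \<le> \<epsilon> * n h"
    proof (intro exI[of _ \<delta>] conjI ballI impI)
      fix h assume "h \<in> G0" "n h < \<delta>"
      then have h: "h \<in> G" "n h < \<delta>" using G0_subset by auto
      then obtain K where K: "K \<ge> 0" "dominated {..<j} (tm_rem (tm_Z j) a h) K" "K * n one \<le> \<epsilon> * n h"
        using \<delta>(2) by blast
      have "mlin_norm j G0 n n (incl_deriv j (a + h) - incl_deriv j a - (\<lambda>hs. incl_deriv (Suc j) a (h # hs)))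
        \<le> K * n one"
      proof (rule mlin_norm_scaled_one_le[OF K(2,1)])
        fix hs :: "'v list"
        \<comment> \<open>The identity has no remainder, in any order.\<close>
        have "incl_lin j (a + h) hs - incl_lin j a hs - incl_lin (Suc j) a (h # hs) = 0"
          by (auto simp: incl_lin_def)
        then show "(incl_deriv j (a + h) - incl_deriv j a - (\<lambda>hs. incl_deriv (Suc j) a (h # hs))) hs
          = tm_rem (tm_Z j) a h (nth hs) *\<^sub>R one"
          by (simp add: incl_deriv_def tm_Z_def nth_Cons_case_nat algebra_simps)
      qed
      then show "mlin_norm j G0 n n (incl_deriv j (a + h) - incl_deriv j a - (\<lambda>hs. incl_deriv (Suc j) a (h # hs)))
        \<le> \<epsilon> * n h" using K by simp
    qed (rule \<delta>(1))
  qed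
next
  fix a and \<epsilon> :: real assume "a \<in> G0" and \<epsilon>: "0 < \<epsilon>"
  then have a: "a \<in> G" using G0_subset by auto
  have "little_o (\<lambda>_. 1) {..<N} (tm_diff (tm_Z N) a)"
    using tm_sem_continuous[OF a multilinear_tm_Z] by auto
  from little_o_rescaled[OF this, of "\<epsilon> / 2"] \<epsilon> obtain \<delta> where \<delta>: "\<delta> > 0" "\<And>h. h \<in> G \<Longrightarrow> n h < \<delta> \<Longrightarrow>
       \<exists>K\<ge>0. dominated {..<N} (tm_diff (tm_Z N) a h) K \<and> K * n one \<le> \<epsilon> / 2 * 1"
    by auto
  show "\<exists>\<delta>>0. \<forall>b\<in>G0. n (b - a) < \<delta> \<longrightarrow> mlin_norm N G0 n n (incl_deriv N b - incl_deriv N a) < \<epsilon>"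
  proof (intro exI[of _ \<delta>] conjI ballI impI)
    fix b assume "b \<in> G0" "n (b - a) < \<delta>"
    then have h: "b - a \<in> G" "n (b - a) < \<delta>" using G0_subset a by (auto simp: G_simps)
    then obtain K where K: "K \<ge> 0" "dominated {..<N} (tm_diff (tm_Z N) a (b - a)) K" "K * n one \<le> \<epsilon> / 2 * 1"
      using \<delta>(2) by blast
    have "mlin_norm N G0 n n (incl_deriv N b - incl_deriv N a) \<le> K * n one"
    proof (rule mlin_norm_scaled_one_le[OF K(2,1)])
      fix hs
      \<comment> \<open>As N \<ge> 1, the contribution of the identity does not depend on the base
        point and cancels.\<close>
      show "(incl_deriv N b - incl_deriv N a) hs = tm_diff (tm_Z N) a (b - a) (nth hs) *\<^sub>R one"
        using N by (simp add: incl_deriv_def incl_lin_def algebra_simps)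
    qed
    then show "mlin_norm N G0 n n (incl_deriv N b - incl_deriv N a) < \<epsilon>" using K \<epsilon> by simp
  qed (rule \<delta>(1))
qed

section \<open>The topology of the inclusion\<close>

lemma Metric_space_norm:
  assumes "subspace S" "S \<subseteq> G"
  shows "Metric_space S (\<lambda>x y. if x \<in> S \<and> y \<in> S then n (x - y) else 0)"
proof
  fix x y z
  have D: "x - y \<in> G" if "x \<in> S" "y \<in> S" for x y using assms that subspace_diff by blast
  show "0 \<le> (if x \<in> S \<and> y \<in> S then n (x - y) else 0)" using D n_nonneg by auto
  show "(if x \<in> S \<and> y \<in> S then n (x - y) else 0) = (if y \<in> S \<and> x \<in> S then n (y - x) else 0)"
    using n_minus[OF D, of x y] by auto
  show "((if x \<in> S \<and> y \<in> S then n (x - y) else 0) = 0) = (x = y)" if "x \<in> S" "y \<in> S"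
    using that n_eq_0[OF D, of x y] n_0 by auto
  show "(if x \<in> S \<and> z \<in> S then n (x - z) else 0)
      \<le> (if x \<in> S \<and> y \<in> S then n (x - y) else 0) + (if y \<in> S \<and> z \<in> S then n (y - z) else 0)"
    if "x \<in> S" "y \<in> S" "z \<in> S"
    using that n_add[OF D D, of x y y z] by simp
qed

lemma continuous_map_norm_topology:
  assumes S: "subspace S" "S \<subseteq> G" and T: "subspace T" "T \<subseteq> G" and f: "f ` S \<subseteq> T"
    and c: "\<And>a \<epsilon>. a \<in> S \<Longrightarrow> 0 < \<epsilon> \<Longrightarrow> \<exists>\<delta>>0. \<forall>x\<in>S. n (x - a) < \<delta> \<longrightarrow> n (f x - f a) < \<epsilon>"
  shows "continuous_map (norm_topology S n) (norm_topology T n) f"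
proof -
  interpret S: Metric_space S "\<lambda>x y. if x \<in> S \<and> y \<in> S then n (x - y) else 0"
    by (rule Metric_space_norm[OF S])
  have D: "n (x - y) = n (y - x)" if "x \<in> S" "y \<in> S" for x y
    using n_minus[of "x - y"] subspace_diff[OF S(1) that] S(2) by auto
  have D': "n (x - y) = n (y - x)" if "x \<in> T" "y \<in> T" for x y
    using n_minus[of "x - y"] subspace_diff[OF T(1) that] T(2) by auto
  show ?thesis
    unfolding norm_topology_def S.metric_continuous_map[OF Metric_space_norm[OF T]]
  proof (intro conjI f ballI allI impI)
    fix a and \<epsilon> :: real assume a: "a \<in> S" and \<epsilon>: "0 < \<epsilon>"
    then obtain \<delta> where \<delta>: "\<delta> > 0" "\<And>x. x \<in> S \<Longrightarrow> n (x - a) < \<delta> \<Longrightarrow> n (f x - f a) < \<epsilon>" using c by meson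
    show "\<exists>\<delta>>0. \<forall>x. x \<in> S \<and> (if a \<in> S \<and> x \<in> S then n (a - x) else 0) < \<delta> \<longrightarrow>
        (if f a \<in> T \<and> f x \<in> T then n (f a - f x) else 0) < \<epsilon>"
    proof (intro exI[of _ \<delta>] conjI allI impI \<delta>(1))
      fix x assume "x \<in> S \<and> (if a \<in> S \<and> x \<in> S then n (a - x) else 0) < \<delta>"
      then have "x \<in> S" "n (x - a) < \<delta>" using a D[of x a] by auto
      then show "(if f a \<in> T \<and> f x \<in> T then n (f a - f x) else 0) < \<epsilon>"
        using \<delta>(2) f a D'[of "f a" "f x"] by auto
    qed
  qed
qed

lemma topspace_norm_topology: "subspace S \<Longrightarrow> S \<subseteq> G \<Longrightarrow> topspace (norm_topology S n) = S"
  unfolding norm_topology_def using Metric_space.topspace_mtopology[OF Metric_space_norm] by simp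

lemma centring_lipschitz: "\<exists>C\<ge>0. \<forall>u\<in>G. n (centring u) \<le> C * n u"
proof -
  obtain C where C: "C \<ge> 0" "\<And>u. u \<in> G \<Longrightarrow> (LINT x|M. \<bar>rep u x\<bar>) \<le> C * n u" using L1_bound by blast
  have "n (centring u) \<le> (1 + C * n one) * n u" if u: "u \<in> G" for u
  proof -
    have "n (centring u) \<le> n u + n ((- expectation (rep u)) *\<^sub>R one)"
      using n_add[OF u scaled_one_in, of "- expectation (rep u)"] by (simp add: centring_def)
    also have "\<dots> = n u + \<bar>expectation (rep u)\<bar> * n one" by (simp only: n_scaled_one abs_minus_cancel)
    also have "\<dots> \<le> n u + (C * n u) * n one"
      using order_trans[OF integral_abs_bound C(2)[OF u]] n_nonneg[OF one_in]
      by (intro add_mono mult_right_mono) auto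
    finally show ?thesis by (simp add: algebra_simps)
  qed
  then show ?thesis using C n_nonneg[OF one_in] by (intro exI[of _ "1 + C * n one"]) auto
qed

lemma centring_diff: "u \<in> G \<Longrightarrow> v \<in> G \<Longrightarrow> centring u - centring v = centring (u - v)"
  using expectation_add[of "u - v" v] by (simp add: centring_def G_simps algebra_simps)

lemma continuous_centring: "continuous_map (norm_topology G n) (norm_topology G0 n) centring"
proof (rule continuous_map_norm_topology[OF subspace_G _ subspace_G0 G0_subset])
  obtain C where C: "C \<ge> 0" "\<And>u. u \<in> G \<Longrightarrow> n (centring u) \<le> C * n u" using centring_lipschitz by blast
  fix a \<epsilon> assume a: "a \<in> G" and \<epsilon>: "0 < (\<epsilon>::real)"
  show "\<exists>\<delta>>0. \<forall>x\<in>G. n (x - a) < \<delta> \<longrightarrow> n (centring x - centring a) < \<epsilon>"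
  proof (intro exI[of _ "\<epsilon> / (C + 1)"] conjI ballI impI)
    fix x assume x: "x \<in> G" "n (x - a) < \<epsilon> / (C + 1)"
    have xa: "x - a \<in> G" using x a by (simp add: G_simps)
    have "n (centring x - centring a) \<le> C * n (x - a)" using C(2)[OF xa] centring_diff x a by simp
    also have "\<dots> \<le> (C + 1) * n (x - a)" using n_nonneg[OF xa] by (simp add: mult_right_mono)
    also have "\<dots> < \<epsilon>" using x C by (simp add: field_simps)
    finally show "n (centring x - centring a) < \<epsilon>" .
  qed (use \<epsilon> C in auto)
qed (use centring_in in auto)

text \<open>Maps that only add a constant to their argument are inverted by \<open>centring\<close>.\<close>

lemma embedding_map_add_one:
  assumes c: "\<And>a \<epsilon>. a \<in> G0 \<Longrightarrow> 0 < \<epsilon> \<Longrightarrow> \<exists>\<delta>>0. \<forall>h\<in>G0. n h < \<delta> \<longrightarrow> \<bar>c (a + h) - c a\<bar> < \<epsilon>"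
  shows "embedding_map (norm_topology G0 n) (norm_topology G n) (\<lambda>a. a + c a *\<^sub>R one)"
proof (rule section_imp_embedding_map, unfold section_map_def retraction_maps_def, intro exI conjI ballI)
  show "continuous_map (norm_topology G n) (norm_topology G0 n) centring" by (rule continuous_centring)
  show "centring (x + c x *\<^sub>R one) = x" if "x \<in> topspace (norm_topology G0 n)" for x
    using that centring_add_one[of x] centring_G0[of x] G0_subset
    by (auto simp: topspace_norm_topology[OF subspace_G0 G0_subset])
  show "continuous_map (norm_topology G0 n) (norm_topology G n) (\<lambda>a. a + c a *\<^sub>R one)"
  proof (rule continuous_map_norm_topology[OF subspace_G0 G0_subset subspace_G])
    show "(\<lambda>a. a + c a *\<^sub>R one) ` G0 \<subseteq> G" using G0_subset by (auto simp: G_simps one_in)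
    fix a \<epsilon> assume a: "a \<in> G0" and \<epsilon>: "0 < (\<epsilon>::real)"
    have pos: "0 < \<epsilon> / 2 / (n one + 1)" using \<epsilon> n_nonneg[OF one_in] by simp
    then obtain \<delta> where \<delta>: "\<delta> > 0" "\<And>h. h \<in> G0 \<Longrightarrow> n h < \<delta> \<Longrightarrow> \<bar>c (a + h) - c a\<bar> < \<epsilon> / 2 / (n one + 1)"
      using c[OF a pos] by blast
    show "\<exists>\<delta>>0. \<forall>x\<in>G0. n (x - a) < \<delta> \<longrightarrow> n (x + c x *\<^sub>R one - (a + c a *\<^sub>R one)) < \<epsilon>"
    proof (intro exI[of _ "min \<delta> (\<epsilon> / 2)"] conjI ballI impI)
      fix x assume x: "x \<in> G0" "n (x - a) < min \<delta> (\<epsilon> / 2)"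
      have h: "x - a \<in> G0" using x a by (simp add: G0_simps)
      then have hG: "x - a \<in> G" using G0_subset by auto
      have eq: "x + c x *\<^sub>R one - (a + c a *\<^sub>R one) = (x - a) + (c x - c a) *\<^sub>R one" by (simp add: algebra_simps)
      have "n (x + c x *\<^sub>R one - (a + c a *\<^sub>R one)) \<le> n (x - a) + \<bar>c x - c a\<bar> * n one"
        using n_add[OF hG scaled_one_in, of "c x - c a"] unfolding eq n_scaled_one .
      also have "\<bar>c x - c a\<bar> * n one \<le> \<epsilon> / 2 / (n one + 1) * (n one + 1)"
        using \<delta>(2)[OF h] x pos n_nonneg[OF one_in] by (intro mult_mono) auto
      also have "\<dots> = \<epsilon> / 2" using n_nonneg[OF one_in] by (intro iffD1[OF nonzero_eq_divide_eq refl]) auto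
      finally show "n (x + c x *\<^sub>R one - (a + c a *\<^sub>R one)) < \<epsilon>" using x by simp
    qed (use \<delta> \<epsilon> in auto)
  qed auto
qed

lemma embedding_map_inclusion: "embedding_map (norm_topology G0 n) (norm_topology G n) inclusion"
  unfolding inclusion_def[abs_def]
proof (rule embedding_map_add_one)
  fix a \<epsilon> assume "a \<in> G0" and \<epsilon>: "0 < (\<epsilon>::real)"
  then have a: "a \<in> G" using G0_subset by auto
  have "little_o (\<lambda>_. 1) {} (tm_diff ZT a)"
    by (rule tm_sem_continuous[OF a multilinear_tm.intros(1)]) simp
  then have "\<exists>\<delta>>0. \<forall>h\<in>G. n h < \<delta> \<longrightarrow> dominated {} (tm_diff ZT a h) (\<epsilon> / 2 * 1)"
    using \<epsilon> unfolding little_o_def eventually_near0 by (metis half_gt_zero)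
  then show "\<exists>\<delta>>0. \<forall>h\<in>G0. n h < \<delta> \<longrightarrow> \<bar>Z (a + h) - Z a\<bar> < \<epsilon>"
    using G0_subset \<epsilon> by (fastforce simp: dominated_def nprod_def)
qed

section \<open>The derivative of the inclusion and its image\<close>

lemma dZ_linear:
  assumes a: "a \<in> G" and xy: "x \<in> G" "y \<in> G"
  shows "dZ a (x + y) = dZ a x + dZ a y" "dZ a (c *\<^sub>R x) = c * dZ a x"
proof -
  have u: "X (Suc 0) {0} a (\<lambda>_. v) = X (Suc 0) {0} a ((\<lambda>_. 0)(0 := v))" for v
    by (simp add: X_def rprod_def)
  note X_linear[OF a _ _ _ _ xy, where S = "{0}" and i = 0 and hs = "\<lambda>_. 0" and m = 0, folded u]
  then show "dZ a (x + y) = dZ a x + dZ a y" "dZ a (c *\<^sub>R x) = c * dZ a x"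
    using N by (simp_all add: dZ_def add_divide_distrib)
qed

lemma dZ_bounded:
  assumes a: "a \<in> G"
  shows "\<exists>C\<ge>0. \<forall>h\<in>G. \<bar>dZ a h\<bar> \<le> C * n h"
proof -
  obtain K where K: "K \<ge> 0" "dominated {0} (X (Suc 0) {0} a) K" using dominated_X[OF a, of "{0}" 0] N by auto
  have "\<bar>dZ a h\<bar> \<le> (K / X (Suc 0) {} a (\<lambda>_. 0)) * n h" if "h \<in> G" for h
  proof -
    have "\<bar>X (Suc 0) {0} a (\<lambda>_. h)\<bar> \<le> K * n h"
      using K(2) that unfolding dominated_def nprod_def by (auto dest: spec[of _ "\<lambda>_. h"])
    then show ?thesis using X_1_pos[OF a, of "\<lambda>_. 0"]
      by (simp add: dZ_def abs_divide divide_right_mono)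
  qed
  then show ?thesis using K X_1_pos[OF a, of "\<lambda>_. 0"] by (intro exI[of _ "K / X (Suc 0) {} a (\<lambda>_. 0)"]) auto
qed

text \<open>Adding a constant to a lowers \<open>Z\<close> by the same constant. As a consequence,
  \<open>h + dZ a h *\<^sub>R one\<close> always lies in the kernel of \<open>dZ a\<close>.\<close>

lemma dZ_one:
  assumes a: "a \<in> G"
  shows "dZ a one = - 1"
proof -
  have "X (Suc 0) {0} a (\<lambda>_. one) = X (Suc 0) {} a (\<lambda>_. 0)"
    unfolding X_def
  proof (rule integral_cong_AE)
    show "AE x in M. exp_d_deriv (Suc 0) (base a x) * rprod {0} (\<lambda>_. one) x
      = exp_d_deriv (Suc 0) (base a x) * rprod {} (\<lambda>_. 0) x"
      using rep_one by eventually_elim (simp add: rprod_def)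
    show "(\<lambda>x. exp_d_deriv (Suc 0) (base a x) * rprod {0} (\<lambda>_. one) x) \<in> borel_measurable M"
      using X_integrable[OF a, of "{0}" "\<lambda>_. one" 0] one_in N by (intro borel_measurable_integrable) auto
    show "(\<lambda>x. exp_d_deriv (Suc 0) (base a x) * rprod {} (\<lambda>_. 0) x) \<in> borel_measurable M"
      using X_integrable[OF a, of "{}" "\<lambda>_. 0" 0] N by (intro borel_measurable_integrable) auto
  qed
  then show ?thesis using X_1_pos[OF a, of "\<lambda>_. 0"] by (simp add: dZ_def)
qed

text \<open>Stated for bounded linear maps of \<open>G\<close> into itself, which covers both
  kernels that occur: the functional \<open>dZ a\<close> times \<open>one\<close>, and
  \<open>centring\<close>.\<close>

lemma closedin_zero_set:
  assumes f: "\<And>x y. x \<in> G \<Longrightarrow> y \<in> G \<Longrightarrow> f (x + y) = f x + f y" "\<And>c x. x \<in> G \<Longrightarrow> f (c *\<^sub>R x) = c *\<^sub>R f x"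
    and f_in: "\<And>x. x \<in> G \<Longrightarrow> f x \<in> G" and C: "C \<ge> 0" "\<And>x. x \<in> G \<Longrightarrow> n (f x) \<le> C * n x"
  shows "closed_subspace_in G n {u \<in> G. f u = 0}"
proof -
  have f0: "f 0 = 0" using f(2)[of one 0] one_in by simp
  have fd: "f x - f y = f (x - y)" if "x \<in> G" "y \<in> G" for x y
    using f(1)[of "x - y" y] that by (simp add: G_simps)
  interpret S: Metric_space G "\<lambda>x y. if x \<in> G \<and> y \<in> G then n (x - y) else 0"
    by (rule Metric_space_norm[OF subspace_G]) auto
  have cont: "continuous_map (norm_topology G n) (norm_topology G n) f"
  proof (rule continuous_map_norm_topology[OF subspace_G order_refl subspace_G order_refl])
    fix a \<epsilon> assume a: "a \<in> G" and \<epsilon>: "0 < (\<epsilon>::real)"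
    show "\<exists>\<delta>>0. \<forall>x\<in>G. n (x - a) < \<delta> \<longrightarrow> n (f x - f a) < \<epsilon>"
    proof (intro exI[of _ "\<epsilon> / (C + 1)"] conjI ballI impI)
      fix x assume x: "x \<in> G" "n (x - a) < \<epsilon> / (C + 1)"
      have xa: "x - a \<in> G" using x a by (simp add: G_simps)
      have "n (f x - f a) \<le> C * n (x - a)" using C(2)[OF xa] fd x a by simp
      also have "\<dots> \<le> (C + 1) * n (x - a)" using n_nonneg[OF xa] by (simp add: mult_right_mono)
      also have "\<dots> < \<epsilon>" using x C by (simp add: field_simps)
      finally show "n (f x - f a) < \<epsilon>" .
    qed (use \<epsilon> C in auto)
  qed (use f_in in auto)
  have top: "topspace (norm_topology G n) = G" by (rule topspace_norm_topology[OF subspace_G order_refl])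
  have "closedin (norm_topology G n) {0}"
    unfolding norm_topology_def using closedin_Hausdorff_singleton[OF S.Hausdorff_space_mtopology] G_simps(3) by simp
  from closedin_continuous_map_preimage[OF cont this]
  have "closedin (norm_topology G n) {u \<in> G. f u = 0}" by (simp add: top)
  moreover have "subspace {u \<in> G. f u = 0}"
    using f f0 by (auto simp: subspace_def G_simps)
  ultimately show ?thesis unfolding closed_subspace_in_def by blast
qed

text \<open>The derivative at a maps \<open>G0\<close> onto the kernel of \<open>dZ a\<close>, a
  closed hyperplane that does not contain \<open>one\<close>. The constants, which form the kernel
  of \<open>centring\<close>, are the complement.\<close>

lemma immersion_inclusion: "immersion G0 n G n inclusion"
  unfolding immersion_def
proof (intro ballI exI conjI)
  fix a assume "a \<in> G0"
  then have a: "a \<in> G" using G0_subset by auto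
  let ?A = "\<lambda>h. h + dZ a h *\<^sub>R one"
  obtain C where C: "C \<ge> 0" "\<And>h. h \<in> G \<Longrightarrow> \<bar>dZ a h\<bar> \<le> C * n h" using dZ_bounded[OF a] by blast
  show "has_frechet_derivative G0 n n inclusion ?A a"
    unfolding has_frechet_derivative_def
  proof (intro allI impI)
    fix \<epsilon> :: real assume \<epsilon>: "0 < \<epsilon>"
    have "\<epsilon> / (n one + 1) > 0" using \<epsilon> n_nonneg[OF one_in] by simp
    from Z_differentiable[OF a this] obtain \<delta> where \<delta>: "\<delta> > 0"
      "\<And>h. h \<in> G \<Longrightarrow> n h < \<delta> \<Longrightarrow> \<bar>Z (a + h) - Z a - dZ a h\<bar> \<le> \<epsilon> / (n one + 1) * n h" by blast
    show "\<exists>\<delta>>0. \<forall>h\<in>G0. n h < \<delta> \<longrightarrow> n (inclusion (a + h) - inclusion a - (h + dZ a h *\<^sub>R one)) \<le> \<epsilon> * n h"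
    proof (intro exI[of _ \<delta>] conjI ballI impI \<delta>(1))
      fix h assume "h \<in> G0" "n h < \<delta>"
      then have h: "h \<in> G" "n h < \<delta>" using G0_subset by auto
      have "inclusion (a + h) - inclusion a - (h + dZ a h *\<^sub>R one) = (Z (a + h) - Z a - dZ a h) *\<^sub>R one"
        by (simp add: inclusion_def algebra_simps)
      then have "n (inclusion (a + h) - inclusion a - (h + dZ a h *\<^sub>R one)) = \<bar>Z (a + h) - Z a - dZ a h\<bar> * n one"
        by (simp add: n_scaled_one)
      also have "\<dots> \<le> (\<epsilon> / (n one + 1) * n h) * (n one + 1)"
        using \<delta>(2)[OF h] n_nonneg[OF one_in] by (intro mult_mono) (auto intro: order_trans[OF abs_ge_zero])
      also have "\<dots> = \<epsilon> * n h" using n_nonneg[OF one_in] by (simp add: add_nonneg_eq_0_iff)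
      finally show "n (inclusion (a + h) - inclusion a - (h + dZ a h *\<^sub>R one)) \<le> \<epsilon> * n h" .
    qed
  qed
  show "toplinear_iso_onto_image G0 n G n ?A"
    unfolding toplinear_iso_onto_image_def
  proof
    show "linear_between G0 G ?A"
      using G0_subset dZ_linear[OF a] by (auto simp: linear_between_def G_simps one_in subset_iff algebra_simps)
    show "embedding_map (norm_topology G0 n) (norm_topology G n) ?A"
    proof (rule embedding_map_add_one)
      fix b \<epsilon> assume "b \<in> G0" and \<epsilon>: "0 < (\<epsilon>::real)"
      then have b: "b \<in> G" using G0_subset by auto
      show "\<exists>\<delta>>0. \<forall>h\<in>G0. n h < \<delta> \<longrightarrow> \<bar>dZ a (b + h) - dZ a b\<bar> < \<epsilon>"
      proof (intro exI[of _ "\<epsilon> / (C + 1)"] conjI ballI impI)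
        fix h assume "h \<in> G0" and h': "n h < \<epsilon> / (C + 1)"
        then have h: "h \<in> G" using G0_subset by auto
        have "\<bar>dZ a (b + h) - dZ a b\<bar> \<le> C * n h" using dZ_linear[OF a b h] C(2)[OF h] by simp
        also have "\<dots> \<le> (C + 1) * n h" using n_nonneg[OF h] by (simp add: mult_right_mono)
        also have "\<dots> < \<epsilon>" using h' C by (simp add: field_simps)
        finally show "\<bar>dZ a (b + h) - dZ a b\<bar> < \<epsilon>" .
      qed (use \<epsilon> C in auto)
    qed
  qed
  have image: "?A ` G0 = {u \<in> G. dZ a u *\<^sub>R one = 0}"
  proof (intro equalityI subsetI)
    fix u assume "u \<in> ?A ` G0"
    then obtain h where h: "h \<in> G" "u = h + dZ a h *\<^sub>R one" using G0_subset by auto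
    then have "dZ a u = 0"
      using dZ_linear(1)[OF a h(1) scaled_one_in] dZ_linear(2)[OF a one_in one_in] dZ_one[OF a] by simp
    then show "u \<in> {u \<in> G. dZ a u *\<^sub>R one = 0}" using h by (simp add: G_simps one_in)
  next
    have "one \<noteq> 0" using expectation_one expectation_scale[of one 0] one_in by auto
    then show "u \<in> ?A ` G0" if "u \<in> {u \<in> G. dZ a u *\<^sub>R one = 0}" for u
    proof -
      have u: "u \<in> G" "dZ a u = 0" using that \<open>one \<noteq> 0\<close> by auto
      have "dZ a (centring u) = expectation (rep u)"
        using dZ_linear(1)[OF a u(1) scaled_one_in, of "- expectation (rep u)"]
          dZ_linear(2)[OF a one_in one_in, of "- expectation (rep u)"] dZ_one[OF a] u
        by (simp add: centring_def)
      \<comment> \<open>On the kernel of \<open>dZ a\<close> the map \<open>centring\<close> inverts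
        the derivative.\<close>
      then have "u = ?A (centring u)" by (simp add: centring_def)
      then show ?thesis using centring_in[OF u(1)] by blast
    qed
  qed
  show closed: "closed_subspace_in G n (?A ` G0)"
    unfolding image
  proof (rule closedin_zero_set[where C = "C * n one"])
    show "n (dZ a x *\<^sub>R one) \<le> C * n one * n x" if "x \<in> G" for x
      using mult_right_mono[OF C(2)[OF that] n_nonneg[OF one_in]] by (simp add: n_scaled_one ac_simps)
  qed (use C n_nonneg[OF one_in] dZ_linear[OF a] in \<open>auto simp: scaled_one_in scaleR_add_left\<close>)
  have closed': "closed_subspace_in G n {u \<in> G. centring u = 0}"
  proof -
    obtain C where C: "C \<ge> 0" "\<And>u. u \<in> G \<Longrightarrow> n (centring u) \<le> C * n u" using centring_lipschitz by blast
    show ?thesis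
    proof (rule closedin_zero_set[OF _ _ _ C])
      show "centring (x + y) = centring x + centring y" if "x \<in> G" "y \<in> G" for x y
        using expectation_add[OF that] by (simp add: centring_def algebra_simps)
      show "centring (c *\<^sub>R x) = c *\<^sub>R centring x" if "x \<in> G" for c x
        using expectation_scale[OF that, of c] by (simp add: centring_def algebra_simps)
    qed (use centring_in G0_subset in auto)
  qed
  show "splits G n (?A ` G0)"
    unfolding splits_def
  proof (intro exI[of _ "{u \<in> G. centring u = 0}"] conjI closed')
    show "?A ` G0 \<inter> {u \<in> G. centring u = 0} = {0}"
    proof (intro equalityI subsetI)
      fix u assume "u \<in> ?A ` G0 \<inter> {u \<in> G. centring u = 0}"
      then obtain h where h: "h \<in> G0" "u = h + dZ a h *\<^sub>R one" and u: "centring u = 0" by auto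
      then have "h = 0" using centring_add_one[of h] centring_G0[of h] G0_subset by auto
      then show "u \<in> {0}" using h dZ_linear(2)[OF a one_in one_in, of 0] by simp
    next
      fix u :: 'v assume "u \<in> {0}"
      then show "u \<in> ?A ` G0 \<inter> {u \<in> G. centring u = 0}"
        using closed closed' by (auto simp: closed_subspace_in_def dest: subspace_0)
    qed
    show "{x + y |x y. x \<in> ?A ` G0 \<and> y \<in> {u \<in> G. centring u = 0}} = G"
    proof (intro equalityI subsetI)
      fix u assume "u \<in> {x + y |x y. x \<in> ?A ` G0 \<and> y \<in> {u \<in> G. centring u = 0}}"
      then show "u \<in> G" unfolding image by (auto simp: G_simps)
    next
      fix u assume u: "u \<in> G"
      \<comment> \<open>\<open>?c\<close> is the constant that remains of u once its centred part
        has been mapped into the kernel of \<open>dZ a\<close>.\<close>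
      let ?x = "?A (centring u)" and ?c = "expectation (rep u) - dZ a (centring u)"
      have "centring (?c *\<^sub>R one) = 0"
        using centring_add_one[OF G_simps(3), of ?c] centring_G0[OF G0_simps(3)] by simp
      moreover have "u = ?x + ?c *\<^sub>R one" by (simp add: centring_def algebra_simps)
      ultimately show "u \<in> {x + y |x y. x \<in> ?A ` G0 \<and> y \<in> {u \<in> G. centring u = 0}}"
        using centring_in[OF u] scaled_one_in[of ?c] by blast
    qed
  qed
qed

end

section \<open>Test functions and weak derivatives\<close>

primrec diff_order :: "nat \<Rightarrow> (real \<Rightarrow> real) \<Rightarrow> bool" where
  "diff_order 0 f \<longleftrightarrow> continuous_on UNIV f"
| "diff_order (Suc n) f \<longleftrightarrow> (\<exists>f'. (\<forall>x. (f has_real_derivative f' x) (at x)) \<and> diff_order n f')"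

definition smooth_fun :: "(real \<Rightarrow> real) \<Rightarrow> bool" where
  "smooth_fun f \<longleftrightarrow> (\<forall>n. diff_order n f)"

lemma diff_order_SucD: "diff_order (Suc n) f \<Longrightarrow> diff_order n f"
proof (induction n arbitrary: f)
  case 0
  then obtain f' where "\<forall>x. (f has_real_derivative f' x) (at x)" by auto
  then have "\<forall>x. isCont f x" using DERIV_isCont by blast
  then show ?case by (simp add: continuous_at_imp_continuous_on)
next
  case (Suc n)
  then obtain f' where "\<forall>x. (f has_real_derivative f' x) (at x)" "diff_order (Suc n) f'" by auto
  then show ?case using Suc.IH[of f'] by auto
qed

lemma diff_order_add: "diff_order n f \<Longrightarrow> diff_order n g \<Longrightarrow> diff_order n (\<lambda>x. f x + g x)"
proof (induction n arbitrary: f g)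
  case (Suc n)
  then obtain f' g' where "\<forall>x. (f has_real_derivative f' x) (at x)" "diff_order n f'"
    "\<forall>x. (g has_real_derivative g' x) (at x)" "diff_order n g'" by auto
  then show ?case using Suc.IH[of f' g'] by (auto intro!: exI[of _ "\<lambda>x. f' x + g' x"] derivative_eq_intros)
qed (auto intro: continuous_intros)

lemma diff_order_mult: "diff_order n f \<Longrightarrow> diff_order n g \<Longrightarrow> diff_order n (\<lambda>x. f x * g x)"
proof (induction n arbitrary: f g)
  case (Suc n)
  then obtain f' g' where d: "\<forall>x. (f has_real_derivative f' x) (at x)" "diff_order n f'"
    "\<forall>x. (g has_real_derivative g' x) (at x)" "diff_order n g'" by auto
  have "diff_order n (\<lambda>x. f' x * g x + f x * g' x)"
    using d Suc.prems[THEN diff_order_SucD] by (intro diff_order_add Suc.IH)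
  then show ?case using d by (auto intro!: exI[of _ "\<lambda>x. f' x * g x + f x * g' x"] derivative_eq_intros)
qed (auto intro: continuous_intros)

lemma diff_order_const: "diff_order n (\<lambda>_. c)"
  by (induction n arbitrary: c) (auto intro!: exI[of _ "\<lambda>_. 0"] derivative_eq_intros)

lemma diff_order_affine: "diff_order n f \<Longrightarrow> diff_order n (\<lambda>x. f (c * x + d))"
proof (induction n arbitrary: f)
  case (Suc n)
  then obtain f' where d: "\<And>x. (f has_real_derivative f' x) (at x)" "diff_order n f'" by auto
  have "diff_order n (\<lambda>x. f' (c * x + d) * c)"
    by (intro diff_order_mult diff_order_const Suc.IH d)
  moreover have "((\<lambda>x. f (c * x + d)) has_real_derivative f' (c * x + d) * c) (at x)" for x
    by (rule DERIV_chain2[OF d(1)]) (auto intro!: derivative_eq_intros)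
  ultimately show ?case
    unfolding diff_order.simps by (intro exI[of _ "\<lambda>x. f' (c * x + d) * c"] conjI allI)
qed (auto intro!: continuous_intros elim!: continuous_on_compose2)

lemma smooth_fun_derivative:
  assumes "\<And>x. (f has_real_derivative f' x) (at x)" "smooth_fun f'"
  shows "smooth_fun f"
  unfolding smooth_fun_def
proof
  show "diff_order n f" for n
    using assms by (cases n) (auto simp: smooth_fun_def intro!: continuous_at_imp_continuous_on DERIV_isCont)
qed

text \<open>\<open>smooth_fun\<close> provides a possibly different derivative for each order;
  uniqueness of derivatives identifies them.\<close>

lemma smooth_fun_obtain_derivative:
  assumes "smooth_fun f"
  shows "\<exists>f'. (\<forall>x. (f has_real_derivative f' x) (at x)) \<and> smooth_fun f'"
proof -
  have "\<forall>n. diff_order (Suc n) f" using assms by (auto simp: smooth_fun_def)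
  then obtain F where F: "\<And>n x. (f has_real_derivative F n x) (at x)" "\<And>n. diff_order n (F n)"
    unfolding diff_order.simps by metis
  have "F n = F 0" for n using DERIV_unique[OF F(1) F(1)] by blast
  then have "\<And>n. diff_order n (F 0)" using F(2) by metis
  then show ?thesis using F(1) unfolding smooth_fun_def by blast
qed

text \<open>The flat function exp(-1/x) times a polynomial in 1/x. With y = 1/x, differentiation
  turns p into (p - p') y^2, so the class is closed under derivatives and consists of smooth
  functions.\<close>

definition half_bump_poly :: "real poly \<Rightarrow> real \<Rightarrow> real" where
  "half_bump_poly p x = (if 0 < x then poly p (1 / x) * exp (- (1 / x)) else 0)"

lemma poly_exp_tendsto_0: "((\<lambda>y. poly p y * exp (- y)) \<longlongrightarrow> 0) (at_top :: real filter)"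
proof -
  have "((\<lambda>y. \<Sum>i\<le>degree p. coeff p i * (y ^ i / exp y)) \<longlongrightarrow> (\<Sum>i\<le>degree p. coeff p i * 0)) (at_top :: real filter)"
    by (intro tendsto_intros tendsto_power_div_exp_0)
  then show ?thesis by (simp add: poly_altdef exp_minus field_simps sum_divide_distrib)
qed

lemma half_bump_poly_derivative:
  "(half_bump_poly p has_real_derivative half_bump_poly ((p - pderiv p) * [:0, 0, 1:]) x) (at x)"
proof -
  consider "x < 0" | "x = 0" | "0 < x" by linarith
  then show ?thesis
  proof cases
    case 1
    have "((\<lambda>_. 0) has_real_derivative 0) (at x)" by simp
    then have "(half_bump_poly p has_real_derivative 0) (at x)"
      by (rule has_field_derivative_transform_within[where d = "- x"])
        (use 1 in \<open>auto simp: half_bump_poly_def dist_real_def\<close>)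
    then show ?thesis using 1 by (simp add: half_bump_poly_def)
  next
    case 3
    have "((\<lambda>x. poly p (1 / x) * exp (- (1 / x))) has_real_derivative
        poly ((p - pderiv p) * [:0, 0, 1:]) (1 / x) * exp (- (1 / x))) (at x)"
      using 3 by (auto intro!: derivative_eq_intros DERIV_chain2[OF poly_DERIV]
          simp: field_simps power2_eq_square)
    then have "(half_bump_poly p has_real_derivative
        poly ((p - pderiv p) * [:0, 0, 1:]) (1 / x) * exp (- (1 / x))) (at x)"
      by (rule has_field_derivative_transform_within[where d = x])
        (use 3 in \<open>auto simp: half_bump_poly_def dist_real_def\<close>)
    then show ?thesis using 3 by (simp add: half_bump_poly_def)
  next
    case 2
    \<comment> \<open>With y = 1/h the right difference quotient at 0 is y p(y) exp(-y), which tends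
      to 0 as y grows.\<close>
    have "((\<lambda>y. poly (p * [:0, 1:]) y * exp (- y)) \<longlongrightarrow> 0) (at_top :: real filter)"
      by (rule poly_exp_tendsto_0)
    then have "((\<lambda>h. poly (p * [:0, 1:]) (inverse h) * exp (- (inverse h))) \<longlongrightarrow> 0) (at_right 0)"
      by (rule filterlim_compose[OF _ filterlim_inverse_at_top_right])
    moreover have "\<forall>\<^sub>F h in at_right 0. poly (p * [:0, 1:]) (inverse h) * exp (- (inverse h)) =
        (half_bump_poly p (0 + h) - half_bump_poly p 0) / h"
      using eventually_at_right_less[of 0]
      by eventually_elim (simp add: half_bump_poly_def field_simps)
    ultimately have "((\<lambda>h. (half_bump_poly p (0 + h) - half_bump_poly p 0) / h) \<longlongrightarrow> 0) (at_right 0)"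
      by (rule Lim_transform_eventually)
    moreover have "\<forall>\<^sub>F h in at_left 0. 0 = (half_bump_poly p (0 + h) - half_bump_poly p 0) / h"
      by (simp add: eventually_at_filter half_bump_poly_def)
    then have "((\<lambda>h. (half_bump_poly p (0 + h) - half_bump_poly p 0) / h) \<longlongrightarrow> 0) (at_left 0)"
      by (rule Lim_transform_eventually[OF tendsto_const])
    ultimately have "((\<lambda>h. (half_bump_poly p (0 + h) - half_bump_poly p 0) / h) \<longlongrightarrow> 0) (at 0)"
      by (simp add: filterlim_split_at)
    then show ?thesis using 2 by (simp add: DERIV_def half_bump_poly_def)
  qed
qed

lemma smooth_half_bump_poly: "smooth_fun (half_bump_poly p)"
  unfolding smooth_fun_def
proof
  show "diff_order n (half_bump_poly p)" for n
  proof (induction n arbitrary: p)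
    case 0
    show ?case
      by (auto intro!: continuous_at_imp_continuous_on DERIV_isCont half_bump_poly_derivative)
  next
    case (Suc n)
    then show ?case using half_bump_poly_derivative by auto
  qed
qed

text \<open>The factor n scales the arguments: exp(-1/(n c)) tends to 1 for every c > 0, so the
  functions converge pointwise to the indicator of the open interval while staying between 0 and
  1.\<close>

definition bump :: "nat \<Rightarrow> real \<Rightarrow> real \<Rightarrow> real \<Rightarrow> real" where
  "bump n a b x = half_bump_poly 1 (real n * (x - a)) * half_bump_poly 1 (real n * (b - x))"

lemma smooth_bump: "smooth_fun (bump n a b)"
proof -
  have "smooth_fun (\<lambda>x. half_bump_poly 1 (real n * x + - real n * a) * half_bump_poly 1 (- real n * x + real n * b))"
    using smooth_half_bump_poly[of 1] unfolding smooth_fun_def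
    by (intro allI diff_order_mult diff_order_affine) blast+
  then show ?thesis unfolding bump_def[abs_def] by (simp add: algebra_simps)
qed

lemma bump_bounds: "0 \<le> bump n a b x" "bump n a b x \<le> 1"
  by (auto simp: bump_def half_bump_poly_def intro!: mult_le_one)

lemma bump_outside: "x \<notin> {a<..<b} \<Longrightarrow> bump n a b x = 0"
  by (auto simp: bump_def half_bump_poly_def zero_less_mult_iff)

lemma bump_tendsto: "(\<lambda>n. bump n a b x) \<longlonglongrightarrow> indicator {a<..<b} x"
proof (cases "x \<in> {a<..<b}")
  case True
  have *: "(\<lambda>n. half_bump_poly 1 (real n * c)) \<longlonglongrightarrow> 1" if "0 < c" for c :: real
  proof -
    have "(\<lambda>n. exp (- (1 / c * inverse (real n)))) \<longlonglongrightarrow> exp (- (1 / c * 0))"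
      by (intro tendsto_intros lim_inverse_n)
    moreover have "\<forall>\<^sub>F n in sequentially. exp (- (1 / c * inverse (real n))) = half_bump_poly 1 (real n * c)"
      using eventually_gt_at_top[of 0] by eventually_elim (use that in \<open>auto simp: half_bump_poly_def field_simps\<close>)
    ultimately show ?thesis using Lim_transform_eventually by fastforce
  qed
  show ?thesis unfolding bump_def using tendsto_mult[OF *[of "x - a"] *[of "b - x"]] True by simp
next
  case False
  then show ?thesis using bump_outside[OF False] by simp
qed

text \<open>Product functions, on which a partial derivative acts in one factor only. The density of
  the reference measure has this form as well.\<close>

definition tensor :: "('d::finite \<Rightarrow> real \<Rightarrow> real) \<Rightarrow> real^'d \<Rightarrow> real" where
  "tensor \<phi> x = (\<Prod>j\<in>UNIV. \<phi> j (x $ j))"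

lemma tensor_remove: "tensor \<phi> x = \<phi> i (x $ i) * (\<Prod>j\<in>UNIV - {i}. \<phi> j (x $ j))"
  unfolding tensor_def by (rule prod.remove) auto

lemma tensor_shift: "tensor \<phi> (x + h *\<^sub>R axis i 1) = \<phi> i (x $ i + h) * (\<Prod>j\<in>UNIV - {i}. \<phi> j (x $ j))"
  unfolding tensor_remove[of _ _ i] by (auto simp: axis_def intro!: prod.cong)

lemma tensor_update: "tensor (\<phi>(i := f)) x = f (x $ i) * (\<Prod>j\<in>UNIV - {i}. \<phi> j (x $ j))"
  unfolding tensor_remove[of _ _ i] by (auto intro!: prod.cong)

lemma partial_deriv_tensor:
  assumes "\<And>x. (\<phi> i has_real_derivative f x) (at x)"
  shows "partial_deriv i (tensor \<phi>) = tensor (\<phi>(i := f))"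
proof
  fix x
  have "((\<lambda>h. \<phi> i (x $ i + h)) has_real_derivative f (x $ i + 0) * 1) (at 0)"
    by (rule DERIV_chain2[OF assms]) (auto intro!: derivative_eq_intros)
  then have "((\<lambda>h. tensor \<phi> (x + h *\<^sub>R axis i 1)) has_real_derivative
      f (x $ i) * (\<Prod>j\<in>UNIV - {i}. \<phi> j (x $ j))) (at 0)"
    unfolding tensor_shift by (auto intro!: derivative_eq_intros)
  then show "partial_deriv i (tensor \<phi>) x = tensor (\<phi>(i := f)) x"
    unfolding partial_deriv_def tensor_update by (rule DERIV_imp_deriv)
qed

lemma tensor_differentiable:
  assumes "\<And>j x. (\<phi> j has_real_derivative f j x) (at x)"
  shows "tensor \<phi> differentiable (at x)"
proof -
  have *: "((\<lambda>x. \<phi> j (x $ j)) has_derivative (\<lambda>h. f j (x $ j) * (h $ j))) (at x)" for j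
  proof -
    have "((\<lambda>x. x $ j) has_derivative (\<lambda>h. h $ j)) (at x)"
      by (rule bounded_linear_imp_has_derivative) (rule bounded_linear_vec_nth)
    from has_derivative_compose[OF this assms[of j, unfolded has_field_derivative_def]]
    show ?thesis by simp
  qed
  have "(tensor \<phi> has_derivative (\<lambda>y. \<Sum>i\<in>UNIV. (f i (x $ i) * (y $ i)) * (\<Prod>j\<in>UNIV - {i}. \<phi> j (x $ j)))) (at x)"
    unfolding tensor_def[abs_def] by (rule has_derivative_prod) (rule *)
  then show ?thesis unfolding differentiable_def by blast
qed

lemma C_fun_tensor: "(\<And>j. smooth_fun (\<phi> j)) \<Longrightarrow> C_fun n (tensor \<phi>)"
proof (induction n arbitrary: \<phi>)
  case 0
  have "continuous_on UNIV (\<phi> j)" for j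
    using 0[of j] unfolding smooth_fun_def by (metis diff_order.simps(1))
  then have "continuous_on UNIV (\<lambda>x. \<phi> j (x $ j))" for j
    by (rule continuous_on_compose2) (auto intro!: continuous_intros)
  then show ?case unfolding tensor_def[abs_def] by (auto intro!: continuous_intros)
next
  case (Suc n)
  obtain f where f: "\<And>j x. (\<phi> j has_real_derivative f j x) (at x)" "\<And>j. smooth_fun (f j)"
    using smooth_fun_obtain_derivative[OF Suc.prems] by metis
  have "C_fun n (partial_deriv i (tensor \<phi>))" for i
    unfolding partial_deriv_tensor[OF f(1)] using f Suc.prems by (intro Suc.IH) auto
  moreover have "tensor \<phi> differentiable (at x)" for x
    by (rule tensor_differentiable[of \<phi> f, OF f(1)])
  ultimately show ?case by simp
qed

lemma tensor_support:
  assumes "\<And>j y. y \<notin> {a $ j..b $ j} \<Longrightarrow> \<phi> j y = 0"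
  shows "{x. tensor \<phi> x \<noteq> 0} \<subseteq> cbox a b"
proof
  fix x assume "x \<in> {x. tensor \<phi> x \<noteq> 0}"
  then have "\<forall>j. \<phi> j (x $ j) \<noteq> 0" by (simp add: tensor_def)
  then have "\<forall>j. x $ j \<in> {a $ j..b $ j}" using assms by blast
  then show "x \<in> cbox a b" by (auto simp: mem_box_cart)
qed

lemma tensor_test_function:
  assumes "\<And>j. smooth_fun (\<phi> j)" "\<And>j y. y \<notin> {a $ j..b $ j} \<Longrightarrow> \<phi> j y = 0"
  shows "tensor \<phi> \<in> test_functions"
proof -
  have "closure {x. tensor \<phi> x \<noteq> 0} \<subseteq> cbox a b"
    by (rule closure_minimal[OF tensor_support]) (use assms in auto)
  then have "compact (closure {x. tensor \<phi> x \<noteq> 0})"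
    by (metis bounded_cbox bounded_subset closed_closure compact_eq_bounded_closed)
  then show ?thesis unfolding test_functions_def using C_fun_tensor assms by blast
qed

definition box_bump :: "nat \<Rightarrow> real^'d \<Rightarrow> real^'d \<Rightarrow> real^'d::finite \<Rightarrow> real" where
  "box_bump n a b = tensor (\<lambda>j. bump n (a $ j) (b $ j))"

lemma box_bump_test_function: "box_bump n a b \<in> test_functions"
  unfolding box_bump_def
proof (rule tensor_test_function)
  show "bump n (a $ j) (b $ j) y = 0" if "y \<notin> {a $ j..b $ j}" for j y
    using that by (intro bump_outside) auto
qed (rule smooth_bump)

lemma box_bump_tendsto: "(\<lambda>n. box_bump n a b x) \<longlonglongrightarrow> indicator (box a b) x"
proof -
  have "(\<lambda>n. box_bump n a b x) \<longlonglongrightarrow> (\<Prod>j\<in>UNIV. indicator {a $ j<..<b $ j} (x $ j))"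
    unfolding box_bump_def tensor_def by (intro tendsto_prod bump_tendsto)
  also have "(\<Prod>j\<in>UNIV. indicator {a $ j<..<b $ j} (x $ j)) = (indicator (box a b) x :: real)"
  proof (cases "x \<in> box a b")
    case True
    then show ?thesis by (simp add: mem_box_cart)
  next
    case False
    then show ?thesis by (auto simp: mem_box_cart indicator_def prod_zero_iff)
  qed
  finally show ?thesis .
qed

lemma box_bump_bound: "\<bar>box_bump n a b x\<bar> \<le> indicator (cbox a b) x"
proof (cases "x \<in> cbox a b")
  case True
  then show ?thesis
    unfolding box_bump_def tensor_def using bump_bounds by (auto simp: abs_prod intro!: prod_le_1)
next
  case False
  have "{x. box_bump n a b x \<noteq> 0} \<subseteq> cbox a b"
    unfolding box_bump_def by (intro tensor_support bump_outside) auto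
  then have "box_bump n a b x = 0" using False by blast
  then show ?thesis by simp
qed

text \<open>The positive and negative parts of g are densities of two measures that agree on all
  boxes and are finite there. Boxes form an intersection-stable generator of the Borel sets, so the
  measures coincide.\<close>

lemma AE_eq_0_if_box_integrals_eq_0:
  fixes g :: "'a::euclidean_space \<Rightarrow> real"
  assumes g[measurable]: "g \<in> borel_measurable borel"
    and int: "\<And>a b. integrable lborel (\<lambda>x. indicator (box a b) x * g x)"
    and zero: "\<And>a b. (LINT x|lborel. indicator (box a b) x * g x) = 0"
  shows "AE x in lborel. g x = 0"
proof -
  define P where "P = density lborel (\<lambda>x. ennreal (g x))"
  define N where "N = density lborel (\<lambda>x. ennreal (- g x))"
  have fin: "emeasure P (box a b) \<noteq> \<infinity>" "emeasure N (box a b) \<noteq> \<infinity>"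
    and eq: "emeasure P (box a b) = emeasure N (box a b)" for a b
  proof -
    let ?f = "\<lambda>x. indicator (box a b) x * g x"
    have eP: "emeasure P (box a b) = (\<integral>\<^sup>+x. ennreal (?f x) \<partial>lborel)"
      unfolding P_def by (subst emeasure_density) (auto intro!: nn_integral_cong simp: indicator_def)
    have eN: "emeasure N (box a b) = (\<integral>\<^sup>+x. ennreal (- ?f x) \<partial>lborel)"
      unfolding N_def by (subst emeasure_density) (auto intro!: nn_integral_cong simp: indicator_def)
    show f: "emeasure P (box a b) \<noteq> \<infinity>" "emeasure N (box a b) \<noteq> \<infinity>"
      using int[of a b] unfolding eP eN real_integrable_def by auto
    have "enn2real (emeasure P (box a b)) - enn2real (emeasure N (box a b)) = 0"
      using zero[of a b] unfolding eP eN real_lebesgue_integral_def[OF int] by simp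
    then show "emeasure P (box a b) = emeasure N (box a b)"
      using f by (metis eq_iff_diff_eq_0 ennreal_enn2real infinity_ennreal_def less_top)
  qed
  have "P = N"
  proof (rule measure_eqI_generator_eq)
    let ?E = "range (\<lambda>(a, b). box a b :: 'a set)"
    show "Int_stable ?E" by (auto simp: Int_stable_def box_Int_box)
    show "sets P = sigma_sets UNIV ?E" "sets N = sigma_sets UNIV ?E"
      unfolding P_def N_def by (simp_all add: borel_eq_box)
    let ?A = "\<lambda>n::nat. box (- (real n *\<^sub>R One)) (real n *\<^sub>R One) :: 'a set"
    show "range ?A \<subseteq> ?E" "(\<Union>i. ?A i) = UNIV" using UN_box_eq_UNIV by auto
    show "emeasure P (?A i) \<noteq> \<infinity>" for i by (rule fin)
    show "emeasure P X = emeasure N X" if "X \<in> ?E" for X using that eq by auto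
  qed auto
  then have "AE x in lborel. ennreal (g x) = ennreal (- g x)"
    unfolding P_def N_def by (intro sigma_finite_measure.density_unique[OF sigma_finite_lborel]) auto
  then show ?thesis
  proof eventually_elim
    case (elim x)
    then show ?case
      by (cases "0 \<le> g x") (auto simp: ennreal_neg dest!: ennreal_eq_0_iff[THEN iffD1] sym[of 0] intro: antisym)
  qed
qed

section \<open>Test functions and the fundamental lemma of the calculus of variations\<close>

lemma continuous_test_function: "f \<in> test_functions \<Longrightarrow> continuous_on UNIV f"
  unfolding test_functions_def by (auto dest: spec[of _ 0])

lemma test_function_bounded:
  assumes "f \<in> test_functions"
  shows "\<exists>K B. compact K \<and> 0 \<le> B \<and> (\<forall>x. \<bar>f x\<bar> \<le> B * indicator K x)"
proof -
  let ?K = "closure {x. f x \<noteq> 0}"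
  have K: "compact ?K" using assms by (auto simp: test_functions_def)
  have "compact (f ` ?K)"
    using K continuous_test_function[OF assms] by (intro compact_continuous_image) (auto intro: continuous_on_subset)
  then obtain B where B: "\<And>y. y \<in> f ` ?K \<Longrightarrow> \<bar>y\<bar> \<le> B" using compact_imp_bounded bounded_iff by (metis real_norm_def)
  have "\<bar>f x\<bar> \<le> max 0 B * indicator ?K x" for x
    using B[of "f x"] closure_subset[of "{x. f x \<noteq> 0}"] by (cases "x \<in> ?K") (auto intro: le_max_iff_disj[THEN iffD2])
  then show ?thesis using K by (intro exI[of _ ?K] exI[of _ "max 0 B"]) auto
qed

lemma integrable_times_test_function:
  assumes g: "locally_integrable g" and f: "f \<in> test_functions"
  shows "integrable lebesgue (\<lambda>x. g x * f x)"
proof -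
  obtain K B where K: "compact K" "0 \<le> B" "\<And>x. \<bar>f x\<bar> \<le> B * indicator K x"
    using test_function_bounded[OF f] by blast
  have i: "integrable lebesgue (\<lambda>x. indicator K x * g x)"
    using g K unfolding locally_integrable_def set_integrable_def by simp
  have m: "(\<lambda>x. g x * f x) = (\<lambda>x. (indicator K x * g x) * f x)"
  proof
    fix x
    show "g x * f x = (indicator K x * g x) * f x"
      using K(3)[of x] by (cases "x \<in> K") auto
  qed
  have [measurable]: "f \<in> borel_measurable lebesgue"
    using borel_measurable_continuous_onI[OF continuous_test_function[OF f]]
    by (intro measurable_completion) simp
  show ?thesis
  proof (rule Bochner_Integration.integrable_bound)
    show "integrable lebesgue (\<lambda>x. B * (indicator K x * g x))" using i by auto
    show "(\<lambda>x. g x * f x) \<in> borel_measurable lebesgue"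
      unfolding m by (rule borel_measurable_times[OF borel_measurable_integrable[OF i]]) measurable
    show "AE x in lebesgue. norm (g x * f x) \<le> norm (B * (indicator K x * g x))"
    proof (rule AE_I2)
      fix x
      have "\<bar>g x\<bar> * \<bar>f x\<bar> \<le> \<bar>g x\<bar> * (B * indicator K x)" by (rule mult_left_mono[OF K(3)]) simp
      then show "norm (g x * f x) \<le> norm (B * (indicator K x * g x))"
        using K(2) by (simp add: abs_mult ac_simps indicator_def)
    qed
  qed
qed

text \<open>The bumps converge boundedly to indicators of boxes, so dominated convergence turns the
  hypothesis into vanishing box integrals.\<close>

lemma fundamental_lemma:
  fixes g :: "real^'d::finite \<Rightarrow> real"
  assumes g: "locally_integrable g"
    and zero: "\<And>n a b. (LINT x|lebesgue. g x * box_bump n a b x) = 0"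
  shows "AE x in lebesgue. g x = 0"
proof -
  have gi: "integrable lebesgue (\<lambda>x. indicator K x * g x)" if "compact K" for K
    using g that unfolding locally_integrable_def set_integrable_def by simp
  \<comment> \<open>Measurability is recovered from local integrability: g is the pointwise limit of
    its restrictions to balls.\<close>
  have "g \<in> borel_measurable lebesgue"
  proof (rule borel_measurable_LIMSEQ_real)
    fix i :: nat
    show "(\<lambda>x. indicator (cball 0 (real i)) x * g x) \<in> borel_measurable lebesgue"
      using gi[of "cball 0 (real i)"] by auto
  next
    fix x
    have "eventually (\<lambda>i. indicator (cball 0 (real i)) x * g x = g x) sequentially"
    proof -
      obtain k :: nat where "norm x \<le> real k" using real_arch_simple by blast
      then show ?thesis unfolding eventually_sequentially by (intro exI[of _ k]) auto
    qed
    then show "(\<lambda>i. indicator (cball 0 (real i)) x * g x) \<longlonglongrightarrow> g x" by (rule tendsto_eventually)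
  qed
  then obtain g' where g'[measurable]: "g' \<in> borel_measurable lborel" and ae: "AE x in lborel. g x = g' x"
    using completion_ex_borel_measurable_real by blast
  have ae': "AE x in lebesgue. g x = g' x" using ae by (rule AE_completion)
  have gm[measurable]: "g' \<in> borel_measurable borel" "g' \<in> borel_measurable lebesgue"
    using g' measurable_completion[OF g'] by simp_all
  have int: "integrable lborel (\<lambda>x. indicator (box a b) x * g' x)" for a b
  proof -
    have "integrable lebesgue (\<lambda>x. indicator (cbox a b) x * g' x)"
    proof (rule integrable_cong_AE_imp[OF gi[of "cbox a b"]])
      show "AE x in lebesgue. indicator (cbox a b) x * g x = indicator (cbox a b) x * g' x"
        using ae' by eventually_elim simp
      show "(\<lambda>x. indicator (cbox a b) x * g' x) \<in> borel_measurable lebesgue"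
        using gm(2) by (intro borel_measurable_times borel_measurable_indicator) auto
    qed auto
    then have "integrable lborel (\<lambda>x. indicator (cbox a b) x * g' x)"
      by (subst (asm) integrable_completion) auto
    then show ?thesis
    proof (rule Bochner_Integration.integrable_bound)
      show "AE x in lborel. norm (indicator (box a b) x * g' x) \<le> norm (indicator (cbox a b) x * g' x)"
        using box_subset_cbox[of a b] by (intro AE_I2) (auto simp: indicator_def)
    qed auto
  qed
  have "(LINT x|lborel. indicator (box a b) x * g' x) = 0" for a b
  proof -
    have "(\<lambda>n. LINT x|lebesgue. g x * box_bump n a b x) \<longlonglongrightarrow> (LINT x|lebesgue. g x * indicator (box a b) x)"
    proof (rule integral_dominated_convergence)
      show "integrable lebesgue (\<lambda>x. \<bar>indicator (cbox a b) x * g x\<bar>)" using gi[of "cbox a b"] by auto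
      show "AE x in lebesgue. (\<lambda>n. g x * box_bump n a b x) \<longlonglongrightarrow> g x * indicator (box a b) x"
        by (intro AE_I2 tendsto_mult tendsto_const box_bump_tendsto)
      show "AE x in lebesgue. norm (g x * box_bump n a b x) \<le> \<bar>indicator (cbox a b) x * g x\<bar>" for n
        using mult_left_mono[OF box_bump_bound[of n a b], of "\<bar>g _\<bar>"]
        by (intro AE_I2) (auto simp: abs_mult ac_simps)
      show "(\<lambda>x. g x * box_bump n a b x) \<in> borel_measurable lebesgue" for n
        using integrable_times_test_function[OF g box_bump_test_function] by auto
      show "(\<lambda>x. g x * indicator (box a b) x) \<in> borel_measurable lebesgue"
        using \<open>g \<in> borel_measurable lebesgue\<close>
        by (intro borel_measurable_times borel_measurable_indicator) auto
    qed
    then have "(LINT x|lebesgue. g x * indicator (box a b) x) = 0"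
      unfolding zero using LIMSEQ_unique tendsto_const by blast
    moreover have "(LINT x|lebesgue. g x * indicator (box a b) x) = (LINT x|lebesgue. indicator (box a b) x * g' x)"
    proof (rule integral_cong_AE)
      show "AE x in lebesgue. g x * indicator (box a b) x = indicator (box a b) x * g' x"
        using ae' by eventually_elim simp
      show "(\<lambda>x. g x * indicator (box a b) x) \<in> borel_measurable lebesgue"
        "(\<lambda>x. indicator (box a b) x * g' x) \<in> borel_measurable lebesgue"
        using \<open>g \<in> borel_measurable lebesgue\<close> gm(2)
        by (intro borel_measurable_times borel_measurable_indicator; simp)+
    qed
    moreover have "\<dots> = (LINT x|lborel. indicator (box a b) x * g' x)" by (rule integral_completion) auto
    ultimately show ?thesis by simp
  qed
  from AE_eq_0_if_box_integrals_eq_0[OF gm(1) int this]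
  have "AE x in lebesgue. g' x = 0" by (rule AE_completion)
  then show ?thesis using ae' by eventually_elim simp
qed

section \<open>Multi-index derivatives of test functions\<close>

lemma test_function_partial_deriv:
  assumes f: "f \<in> test_functions"
  shows "partial_deriv i f \<in> test_functions"
proof -
  let ?S = "closure {x. f x \<noteq> 0}"
  have "C_fun n (partial_deriv i f)" for n
    using f by (auto simp: test_functions_def dest: spec[of _ "Suc n"])
  moreover have "{x. partial_deriv i f x \<noteq> 0} \<subseteq> ?S"
  proof
    fix x assume x: "x \<in> {x. partial_deriv i f x \<noteq> 0}"
    show "x \<in> ?S"
    proof (rule ccontr)
      assume "x \<notin> ?S"
      then have "eventually (\<lambda>y. y \<in> - ?S) (nhds x)"
        by (intro eventually_nhds_in_open) auto
      moreover have "((\<lambda>h. x + h *\<^sub>R axis i 1) \<longlongrightarrow> x + 0 *\<^sub>R axis i 1) (nhds 0)"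
        by (intro tendsto_intros filterlim_ident)
      ultimately have "eventually (\<lambda>h. x + h *\<^sub>R axis i 1 \<in> - ?S) (nhds 0)"
        using eventually_compose_filterlim[of "\<lambda>y. y \<in> - ?S" "nhds x"] by simp
      then have "eventually (\<lambda>h. f (x + h *\<^sub>R axis i 1) = 0) (nhds 0)"
        by (rule eventually_mono) (use closure_subset[of "{x. f x \<noteq> 0}"] in auto)
      then have "((\<lambda>h. f (x + h *\<^sub>R axis i 1)) has_real_derivative 0) (at 0)"
        by (subst DERIV_cong_ev[OF refl _ refl, where g = "\<lambda>_. 0"]) auto
      then have "partial_deriv i f x = 0" unfolding partial_deriv_def by (rule DERIV_imp_deriv)
      then show False using x by simp
    qed
  qed
  then have "closure {x. partial_deriv i f x \<noteq> 0} \<subseteq> ?S" by (simp add: closure_minimal)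
  then have "compact (closure {x. partial_deriv i f x \<noteq> 0})"
    using f unfolding test_functions_def
    by (metis (no_types, lifting) bounded_subset closed_closure compact_eq_bounded_closed mem_Collect_eq)
  ultimately show ?thesis unfolding test_functions_def by blast
qed

lemma test_function_partial_deriv_funpow:
  "f \<in> test_functions \<Longrightarrow> (partial_deriv i ^^ k) f \<in> test_functions"
  by (induction k) (auto intro: test_function_partial_deriv)

lemma test_function_foldr:
  "f \<in> test_functions \<Longrightarrow> foldr (\<lambda>i. partial_deriv i ^^ s i) is f \<in> test_functions"
  by (induction "is") (auto intro: test_function_partial_deriv_funpow)

lemma test_function_multi_deriv: "f \<in> test_functions \<Longrightarrow> multi_deriv s f \<in> test_functions"
  unfolding multi_deriv_def by (rule test_function_foldr)

lemma set_coordinates: "set (coordinates :: 'd::finite list) = UNIV"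
  "distinct (coordinates :: 'd list)"
proof -
  have "\<exists>is. distinct is \<and> set is = (UNIV :: 'd set)" using finite_distinct_list[OF finite[of "UNIV :: 'd set"]] by auto
  then have "distinct (coordinates :: 'd list) \<and> set (coordinates :: 'd list) = UNIV"
    unfolding coordinates_def by (rule someI_ex)
  then show "set (coordinates :: 'd list) = UNIV" "distinct (coordinates :: 'd list)" by auto
qed

lemma multi_deriv_0: "multi_deriv (\<lambda>_. 0) f = f"
proof -
  have "foldr (\<lambda>i. partial_deriv i ^^ 0) is f = f" for "is" by (induction "is") auto
  then show ?thesis unfolding multi_deriv_def by simp
qed

lemma multi_deriv_single: "multi_deriv ((\<lambda>_. 0)(i := 1)) f = partial_deriv i f"
proof -
  have "foldr (\<lambda>j. partial_deriv j ^^ (((\<lambda>_. 0)(i := 1)) j)) is f = (if i \<in> set is then partial_deriv i f else f)"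
    if "distinct is" for "is"
    using that by (induction "is") auto
  from this[OF set_coordinates(2)] show ?thesis unfolding multi_deriv_def by (simp add: set_coordinates)
qed

lemma order_of_0: "order_of (\<lambda>_. 0) = 0"
  by (simp add: order_of_def)

lemma order_of_eq_0: "order_of s = 0 \<Longrightarrow> s = (\<lambda>_. 0)"
  by (auto simp: order_of_def fun_eq_iff)

lemma order_of_single: "order_of ((\<lambda>_. 0)(i := 1)) = 1"
  unfolding order_of_def fun_upd_apply by (subst sum.delta) auto

lemma finite_order_of_le: "finite {s :: 'd::finite \<Rightarrow> nat. order_of s \<le> k}"
proof (rule finite_subset)
  show "{s :: 'd \<Rightarrow> nat. order_of s \<le> k} \<subseteq> Pi\<^sub>E UNIV (\<lambda>_. {..k})"
  proof
    fix s :: "'d \<Rightarrow> nat" assume "s \<in> {s. order_of s \<le> k}"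
    moreover have "s i \<le> order_of s" for i unfolding order_of_def by (rule member_le_sum) auto
    ultimately show "s \<in> Pi\<^sub>E UNIV (\<lambda>_. {..k})" by (auto intro: order_trans)
  qed
  show "finite (Pi\<^sub>E (UNIV :: 'd set) (\<lambda>_. {..k}))" by (intro finite_PiE) auto
qed

section \<open>Translation invariance and integrals of partial derivatives\<close>

lemma nn_integral_shift:
  fixes f :: "'a::euclidean_space \<Rightarrow> ennreal"
  assumes [measurable]: "f \<in> borel_measurable borel"
  shows "(\<integral>\<^sup>+x. f (x + v) \<partial>lborel) = (\<integral>\<^sup>+x. f x \<partial>lborel)"
proof -
  have "(\<integral>\<^sup>+x. f x \<partial>lborel) = (\<integral>\<^sup>+x. f x \<partial>distr lborel borel ((+) v))" by (simp add: lborel_distr_plus)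
  also have "\<dots> = (\<integral>\<^sup>+x. f (x + v) \<partial>lborel)" by (subst nn_integral_distr) (auto simp: add.commute)
  finally show ?thesis by simp
qed

lemma lborel_integral_shift:
  fixes f :: "'a::euclidean_space \<Rightarrow> real"
  assumes f: "f \<in> borel_measurable borel"
  shows "(LINT x|lborel. f (x + v)) = (LINT x|lborel. f x)"
    and "integrable lborel (\<lambda>x. f (x + v)) \<longleftrightarrow> integrable lborel f"
proof -
  have "(LINT x|lborel. f x) = (LINT x|distr lborel borel ((+) v). f x)" by (simp add: lborel_distr_plus)
  also have "\<dots> = (LINT x|lborel. f (x + v))"
    by (subst integral_distr) (auto simp: add.commute f)
  finally show "(LINT x|lborel. f (x + v)) = (LINT x|lborel. f x)" by simp
  have "integrable lborel f \<longleftrightarrow> integrable (distr lborel borel ((+) v)) f" by (simp add: lborel_distr_plus)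
  also have "\<dots> \<longleftrightarrow> integrable lborel (\<lambda>x. f (x + v))"
    by (subst integrable_distr_eq) (auto simp: add.commute f)
  finally show "integrable lborel (\<lambda>x. f (x + v)) \<longleftrightarrow> integrable lborel f" ..
qed

text \<open>By translation invariance the difference quotients of f integrate to zero. They converge
  to the partial derivative, are bounded, and are supported in a fixed ball.\<close>

lemma integral_partial_deriv_test_function:
  assumes f: "f \<in> test_functions"
  shows "(LINT x|lebesgue. partial_deriv i f x) = 0"
proof -
  have c: "continuous_on UNIV f" "continuous_on UNIV (partial_deriv i f)"
    using continuous_test_function f test_function_partial_deriv by auto
  have d: "((\<lambda>h. f (x + h *\<^sub>R axis i 1)) has_real_derivative partial_deriv i f (x + h *\<^sub>R axis i 1)) (at h)" for x h
  proof -
    have "f differentiable (at y)" for y using f by (auto simp: test_functions_def dest: spec[of _ "Suc 0"])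
    then have "(\<lambda>h. f (y + h *\<^sub>R axis i 1)) differentiable (at 0)" for y
      by (intro differentiable_chain_at[of "\<lambda>h. y + h *\<^sub>R axis i 1" 0 f, unfolded o_def]) (auto intro!: derivative_intros)
    then have "((\<lambda>h. f (y + h *\<^sub>R axis i 1)) has_real_derivative partial_deriv i f y) (at 0)" for y
      unfolding partial_deriv_def by (metis DERIV_deriv_iff_real_differentiable)
    from this[of "x + h *\<^sub>R axis i 1"]
    have "((\<lambda>k. f (x + (k + h) *\<^sub>R axis i 1)) has_real_derivative partial_deriv i f (x + h *\<^sub>R axis i 1)) (at 0)"
      by (simp add: algebra_simps)
    then show ?thesis using DERIV_shift[of "\<lambda>k. f (x + k *\<^sub>R axis i 1)" _ 0 h] by simp
  qed
  obtain K B where K: "compact K" "0 \<le> B" "\<And>x. \<bar>partial_deriv i f x\<bar> \<le> B * indicator K x"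
    using test_function_bounded[OF test_function_partial_deriv[OF f]] by blast
  obtain K0 B0 where K0: "compact K0" "0 \<le> B0" "\<And>x. \<bar>f x\<bar> \<le> B0 * indicator K0 x"
    using test_function_bounded[OF f] by blast
  obtain R where R: "\<And>x. x \<in> K \<Longrightarrow> norm x \<le> R"
    using compact_imp_bounded[OF K(1)] unfolding bounded_iff by blast
  define q where "q n x = (f (x + (1 / real (Suc n)) *\<^sub>R axis i 1) - f x) / (1 / real (Suc n))" for n x
  have fi: "integrable lborel f"
  proof (rule Bochner_Integration.integrable_bound)
    show "integrable lborel (\<lambda>x. B0 * indicator K0 x)"
      using K0(1) by (auto intro!: emeasure_compact_finite[unfolded infinity_ennreal_def[symmetric]] borel_compact)
    show "AE x in lborel. norm (f x) \<le> norm (B0 * indicator K0 x)" using K0 by (auto simp: abs_mult)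
  qed (use borel_measurable_continuous_onI[OF c(1)] in simp)
  have sh: "integrable lborel (\<lambda>x. f (x + v))" "(LINT x|lborel. f (x + v)) = (LINT x|lborel. f x)" for v
    using fi lborel_integral_shift[OF borel_measurable_continuous_onI[OF c(1)]] by auto
  have q0: "(LINT x|lborel. q n x) = 0" for n
    unfolding q_def using sh fi by simp
  have "(\<lambda>n. LINT x|lborel. q n x) \<longlonglongrightarrow> (LINT x|lborel. partial_deriv i f x)"
  proof (rule integral_dominated_convergence)
    \<comment> \<open>The radius is R + 1 because the intermediate point of the mean value theorem
      has distance less than 1 from x.\<close>
    show "integrable lborel (\<lambda>x. B * indicator (cball 0 (R + 1)) x :: real)"
      by (auto intro!: emeasure_compact_finite[unfolded infinity_ennreal_def[symmetric]])
    show "partial_deriv i f \<in> borel_measurable lborel" "q n \<in> borel_measurable lborel" for n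
      using borel_measurable_continuous_onI[OF c(2)] fi sh(1) unfolding q_def[abs_def] by auto
    show "AE x in lborel. (\<lambda>n. q n x) \<longlonglongrightarrow> partial_deriv i f x"
    proof (rule AE_I2)
      fix x
      have "((\<lambda>h. (f (x + h *\<^sub>R axis i 1) - f x) / h) \<longlongrightarrow> partial_deriv i f x) (at 0)"
        using d[of x 0] unfolding DERIV_def by simp
      then show "(\<lambda>n. q n x) \<longlonglongrightarrow> partial_deriv i f x"
        unfolding q_def tendsto_at_iff_sequentially o_def
        using LIMSEQ_inverse_real_of_nat by (auto simp: inverse_eq_divide dest!: spec[of _ "\<lambda>n. 1 / real (Suc n)"])
    qed
    show "AE x in lborel. norm (q n x) \<le> B * indicator (cball 0 (R + 1)) x" for n
    proof (rule AE_I2)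
      fix x
      let ?h = "1 / real (Suc n)"
      obtain z where z: "0 < z" "z < ?h" "f (x + ?h *\<^sub>R axis i 1) - f x = ?h * partial_deriv i f (x + z *\<^sub>R axis i 1)"
        using MVT2[of 0 ?h "\<lambda>h. f (x + h *\<^sub>R axis i 1)" "\<lambda>h. partial_deriv i f (x + h *\<^sub>R axis i 1)"] d by auto
      have q: "q n x = partial_deriv i f (x + z *\<^sub>R axis i 1)" unfolding q_def z(3) by simp
      show "norm (q n x) \<le> B * indicator (cball 0 (R + 1)) x"
      proof (cases "x + z *\<^sub>R axis i 1 \<in> K")
        case True
        have "norm x \<le> norm (x + z *\<^sub>R axis i 1) + norm (z *\<^sub>R (axis i 1 :: real^'a))"
          using norm_triangle_ineq4[of "x + z *\<^sub>R axis i 1" "z *\<^sub>R axis i 1"] by simp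
        also have "\<dots> \<le> R + 1"
        proof (intro add_mono R[OF True])
          have "z < 1" by (rule less_le_trans[OF z(2)]) simp
          then show "norm (z *\<^sub>R (axis i 1 :: real^'a)) \<le> 1" using z(1) by simp
        qed
        finally have "x \<in> cball 0 (R + 1)" by simp
        then show ?thesis using K(3)[of "x + z *\<^sub>R axis i 1"] True unfolding q by simp
      next
        case False
        then show ?thesis using K(3)[of "x + z *\<^sub>R axis i 1"] K(2) unfolding q by simp
      qed
    qed
  qed
  then have "(LINT x|lborel. partial_deriv i f x) = 0" unfolding q0 using LIMSEQ_unique tendsto_const by blast
  then show ?thesis using borel_measurable_continuous_onI[OF c(2)] by (simp add: integral_completion)
qed

text \<open>Exhibits a multi-index derivative as a function with integral zero; the weak derivatives
  of constants vanish for this reason.\<close>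

lemma multi_deriv_eq_partial_deriv:
  assumes "1 \<le> order_of s" "f \<in> test_functions"
  shows "\<exists>i g. g \<in> test_functions \<and> multi_deriv s f = partial_deriv i g"
proof -
  have "\<exists>i g. g \<in> test_functions \<and> foldr (\<lambda>i. partial_deriv i ^^ s i) is f = partial_deriv i g"
    if "\<exists>i\<in>set is. s i \<noteq> 0" for "is"
    using that
  proof (induction "is")
    case (Cons j js)
    show ?case
    proof (cases "s j")
      case 0
      then show ?thesis using Cons by auto
    next
      case (Suc k)
      have "(partial_deriv j ^^ k) (foldr (\<lambda>i. partial_deriv i ^^ s i) js f) \<in> test_functions"
        using assms(2) by (intro test_function_partial_deriv_funpow test_function_foldr)
      then show ?thesis using Suc by auto
    qed
  qed auto
  moreover have "\<exists>i. s i \<noteq> 0"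
  proof (rule ccontr)
    assume "\<not> (\<exists>i. s i \<noteq> 0)"
    then have "order_of s = 0" by (simp add: order_of_def)
    then show False using assms(1) by simp
  qed
  ultimately show ?thesis unfolding multi_deriv_def by (simp add: set_coordinates)
qed

section \<open>Classes modulo null sets and their weak derivatives\<close>

lemma rep_abs_ae_fun: "AE x in lebesgue. rep_ae_fun (abs_ae_fun f) x = f x"
  using Quotient3_rep_abs[OF Quotient3_ae_fun, of f] by simp

lemma ae_fun_eqI: "AE x in lebesgue. rep_ae_fun u x = rep_ae_fun v x \<Longrightarrow> u = v"
  using Quotient3_rel_rep[OF Quotient3_ae_fun, of u v] by simp

lemma abs_ae_fun_eqI: "AE x in lebesgue. f x = g x \<Longrightarrow> abs_ae_fun f = abs_ae_fun g"
  by (rule ae_fun.abs_eq_iff[THEN iffD2])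

lemma abs_rep_ae_fun: "abs_ae_fun (rep_ae_fun u) = u"
  by (rule Quotient3_abs_rep[OF Quotient3_ae_fun])

lemma rep_ae_fun_add: "AE x in lebesgue. rep_ae_fun (u + v) x = rep_ae_fun u x + rep_ae_fun v x"
proof -
  have "u + v = abs_ae_fun (\<lambda>x. rep_ae_fun u x + rep_ae_fun v x)"
    by (metis abs_rep_ae_fun plus_ae_fun.abs_eq)
  then show ?thesis using rep_abs_ae_fun by metis
qed

lemma rep_ae_fun_scale: "AE x in lebesgue. rep_ae_fun (c *\<^sub>R u) x = c * rep_ae_fun u x"
proof -
  have "c *\<^sub>R u = abs_ae_fun (\<lambda>x. c * rep_ae_fun u x)"
    by (metis abs_rep_ae_fun scaleR_ae_fun.abs_eq)
  then show ?thesis using rep_abs_ae_fun by metis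
qed

text \<open>\<open>lebesgue\<close> is complete, so measurability passes from f to g.\<close>

lemma locally_integrable_cong_AE:
  assumes f: "locally_integrable f" and ae: "AE x in lebesgue. f x = g x"
  shows "locally_integrable g"
  unfolding locally_integrable_def set_integrable_def
proof (intro allI impI)
  fix K :: "(real^'a) set" assume "compact K"
  then have i: "integrable lebesgue (\<lambda>x. indicator K x *\<^sub>R f x)"
    using f by (simp add: locally_integrable_def set_integrable_def)
  have ae': "AE x in lebesgue. indicator K x *\<^sub>R f x = indicator K x *\<^sub>R g x"
    using ae by eventually_elim simp
  moreover have "(\<lambda>x. indicator K x *\<^sub>R g x) \<in> borel_measurable lebesgue"
    using borel_measurable_integrable[OF i] ae' by (rule borel_measurable_AE)
  ultimately show "integrable lebesgue (\<lambda>x. indicator K x *\<^sub>R g x)"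
    using i by (intro integrable_cong_AE_imp[OF i]) (auto elim: eventually_mono)
qed

lemma locally_integrable_add: "locally_integrable f \<Longrightarrow> locally_integrable g \<Longrightarrow> locally_integrable (\<lambda>x. f x + g x)"
  unfolding locally_integrable_def using set_integral_add(1) by blast

lemma locally_integrable_mult: "locally_integrable f \<Longrightarrow> locally_integrable (\<lambda>x. c * f x)"
  unfolding locally_integrable_def by (auto intro: set_integrable_mult_right)

lemma integral_cong_AE_times:
  assumes "locally_integrable f" "AE x in lebesgue. f x = g x" "h \<in> test_functions"
  shows "(LINT x|lebesgue. f x * h x) = (LINT x|lebesgue. g x * h x)"
proof (rule integral_cong_AE)
  show "(\<lambda>x. f x * h x) \<in> borel_measurable lebesgue"
    by (rule borel_measurable_integrable[OF integrable_times_test_function[OF assms(1,3)]])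
  show "(\<lambda>x. g x * h x) \<in> borel_measurable lebesgue"
    by (rule borel_measurable_integrable[OF integrable_times_test_function[OF locally_integrable_cong_AE[OF assms(1,2)] assms(3)]])
  show "AE x in lebesgue. f x * h x = g x * h x" using assms(2) by eventually_elim simp
qed

text \<open>The same notion for functions instead of classes, so that representatives can be
  exchanged for Borel measurable ones.\<close>

definition weak_deriv_fun :: "'d::finite multi_index \<Rightarrow> (real^'d \<Rightarrow> real) \<Rightarrow> (real^'d \<Rightarrow> real) \<Rightarrow> bool" where
  "weak_deriv_fun s u v \<longleftrightarrow> locally_integrable u \<and> locally_integrable v \<and>
     (\<forall>f\<in>test_functions. (LINT x|lebesgue. u x * multi_deriv s f x) =
        (-1) ^ order_of s * (LINT x|lebesgue. v x * f x))"

lemma has_weak_derivative_iff: "has_weak_derivative s u v \<longleftrightarrow> weak_deriv_fun s (rep_ae_fun u) (rep_ae_fun v)"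
  by (simp add: has_weak_derivative_def weak_deriv_fun_def)

lemma weak_deriv_fun_cong_AE:
  assumes "weak_deriv_fun s u v" "AE x in lebesgue. u x = u' x" "AE x in lebesgue. v x = v' x"
  shows "weak_deriv_fun s u' v'"
proof -
  have li: "locally_integrable u" "locally_integrable v" using assms(1) by (auto simp: weak_deriv_fun_def)
  show ?thesis
    unfolding weak_deriv_fun_def
  proof (intro conjI ballI)
    show "locally_integrable u'" "locally_integrable v'"
      using locally_integrable_cong_AE[OF li(1) assms(2)] locally_integrable_cong_AE[OF li(2) assms(3)] .
    fix f :: "real^'a \<Rightarrow> real" assume f: "f \<in> test_functions"
    show "(LINT x|lebesgue. u' x * multi_deriv s f x) = (-1) ^ order_of s * (LINT x|lebesgue. v' x * f x)"
      using assms(1) f integral_cong_AE_times[OF li(1) assms(2) test_function_multi_deriv[OF f, of s]]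
        integral_cong_AE_times[OF li(2) assms(3) f] by (simp add: weak_deriv_fun_def)
  qed
qed

lemma weak_deriv_fun_add:
  assumes "weak_deriv_fun s u v" "weak_deriv_fun s u' v'"
  shows "weak_deriv_fun s (\<lambda>x. u x + u' x) (\<lambda>x. v x + v' x)"
  using assms unfolding weak_deriv_fun_def
  by (auto simp: locally_integrable_add distrib_right distrib_left integrable_times_test_function test_function_multi_deriv)

lemma weak_deriv_fun_scale:
  assumes "weak_deriv_fun s u v"
  shows "weak_deriv_fun s (\<lambda>x. c * u x) (\<lambda>x. c * v x)"
  using assms unfolding weak_deriv_fun_def
  by (auto simp: locally_integrable_mult mult.assoc)

lemma has_weak_derivative_add:
  assumes "has_weak_derivative s u v" "has_weak_derivative s u' v'"
  shows "has_weak_derivative s (u + u') (v + v')"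
  using weak_deriv_fun_cong_AE[OF weak_deriv_fun_add] assms rep_ae_fun_add[THEN AE_symmetric]
  unfolding has_weak_derivative_iff by blast

lemma has_weak_derivative_scale:
  assumes "has_weak_derivative s u v"
  shows "has_weak_derivative s (c *\<^sub>R u) (c *\<^sub>R v)"
  using weak_deriv_fun_cong_AE[OF weak_deriv_fun_scale] assms rep_ae_fun_scale[THEN AE_symmetric]
  unfolding has_weak_derivative_iff by blast

text \<open>The fundamental lemma, applied to the difference of the candidates. It makes the
  definite description in \<open>weak_deriv\<close> meaningful.\<close>

lemma has_weak_derivative_unique:
  assumes "has_weak_derivative s u v" "has_weak_derivative s u w"
  shows "v = w"
proof -
  let ?g = "\<lambda>x. rep_ae_fun v x + (-1) * rep_ae_fun w x"
  have li: "locally_integrable (rep_ae_fun v)" "locally_integrable (rep_ae_fun w)"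
    using assms by (auto simp: has_weak_derivative_def)
  have "AE x in lebesgue. ?g x = 0"
  proof (rule fundamental_lemma)
    show "locally_integrable ?g" using li by (intro locally_integrable_add locally_integrable_mult)
    fix n :: nat and a b :: "real^'a"
    let ?f = "box_bump n a b"
    have f: "?f \<in> test_functions" by (rule box_bump_test_function)
    have "(-1) ^ order_of s * (LINT x|lebesgue. rep_ae_fun v x * ?f x) = (-1) ^ order_of s * (LINT x|lebesgue. rep_ae_fun w x * ?f x)"
      using assms[unfolded has_weak_derivative_def, THEN conjunct2, THEN conjunct2, THEN bspec, OF f] by simp
    then have "(LINT x|lebesgue. rep_ae_fun v x * ?f x) = (LINT x|lebesgue. rep_ae_fun w x * ?f x)" by simp
    moreover have "(\<lambda>x. ?g x * ?f x) = (\<lambda>x. rep_ae_fun v x * ?f x - rep_ae_fun w x * ?f x)"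
      by (simp add: fun_eq_iff algebra_simps)
    ultimately show "(LINT x|lebesgue. ?g x * ?f x) = 0"
      using li f by (simp add: integrable_times_test_function)
  qed
  then show ?thesis by (intro ae_fun_eqI) (auto elim: eventually_mono)
qed

lemma weak_deriv_eq: "has_weak_derivative s u v \<Longrightarrow> weak_deriv s u = v"
  unfolding weak_deriv_def using has_weak_derivative_unique by blast

lemma has_weak_derivative_0: "locally_integrable (rep_ae_fun u) \<Longrightarrow> has_weak_derivative (\<lambda>_. 0) u u"
  by (simp add: has_weak_derivative_def multi_deriv_0 order_of_0)

lemma locally_integrable_const: "locally_integrable (\<lambda>_. c)"
  unfolding locally_integrable_def set_integrable_def
  using lmeasurable_compact by (auto simp: lmeasurable_iff_integrable)

lemma has_weak_derivative_const:
  assumes s: "1 \<le> order_of s"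
  shows "has_weak_derivative s (abs_ae_fun (\<lambda>_. c)) 0"
proof -
  have "weak_deriv_fun s (\<lambda>_. c) (\<lambda>_. 0)"
    unfolding weak_deriv_fun_def
  proof (intro conjI ballI locally_integrable_const)
    fix f :: "real^'a \<Rightarrow> real" assume "f \<in> test_functions"
    from multi_deriv_eq_partial_deriv[OF s this] obtain i g where
      g: "g \<in> test_functions" "multi_deriv s f = partial_deriv i g" by blast
    then show "(LINT x|lebesgue. c * multi_deriv s f x) = (-1) ^ order_of s * (LINT x|lebesgue. 0 * f x)"
      using integral_partial_deriv_test_function[OF g(1), of i] g(2) by simp
  qed
  moreover have "AE x in lebesgue. 0 = rep_ae_fun (0 :: 'a ae_fun) x"
    using rep_abs_ae_fun[of "\<lambda>_. 0", THEN AE_symmetric] by (simp add: zero_ae_fun.abs_eq)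
  ultimately show ?thesis
    unfolding has_weak_derivative_iff
    by (rule weak_deriv_fun_cong_AE[OF _ rep_abs_ae_fun[THEN AE_symmetric]])
qed

text \<open>Moves local integrability of Borel functions to \<open>lborel\<close>, where
  translations and Fubini are at hand. Boxes suffice, as every compact set lies in one.\<close>

lemma locally_integrable_cbox:
  assumes "f \<in> borel_measurable borel"
  shows "locally_integrable f \<longleftrightarrow> (\<forall>a b. integrable lborel (\<lambda>x. indicator (cbox a b) x * f x))"
proof
  assume "locally_integrable f"
  then have "integrable lebesgue (\<lambda>x. indicator (cbox a b) x * f x)" for a b
    by (simp add: locally_integrable_def set_integrable_def)
  then show "\<forall>a b. integrable lborel (\<lambda>x. indicator (cbox a b) x * f x)"
    using assms by (simp add: integrable_completion)
next
  assume f: "\<forall>a b. integrable lborel (\<lambda>x. indicator (cbox a b) x * f x)"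
  show "locally_integrable f"
    unfolding locally_integrable_def
  proof (intro allI impI)
    fix K :: "(real^'a) set" assume K: "compact K"
    then obtain a where "K \<subseteq> cbox (- a) a" using bounded_subset_cbox_symmetric[OF compact_imp_bounded] by metis
    moreover have "set_integrable lebesgue (cbox (- a) a) f"
      using f assms unfolding set_integrable_def by (simp add: integrable_completion)
    ultimately show "set_integrable lebesgue K f"
      using K by (auto intro: set_integrable_subset lmeasurable_compact[THEN fmeasurableD])
  qed
qed

section \<open>Differences along a coordinate as integrals of the weak derivative\<close>

lemma smooth_fun_continuous: "smooth_fun f \<Longrightarrow> isCont f x"
  unfolding smooth_fun_def using diff_order.simps(1) continuous_on_eq_continuous_at open_UNIV by blast

text \<open>In the i-th factor \<phi> is replaced by P(z) - P(z - y), where P is an antiderivative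
  of \<phi>. Unlike P this has compact support; it is the integral of the translates of \<phi> by s
  in [0, y], and its derivative is the difference of two translates.\<close>

lemma averaged_bump:
  fixes a b :: "real^'d::finite"
  assumes y: "0 < y"
  shows "\<exists>F\<in>test_functions. (\<forall>x. F x = (LINT s|lborel. indicator {0..y} s * box_bump n a b (x - s *\<^sub>R axis i 1))) \<and>
    (\<forall>x. partial_deriv i F x = box_bump n a b x - box_bump n a b (x - y *\<^sub>R axis i 1))"
proof -
  define \<phi> where "\<phi> j = bump n (a $ j) (b $ j)" for j
  have \<phi>: "smooth_fun (\<phi> j)" for j unfolding \<phi>_def by (rule smooth_bump)
  have bb: "box_bump n a b = tensor \<phi>" unfolding box_bump_def \<phi>_def ..
  have "\<exists>P. \<forall>x::real. -\<infinity> < x \<longrightarrow> x < \<infinity> \<longrightarrow> (P has_vector_derivative \<phi> i x) (at x)"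
    using smooth_fun_continuous[OF \<phi>] by (intro einterval_antiderivative) auto
  then obtain P where P: "\<And>x. (P has_real_derivative \<phi> i x) (at x)"
    by (auto simp: has_real_derivative_iff_has_vector_derivative)
  define \<Phi> where "\<Phi> z = P z - P (z - y)" for z
  have d\<Phi>: "(\<Phi> has_real_derivative \<phi> i z - \<phi> i (z - y)) (at z)" for z
    unfolding \<Phi>_def[abs_def] by (auto intro!: derivative_eq_intros P DERIV_chain2[OF P])
  have "smooth_fun (\<lambda>z. \<phi> i z + (- 1) * \<phi> i (1 * z + - y))"
    using \<phi>[of i] unfolding smooth_fun_def
    by (intro allI diff_order_add diff_order_mult diff_order_const diff_order_affine) blast+
  then have sm: "smooth_fun (\<lambda>z. \<phi> i z - \<phi> i (z - y))" by simp
  have s\<Phi>: "smooth_fun \<Phi>" by (rule smooth_fun_derivative[OF d\<Phi> sm])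
  have int: "\<Phi> z = (LINT s|lborel. indicator {0..y} s * \<phi> i (z - s))" for z
  proof -
    have "(LINT s|lborel. indicator {0..y} s *\<^sub>R \<phi> i (z - s)) = (- P (z - y)) - (- P (z - 0))"
    proof (rule integral_FTC_atLeastAtMost)
      show "((\<lambda>s. - P (z - s)) has_vector_derivative \<phi> i (z - s)) (at s within {0..y})" for s
        unfolding has_real_derivative_iff_has_vector_derivative[symmetric]
        by (rule has_field_derivative_at_within) (auto intro!: derivative_eq_intros DERIV_chain2[OF P])
      show "continuous_on {0..y} (\<lambda>s. \<phi> i (z - s))"
      proof (rule continuous_on_compose2[where g = "\<phi> i" and f = "\<lambda>s. z - s" and t = UNIV])
        show "continuous_on UNIV (\<phi> i)"
          using smooth_fun_continuous[OF \<phi>[of i]] by (simp add: continuous_on_eq_continuous_at)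
      qed (auto intro!: continuous_intros)
    qed (use y in auto)
    then show ?thesis by (simp add: \<Phi>_def)
  qed
  define F where "F = tensor (\<phi>(i := \<Phi>))"
  have Fx: "F x = (LINT s|lborel. indicator {0..y} s * box_bump n a b (x - s *\<^sub>R axis i 1))" for x
  proof -
    have "box_bump n a b (x - s *\<^sub>R axis i 1) = \<phi> i (x $ i - s) * (\<Prod>j\<in>UNIV - {i}. \<phi> j (x $ j))" for s
      using tensor_shift[of \<phi> x "- s" i] by (simp add: bb)
    then have "(LINT s|lborel. indicator {0..y} s * box_bump n a b (x - s *\<^sub>R axis i 1))
      = (LINT s|lborel. (indicator {0..y} s * \<phi> i (x $ i - s)) * (\<Prod>j\<in>UNIV - {i}. \<phi> j (x $ j)))"
      by (simp add: mult.assoc)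
    also have "\<dots> = \<Phi> (x $ i) * (\<Prod>j\<in>UNIV - {i}. \<phi> j (x $ j))" unfolding int by simp
    finally show ?thesis unfolding F_def tensor_update by simp
  qed
  have pd: "partial_deriv i F x = box_bump n a b x - box_bump n a b (x - y *\<^sub>R axis i 1)" for x
  proof -
    have "partial_deriv i F = tensor ((\<phi>(i := \<Phi>))(i := (\<lambda>z. \<phi> i z - \<phi> i (z - y))))"
      unfolding F_def by (rule partial_deriv_tensor) (simp add: d\<Phi>)
    then have "partial_deriv i F x = (\<phi> i (x $ i) - \<phi> i (x $ i - y)) * (\<Prod>j\<in>UNIV - {i}. \<phi> j (x $ j))"
      by (simp add: tensor_update)
    moreover have "box_bump n a b (x - y *\<^sub>R axis i 1) = \<phi> i (x $ i - y) * (\<Prod>j\<in>UNIV - {i}. \<phi> j (x $ j))"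
      using tensor_shift[of \<phi> x "- y" i] by (simp add: bb)
    moreover have "box_bump n a b x = \<phi> i (x $ i) * (\<Prod>j\<in>UNIV - {i}. \<phi> j (x $ j))"
      unfolding bb by (rule tensor_remove)
    ultimately show ?thesis by (simp add: algebra_simps)
  qed
  \<comment> \<open>Shifts up to y enlarge the support by y in direction i.\<close>
  have "F \<in> test_functions"
    unfolding F_def
  proof (rule tensor_test_function[where a = a and b = "b + y *\<^sub>R axis i 1"])
    show "smooth_fun ((\<phi>(i := \<Phi>)) j)" for j using \<phi> s\<Phi> by auto
    fix j z assume z: "z \<notin> {a $ j..(b + y *\<^sub>R axis i 1) $ j}"
    show "(\<phi>(i := \<Phi>)) j z = 0"
    proof (cases "j = i")
      case True
      have "indicator {0..y} s * \<phi> i (z - s) = 0" for s :: real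
        using z True unfolding \<phi>_def by (cases "s \<in> {0..y}") (auto intro!: bump_outside)
      then have "\<Phi> z = 0" unfolding int by (simp only: Bochner_Integration.integral_zero)
      then show ?thesis using True by simp
    next
      case False
      then have "z \<notin> {a $ j<..<b $ j}" using z by (auto simp: axis_def)
      then show ?thesis using False bump_outside by (simp add: \<phi>_def)
    qed
  qed
  then show ?thesis using Fx pd by blast
qed

lemma shift_in_cbox:
  fixes x :: "real^'d::finite"
  assumes "x \<in> cbox a b" "0 \<le> s" "s \<le> y"
  shows "x + s *\<^sub>R axis i 1 \<in> cbox a (b + y *\<^sub>R axis i 1)"
  unfolding mem_box_cart
proof
  fix j
  have "a $ j \<le> x $ j" "x $ j \<le> b $ j" using assms(1) by (auto simp: mem_box_cart)
  then show "a $ j \<le> (x + s *\<^sub>R axis i 1) $ j \<and> (x + s *\<^sub>R axis i 1) $ j \<le> (b + y *\<^sub>R axis i 1) $ j"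
    using assms(2,3) by (cases "j = i") (auto simp: axis_def)
qed

text \<open>Justifies exchanging the integrals over x and s below: from a box, all shifts up to y
  lead into the box enlarged by y in direction i.\<close>

lemma integrable_translates:
  fixes v :: "real^'d::finite \<Rightarrow> real"
  assumes [measurable]: "v \<in> borel_measurable borel" and v: "locally_integrable v" and y: "0 < y"
  shows "integrable (lborel \<Otimes>\<^sub>M lborel)
    (\<lambda>(x, s). indicator {0..y} s * v (x + s *\<^sub>R axis i 1) * indicator (cbox a b) x)"
proof -
  let ?H = "\<lambda>(x, s). indicator {0..y} s * v (x + s *\<^sub>R axis i 1) * indicator (cbox a b) x"
  define b' where "b' = b + y *\<^sub>R axis i 1"
  have in_box: "x + s *\<^sub>R axis i 1 \<in> cbox a b'" if "x \<in> cbox a b" "s \<in> {0..y}" for x s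
    using that shift_in_cbox[of x a b s y i] by (simp add: b'_def)
  have vi: "(\<integral>\<^sup>+x. ennreal (norm (indicator (cbox a b') x * v x)) \<partial>lborel) < \<infinity>"
    using v locally_integrable_cbox[of v] unfolding integrable_iff_bounded by auto
  have meas: "?H \<in> borel_measurable (lborel \<Otimes>\<^sub>M lborel)" by measurable
  have "(\<integral>\<^sup>+z. ennreal (norm (?H z)) \<partial>(lborel \<Otimes>\<^sub>M lborel))
    = (\<integral>\<^sup>+s. (\<integral>\<^sup>+x. ennreal (norm (?H (x, s))) \<partial>lborel) \<partial>lborel)"
    by (rule lborel_pair.nn_integral_snd[symmetric]) measurable
  also have "\<dots> \<le> (\<integral>\<^sup>+s. (\<integral>\<^sup>+x. ennreal (norm (indicator (cbox a b') x * v x)) \<partial>lborel) * indicator {0..y} s \<partial>lborel)"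
  proof (rule nn_integral_mono)
    fix s :: real
    show "(\<integral>\<^sup>+x. ennreal (norm (?H (x, s))) \<partial>lborel)
      \<le> (\<integral>\<^sup>+x. ennreal (norm (indicator (cbox a b') x * v x)) \<partial>lborel) * indicator {0..y} s"
    proof (cases "s \<in> {0..y}")
      case True
      have "(\<integral>\<^sup>+x. ennreal (norm (?H (x, s))) \<partial>lborel)
        \<le> (\<integral>\<^sup>+x. ennreal (norm (indicator (cbox a b') (x + s *\<^sub>R axis i 1) * v (x + s *\<^sub>R axis i 1))) \<partial>lborel)"
        using in_box[OF _ True] True
        by (intro nn_integral_mono) (auto simp: indicator_def)
      also have "\<dots> = (\<integral>\<^sup>+x. ennreal (norm (indicator (cbox a b') x * v x)) \<partial>lborel)"
        by (rule nn_integral_shift) measurable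
      finally show ?thesis using True by simp
    next
      case False
      then show ?thesis by simp
    qed
  qed
  also have "\<dots> = (\<integral>\<^sup>+x. ennreal (norm (indicator (cbox a b') x * v x)) \<partial>lborel) * emeasure lborel {0..y}"
    by (subst nn_integral_cmult) auto
  also have "\<dots> < \<infinity>" using vi y by (simp add: ennreal_mult_less_top)
  finally show ?thesis using meas unfolding integrable_iff_bounded by blast
qed

text \<open>Testing against a bump averaged over translations in one coordinate moves the difference of \<open>h\<close>
  onto the test function.\<close>

lemma translation_formula:
  fixes h v :: "real^'d::finite \<Rightarrow> real"
  assumes [measurable]: "h \<in> borel_measurable borel" "v \<in> borel_measurable borel"
    and w: "weak_deriv_fun ((\<lambda>_. 0)(i := 1)) h v" and y: "0 < y"
  shows "AE x in lborel. h (x + y *\<^sub>R axis i 1) - h x = (LINT s|lborel. indicator {0..y} s * v (x + s *\<^sub>R axis i 1))"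
proof -
  let ?e = "axis i 1 :: real^'d"
  define I where "I x = (LINT s|lborel. indicator {0..y} s * v (x + s *\<^sub>R ?e))" for x
  have [measurable]: "I \<in> borel_measurable borel" unfolding I_def[abs_def] by measurable
  have lh: "locally_integrable h" and lv: "locally_integrable v" using w by (auto simp: weak_deriv_fun_def)
  note H = integrable_translates[OF assms(2) lv y, of i]
  have lI: "locally_integrable I"
    unfolding locally_integrable_cbox[OF \<open>I \<in> borel_measurable borel\<close>]
  proof (intro allI)
    fix a b :: "real^'d"
    have "integrable lborel (\<lambda>x. LINT s|lborel. indicator {0..y} s * v (x + s *\<^sub>R ?e) * indicator (cbox a b) x)"
      using lborel_pair.integrable_fst'[OF H[of a b]] by simp
    then show "integrable lborel (\<lambda>x. indicator (cbox a b) x * I x)" by (simp add: I_def mult.commute)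
  qed
  have lhs: "locally_integrable (\<lambda>x. h (x + y *\<^sub>R ?e))"
  proof (subst locally_integrable_cbox, measurable, intro allI)
    fix a b :: "real^'d"
    have "integrable lborel (\<lambda>x. indicator (cbox (a + y *\<^sub>R ?e) (b + y *\<^sub>R ?e)) x * h x)"
      using lh locally_integrable_cbox[of h] by auto
    then have "integrable lborel (\<lambda>x. indicator (cbox (a + y *\<^sub>R ?e) (b + y *\<^sub>R ?e)) (x + y *\<^sub>R ?e) * h (x + y *\<^sub>R ?e))"
      by (subst lborel_integral_shift(2)[where f = "\<lambda>x. indicator (cbox (a + y *\<^sub>R ?e) (b + y *\<^sub>R ?e)) x * h x"]) auto
    moreover have "indicator (cbox (a + y *\<^sub>R ?e) (b + y *\<^sub>R ?e)) (x + y *\<^sub>R ?e) = (indicator (cbox a b) x :: real)" for x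
      by (auto simp: indicator_def mem_box_cart)
    ultimately show "integrable lborel (\<lambda>x. indicator (cbox a b) x * h (x + y *\<^sub>R ?e))" by simp
  qed
  \<comment> \<open>The claim is that g vanishes almost everywhere, which the fundamental lemma
    allows to be tested against box bumps.\<close>
  define g where "g x = h (x + y *\<^sub>R ?e) + ((-1) * h x + (-1) * I x)" for x
  have lg: "locally_integrable g"
    unfolding g_def using lh lI lhs by (intro locally_integrable_add locally_integrable_mult)
  have [measurable]: "g \<in> borel_measurable borel" unfolding g_def[abs_def] by measurable
  have "(LINT x|lebesgue. g x * box_bump n a b x) = 0" for n and a b :: "real^'d"
  proof -
    let ?f = "box_bump n a b"
    have f: "?f \<in> test_functions" by (rule box_bump_test_function)
    have fm[measurable]: "?f \<in> borel_measurable borel"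
      by (rule borel_measurable_continuous_onI[OF continuous_test_function[OF f]])
    have f0: "?f x = ?f x * indicator (cbox a b) x" for x
      using box_bump_bound[of n a b x] by (cases "x \<in> cbox a b") auto
    obtain F where F: "F \<in> test_functions" "\<And>x. F x = (LINT s|lborel. indicator {0..y} s * ?f (x - s *\<^sub>R ?e))"
      "\<And>x. partial_deriv i F x = ?f x - ?f (x - y *\<^sub>R ?e)"
      using averaged_bump[OF y, of n a b i] by blast
    have Fm[measurable]: "F \<in> borel_measurable borel"
      by (rule borel_measurable_continuous_onI[OF continuous_test_function[OF F(1)]])
    have tl: "integrable lborel (\<lambda>x. k x * q x)" "(LINT x|lebesgue. k x * q x) = (LINT x|lborel. k x * q x)"
      if "locally_integrable k" "q \<in> test_functions" and [measurable]: "k \<in> borel_measurable borel" for k q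
    proof -
      have [measurable]: "q \<in> borel_measurable borel"
        by (rule borel_measurable_continuous_onI[OF continuous_test_function[OF that(2)]])
      show "integrable lborel (\<lambda>x. k x * q x)"
        using integrable_times_test_function[OF that(1,2)] by (subst (asm) integrable_completion) auto
      show "(LINT x|lebesgue. k x * q x) = (LINT x|lborel. k x * q x)" by (rule integral_completion) measurable
    qed
    have "(LINT x|lebesgue. h x * partial_deriv i F x) = - (LINT x|lebesgue. v x * F x)"
      using w F(1) multi_deriv_single[of i F] order_of_single[of i] unfolding weak_deriv_fun_def by force
    then have 1: "(LINT x|lborel. h x * partial_deriv i F x) = - (LINT x|lborel. v x * F x)"
      using tl(2)[OF lh test_function_partial_deriv[OF F(1), of i]] tl(2)[OF lv F(1)] by simp
    have i2: "integrable lborel (\<lambda>x. h (x + y *\<^sub>R ?e) * ?f x)" using tl(1)[OF lhs f] by simp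
    have sh: "(LINT x|lborel. h (x + y *\<^sub>R ?e) * ?f x) = (LINT x|lborel. h x * ?f (x - y *\<^sub>R ?e))"
      using lborel_integral_shift(1)[of "\<lambda>x. h x * ?f (x - y *\<^sub>R ?e)" "y *\<^sub>R ?e"] by simp
    have i3: "integrable lborel (\<lambda>x. h x * ?f (x - y *\<^sub>R ?e))"
      using lborel_integral_shift(2)[of "\<lambda>x. h x * ?f (x - y *\<^sub>R ?e)" "y *\<^sub>R ?e"] i2 by simp
    have "(LINT x|lborel. h x * partial_deriv i F x) = (LINT x|lborel. h x * ?f x) - (LINT x|lborel. h x * ?f (x - y *\<^sub>R ?e))"
      unfolding F(3) right_diff_distrib using i3 tl(1)[OF lh f] by simp
    then have 2: "(LINT x|lborel. h (x + y *\<^sub>R ?e) * ?f x) - (LINT x|lborel. h x * ?f x) = (LINT x|lborel. v x * F x)"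
      using 1 sh by simp
    have "(LINT x|lborel. v x * F x) = (LINT x|lborel. LINT s|lborel. indicator {0..y} s * v x * ?f (x - s *\<^sub>R ?e))"
      unfolding F(2) by (intro Bochner_Integration.integral_cong refl) (simp add: ac_simps flip: integral_mult_right_zero)
    also have "\<dots> = (LINT s|lborel. LINT x|lborel. indicator {0..y} s * v x * ?f (x - s *\<^sub>R ?e))"
    proof (rule lborel_pair.Fubini_integral[symmetric])
      define b' where "b' = b + y *\<^sub>R ?e"
      have vb: "integrable lborel (\<lambda>x. indicator (cbox a b') x * v x)"
        using lv locally_integrable_cbox[of v] by auto
      have iI: "integrable lborel (indicator {0..y} :: real \<Rightarrow> real)"
        by (rule integrable_real_indicator) (use y in auto)
      have "integrable (lborel \<Otimes>\<^sub>M lborel) (\<lambda>(x, s). (indicator (cbox a b') x * v x) * indicator {0..y} s)"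
      proof (rule lborel_pair.Fubini_integrable)
        show "(\<lambda>(x, s). indicator (cbox a b') x * v x * indicator {0..y} s) \<in> borel_measurable (lborel \<Otimes>\<^sub>M lborel)"
          by measurable
        show "AE x in lborel. integrable lborel (\<lambda>s. case (x, s) of (x, s) \<Rightarrow> indicator (cbox a b') x * v x * indicator {0..y} s)"
          using iI by simp
        show "integrable lborel (\<lambda>x. LINT s|lborel. norm (case (x, s) of (x, s) \<Rightarrow> indicator (cbox a b') x * v x * indicator {0..y} s))"
          using integrable_abs[OF vb] by (simp add: abs_mult)
      qed
      then show "integrable (lborel \<Otimes>\<^sub>M lborel) (\<lambda>(x, s). indicator {0..y} s * v x * ?f (x - s *\<^sub>R ?e))"
      proof (rule Bochner_Integration.integrable_bound)
        show "(\<lambda>(x, s). indicator {0..y} s * v x * ?f (x - s *\<^sub>R ?e)) \<in> borel_measurable (lborel \<Otimes>\<^sub>M lborel)"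
          by measurable
        show "AE z in lborel \<Otimes>\<^sub>M lborel. norm (case z of (x, s) \<Rightarrow> indicator {0..y} s * v x * ?f (x - s *\<^sub>R ?e))
           \<le> norm (case z of (x, s) \<Rightarrow> (indicator (cbox a b') x * v x) * indicator {0..y} s)"
        proof (rule AE_I2, clarify)
          fix x s
          have bb: "\<bar>?f (x - s *\<^sub>R ?e)\<bar> \<le> indicator (cbox a b) (x - s *\<^sub>R ?e)" by (rule box_bump_bound)
          have "indicator {0..y} s * \<bar>?f (x - s *\<^sub>R ?e)\<bar> \<le> indicator (cbox a b') x * indicator {0..y} s"
          proof (cases "s \<in> {0..y} \<and> x - s *\<^sub>R ?e \<in> cbox a b")
            case True
            then have "x \<in> cbox a b'"
              using shift_in_cbox[of "x - s *\<^sub>R ?e" a b s y i] by (simp add: b'_def)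
            then show ?thesis using True bb by simp
          next
            case False
            then have "s \<notin> {0..y} \<or> ?f (x - s *\<^sub>R ?e) = 0" using bb by (auto simp: indicator_def)
            then show ?thesis by auto
          qed
          then have "\<bar>v x\<bar> * (indicator {0..y} s * \<bar>?f (x - s *\<^sub>R ?e)\<bar>) \<le> \<bar>v x\<bar> * (indicator (cbox a b') x * indicator {0..y} s)"
            by (rule mult_left_mono) simp
          then show "norm (indicator {0..y} s * v x * ?f (x - s *\<^sub>R ?e)) \<le> norm (indicator (cbox a b') x * v x * indicator {0..y} s)"
            by (simp add: abs_mult ac_simps)
        qed
      qed
    qed
    \<comment> \<open>For each s, a substitution moves the translation from the bump onto v.\<close>
    also have "\<dots> = (LINT s|lborel. LINT x|lborel. indicator {0..y} s * v (x + s *\<^sub>R ?e) * ?f x)"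
    proof (rule Bochner_Integration.integral_cong[OF refl])
      fix s :: real
      show "(LINT x|lborel. indicator {0..y} s * v x * ?f (x - s *\<^sub>R ?e)) = (LINT x|lborel. indicator {0..y} s * v (x + s *\<^sub>R ?e) * ?f x)"
        using lborel_integral_shift(1)[of "\<lambda>x. indicator {0..y} s * v x * ?f (x - s *\<^sub>R ?e)" "s *\<^sub>R ?e"] by simp
    qed
    also have "\<dots> = (LINT x|lborel. LINT s|lborel. indicator {0..y} s * v (x + s *\<^sub>R ?e) * ?f x)"
    proof (rule lborel_pair.Fubini_integral)
      show "integrable (lborel \<Otimes>\<^sub>M lborel) (\<lambda>(x, s). indicator {0..y} s * v (x + s *\<^sub>R ?e) * ?f x)"
      proof (rule Bochner_Integration.integrable_bound[OF H[of a b]])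
        show "(\<lambda>(x, s). indicator {0..y} s * v (x + s *\<^sub>R ?e) * ?f x) \<in> borel_measurable (lborel \<Otimes>\<^sub>M lborel)"
          by measurable
        show "AE z in lborel \<Otimes>\<^sub>M lborel. norm (case z of (x, s) \<Rightarrow> indicator {0..y} s * v (x + s *\<^sub>R ?e) * ?f x)
          \<le> norm (case z of (x, s) \<Rightarrow> indicator {0..y} s * v (x + s *\<^sub>R ?e) * indicator (cbox a b) x)"
          using box_bump_bound[of n a b] by (intro AE_I2) (auto simp: abs_mult intro!: mult_left_mono)
      qed
    qed
    also have "\<dots> = (LINT x|lborel. I x * ?f x)" by (simp add: I_def)
    finally have 3: "(LINT x|lborel. v x * F x) = (LINT x|lborel. I x * ?f x)" .
    have "(LINT x|lborel. g x * ?f x) = (LINT x|lborel. h (x + y *\<^sub>R ?e) * ?f x) - (LINT x|lborel. h x * ?f x) - (LINT x|lborel. I x * ?f x)"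
      unfolding g_def distrib_right using tl(1)[OF lh f] tl(1)[OF lI f] i2 by simp
    then show ?thesis using 2 3 tl(2)[OF lg f] by simp
  qed
  from fundamental_lemma[OF lg this] have "AE x in lborel. g x = 0"
    by (subst (asm) AE_completion_iff) auto
  then show ?thesis by eventually_elim (simp add: g_def I_def)
qed

section \<open>Uniform integrability\<close>

text \<open>Bernoulli's inequality for a / m = 1 + (a - m) / m: the graph of the p-th power lies
  above its tangent at m.\<close>

lemma power_tangent_le:
  fixes a m :: real
  assumes "0 \<le> a" "0 \<le> m" "1 \<le> p"
  shows "m ^ p + real p * m ^ (p - 1) * (a - m) \<le> a ^ p"
proof (cases "m = 0")
  case True
  then show ?thesis using assms by (cases "p = 1") (auto simp: power_0_left)
next
  case False
  then have m: "0 < m" using assms by simp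
  have "1 + real p * ((a - m) / m) \<le> (1 + (a - m) / m) ^ p"
    using m assms by (intro Bernoulli_inequality) (simp add: field_simps)
  also have "1 + (a - m) / m = a / m" using m by (simp add: field_simps)
  finally have "m ^ p * (1 + real p * ((a - m) / m)) \<le> m ^ p * (a / m) ^ p"
    using m by (intro mult_left_mono) auto
  moreover have "m ^ p * (a / m) ^ p = a ^ p" using m by (simp add: power_divide)
  moreover have "m ^ p * (1 + real p * ((a - m) / m)) = m ^ p + real p * m ^ (p - 1) * (a - m)"
    using m assms(3) by (cases p) (auto simp: field_simps)
  ultimately show ?thesis by simp
qed

lemma power_integral_le:
  fixes f :: "real \<Rightarrow> real"
  assumes [measurable]: "f \<in> borel_measurable borel" and y: "0 < y" and p: "1 \<le> p"
  shows "ennreal (\<bar>LINT s|lborel. indicator {0..y} s * f s\<bar> ^ p)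
    \<le> ennreal (y ^ (p - 1)) * (\<integral>\<^sup>+s. ennreal (\<bar>f s\<bar> ^ p) * indicator {0..y} s \<partial>lborel)"
proof (cases "(\<integral>\<^sup>+s. ennreal (\<bar>f s\<bar> ^ p) * indicator {0..y} s \<partial>lborel) = \<infinity>")
  case True
  then show ?thesis using y by (simp add: ennreal_mult_top)
next
  case False
  let ?I = "indicator {0..y} :: real \<Rightarrow> real"
  have eq: "(\<integral>\<^sup>+s. ennreal (\<bar>f s\<bar> ^ p) * indicator {0..y} s \<partial>lborel) = (\<integral>\<^sup>+s. ennreal (?I s * \<bar>f s\<bar> ^ p) \<partial>lborel)"
    by (intro nn_integral_cong) (auto simp: indicator_def)
  have int: "integrable lborel (\<lambda>s. ?I s * \<bar>f s\<bar> ^ p)"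
  proof (rule integrableI_nonneg)
    show "(\<integral>\<^sup>+s. ennreal (?I s * \<bar>f s\<bar> ^ p) \<partial>lborel) < \<infinity>"
      using False unfolding eq by (simp add: top.not_eq_extremum)
  qed auto
  have int1: "integrable lborel ?I" by (rule integrable_real_indicator) (use y in auto)
  have le: "\<bar>f s\<bar> \<le> 1 + \<bar>f s\<bar> ^ p" for s
  proof (cases "\<bar>f s\<bar> \<le> 1")
    case True
    then show ?thesis by (simp add: add_increasing2)
  next
    case False
    then have "\<bar>f s\<bar> ^ 1 \<le> \<bar>f s\<bar> ^ p" using p by (intro power_increasing) auto
    then show ?thesis by simp
  qed
  have intf: "integrable lborel (\<lambda>s. ?I s * \<bar>f s\<bar>)"
  proof (rule Bochner_Integration.integrable_bound[of _ "\<lambda>s. ?I s + ?I s * \<bar>f s\<bar> ^ p"])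
    show "AE s in lborel. norm (?I s * \<bar>f s\<bar>) \<le> norm (?I s + ?I s * \<bar>f s\<bar> ^ p)"
      using le by (intro AE_I2) (auto simp: indicator_def)
  qed (use int int1 in auto)
  define A where "A = (LINT s|lborel. ?I s * \<bar>f s\<bar>)"
  \<comment> \<open>The mean of |f| over the interval, so that the linear term of the tangent
    integrates to zero.\<close>
  define m where "m = A / y"
  have A0: "0 \<le> A" unfolding A_def by (intro Bochner_Integration.integral_nonneg) auto
  have m0: "0 \<le> m" using A0 y by (simp add: m_def)
  have "(LINT s|lborel. (m ^ p - real p * m ^ (p - 1) * m) * ?I s + (real p * m ^ (p - 1)) * (?I s * \<bar>f s\<bar>))
      \<le> (LINT s|lborel. ?I s * \<bar>f s\<bar> ^ p)"
  proof (rule integral_mono)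
    fix s
    show "(m ^ p - real p * m ^ (p - 1) * m) * ?I s + (real p * m ^ (p - 1)) * (?I s * \<bar>f s\<bar>) \<le> ?I s * \<bar>f s\<bar> ^ p"
      using power_tangent_le[OF abs_ge_zero[of "f s"] m0 p] by (auto simp: indicator_def algebra_simps)
  qed (use int int1 intf in auto)
  moreover have "(LINT s|lborel. (m ^ p - real p * m ^ (p - 1) * m) * ?I s + (real p * m ^ (p - 1)) * (?I s * \<bar>f s\<bar>))
      = (m ^ p - real p * m ^ (p - 1) * m) * y + (real p * m ^ (p - 1)) * A"
    using int1 intf y by (simp add: A_def)
  moreover have "A = m * y" using y by (simp add: m_def)
  ultimately have "m ^ p * y \<le> (LINT s|lborel. ?I s * \<bar>f s\<bar> ^ p)" by (simp add: algebra_simps)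
  then have "y ^ (p - 1) * (m ^ p * y) \<le> y ^ (p - 1) * (LINT s|lborel. ?I s * \<bar>f s\<bar> ^ p)"
    using y by (intro mult_left_mono) auto
  moreover have "y ^ (p - 1) * (m ^ p * y) = A ^ p"
    using \<open>A = m * y\<close> p by (cases p) (auto simp: power_mult_distrib)
  moreover have "\<bar>LINT s|lborel. ?I s * f s\<bar> ^ p \<le> A ^ p"
  proof (rule power_mono)
    have "\<bar>LINT s|lborel. ?I s * f s\<bar> \<le> (LINT s|lborel. \<bar>?I s * f s\<bar>)" by (rule integral_abs_bound)
    then show "\<bar>LINT s|lborel. ?I s * f s\<bar> \<le> A" by (simp add: A_def abs_mult)
  qed simp
  ultimately have "\<bar>LINT s|lborel. ?I s * f s\<bar> ^ p \<le> y ^ (p - 1) * (LINT s|lborel. ?I s * \<bar>f s\<bar> ^ p)" by linarith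
  then have "ennreal (\<bar>LINT s|lborel. ?I s * f s\<bar> ^ p) \<le> ennreal (y ^ (p - 1) * (LINT s|lborel. ?I s * \<bar>f s\<bar> ^ p))"
    by (rule ennreal_leI)
  also have "\<dots> = ennreal (y ^ (p - 1)) * ennreal (LINT s|lborel. ?I s * \<bar>f s\<bar> ^ p)"
    using y by (intro ennreal_mult Bochner_Integration.integral_nonneg) auto
  also have "ennreal (LINT s|lborel. ?I s * \<bar>f s\<bar> ^ p) = (\<integral>\<^sup>+s. ennreal (?I s * \<bar>f s\<bar> ^ p) \<partial>lborel)"
    by (rule nn_integral_eq_integral[symmetric, OF int]) auto
  finally show ?thesis unfolding eq .
qed

text \<open>The difference is the integral of v along a segment; Jensen gives the factor y^(p-1),
  and Fubini a further factor y. Comparing w at the start with W along the segment covers cubes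
  inside larger cubes as well as densities that grow towards the origin.\<close>

lemma weighted_difference_bound:
  fixes h v :: "real^'d::finite \<Rightarrow> real" and w W :: "real^'d \<Rightarrow> ennreal"
  assumes [measurable]: "h \<in> borel_measurable borel" "v \<in> borel_measurable borel"
      "w \<in> borel_measurable borel" "W \<in> borel_measurable borel"
    and hv: "weak_deriv_fun ((\<lambda>_. 0)(i := 1)) h v" and y: "0 \<le> y" and p: "1 \<le> p"
    and wW: "\<And>x s. 0 \<le> s \<Longrightarrow> s \<le> y \<Longrightarrow> w x \<le> W (x + s *\<^sub>R axis i 1)"
  shows "(\<integral>\<^sup>+x. w x * ennreal (\<bar>h (x + y *\<^sub>R axis i 1) - h x\<bar> ^ p) \<partial>lborel)
    \<le> ennreal (y ^ p) * (\<integral>\<^sup>+x. W x * ennreal (\<bar>v x\<bar> ^ p) \<partial>lborel)"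
proof (cases "y = 0")
  case True
  then show ?thesis using p by (simp add: power_0_left)
next
  case False
  then have y: "0 < y" using y by simp
  let ?e = "axis i 1 :: real^'d"
  let ?J = "\<lambda>x s. ennreal (\<bar>v (x + s *\<^sub>R ?e)\<bar> ^ p) * indicator {0..y} s"
  have "(\<integral>\<^sup>+x. w x * ennreal (\<bar>h (x + y *\<^sub>R ?e) - h x\<bar> ^ p) \<partial>lborel)
    \<le> (\<integral>\<^sup>+x. w x * (ennreal (y ^ (p - 1)) * (\<integral>\<^sup>+s. ?J x s \<partial>lborel)) \<partial>lborel)"
  proof (rule nn_integral_mono_AE)
    show "AE x in lborel. w x * ennreal (\<bar>h (x + y *\<^sub>R ?e) - h x\<bar> ^ p)
      \<le> w x * (ennreal (y ^ (p - 1)) * (\<integral>\<^sup>+s. ?J x s \<partial>lborel))"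
      using translation_formula[OF assms(1,2) hv y]
    proof eventually_elim
      case (elim x)
      have "ennreal (\<bar>LINT s|lborel. indicator {0..y} s * v (x + s *\<^sub>R ?e)\<bar> ^ p)
        \<le> ennreal (y ^ (p - 1)) * (\<integral>\<^sup>+s. ?J x s \<partial>lborel)"
        by (rule power_integral_le[OF _ y p]) measurable
      then show ?case unfolding elim by (rule mult_left_mono) simp
    qed
  qed
  also have "\<dots> = ennreal (y ^ (p - 1)) * (\<integral>\<^sup>+x. (\<integral>\<^sup>+s. w x * ?J x s \<partial>lborel) \<partial>lborel)"
    by (simp add: nn_integral_cmult[symmetric] mult.left_commute)
  also have "(\<integral>\<^sup>+x. (\<integral>\<^sup>+s. w x * ?J x s \<partial>lborel) \<partial>lborel) = (\<integral>\<^sup>+s. (\<integral>\<^sup>+x. w x * ?J x s \<partial>lborel) \<partial>lborel)"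
    by (rule lborel_pair.Fubini') measurable
  also have "\<dots> \<le> (\<integral>\<^sup>+s. (\<integral>\<^sup>+x. W x * ennreal (\<bar>v x\<bar> ^ p) \<partial>lborel) * indicator {0..y} s \<partial>lborel)"
  proof (rule nn_integral_mono)
    fix s :: real
    show "(\<integral>\<^sup>+x. w x * ?J x s \<partial>lborel) \<le> (\<integral>\<^sup>+x. W x * ennreal (\<bar>v x\<bar> ^ p) \<partial>lborel) * indicator {0..y} s"
    proof (cases "s \<in> {0..y}")
      case True
      have "(\<integral>\<^sup>+x. w x * ?J x s \<partial>lborel) \<le> (\<integral>\<^sup>+x. W (x + s *\<^sub>R ?e) * ennreal (\<bar>v (x + s *\<^sub>R ?e)\<bar> ^ p) \<partial>lborel)"
        using True wW by (intro nn_integral_mono) (auto intro: mult_right_mono)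
      also have "\<dots> = (\<integral>\<^sup>+x. W x * ennreal (\<bar>v x\<bar> ^ p) \<partial>lborel)"
        by (rule nn_integral_shift[of "\<lambda>x. W x * ennreal (\<bar>v x\<bar> ^ p)"]) measurable
      finally show ?thesis using True by simp
    qed simp
  qed
  also have "\<dots> = (\<integral>\<^sup>+x. W x * ennreal (\<bar>v x\<bar> ^ p) \<partial>lborel) * ennreal y"
    using y by (subst nn_integral_cmult) auto
  also have "ennreal (y ^ (p - 1)) * ((\<integral>\<^sup>+x. W x * ennreal (\<bar>v x\<bar> ^ p) \<partial>lborel) * ennreal y)
    = ennreal (y ^ p) * (\<integral>\<^sup>+x. W x * ennreal (\<bar>v x\<bar> ^ p) \<partial>lborel)"
  proof -
    have "ennreal (y ^ p) = ennreal (y ^ (p - 1)) * ennreal y"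
      using y p by (cases p) (auto simp: ennreal_mult mult.commute)
    then show ?thesis by (simp add: ac_simps)
  qed
  finally show ?thesis by (simp add: mult_left_mono)
qed

section \<open>Differences and averaging on cubes\<close>

lemma power_abs_le_difference: "\<bar>a::real\<bar> ^ p \<le> 2 ^ p * (\<bar>b\<bar> ^ p + \<bar>b - a\<bar> ^ p)"
proof -
  let ?m = "max \<bar>b\<bar> \<bar>b - a\<bar>"
  have "\<bar>a\<bar> \<le> \<bar>b\<bar> + \<bar>b - a\<bar>" by linarith
  also have "\<dots> \<le> ?m + ?m" by (intro add_mono) auto
  finally have "\<bar>a\<bar> ^ p \<le> (2 * ?m) ^ p" by (intro power_mono) auto
  also have "\<dots> = 2 ^ p * ?m ^ p" by (simp add: power_mult_distrib)
  also have "?m ^ p \<le> \<bar>b\<bar> ^ p + \<bar>b - a\<bar> ^ p" by (auto simp: max_def)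
  finally show ?thesis by simp
qed

lemma nn_integral_power_le_difference:
  fixes h k :: "real^'d::finite \<Rightarrow> real" and w :: "real^'d \<Rightarrow> ennreal"
  assumes [measurable]: "h \<in> borel_measurable borel" "k \<in> borel_measurable borel" "w \<in> borel_measurable borel"
  shows "(\<integral>\<^sup>+x. w x * ennreal (\<bar>h x\<bar> ^ p) \<partial>lborel)
    \<le> 2 ^ p * ((\<integral>\<^sup>+x. w x * ennreal (\<bar>k x\<bar> ^ p) \<partial>lborel) + (\<integral>\<^sup>+x. w x * ennreal (\<bar>k x - h x\<bar> ^ p) \<partial>lborel))"
proof -
  have "(\<integral>\<^sup>+x. w x * ennreal (\<bar>h x\<bar> ^ p) \<partial>lborel)
    \<le> (\<integral>\<^sup>+x. 2 ^ p * (w x * ennreal (\<bar>k x\<bar> ^ p) + w x * ennreal (\<bar>k x - h x\<bar> ^ p)) \<partial>lborel)"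
  proof (rule nn_integral_mono)
    fix x
    have "ennreal (\<bar>h x\<bar> ^ p) \<le> ennreal (2 ^ p * (\<bar>k x\<bar> ^ p + \<bar>k x - h x\<bar> ^ p))"
      by (rule ennreal_leI[OF power_abs_le_difference])
    also have "\<dots> = 2 ^ p * (ennreal (\<bar>k x\<bar> ^ p) + ennreal (\<bar>k x - h x\<bar> ^ p))"
      by (simp add: ennreal_mult ennreal_plus flip: ennreal_power)
    finally have "w x * ennreal (\<bar>h x\<bar> ^ p) \<le> w x * (2 ^ p * (ennreal (\<bar>k x\<bar> ^ p) + ennreal (\<bar>k x - h x\<bar> ^ p)))"
      by (rule mult_left_mono) simp
    then show "w x * ennreal (\<bar>h x\<bar> ^ p) \<le> 2 ^ p * (w x * ennreal (\<bar>k x\<bar> ^ p) + w x * ennreal (\<bar>k x - h x\<bar> ^ p))"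
      by (simp add: distrib_left mult.left_commute)
  qed
  also have "\<dots> = 2 ^ p * (\<integral>\<^sup>+x. w x * ennreal (\<bar>k x\<bar> ^ p) + w x * ennreal (\<bar>k x - h x\<bar> ^ p) \<partial>lborel)"
    by (rule nn_integral_cmult) measurable
  also have "(\<integral>\<^sup>+x. w x * ennreal (\<bar>k x\<bar> ^ p) + w x * ennreal (\<bar>k x - h x\<bar> ^ p) \<partial>lborel)
    = (\<integral>\<^sup>+x. w x * ennreal (\<bar>k x\<bar> ^ p) \<partial>lborel) + (\<integral>\<^sup>+x. w x * ennreal (\<bar>k x - h x\<bar> ^ p) \<partial>lborel)"
    by (rule nn_integral_add) measurable
  finally show ?thesis .
qed

text \<open>Keeps only the coordinates in S, so that a shift by y can be built up one coordinate at
  a time.\<close>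

definition restrict_vec :: "real^'d \<Rightarrow> 'd set \<Rightarrow> real^'d::finite" where
  "restrict_vec y S = (\<chi> j. if j \<in> S then y $ j else 0)"

lemma restrict_vec_simps:
  "restrict_vec y {} = 0" "restrict_vec y UNIV = y"
  "i \<notin> S \<Longrightarrow> restrict_vec y (insert i S) = restrict_vec y S + (y $ i) *\<^sub>R axis i 1"
  by (auto simp: restrict_vec_def vec_eq_iff axis_def)

definition cube :: "real \<Rightarrow> (real^'d::finite) set" where
  "cube R = cbox (\<chi> _. - R) (\<chi> _. R)"

lemma mem_cube: "x \<in> cube R \<longleftrightarrow> (\<forall>j. \<bar>x $ j\<bar> \<le> R)"
  by (auto simp: cube_def mem_box_cart abs_le_iff minus_le_iff)

lemma cube_measurable [measurable]: "cube R \<in> sets borel"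
  by (simp add: cube_def)

text \<open>Induction over the coordinates shifted so far. Each costs a factor 2^p for splitting the
  difference and a factor 2 for joining the two parts. Every coordinate moves by at most \<delta>
  \<le> 1, so the segments stay in the cube of radius R + 1.\<close>

lemma cube_difference_bound:
  fixes h :: "real^'d::finite \<Rightarrow> real" and v :: "'d \<Rightarrow> real^'d \<Rightarrow> real" and V :: ennreal
  assumes [measurable]: "h \<in> borel_measurable borel" "\<And>i. v i \<in> borel_measurable borel"
    and hv: "\<And>i. weak_deriv_fun ((\<lambda>_. 0)(i := 1)) h (v i)" and p: "1 \<le> p"
    and y: "\<And>j. 0 \<le> y $ j \<and> y $ j \<le> \<delta>" and \<delta>: "\<delta> \<le> 1"
    and V: "\<And>i. (\<integral>\<^sup>+x. indicator (cube (R + 1)) x * ennreal (\<bar>v i x\<bar> ^ p) \<partial>lborel) \<le> V"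
  shows "(\<integral>\<^sup>+x. indicator (cube R) x * ennreal (\<bar>h (x + restrict_vec y S) - h x\<bar> ^ p) \<partial>lborel)
    \<le> (2 ^ (p + 1)) ^ card S * (ennreal (\<delta> ^ p) * V)"
proof -
  have "finite S" by simp
  then show ?thesis
  proof (induction S rule: finite_induct)
    case empty
    then show ?case using p by (simp add: restrict_vec_simps power_0_left)
  next
    case (insert i S)
    let ?X = "ennreal (\<delta> ^ p) * V" and ?z = "restrict_vec y S" and ?e = "axis i 1 :: real^'d"
    let ?I = "indicator (cube R) :: real^'d \<Rightarrow> ennreal"
    have "(\<integral>\<^sup>+x. ?I x * ennreal (\<bar>h (x + restrict_vec y (insert i S)) - h x\<bar> ^ p) \<partial>lborel)
      \<le> 2 ^ p * ((\<integral>\<^sup>+x. ?I x * ennreal (\<bar>h (x + ?z) - h x\<bar> ^ p) \<partial>lborel)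
        + (\<integral>\<^sup>+x. ?I x * ennreal (\<bar>(h (x + ?z) - h x) - (h (x + restrict_vec y (insert i S)) - h x)\<bar> ^ p) \<partial>lborel))"
      by (rule nn_integral_power_le_difference) measurable
    also have "(\<integral>\<^sup>+x. ?I x * ennreal (\<bar>(h (x + ?z) - h x) - (h (x + restrict_vec y (insert i S)) - h x)\<bar> ^ p) \<partial>lborel)
      = (\<integral>\<^sup>+x. ?I ((x + ?z) - ?z) * ennreal (\<bar>h ((x + ?z) + (y $ i) *\<^sub>R ?e) - h (x + ?z)\<bar> ^ p) \<partial>lborel)"
      using insert by (intro nn_integral_cong) (simp add: restrict_vec_simps abs_minus_commute add.assoc)
    also have "\<dots> = (\<integral>\<^sup>+x. ?I (x - ?z) * ennreal (\<bar>h (x + (y $ i) *\<^sub>R ?e) - h x\<bar> ^ p) \<partial>lborel)"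
      by (rule nn_integral_shift[of "\<lambda>x. ?I (x - ?z) * ennreal (\<bar>h (x + (y $ i) *\<^sub>R ?e) - h x\<bar> ^ p)"]) measurable
    also have "\<dots> \<le> ennreal ((y $ i) ^ p) * (\<integral>\<^sup>+x. indicator (cube (R + 1)) x * ennreal (\<bar>v i x\<bar> ^ p) \<partial>lborel)"
    proof (rule weighted_difference_bound[OF _ _ _ _ hv _ p])
      fix x s assume s: "0 \<le> s" "s \<le> y $ i"
      show "?I (x - ?z) \<le> indicator (cube (R + 1)) (x + s *\<^sub>R axis i 1)"
      proof (cases "x - ?z \<in> cube R")
        case True
        have "\<bar>(x + s *\<^sub>R axis i 1) $ j\<bar> \<le> R + 1" for j
        proof -
          have "\<bar>(x - ?z) $ j\<bar> \<le> R" using True by (simp add: mem_cube)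
          moreover have "\<bar>(?z + s *\<^sub>R ?e) $ j\<bar> \<le> 1"
            using y[of j] s insert(2) \<delta> by (auto simp: restrict_vec_def axis_def)
          moreover have "(x + s *\<^sub>R ?e) $ j = (x - ?z) $ j + (?z + s *\<^sub>R ?e) $ j" by simp
          ultimately show ?thesis by linarith
        qed
        then show ?thesis using True by (simp add: mem_cube)
      qed simp
    qed (use y in auto)
    also have "\<dots> \<le> ?X"
      using y[of i] V[of i] by (intro mult_mono ennreal_leI power_mono) auto
    also have "2 ^ p * ((\<integral>\<^sup>+x. ?I x * ennreal (\<bar>h (x + ?z) - h x\<bar> ^ p) \<partial>lborel) + ?X)
      \<le> 2 ^ p * ((2 ^ (p + 1)) ^ card S * ?X + ?X)"
      by (intro mult_left_mono add_right_mono insert.IH) simp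
    finally have "(\<integral>\<^sup>+x. ?I x * ennreal (\<bar>h (x + restrict_vec y (insert i S)) - h x\<bar> ^ p) \<partial>lborel)
      \<le> 2 ^ p * ((2 ^ (p + 1)) ^ card S * ?X + ?X)"
      by (simp add: add_left_mono mult_left_mono)
    also have "\<dots> \<le> 2 ^ p * ((2 ^ (p + 1)) ^ card S * ?X + (2 ^ (p + 1)) ^ card S * ?X)"
    proof -
      have "(1::ennreal) \<le> (2 ^ (p + 1)) ^ card S" by (intro one_le_power) simp
      from mult_right_mono[OF this, of ?X] show ?thesis by (intro mult_left_mono add_left_mono) auto
    qed
    also have "\<dots> = (2 ^ (p + 1)) ^ card (insert i S) * ?X"
      using insert by (simp add: mult.assoc mult.left_commute flip: mult_2)
    finally show ?case .
  qed
qed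

text \<open>Instead of a local Sobolev embedding: \<open>h x\<close> is compared with \<open>h (x + y)\<close> and the comparison is
  averaged over \<open>y\<close> in a small box, which turns \<open>g\<close> into a bounded function.\<close>

lemma cube_uniform_integrability:
  fixes h :: "real^'d::finite \<Rightarrow> real" and v :: "'d \<Rightarrow> real^'d \<Rightarrow> real" and g :: "real^'d \<Rightarrow> ennreal"
  assumes [measurable]: "h \<in> borel_measurable borel" "\<And>i. v i \<in> borel_measurable borel" "g \<in> borel_measurable borel"
    and hv: "\<And>i. weak_deriv_fun ((\<lambda>_. 0)(i := 1)) h (v i)" and p: "1 \<le> p"
    and \<delta>: "0 < \<delta>" "\<delta> \<le> 1" and K: "\<And>x. g x \<le> ennreal K" "0 \<le> K"
    and V: "\<And>i. (\<integral>\<^sup>+x. indicator (cube (R + 1)) x * ennreal (\<bar>v i x\<bar> ^ p) \<partial>lborel) \<le> ennreal V" "0 \<le> V"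
    and H: "(\<integral>\<^sup>+x. indicator (cube (R + 1)) x * ennreal (\<bar>h x\<bar> ^ p) \<partial>lborel) \<le> ennreal H" "0 \<le> H"
    and A: "(\<integral>\<^sup>+x. indicator (cube R) x * g x \<partial>lborel) \<le> ennreal A" "0 \<le> A"
  shows "(\<integral>\<^sup>+x. indicator (cube R) x * g x * ennreal (\<bar>h x\<bar> ^ p) \<partial>lborel)
    \<le> ennreal (2 ^ p * (A * H / \<delta> ^ CARD('d) + K * ((2 ^ (p + 1)) ^ CARD('d) * \<delta> ^ p * V)))"
proof -
  \<comment> \<open>The averaging box; its volume is the power of \<delta> that divides A * H in the
    final estimate.\<close>
  define Q where "Q = cbox 0 (\<chi> _. \<delta> :: real^'d)"
  have Qm[measurable]: "Q \<in> sets borel" by (simp add: Q_def)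
  define c where "c = \<delta> ^ CARD('d)"
  have c: "0 < c" using \<delta> by (simp add: c_def)
  have memQ: "x \<in> Q \<longleftrightarrow> (\<forall>j. 0 \<le> x $ j \<and> x $ j \<le> \<delta>)" for x by (auto simp: Q_def mem_box_cart)
  have "Q \<noteq> {}" using \<delta> memQ[of 0] by auto
  then have "measure lborel Q = c" unfolding Q_def c_def by (subst content_cbox_cart) auto
  moreover have "emeasure lborel Q \<noteq> \<infinity>" by (simp add: Q_def emeasure_lborel_cbox_eq)
  ultimately have eQ: "emeasure lborel Q = ennreal c" by (simp add: emeasure_eq_ennreal_measure)
  let ?I = "indicator (cube R) :: real^'d \<Rightarrow> ennreal"
  let ?D = "(2 ^ (p + 1)) ^ CARD('d) * (ennreal (\<delta> ^ p) * ennreal V)"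
  have fix_y: "(\<integral>\<^sup>+x. ?I x * g x * ennreal (\<bar>h x\<bar> ^ p) \<partial>lborel)
      \<le> 2 ^ p * ((\<integral>\<^sup>+x. ?I x * g x * ennreal (\<bar>h (x + y)\<bar> ^ p) \<partial>lborel) + ennreal K * ?D)" if y: "y \<in> Q" for y
  proof -
    have "(\<integral>\<^sup>+x. ?I x * g x * ennreal (\<bar>h x\<bar> ^ p) \<partial>lborel)
      \<le> 2 ^ p * ((\<integral>\<^sup>+x. ?I x * g x * ennreal (\<bar>h (x + y)\<bar> ^ p) \<partial>lborel)
        + (\<integral>\<^sup>+x. ?I x * g x * ennreal (\<bar>h (x + y) - h x\<bar> ^ p) \<partial>lborel))"
      by (rule nn_integral_power_le_difference) measurable
    also have "(\<integral>\<^sup>+x. ?I x * g x * ennreal (\<bar>h (x + y) - h x\<bar> ^ p) \<partial>lborel)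
      \<le> (\<integral>\<^sup>+x. ennreal K * (?I x * ennreal (\<bar>h (x + y) - h x\<bar> ^ p)) \<partial>lborel)"
    proof (rule nn_integral_mono)
      fix x
      have "g x * (?I x * ennreal (\<bar>h (x + y) - h x\<bar> ^ p)) \<le> ennreal K * (?I x * ennreal (\<bar>h (x + y) - h x\<bar> ^ p))"
        by (intro mult_right_mono K) simp
      then show "?I x * g x * ennreal (\<bar>h (x + y) - h x\<bar> ^ p) \<le> ennreal K * (?I x * ennreal (\<bar>h (x + y) - h x\<bar> ^ p))"
        by (simp add: ac_simps)
    qed
    also have "\<dots> = ennreal K * (\<integral>\<^sup>+x. ?I x * ennreal (\<bar>h (x + y) - h x\<bar> ^ p) \<partial>lborel)"
      by (rule nn_integral_cmult) measurable
    also have "\<dots> \<le> ennreal K * ?D"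
      using cube_difference_bound[OF assms(1,2) hv p _ \<delta>(2) V(1), of y UNIV] y
      by (intro mult_left_mono) (auto simp: restrict_vec_simps memQ)
    finally show ?thesis by (simp add: add_left_mono mult_left_mono)
  qed
  \<comment> \<open>For fixed x the integral over the shifts is at most H, so g enters only through
    its integral A over the cube.\<close>
  have swap: "(\<integral>\<^sup>+y. indicator Q y * (\<integral>\<^sup>+x. ?I x * g x * ennreal (\<bar>h (x + y)\<bar> ^ p) \<partial>lborel) \<partial>lborel) \<le> ennreal A * ennreal H"
  proof -
    have "(\<integral>\<^sup>+y. indicator Q y * (\<integral>\<^sup>+x. ?I x * g x * ennreal (\<bar>h (x + y)\<bar> ^ p) \<partial>lborel) \<partial>lborel)
      = (\<integral>\<^sup>+y. (\<integral>\<^sup>+x. indicator Q y * (?I x * g x * ennreal (\<bar>h (x + y)\<bar> ^ p)) \<partial>lborel) \<partial>lborel)"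
      by (intro nn_integral_cong nn_integral_cmult[symmetric]) measurable
    also have "\<dots> = (\<integral>\<^sup>+x. (\<integral>\<^sup>+y. indicator Q y * (?I x * g x * ennreal (\<bar>h (x + y)\<bar> ^ p)) \<partial>lborel) \<partial>lborel)"
      by (rule lborel_pair.Fubini'[symmetric]) measurable
    also have "\<dots> \<le> (\<integral>\<^sup>+x. (?I x * g x) * ennreal H \<partial>lborel)"
    proof (rule nn_integral_mono)
      fix x
      show "(\<integral>\<^sup>+y. indicator Q y * (?I x * g x * ennreal (\<bar>h (x + y)\<bar> ^ p)) \<partial>lborel) \<le> (?I x * g x) * ennreal H"
      proof (cases "x \<in> cube R")
        case True
        have "(\<integral>\<^sup>+y. indicator Q y * (?I x * g x * ennreal (\<bar>h (x + y)\<bar> ^ p)) \<partial>lborel)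
          = (?I x * g x) * (\<integral>\<^sup>+y. indicator Q y * ennreal (\<bar>h (x + y)\<bar> ^ p) \<partial>lborel)"
          by (subst nn_integral_cmult[symmetric]) (auto intro!: nn_integral_cong simp: ac_simps)
        also have "(\<integral>\<^sup>+y. indicator Q y * ennreal (\<bar>h (x + y)\<bar> ^ p) \<partial>lborel)
          \<le> (\<integral>\<^sup>+y. indicator (cube (R + 1)) (y + x) * ennreal (\<bar>h (y + x)\<bar> ^ p) \<partial>lborel)"
        proof (rule nn_integral_mono)
          fix y
          have "y + x \<in> cube (R + 1)" if "y \<in> Q"
            unfolding mem_cube
          proof
            fix j
            have "\<bar>x $ j\<bar> \<le> R" "0 \<le> y $ j" "y $ j \<le> \<delta>" using True that by (auto simp: mem_cube memQ)
            then show "\<bar>(y + x) $ j\<bar> \<le> R + 1" using \<delta>(2) by simp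
          qed
          then show "indicator Q y * ennreal (\<bar>h (x + y)\<bar> ^ p) \<le> indicator (cube (R + 1)) (y + x) * ennreal (\<bar>h (y + x)\<bar> ^ p)"
            by (cases "y \<in> Q") (auto simp: add.commute)
        qed
        also have "\<dots> = (\<integral>\<^sup>+y. indicator (cube (R + 1)) y * ennreal (\<bar>h y\<bar> ^ p) \<partial>lborel)"
          by (rule nn_integral_shift[of "\<lambda>y. indicator (cube (R + 1)) y * ennreal (\<bar>h y\<bar> ^ p)"]) measurable
        also have "\<dots> \<le> ennreal H" by (rule H)
        finally show ?thesis by (simp add: mult_left_mono)
      qed simp
    qed
    also have "\<dots> = (\<integral>\<^sup>+x. ?I x * g x \<partial>lborel) * ennreal H"
      by (rule nn_integral_multc) measurable
    also have "\<dots> \<le> ennreal A * ennreal H" by (intro mult_right_mono A) simp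
    finally show ?thesis .
  qed
  let ?L = "\<integral>\<^sup>+x. ?I x * g x * ennreal (\<bar>h x\<bar> ^ p) \<partial>lborel"
  \<comment> \<open>The left side does not depend on y, so integration over Q multiplies it by the
    volume c.\<close>
  have "ennreal c * ?L = (\<integral>\<^sup>+y. indicator Q y * ?L \<partial>lborel)"
    using eQ by (subst nn_integral_multc) auto
  also have "\<dots> \<le> (\<integral>\<^sup>+y. 2 ^ p * (indicator Q y * (\<integral>\<^sup>+x. ?I x * g x * ennreal (\<bar>h (x + y)\<bar> ^ p) \<partial>lborel)
      + ennreal K * ?D * indicator Q y) \<partial>lborel)"
  proof (rule nn_integral_mono)
    fix y
    show "indicator Q y * ?L \<le> 2 ^ p * (indicator Q y * (\<integral>\<^sup>+x. ?I x * g x * ennreal (\<bar>h (x + y)\<bar> ^ p) \<partial>lborel)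
      + ennreal K * ?D * indicator Q y)"
      using fix_y[of y] by (cases "y \<in> Q") auto
  qed
  also have "\<dots> = 2 ^ p * ((\<integral>\<^sup>+y. indicator Q y * (\<integral>\<^sup>+x. ?I x * g x * ennreal (\<bar>h (x + y)\<bar> ^ p) \<partial>lborel) \<partial>lborel)
      + ennreal K * ?D * ennreal c)"
    by (simp add: nn_integral_cmult nn_integral_add eQ)
  also have "\<dots> \<le> 2 ^ p * (ennreal A * ennreal H + ennreal K * ?D * ennreal c)"
    by (intro mult_left_mono add_right_mono swap) simp
  also have "\<dots> = ennreal (2 ^ p * (A * H + K * ((2 ^ (p + 1)) ^ CARD('d) * (\<delta> ^ p * V)) * c))"
    using A H K V \<delta> c by (simp add: ennreal_mult ennreal_plus flip: ennreal_power)
  also have "\<dots> = ennreal c * ennreal (2 ^ p * (A * H / c + K * ((2 ^ (p + 1)) ^ CARD('d) * \<delta> ^ p * V)))"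
  proof -
    have "2 ^ p * (A * H + K * ((2 ^ (p + 1)) ^ CARD('d) * (\<delta> ^ p * V)) * c)
      = c * (2 ^ p * (A * H / c + K * ((2 ^ (p + 1)) ^ CARD('d) * \<delta> ^ p * V)))"
      using c by (simp add: field_simps)
    then show ?thesis using c by (simp only: ennreal_mult'[OF less_imp_le])
  qed
  finally show ?thesis
    using c \<delta>(1) by (subst (asm) ennreal_mult_le_mult_iff) (auto simp: c_def)
qed

section \<open>Decay of product weights along coordinate directions\<close>

locale product_weight =
  fixes q :: "real \<Rightarrow> real"
  assumes q_measurable [measurable]: "q \<in> borel_measurable borel"
    and q_pos: "0 < q z" and q_even: "q (- z) = q z"
    and q_antimono: "0 \<le> z \<Longrightarrow> z \<le> w \<Longrightarrow> q w \<le> q z"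
begin

abbreviation r :: "real^'d::finite \<Rightarrow> real" where "r \<equiv> tensor (\<lambda>_. q)"

lemma q_abs: "q \<bar>z\<bar> = q z"
  using q_even[of z] by (auto simp: abs_if)

lemma q_le: "\<bar>z\<bar> \<le> \<bar>w\<bar> \<Longrightarrow> q w \<le> q z"
  using q_antimono[of "\<bar>z\<bar>" "\<bar>w\<bar>"] by (simp add: q_abs)

lemma r_measurable [measurable]: "r \<in> borel_measurable borel"
  unfolding tensor_def[abs_def] by measurable

lemma r_pos: "0 < r x"
  unfolding tensor_def using q_pos by (intro prod_pos) auto

lemma r_shift_le:
  assumes "q (x $ i + s) \<le> \<kappa> * q (x $ i + s')"
  shows "r (x + s *\<^sub>R axis i 1) \<le> \<kappa> * r (x + s' *\<^sub>R axis i 1)"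
  using mult_right_mono[OF assms, of "\<Prod>j\<in>UNIV - {i}. q (x $ j)"] q_pos
  unfolding tensor_shift by (simp add: prod_nonneg less_imp_le mult.assoc)

lemma r_le: "r x \<le> q 0 ^ CARD('d)" for x :: "real^'d::finite"
proof -
  have "r x \<le> (\<Prod>j\<in>(UNIV::'d set). q 0)"
    unfolding tensor_def using q_pos q_le[of 0] by (intro prod_mono) (auto intro: less_imp_le)
  then show ?thesis by simp
qed

lemma r_ge: 
  fixes x :: "real^'d::finite"
  assumes "x \<in> cube R"
  shows "q R ^ CARD('d) \<le> r x"
proof -
  have "(\<Prod>j\<in>(UNIV::'d set). q R) \<le> r x"
    unfolding tensor_def using q_pos assms
    by (intro prod_mono conjI less_imp_le[OF q_pos] q_le) (auto simp: mem_cube intro: order_trans)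
  then show ?thesis by simp
qed

text \<open>A step of length \<open>y\<close> towards the origin multiplies the weight by at least \<open>1 / \<kappa>\<close> and costs only
  \<open>y ^ p\<close> in terms of the derivative, so no chain rule for \<open>\<bar>h\<bar> ^ p\<close> is needed.\<close>

lemma negative_tail_bound:
  fixes h :: "real^'d::finite \<Rightarrow> real"
  assumes [measurable]: "h \<in> borel_measurable borel" "v \<in> borel_measurable borel"
    and hv: "weak_deriv_fun ((\<lambda>_. 0)(i := 1)) h v" and p: "1 \<le> p"
    and y: "0 \<le> y" and R: "0 \<le> R" and \<kappa>: "\<And>z. R \<le> z \<Longrightarrow> q (z + y) \<le> \<kappa> * q z" "0 \<le> \<kappa>"
    and H: "(\<integral>\<^sup>+x. ennreal (r x) * ennreal (\<bar>h x\<bar> ^ p) \<partial>lborel) \<le> 1"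
    and V: "(\<integral>\<^sup>+x. ennreal (r x) * ennreal (\<bar>v x\<bar> ^ p) \<partial>lborel) \<le> 1"
  shows "(\<integral>\<^sup>+x. indicator {x. x $ i < - (R + y)} x * ennreal (r x) * ennreal (\<bar>h x\<bar> ^ p) \<partial>lborel)
    \<le> ennreal (2 ^ p * (\<kappa> + y ^ p))"
proof -
  let ?e = "axis i 1 :: real^'d" and ?w = "\<lambda>x. indicator {x. x $ i < - (R + y)} x * ennreal (r x)"
  have "(\<integral>\<^sup>+x. ?w x * ennreal (\<bar>h x\<bar> ^ p) \<partial>lborel)
    \<le> 2 ^ p * ((\<integral>\<^sup>+x. ?w x * ennreal (\<bar>h (x + y *\<^sub>R ?e)\<bar> ^ p) \<partial>lborel)
      + (\<integral>\<^sup>+x. ?w x * ennreal (\<bar>h (x + y *\<^sub>R ?e) - h x\<bar> ^ p) \<partial>lborel))"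
    by (rule nn_integral_power_le_difference) measurable
  also have "(\<integral>\<^sup>+x. ?w x * ennreal (\<bar>h (x + y *\<^sub>R ?e)\<bar> ^ p) \<partial>lborel)
    \<le> (\<integral>\<^sup>+x. ennreal \<kappa> * (ennreal (r (x + y *\<^sub>R ?e)) * ennreal (\<bar>h (x + y *\<^sub>R ?e)\<bar> ^ p)) \<partial>lborel)"
  proof (rule nn_integral_mono)
    fix x
    have "?w x \<le> ennreal \<kappa> * ennreal (r (x + y *\<^sub>R ?e))"
    proof (cases "x $ i < - (R + y)")
      case True
      \<comment> \<open>After the step the coordinate is still to the left of -R, and since q is
        even the decay hypothesis applies to its mirror image.\<close>
      then have "q (- (x $ i + y) + y) \<le> \<kappa> * q (- (x $ i + y))" by (intro \<kappa>) simp
      then have "q (x $ i + 0) \<le> \<kappa> * q (x $ i + y)" using q_even[of "x $ i"] q_even[of "x $ i + y"] by simp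
      from r_shift_le[OF this] show ?thesis using True \<kappa>(2)
        by (simp add: ennreal_leI flip: ennreal_mult')
    qed simp
    from mult_right_mono[OF this, of "ennreal (\<bar>h (x + y *\<^sub>R ?e)\<bar> ^ p)"]
    show "?w x * ennreal (\<bar>h (x + y *\<^sub>R ?e)\<bar> ^ p)
      \<le> ennreal \<kappa> * (ennreal (r (x + y *\<^sub>R ?e)) * ennreal (\<bar>h (x + y *\<^sub>R ?e)\<bar> ^ p))"
      by (simp add: mult.assoc)
  qed
  also have "\<dots> = ennreal \<kappa> * (\<integral>\<^sup>+x. ennreal (r (x + y *\<^sub>R ?e)) * ennreal (\<bar>h (x + y *\<^sub>R ?e)\<bar> ^ p) \<partial>lborel)"
    by (rule nn_integral_cmult) measurable
  also have "(\<integral>\<^sup>+x. ennreal (r (x + y *\<^sub>R ?e)) * ennreal (\<bar>h (x + y *\<^sub>R ?e)\<bar> ^ p) \<partial>lborel)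
    = (\<integral>\<^sup>+x. ennreal (r x) * ennreal (\<bar>h x\<bar> ^ p) \<partial>lborel)"
    by (rule nn_integral_shift[of "\<lambda>x. ennreal (r x) * ennreal (\<bar>h x\<bar> ^ p)"]) measurable
  also have "(\<integral>\<^sup>+x. ?w x * ennreal (\<bar>h (x + y *\<^sub>R ?e) - h x\<bar> ^ p) \<partial>lborel)
    \<le> ennreal (y ^ p) * (\<integral>\<^sup>+x. ennreal (r x) * ennreal (\<bar>v x\<bar> ^ p) \<partial>lborel)"
  proof (rule weighted_difference_bound[OF _ _ _ _ hv y p])
    fix x s assume s: "0 \<le> s" "s \<le> y"
    show "?w x \<le> ennreal (r (x + s *\<^sub>R axis i 1))"
    proof (cases "x $ i < - (R + y)")
      case True
      then have "q (x $ i + 0) \<le> 1 * q (x $ i + s)" using s R y unfolding mult_1 by (intro q_le) linarith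
      from r_shift_le[OF this] show ?thesis using True by (simp add: ennreal_leI)
    qed simp
  qed measurable
  finally have "(\<integral>\<^sup>+x. ?w x * ennreal (\<bar>h x\<bar> ^ p) \<partial>lborel)
    \<le> 2 ^ p * (ennreal \<kappa> * (\<integral>\<^sup>+x. ennreal (r x) * ennreal (\<bar>h x\<bar> ^ p) \<partial>lborel)
      + ennreal (y ^ p) * (\<integral>\<^sup>+x. ennreal (r x) * ennreal (\<bar>v x\<bar> ^ p) \<partial>lborel))"
    by (simp add: add_mono mult_left_mono)
  also have "\<dots> \<le> 2 ^ p * (ennreal \<kappa> * 1 + ennreal (y ^ p) * 1)"
    by (intro mult_left_mono add_mono H V) auto
  also have "\<dots> = ennreal (2 ^ p * (\<kappa> + y ^ p))"
    using \<kappa>(2) y by (simp add: ennreal_mult ennreal_plus flip: ennreal_power)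
  finally show ?thesis .
qed

text \<open>Mirror image of \<open>negative_tail_bound\<close>. The difference bound is for steps in
  the positive direction, so the tail integral is first translated by y; then h(x + y) is compared
  with h(x), whose argument is closer to the origin.\<close>

lemma positive_tail_bound:
  fixes h :: "real^'d::finite \<Rightarrow> real"
  assumes [measurable]: "h \<in> borel_measurable borel" "v \<in> borel_measurable borel"
    and hv: "weak_deriv_fun ((\<lambda>_. 0)(i := 1)) h v" and p: "1 \<le> p"
    and y: "0 \<le> y" and R: "0 \<le> R" and \<kappa>: "\<And>z. R \<le> z \<Longrightarrow> q (z + y) \<le> \<kappa> * q z" "0 \<le> \<kappa>"
    and H: "(\<integral>\<^sup>+x. ennreal (r x) * ennreal (\<bar>h x\<bar> ^ p) \<partial>lborel) \<le> 1"
    and V: "(\<integral>\<^sup>+x. ennreal (r x) * ennreal (\<bar>v x\<bar> ^ p) \<partial>lborel) \<le> 1"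
  shows "(\<integral>\<^sup>+x. indicator {x. x $ i > R + y} x * ennreal (r x) * ennreal (\<bar>h x\<bar> ^ p) \<partial>lborel)
    \<le> ennreal (2 ^ p * (\<kappa> + y ^ p))"
proof -
  let ?e = "axis i 1 :: real^'d" and ?w = "\<lambda>x. indicator {x. x $ i > R + y} x * ennreal (r x)"
  have "(\<integral>\<^sup>+x. ?w x * ennreal (\<bar>h x\<bar> ^ p) \<partial>lborel) = (\<integral>\<^sup>+x. ?w (x + y *\<^sub>R ?e) * ennreal (\<bar>h (x + y *\<^sub>R ?e)\<bar> ^ p) \<partial>lborel)"
    by (rule nn_integral_shift[of "\<lambda>x. ?w x * ennreal (\<bar>h x\<bar> ^ p)", symmetric]) measurable
  also have "\<dots> \<le> 2 ^ p * ((\<integral>\<^sup>+x. ?w (x + y *\<^sub>R ?e) * ennreal (\<bar>h x\<bar> ^ p) \<partial>lborel)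
      + (\<integral>\<^sup>+x. ?w (x + y *\<^sub>R ?e) * ennreal (\<bar>h x - h (x + y *\<^sub>R ?e)\<bar> ^ p) \<partial>lborel))"
    by (rule nn_integral_power_le_difference) measurable
  also have "(\<integral>\<^sup>+x. ?w (x + y *\<^sub>R ?e) * ennreal (\<bar>h x\<bar> ^ p) \<partial>lborel)
    \<le> (\<integral>\<^sup>+x. ennreal \<kappa> * (ennreal (r x) * ennreal (\<bar>h x\<bar> ^ p)) \<partial>lborel)"
  proof (rule nn_integral_mono)
    fix x
    have "?w (x + y *\<^sub>R ?e) \<le> ennreal \<kappa> * ennreal (r x)"
    proof (cases "x $ i > R")
      case True
      then have "q (x $ i + y) \<le> \<kappa> * q (x $ i + 0)" using \<kappa>(1)[of "x $ i"] by simp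
      from r_shift_le[OF this] show ?thesis using \<kappa>(2)
        by (auto simp: ennreal_leI indicator_def simp flip: ennreal_mult')
    qed (simp add: axis_def)
    from mult_right_mono[OF this, of "ennreal (\<bar>h x\<bar> ^ p)"]
    show "?w (x + y *\<^sub>R ?e) * ennreal (\<bar>h x\<bar> ^ p) \<le> ennreal \<kappa> * (ennreal (r x) * ennreal (\<bar>h x\<bar> ^ p))"
      by (simp add: mult.assoc)
  qed
  also have "\<dots> = ennreal \<kappa> * (\<integral>\<^sup>+x. ennreal (r x) * ennreal (\<bar>h x\<bar> ^ p) \<partial>lborel)"
    by (rule nn_integral_cmult) measurable
  also have "(\<integral>\<^sup>+x. ?w (x + y *\<^sub>R ?e) * ennreal (\<bar>h x - h (x + y *\<^sub>R ?e)\<bar> ^ p) \<partial>lborel)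
    = (\<integral>\<^sup>+x. ?w (x + y *\<^sub>R ?e) * ennreal (\<bar>h (x + y *\<^sub>R ?e) - h x\<bar> ^ p) \<partial>lborel)"
    by (simp only: abs_minus_commute)
  also have "\<dots> \<le> ennreal (y ^ p) * (\<integral>\<^sup>+x. ennreal (r x) * ennreal (\<bar>v x\<bar> ^ p) \<partial>lborel)"
  proof (rule weighted_difference_bound[OF _ _ _ _ hv y p])
    fix x s assume s: "0 \<le> s" "s \<le> y"
    show "?w (x + y *\<^sub>R ?e) \<le> ennreal (r (x + s *\<^sub>R axis i 1))"
    proof (cases "x $ i > R")
      case True
      then have "q (x $ i + y) \<le> 1 * q (x $ i + s)" using s R y unfolding mult_1 by (intro q_le) linarith
      from r_shift_le[OF this] show ?thesis by (auto simp: ennreal_leI indicator_def)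
    qed (simp add: axis_def)
  qed measurable
  finally have "(\<integral>\<^sup>+x. ?w x * ennreal (\<bar>h x\<bar> ^ p) \<partial>lborel)
    \<le> 2 ^ p * (ennreal \<kappa> * (\<integral>\<^sup>+x. ennreal (r x) * ennreal (\<bar>h x\<bar> ^ p) \<partial>lborel)
      + ennreal (y ^ p) * (\<integral>\<^sup>+x. ennreal (r x) * ennreal (\<bar>v x\<bar> ^ p) \<partial>lborel))"
    by (simp add: add_mono mult_left_mono)
  also have "\<dots> \<le> 2 ^ p * (ennreal \<kappa> * 1 + ennreal (y ^ p) * 1)"
    by (intro mult_left_mono add_mono H V) auto
  also have "\<dots> = ennreal (2 ^ p * (\<kappa> + y ^ p))"
    using \<kappa>(2) y by (simp add: ennreal_mult ennreal_plus flip: ennreal_power)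
  finally show ?thesis .
qed

text \<open>On the cube the weight is at least q(R)^d, so weighted bounds turn into unweighted
  ones.\<close>

lemma indicator_cube_le:
  fixes f :: "real^'d::finite \<Rightarrow> real"
  assumes [measurable]: "f \<in> borel_measurable borel" and p: "(\<integral>\<^sup>+x. ennreal (r x) * ennreal (\<bar>f x\<bar> ^ p) \<partial>lborel) \<le> 1"
  shows "(\<integral>\<^sup>+x. indicator (cube R) x * ennreal (\<bar>f x\<bar> ^ p) \<partial>lborel) \<le> ennreal (1 / q R ^ CARD('d))"
proof -
  let ?m = "q R ^ CARD('d)"
  have m: "0 < ?m" using q_pos by simp
  have "(\<integral>\<^sup>+x. indicator (cube R) x * ennreal (\<bar>f x\<bar> ^ p) \<partial>lborel)
    \<le> (\<integral>\<^sup>+x. ennreal (1 / ?m) * (ennreal (r x) * ennreal (\<bar>f x\<bar> ^ p)) \<partial>lborel)"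
  proof (rule nn_integral_mono)
    fix x :: "real^'d"
    have "indicator (cube R) x \<le> ennreal (1 / ?m) * ennreal (r x)"
    proof (cases "x \<in> cube R")
      case True
      have "1 \<le> 1 / ?m * r x" using r_ge[OF True] m by (simp add: field_simps)
      then have "ennreal 1 \<le> ennreal (1 / ?m * r x)" by (rule ennreal_leI)
      also have "\<dots> = ennreal (1 / ?m) * ennreal (r x)" using m by (intro ennreal_mult') simp
      finally show ?thesis unfolding indicator_simps(1)[OF True] by (simp only: ennreal_1)
    qed simp
    from mult_right_mono[OF this, of "ennreal (\<bar>f x\<bar> ^ p)"]
    show "indicator (cube R) x * ennreal (\<bar>f x\<bar> ^ p) \<le> ennreal (1 / ?m) * (ennreal (r x) * ennreal (\<bar>f x\<bar> ^ p))"
      by (simp add: mult.assoc)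
  qed
  also have "\<dots> = ennreal (1 / ?m) * (\<integral>\<^sup>+x. ennreal (r x) * ennreal (\<bar>f x\<bar> ^ p) \<partial>lborel)"
    by (rule nn_integral_cmult) measurable
  also have "\<dots> \<le> ennreal (1 / ?m) * 1" by (intro mult_left_mono p) simp
  finally show ?thesis by simp
qed

text \<open>Outside a large cube the tails are of order \<tau> + \<tau>^p, where \<tau> serves both
  as the step length and as the decay factor. Inside, the weight is comparable to constants and
  \<open>cube_uniform_integrability\<close> applies. The order of choices \<tau>, R, \<delta>,
  \<eta> matters, as each depends on the earlier ones.\<close>

lemma weighted_uniform_integrability:
  assumes tail: "\<And>y \<kappa>. 0 < y \<Longrightarrow> 0 < \<kappa> \<Longrightarrow> \<exists>R\<ge>0. \<forall>z\<ge>R. q (z + y) \<le> \<kappa> * q z"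
    and p: "1 \<le> p" and K: "0 \<le> K" and \<epsilon>: "0 < \<epsilon>"
  shows "\<exists>\<eta>>0. \<forall>(g :: real^'d::finite \<Rightarrow> ennreal) (h :: real^'d \<Rightarrow> real) (v :: 'd \<Rightarrow> real^'d \<Rightarrow> real). g \<in> borel_measurable borel \<longrightarrow> h \<in> borel_measurable borel \<longrightarrow>
    (\<forall>i. v i \<in> borel_measurable borel) \<longrightarrow> (\<forall>i. weak_deriv_fun ((\<lambda>_. 0)(i := 1)) h (v i)) \<longrightarrow>
    (\<forall>x. g x \<le> ennreal K) \<longrightarrow> (\<integral>\<^sup>+x. g x * ennreal (r x) \<partial>lborel) \<le> ennreal \<eta> \<longrightarrow>
    (\<integral>\<^sup>+x. ennreal (r x) * ennreal (\<bar>h x\<bar> ^ p) \<partial>lborel) \<le> 1 \<longrightarrow>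
    (\<forall>i. (\<integral>\<^sup>+x. ennreal (r x) * ennreal (\<bar>v i x\<bar> ^ p) \<partial>lborel) \<le> 1) \<longrightarrow>
    (\<integral>\<^sup>+x. g x * ennreal (r x) * ennreal (\<bar>h x\<bar> ^ p) \<partial>lborel) \<le> ennreal \<epsilon>"
proof -
  let ?d = "CARD('d)"
  \<comment> \<open>There are 2 d tails, each at most 2^p (\<tau> + \<tau>^p) \<le> 2^(p+1) \<tau>;
    times K they stay below \<epsilon> / 2.\<close>
  define \<tau> where "\<tau> = min 1 (\<epsilon> / (8 * real ?d * (K + 1) * 2 ^ p))"
  have \<tau>: "0 < \<tau>" "\<tau> \<le> 1" using \<epsilon> K by (auto simp: \<tau>_def)
  obtain R0 where R0: "0 \<le> R0" "\<And>z. R0 \<le> z \<Longrightarrow> q (z + \<tau>) \<le> \<tau> * q z" using tail[OF \<tau>(1) \<tau>(1)] by blast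
  define R where "R = R0 + \<tau>"
  define M where "M = q 0 ^ ?d"
  define m where "m = q (R + 1) ^ ?d"
  define m0 where "m0 = q R ^ ?d"
  have M: "0 < M" and m: "0 < m" and m0: "0 < m0" using q_pos by (auto simp: M_def m_def m0_def)
  \<comment> \<open>B and, further down, E are the coefficients of \<delta>^p and of \<eta> in the
    estimate on the cube. The choices of \<delta> and \<eta> make each product at most \<epsilon> /
    4.\<close>
  define B where "B = M * 2 ^ p * K * ((2 ^ (p + 1)) ^ ?d * (1 / m))"
  have B: "0 \<le> B" using M m K by (simp add: B_def)
  define \<delta> where "\<delta> = min 1 (\<epsilon> / (4 * (B + 1)))"
  have \<delta>: "0 < \<delta>" "\<delta> \<le> 1" using \<epsilon> B by (auto simp: \<delta>_def)
  define E where "E = M * 2 ^ p * ((1 / m0) * (1 / m) / \<delta> ^ ?d)"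
  have E: "0 \<le> E" using M m m0 \<delta> by (simp add: E_def)
  define \<eta> where "\<eta> = \<epsilon> / (4 * (E + 1))"
  have \<eta>: "0 < \<eta>" using \<epsilon> E by (simp add: \<eta>_def)
  have num: "M * (2 ^ p * (\<eta> / m0 * (1 / m) / \<delta> ^ ?d + K * ((2 ^ (p + 1)) ^ ?d * \<delta> ^ p * (1 / m))))
      + K * (real ?d * (2 * (2 ^ p * (\<tau> + \<tau> ^ p)))) \<le> \<epsilon>"
  proof -
    have eq: "M * (2 ^ p * (\<eta> / m0 * (1 / m) / \<delta> ^ ?d + K * ((2 ^ (p + 1)) ^ ?d * \<delta> ^ p * (1 / m))))
      = E * \<eta> + B * \<delta> ^ p" by (simp add: E_def B_def algebra_simps)
    have "E * \<eta> \<le> (E + 1) * \<eta>" using \<eta> by (simp add: mult_right_mono)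
    moreover have "(E + 1) * \<eta> = \<epsilon> / 4" using E by (simp add: \<eta>_def field_simps)
    ultimately have 1: "E * \<eta> \<le> \<epsilon> / 4" by simp
    have "B * \<delta> ^ p \<le> (B + 1) * \<delta>"
      using power_decreasing[OF p, of \<delta>] \<delta> B by (intro mult_mono) auto
    moreover have "\<delta> \<le> \<epsilon> / (4 * (B + 1))" unfolding \<delta>_def by (rule min.cobounded2)
    then have "(B + 1) * \<delta> \<le> \<epsilon> / 4" using B by (simp add: field_simps)
    ultimately have 2: "B * \<delta> ^ p \<le> \<epsilon> / 4" by linarith
    have "K * (real ?d * (2 * (2 ^ p * (\<tau> + \<tau> ^ p)))) \<le> (K + 1) * (real ?d * (2 * (2 ^ p * (\<tau> + \<tau>))))"
      using power_decreasing[OF p, of \<tau>] \<tau> K by (intro mult_mono mult_left_mono) auto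
    also have "\<dots> = (\<tau> * (8 * real ?d * (K + 1) * 2 ^ p)) / 2" by (simp add: algebra_simps)
    also have "\<tau> * (8 * real ?d * (K + 1) * 2 ^ p) \<le> \<epsilon>"
    proof -
      have "0 < 8 * real ?d * (K + 1) * 2 ^ p" using K by simp
      moreover have "\<tau> \<le> \<epsilon> / (8 * real ?d * (K + 1) * 2 ^ p)" unfolding \<tau>_def by (rule min.cobounded2)
      ultimately show ?thesis by (simp only: pos_le_divide_eq)
    qed
    finally have "K * (real ?d * (2 * (2 ^ p * (\<tau> + \<tau> ^ p)))) \<le> \<epsilon> / 2" by simp
    with 1 2 show ?thesis unfolding eq by linarith
  qed
  show ?thesis
  proof (intro exI[of _ \<eta>] conjI allI impI \<eta>)
    fix g :: "real^'d \<Rightarrow> ennreal" and h :: "real^'d \<Rightarrow> real" and v :: "'d \<Rightarrow> real^'d \<Rightarrow> real"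
    assume gm[measurable]: "g \<in> borel_measurable borel" and hm[measurable]: "h \<in> borel_measurable borel"
      and vm: "\<forall>i. v i \<in> borel_measurable borel" and hv: "\<forall>i. weak_deriv_fun ((\<lambda>_. 0)(i := 1)) h (v i)"
      and gK: "\<forall>x. g x \<le> ennreal K" and g\<eta>: "(\<integral>\<^sup>+x. g x * ennreal (r x) \<partial>lborel) \<le> ennreal \<eta>"
      and H: "(\<integral>\<^sup>+x. ennreal (r x) * ennreal (\<bar>h x\<bar> ^ p) \<partial>lborel) \<le> 1"
      and V: "\<forall>i. (\<integral>\<^sup>+x. ennreal (r x) * ennreal (\<bar>v i x\<bar> ^ p) \<partial>lborel) \<le> 1"
    have A: "(\<integral>\<^sup>+x. indicator (cube R) x * g x \<partial>lborel) \<le> ennreal (\<eta> / m0)"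
    proof -
      have "(\<integral>\<^sup>+x. indicator (cube R) x * g x \<partial>lborel) \<le> (\<integral>\<^sup>+x. ennreal (1 / m0) * (g x * ennreal (r x)) \<partial>lborel)"
      proof (rule nn_integral_mono)
        fix x :: "real^'d"
        have "indicator (cube R) x \<le> ennreal (1 / m0) * ennreal (r x)"
        proof (cases "x \<in> cube R")
          case True
          have "1 \<le> 1 / m0 * r x" using r_ge[OF True] m0 by (simp add: field_simps m0_def)
          then have "ennreal 1 \<le> ennreal (1 / m0 * r x)" by (rule ennreal_leI)
          also have "\<dots> = ennreal (1 / m0) * ennreal (r x)" using m0 by (intro ennreal_mult') simp
          finally show ?thesis unfolding indicator_simps(1)[OF True] by (simp only: ennreal_1)
        qed simp
        from mult_right_mono[OF this, of "g x"]
        show "indicator (cube R) x * g x \<le> ennreal (1 / m0) * (g x * ennreal (r x))"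
          by (simp add: ac_simps)
      qed
      also have "\<dots> = ennreal (1 / m0) * (\<integral>\<^sup>+x. g x * ennreal (r x) \<partial>lborel)"
        by (rule nn_integral_cmult) measurable
      also have "\<dots> \<le> ennreal (1 / m0) * ennreal \<eta>" by (intro mult_left_mono g\<eta>) simp
      also have "\<dots> = ennreal (\<eta> / m0)" using m0 by (simp flip: ennreal_mult')
      finally show ?thesis .
    qed
    have near: "(\<integral>\<^sup>+x. indicator (cube R) x * g x * ennreal (\<bar>h x\<bar> ^ p) \<partial>lborel)
      \<le> ennreal (2 ^ p * (\<eta> / m0 * (1 / m) / \<delta> ^ ?d + K * ((2 ^ (p + 1)) ^ ?d * \<delta> ^ p * (1 / m))))"
      using gK K vm hv V m m0 \<eta> A H
      by (intro cube_uniform_integrability[where v = v] p \<delta>)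
        (auto simp: m_def intro!: indicator_cube_le)
    let ?N = "\<lambda>i x. indicator {x. x $ i < - (R0 + \<tau>)} x * ennreal (r x) * ennreal (\<bar>h x\<bar> ^ p) :: ennreal"
    let ?P = "\<lambda>i x. indicator {x. x $ i > R0 + \<tau>} x * ennreal (r x) * ennreal (\<bar>h x\<bar> ^ p) :: ennreal"
    have N: "(\<integral>\<^sup>+x. ?N i x \<partial>lborel) \<le> ennreal (2 ^ p * (\<tau> + \<tau> ^ p))" for i
      using vm hv V \<tau> R0 H by (intro negative_tail_bound[where v = "v i"] p) auto
    have P: "(\<integral>\<^sup>+x. ?P i x \<partial>lborel) \<le> ennreal (2 ^ p * (\<tau> + \<tau> ^ p))" for i
      using vm hv V \<tau> R0 H by (intro positive_tail_bound[where v = "v i"] p) auto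
    have "(\<integral>\<^sup>+x. g x * ennreal (r x) * ennreal (\<bar>h x\<bar> ^ p) \<partial>lborel)
      \<le> (\<integral>\<^sup>+x. ennreal M * (indicator (cube R) x * g x * ennreal (\<bar>h x\<bar> ^ p))
          + ennreal K * (\<Sum>i\<in>UNIV. ?N i x + ?P i x) \<partial>lborel)"
    proof (rule nn_integral_mono)
      fix x :: "real^'d"
      show "g x * ennreal (r x) * ennreal (\<bar>h x\<bar> ^ p) \<le> ennreal M * (indicator (cube R) x * g x * ennreal (\<bar>h x\<bar> ^ p))
          + ennreal K * (\<Sum>i\<in>UNIV. ?N i x + ?P i x)"
      proof (cases "x \<in> cube R")
        case True
        have "ennreal (r x) * (g x * ennreal (\<bar>h x\<bar> ^ p)) \<le> ennreal M * (g x * ennreal (\<bar>h x\<bar> ^ p))"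
          using r_le[of x] by (intro mult_right_mono ennreal_leI) (auto simp: M_def)
        then show ?thesis using True by (simp add: ac_simps add_increasing2)
      next
        case False
        then obtain i where i: "R < \<bar>x $ i\<bar>" by (auto simp: mem_cube not_le)
        have "ennreal (r x) * ennreal (\<bar>h x\<bar> ^ p) \<le> ?N i x + ?P i x"
          using i R0 \<tau> by (auto simp: R_def abs_if indicator_def split: if_splits)
        also have "\<dots> \<le> (\<Sum>i\<in>UNIV. ?N i x + ?P i x)" by (rule member_le_sum) auto
        finally have "g x * (ennreal (r x) * ennreal (\<bar>h x\<bar> ^ p)) \<le> ennreal K * (\<Sum>i\<in>UNIV. ?N i x + ?P i x)"
          using gK by (intro mult_mono) auto
        then show ?thesis using False by (simp add: mult.assoc)
      qed
    qed
    also have "\<dots> = ennreal M * (\<integral>\<^sup>+x. indicator (cube R) x * g x * ennreal (\<bar>h x\<bar> ^ p) \<partial>lborel)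
        + ennreal K * (\<Sum>i\<in>UNIV. (\<integral>\<^sup>+x. ?N i x \<partial>lborel) + (\<integral>\<^sup>+x. ?P i x \<partial>lborel))"
      by (simp add: nn_integral_add nn_integral_cmult nn_integral_sum)
    also have "\<dots> \<le> ennreal M * ennreal (2 ^ p * (\<eta> / m0 * (1 / m) / \<delta> ^ ?d + K * ((2 ^ (p + 1)) ^ ?d * \<delta> ^ p * (1 / m))))
        + ennreal K * (\<Sum>i\<in>(UNIV::'d set). ennreal (2 ^ p * (\<tau> + \<tau> ^ p)) + ennreal (2 ^ p * (\<tau> + \<tau> ^ p)))"
      by (intro add_mono mult_left_mono sum_mono near N P) auto
    also have "(\<Sum>i\<in>(UNIV::'d set). ennreal (2 ^ p * (\<tau> + \<tau> ^ p)) + ennreal (2 ^ p * (\<tau> + \<tau> ^ p)))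
      = ennreal (real ?d * (2 * (2 ^ p * (\<tau> + \<tau> ^ p))))"
      using \<tau> by (simp add: ennreal_mult' ennreal_of_nat_eq_real_of_nat flip: ennreal_plus mult_2)
    also have "ennreal M * ennreal (2 ^ p * (\<eta> / m0 * (1 / m) / \<delta> ^ ?d + K * ((2 ^ (p + 1)) ^ ?d * \<delta> ^ p * (1 / m))))
      + ennreal K * ennreal (real ?d * (2 * (2 ^ p * (\<tau> + \<tau> ^ p))))
      = ennreal (M * (2 ^ p * (\<eta> / m0 * (1 / m) / \<delta> ^ ?d + K * ((2 ^ (p + 1)) ^ ?d * \<delta> ^ p * (1 / m))))
      + K * (real ?d * (2 * (2 ^ p * (\<tau> + \<tau> ^ p)))))"
      using M m m0 \<eta> \<delta> \<tau> K by (subst ennreal_plus) (auto simp: ennreal_mult')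
    also have "\<dots> \<le> ennreal \<epsilon>" by (rule ennreal_leI[OF num])
    finally show "(\<integral>\<^sup>+x. g x * ennreal (r x) * ennreal (\<bar>h x\<bar> ^ p) \<partial>lborel) \<le> ennreal \<epsilon>" .
  qed
qed

end

section \<open>Lebesgue and Sobolev spaces\<close>

text \<open>Convexity of the power, including the argument 0, where it reduces to s^p \<le> s for s
  between 0 and 1.\<close>

lemma powr_convex_combination:
  fixes x y :: real
  assumes "0 \<le> t" "t \<le> 1" "0 \<le> x" "0 \<le> y" "1 \<le> p"
  shows "(t * x + (1 - t) * y) powr p \<le> t * x powr p + (1 - t) * y powr p"
proof -
  have *: "(s * z) powr p \<le> s * z powr p" if "0 \<le> s" "s \<le> 1" "0 \<le> z" for s z :: real
  proof (cases "s = 0")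
    case False
    then have "s powr p \<le> s powr 1" using that assms(5) by (intro powr_mono') auto
    then show ?thesis using that False by (simp add: powr_mult mult_right_mono)
  qed simp
  consider "x = 0" | "y = 0" | "0 < x" "0 < y" using assms by linarith
  then show ?thesis
  proof cases
    case 1
    then show ?thesis using *[of "1 - t" y] assms by simp
  next
    case 2
    then show ?thesis using *[of t x] assms by simp
  next
    case 3
    then show ?thesis
      using convex_onD[OF powr_convex[OF assms(5)], of "1 - t" x y] assms by (simp add: algebra_simps)
  qed
qed

text \<open>With a and b the two norms, |f + g| / (a + b) is at most a convex combination of |f| / a
  and |g| / b, and convexity of the power bounds the integral of its p-th power by 1. If one norm
  vanishes, that function is zero almost everywhere.\<close>

lemma Minkowski:
  fixes f g :: "'a \<Rightarrow> real"
  assumes [measurable]: "f \<in> borel_measurable M" "g \<in> borel_measurable M" and p: "1 \<le> p"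
    and f: "integrable M (\<lambda>x. \<bar>f x\<bar> powr p)" and g: "integrable M (\<lambda>x. \<bar>g x\<bar> powr p)"
  shows "integrable M (\<lambda>x. \<bar>f x + g x\<bar> powr p)"
    and "(LINT x|M. \<bar>f x + g x\<bar> powr p) powr (1 / p)
      \<le> (LINT x|M. \<bar>f x\<bar> powr p) powr (1 / p) + (LINT x|M. \<bar>g x\<bar> powr p) powr (1 / p)"
proof -
  have conv: "\<bar>f x + g x\<bar> powr p \<le> (a + b) powr p * (a / (a + b) * (\<bar>f x\<bar> / a) powr p + b / (a + b) * (\<bar>g x\<bar> / b) powr p)"
    if "0 < a" "0 < b" for a b x
  proof -
    have t: "1 - a / (a + b) = b / (a + b)" using that by (simp add: field_simps)
    have "a / (a + b) * (\<bar>f x\<bar> / a) + b / (a + b) * (\<bar>g x\<bar> / b) = (\<bar>f x\<bar> + \<bar>g x\<bar>) / (a + b)"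
      using that by (simp add: add_divide_distrib)
    then have eq: "(a + b) * (a / (a + b) * (\<bar>f x\<bar> / a) + b / (a + b) * (\<bar>g x\<bar> / b)) = \<bar>f x\<bar> + \<bar>g x\<bar>"
      using that by (simp only:) simp
    have "\<bar>f x + g x\<bar> powr p \<le> (\<bar>f x\<bar> + \<bar>g x\<bar>) powr p" using p by (intro powr_mono2) auto
    also have "\<dots> = (a + b) powr p * (a / (a + b) * (\<bar>f x\<bar> / a) + b / (a + b) * (\<bar>g x\<bar> / b)) powr p"
      unfolding eq[symmetric] by (rule powr_mult)
    also have "\<dots> \<le> (a + b) powr p * (a / (a + b) * (\<bar>f x\<bar> / a) powr p + b / (a + b) * (\<bar>g x\<bar> / b) powr p)"
      using powr_convex_combination[of "a / (a + b)" "\<bar>f x\<bar> / a" "\<bar>g x\<bar> / b" p] that p unfolding t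
      by (intro mult_left_mono) auto
    finally show ?thesis .
  qed
  show int: "integrable M (\<lambda>x. \<bar>f x + g x\<bar> powr p)"
  proof (rule Bochner_Integration.integrable_bound)
    \<comment> \<open>The majorant is the convexity estimate for a = b = 1.\<close>
    show "integrable M (\<lambda>x. 2 powr p * (1 / 2 * \<bar>f x\<bar> powr p + 1 / 2 * \<bar>g x\<bar> powr p))" using f g by auto
    show "AE x in M. norm (\<bar>f x + g x\<bar> powr p) \<le> norm (2 powr p * (1 / 2 * \<bar>f x\<bar> powr p + 1 / 2 * \<bar>g x\<bar> powr p))"
      using conv[of 1 1] by simp
  qed measurable
  define a where "a = (LINT x|M. \<bar>f x\<bar> powr p) powr (1 / p)"
  define b where "b = (LINT x|M. \<bar>g x\<bar> powr p) powr (1 / p)"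
  have zero: "AE x in M. u x = 0" if "integrable M (\<lambda>x. \<bar>u x\<bar> powr p)" "(LINT x|M. \<bar>u x\<bar> powr p) powr (1 / p) = 0"
    for u :: "'a \<Rightarrow> real"
  proof -
    have "(LINT x|M. \<bar>u x\<bar> powr p) = 0" using that(2) by simp
    then have "AE x in M. \<bar>u x\<bar> powr p = 0" using integral_nonneg_eq_0_iff_AE[OF that(1)] by auto
    then show ?thesis by eventually_elim simp
  qed
  have pw: "a powr p = (LINT x|M. \<bar>f x\<bar> powr p)" "b powr p = (LINT x|M. \<bar>g x\<bar> powr p)"
    using p by (auto simp: a_def b_def powr_powr Bochner_Integration.integral_nonneg)
  have "(LINT x|M. \<bar>f x + g x\<bar> powr p) powr (1 / p) \<le> a + b"
  proof -
    consider "a = 0" | "b = 0" | "0 < a" "0 < b" unfolding a_def b_def by (metis less_eq_real_def powr_ge_zero)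
    then show ?thesis
    proof cases
      case 1
      then have "AE x in M. f x = 0" using zero[OF f] by (simp add: a_def)
      then have "(LINT x|M. \<bar>f x + g x\<bar> powr p) = (LINT x|M. \<bar>g x\<bar> powr p)"
        by (intro integral_cong_AE) (auto elim: eventually_mono)
      then show ?thesis using 1 by (simp add: b_def)
    next
      case 2
      then have "AE x in M. g x = 0" using zero[OF g] by (simp add: b_def)
      then have "(LINT x|M. \<bar>f x + g x\<bar> powr p) = (LINT x|M. \<bar>f x\<bar> powr p)"
        by (intro integral_cong_AE) (auto elim: eventually_mono)
      then show ?thesis using 2 by (simp add: a_def)
    next
      case 3
      have div: "(\<bar>u x\<bar> / c) powr p = 1 / c powr p * \<bar>u x\<bar> powr p" if "0 < c" for c x and u :: "'a \<Rightarrow> real"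
        using that by (simp add: powr_divide)
      have "(LINT x|M. \<bar>f x + g x\<bar> powr p)
        \<le> (LINT x|M. (a + b) powr p * (a / (a + b) * (\<bar>f x\<bar> / a) powr p + b / (a + b) * (\<bar>g x\<bar> / b) powr p))"
        using int f g conv[OF 3] unfolding div[OF 3(1)] div[OF 3(2)]
        by (intro integral_mono) auto
      also have "\<dots> = (a + b) powr p * (a / (a + b) * (1 / a powr p * (LINT x|M. \<bar>f x\<bar> powr p))
          + b / (a + b) * (1 / b powr p * (LINT x|M. \<bar>g x\<bar> powr p)))"
        unfolding div[OF 3(1)] div[OF 3(2)] using f g by simp
      also have "\<dots> = (a + b) powr p"
        unfolding pw[symmetric] using 3 by (simp add: add_divide_distrib[symmetric])
      finally have "(LINT x|M. \<bar>f x + g x\<bar> powr p) powr (1 / p) \<le> ((a + b) powr p) powr (1 / p)"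
        using p by (intro powr_mono2) (auto intro!: Bochner_Integration.integral_nonneg)
      then show ?thesis using 3 p by (simp add: powr_powr)
    qed
  qed
  then show "(LINT x|M. \<bar>f x + g x\<bar> powr p) powr (1 / p)
      \<le> (LINT x|M. \<bar>f x\<bar> powr p) powr (1 / p) + (LINT x|M. \<bar>g x\<bar> powr p) powr (1 / p)"
    by (simp add: a_def b_def)
qed

text \<open>The case of counting measure, used for the outer sum over multi-indices in the Sobolev
  norm.\<close>

lemma Minkowski_sum:
  fixes a b :: "'i \<Rightarrow> real"
  assumes "finite S" "1 \<le> p" "\<And>s. s \<in> S \<Longrightarrow> 0 \<le> a s" "\<And>s. s \<in> S \<Longrightarrow> 0 \<le> b s"
  shows "(\<Sum>s\<in>S. (a s + b s) powr p) powr (1 / p) \<le> (\<Sum>s\<in>S. a s powr p) powr (1 / p) + (\<Sum>s\<in>S. b s powr p) powr (1 / p)"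
  using Minkowski(2)[of a "count_space S" b p] assms
  by (simp add: lebesgue_integral_count_space_finite integrable_count_space cong: sum.cong)

section \<open>The reference measure as a product probability measure\<close>

locale reference_setting =
  fixes t C :: real and \<theta> :: "real \<Rightarrow> real" and k :: nat and \<Lambda> :: "nat \<Rightarrow> real"
    and \<mu> :: "(real^'d::finite) measure"
  assumes t: "0 < t" "t \<le> 2" and admissible: "admissible_potential t \<theta>"
    and normalised: "(LINT z|lborel. exp (C - \<theta> \<bar>z\<bar>)) = 1"
    and k: "1 \<le> k" and \<Lambda>: "antimono_on {0..k} \<Lambda>" "1 \<le> \<Lambda> k"
    and \<Lambda>_0: "\<Lambda> 0 > 1 \<or> (\<Lambda> 0 = 1 \<and> 1 < t \<and> t \<le> 2 \<and> \<Lambda> 1 = \<Lambda> 0)"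
    and \<mu>_def: "\<mu> = reference_measure C \<theta>"
begin

definition q :: "real \<Rightarrow> real" where "q z = exp (C - \<theta> \<bar>z\<bar>)"

sublocale product_weight q
proof
  have sm: "strict_mono_on {0..} \<theta>" using admissible by (simp add: admissible_potential_def)
  then have mono: "\<theta> z \<le> \<theta> w" if "0 \<le> z" "z \<le> w" for z w
    using strict_mono_onD[OF sm, of z w] that by (cases "z = w") (auto intro: less_imp_le)
  \<comment> \<open>Monotonicity of \<theta> is known on the half-line only. Cutting off the
    argument at 0 gives a function that is monotone on the whole line, hence Borel
    measurable.\<close>
  have "mono (\<lambda>z. \<theta> (max z 0))" by (intro monoI mono) auto
  then have "(\<lambda>z. \<theta> (max z 0)) \<in> borel_measurable borel" by (rule borel_measurable_mono)
  then have [measurable]: "(\<lambda>z. \<theta> (max \<bar>z\<bar> 0)) \<in> borel_measurable borel"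
    by (rule measurable_compose[where f = "\<lambda>z::real. \<bar>z\<bar>" and N = borel, rotated]) measurable
  have "q = (\<lambda>z. exp (C - \<theta> (max \<bar>z\<bar> 0)))" by (simp add: q_def fun_eq_iff)
  moreover have "(\<lambda>z. exp (C - \<theta> (max \<bar>z\<bar> 0))) \<in> borel_measurable borel" by measurable
  ultimately show "q \<in> borel_measurable borel" by (simp only:)
  show "0 < q z" "q (- z) = q z" for z by (auto simp: q_def)
  show "q w \<le> q z" if "0 \<le> z" "z \<le> w" for z w using mono[OF that] that by (simp add: q_def)
qed

lemma \<mu>_density: "\<mu> = density lebesgue (\<lambda>x. ennreal (r x))"
  unfolding \<mu>_def reference_measure_def tensor_def q_def by (simp add: exp_sum)

lemma r_measurable_lebesgue [measurable]: "r \<in> borel_measurable lebesgue"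
  by (intro measurable_completion) simp

lemma sets_\<mu> [measurable_cong]: "sets \<mu> = sets lebesgue"
  by (simp add: \<mu>_density)

lemma measurable_\<mu>: "f \<in> borel_measurable \<mu> \<longleftrightarrow> f \<in> borel_measurable lebesgue"
  by (simp add: measurable_cong_sets[OF sets_\<mu> refl])

lemma AE_\<mu>: "(AE x in \<mu>. P x) \<longleftrightarrow> (AE x in lebesgue. P x)"
  unfolding \<mu>_density by (subst AE_density) (auto simp: r_pos)

lemma nn_integral_\<mu>:
  "f \<in> borel_measurable borel \<Longrightarrow> (\<integral>\<^sup>+x. f x \<partial>\<mu>) = (\<integral>\<^sup>+x. ennreal (r x) * f x \<partial>lborel)"
  unfolding \<mu>_density
  by (subst nn_integral_density) (auto simp: nn_integral_completion intro!: measurable_completion)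

lemma prob_space_\<mu>: "prob_space \<mu>"
proof
  \<comment> \<open>The integral of a function that is not integrable is 0 by convention, so the
    normalisation to 1 implies integrability.\<close>
  have int: "integrable lborel q"
  proof (rule ccontr)
    assume "\<not> integrable lborel q"
    then show False using normalised not_integrable_integral_eq[of lborel q] by (simp add: q_def[abs_def])
  qed
  have 1: "(\<integral>\<^sup>+z. ennreal (q z) \<partial>lborel) = 1"
    using nn_integral_eq_integral[OF int] normalised q_pos by (simp add: less_imp_le q_def[abs_def])
  have "r x = (\<Prod>b\<in>Basis. q (x \<bullet> b))" for x :: "real^'d"
  proof -
    have "(\<Prod>b\<in>(Basis :: (real^'d) set). q (x \<bullet> b)) = (\<Prod>i\<in>UNIV. q (x \<bullet> axis i 1))"
      unfolding Basis_vec_def using axis_eq_axis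
      by (subst prod.reindex[of "\<lambda>i. axis i 1" UNIV, symmetric, unfolded o_def])
        (auto simp: inj_on_def axis_eq_axis intro!: prod.cong)
    then show ?thesis by (simp add: tensor_def inner_axis)
  qed
  then have "(\<integral>\<^sup>+x. ennreal (r x) \<partial>(lborel :: (real^'d) measure)) = (\<integral>\<^sup>+x. (\<Prod>b\<in>Basis. ennreal (q (x \<bullet> b))) \<partial>(lborel :: (real^'d) measure))"
    using q_pos by (simp add: prod_ennreal less_imp_le)
  also have "\<dots> = (\<Prod>b\<in>(Basis :: (real^'d) set). \<integral>\<^sup>+z. ennreal (q z) \<partial>lborel)"
    by (rule nn_integral_lborel_prod) auto
  finally have "(\<integral>\<^sup>+x. ennreal (r x) \<partial>(lborel :: (real^'d) measure)) = 1" by (simp add: 1)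
  then have "(\<integral>\<^sup>+x. 1 \<partial>\<mu>) = 1" using nn_integral_\<mu>[of "\<lambda>_. 1"] by simp
  then show "emeasure \<mu> (space \<mu>) = 1" by simp
qed

sublocale prob_space \<mu>
  by (rule prob_space_\<mu>)

section \<open>The Lebesgue spaces of the reference measure\<close>

lemma Lp_space_iff: "u \<in> Lp_space \<mu> p \<longleftrightarrow>
    rep_ae_fun u \<in> borel_measurable \<mu> \<and> integrable \<mu> (\<lambda>x. \<bar>rep_ae_fun u x\<bar> powr p)"
  by (simp add: Lp_space_def)

lemma rep_add_\<mu>: "AE x in \<mu>. rep_ae_fun (u + v) x = rep_ae_fun u x + rep_ae_fun v x"
  unfolding AE_\<mu> by (rule rep_ae_fun_add)

lemma rep_scale_\<mu>: "AE x in \<mu>. rep_ae_fun (c *\<^sub>R u) x = c * rep_ae_fun u x"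
  unfolding AE_\<mu> by (rule rep_ae_fun_scale)

lemma measurable_AE_\<mu>:
  fixes f g :: "real^'d \<Rightarrow> real"
  assumes "f \<in> borel_measurable \<mu>" "AE x in \<mu>. f x = g x"
  shows "g \<in> borel_measurable \<mu>"
  using borel_measurable_AE[of f g] assms unfolding measurable_\<mu> AE_\<mu> by blast

lemma Lp_add:
  assumes u: "u \<in> Lp_space \<mu> p" and v: "v \<in> Lp_space \<mu> p" and p: "1 \<le> p"
  shows "u + v \<in> Lp_space \<mu> p" "Lp_norm \<mu> p (u + v) \<le> Lp_norm \<mu> p u + Lp_norm \<mu> p v"
proof -
  have [measurable]: "rep_ae_fun u \<in> borel_measurable \<mu>" "rep_ae_fun v \<in> borel_measurable \<mu>"
    using u v by (auto simp: Lp_space_iff)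
  have m[measurable]: "rep_ae_fun (u + v) \<in> borel_measurable \<mu>"
    by (rule measurable_AE_\<mu>[OF _ AE_symmetric[OF rep_add_\<mu>]]) measurable
  have i: "integrable \<mu> (\<lambda>x. \<bar>rep_ae_fun u x\<bar> powr p)" "integrable \<mu> (\<lambda>x. \<bar>rep_ae_fun v x\<bar> powr p)"
    using u v by (auto simp: Lp_space_iff)
  note M = Minkowski[OF _ _ p i]
  have ae: "AE x in \<mu>. \<bar>rep_ae_fun u x + rep_ae_fun v x\<bar> powr p = \<bar>rep_ae_fun (u + v) x\<bar> powr p"
    using rep_add_\<mu>[of u v] by eventually_elim simp
  have "integrable \<mu> (\<lambda>x. \<bar>rep_ae_fun (u + v) x\<bar> powr p)"
    by (rule integrable_cong_AE_imp[OF M(1) _ ae]) measurable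
  then show "u + v \<in> Lp_space \<mu> p" using m by (simp add: Lp_space_iff)
  have "(LINT x|\<mu>. \<bar>rep_ae_fun (u + v) x\<bar> powr p) = (LINT x|\<mu>. \<bar>rep_ae_fun u x + rep_ae_fun v x\<bar> powr p)"
    by (rule integral_cong_AE[OF _ _ ae[THEN AE_symmetric]]) measurable
  then show "Lp_norm \<mu> p (u + v) \<le> Lp_norm \<mu> p u + Lp_norm \<mu> p v"
    using M(2) by (simp add: Lp_norm_def)
qed

lemma Lp_scale:
  assumes u: "u \<in> Lp_space \<mu> p" and p: "1 \<le> p"
  shows "c *\<^sub>R u \<in> Lp_space \<mu> p" "Lp_norm \<mu> p (c *\<^sub>R u) = \<bar>c\<bar> * Lp_norm \<mu> p u"
proof -
  have [measurable]: "rep_ae_fun u \<in> borel_measurable \<mu>" using u by (auto simp: Lp_space_iff)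
  have m[measurable]: "rep_ae_fun (c *\<^sub>R u) \<in> borel_measurable \<mu>"
    by (rule measurable_AE_\<mu>[OF _ AE_symmetric[OF rep_scale_\<mu>]]) measurable
  have i: "integrable \<mu> (\<lambda>x. \<bar>c\<bar> powr p * \<bar>rep_ae_fun u x\<bar> powr p)" using u by (auto simp: Lp_space_iff)
  have ae: "AE x in \<mu>. \<bar>rep_ae_fun (c *\<^sub>R u) x\<bar> powr p = \<bar>c\<bar> powr p * \<bar>rep_ae_fun u x\<bar> powr p"
    using rep_scale_\<mu>[of c u] by eventually_elim (simp add: abs_mult powr_mult)
  have "integrable \<mu> (\<lambda>x. \<bar>rep_ae_fun (c *\<^sub>R u) x\<bar> powr p)"
    by (rule integrable_cong_AE_imp[OF i _ ae[THEN AE_symmetric]]) measurable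
  then show "c *\<^sub>R u \<in> Lp_space \<mu> p" using m by (simp add: Lp_space_iff)
  have "(LINT x|\<mu>. \<bar>rep_ae_fun (c *\<^sub>R u) x\<bar> powr p) = \<bar>c\<bar> powr p * (LINT x|\<mu>. \<bar>rep_ae_fun u x\<bar> powr p)"
    by (subst integral_cong_AE[OF _ _ ae]) auto
  then show "Lp_norm \<mu> p (c *\<^sub>R u) = \<bar>c\<bar> * Lp_norm \<mu> p u"
    using p by (simp add: Lp_norm_def powr_mult powr_powr Bochner_Integration.integral_nonneg)
qed

lemma Lp_norm_nonneg: "0 \<le> Lp_norm \<mu> p u"
  by (simp add: Lp_norm_def)

lemma Lp_norm_powr: "1 \<le> p \<Longrightarrow> Lp_norm \<mu> p u powr p = (LINT x|\<mu>. \<bar>rep_ae_fun u x\<bar> powr p)"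
  by (simp add: Lp_norm_def powr_powr Bochner_Integration.integral_nonneg)

lemma Lp_norm_eq_0:
  assumes "u \<in> Lp_space \<mu> p" "1 \<le> p" "Lp_norm \<mu> p u = 0"
  shows "u = 0"
proof (rule ae_fun_eqI)
  have "(LINT x|\<mu>. \<bar>rep_ae_fun u x\<bar> powr p) = 0" using assms(3) by (simp add: Lp_norm_def)
  then have "AE x in \<mu>. \<bar>rep_ae_fun u x\<bar> powr p = 0"
    using assms(1) integral_nonneg_eq_0_iff_AE[of \<mu>] by (auto simp: Lp_space_iff)
  then have "AE x in lebesgue. rep_ae_fun u x = 0" unfolding AE_\<mu> by eventually_elim simp
  moreover have "AE x in lebesgue. rep_ae_fun (0 :: 'd ae_fun) x = 0"
    using rep_abs_ae_fun[of "\<lambda>_. 0"] by (simp add: zero_ae_fun.abs_eq)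
  ultimately show "AE x in lebesgue. rep_ae_fun u x = rep_ae_fun 0 x" by eventually_elim simp
qed

lemma abs_le_one_plus_powr:
  fixes x p :: real
  assumes p: "1 \<le> p"
  shows "\<bar>x\<bar> \<le> 1 + \<bar>x\<bar> powr p"
proof -
  show ?thesis
  proof (cases "\<bar>x\<bar> \<le> 1")
    case False
    then have "\<bar>x\<bar> powr 1 \<le> \<bar>x\<bar> powr p" using p by (intro powr_mono) auto
    then show ?thesis using False by simp
  qed (simp add: add_increasing2)
qed

text \<open>An exponent p \<ge> 1 gives integrability for the probability measure, and its density
  is bounded below on every cube.\<close>

lemma Lp_locally_integrable:
  assumes u: "u \<in> Lp_space \<mu> p" and p: "1 \<le> p"
  shows "locally_integrable (rep_ae_fun u)"
  unfolding locally_integrable_def set_integrable_def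
proof (intro allI impI)
  fix K :: "(real^'d) set" assume K: "compact K"
  have um: "rep_ae_fun u \<in> borel_measurable lebesgue" using u by (simp add: Lp_space_iff measurable_\<mu>)
  have i: "integrable \<mu> (rep_ae_fun u)"
  proof (rule Bochner_Integration.integrable_bound)
    show "integrable \<mu> (\<lambda>x. 1 + \<bar>rep_ae_fun u x\<bar> powr p)" using u by (simp add: Lp_space_iff)
    show "AE x in \<mu>. norm (rep_ae_fun u x) \<le> norm (1 + \<bar>rep_ae_fun u x\<bar> powr p)"
      using abs_le_one_plus_powr[OF p] by (intro AE_I2) simp
  qed (use u in \<open>simp add: Lp_space_iff\<close>)
  then have i2: "integrable lebesgue (\<lambda>x. r x * rep_ae_fun u x)"
    unfolding \<mu>_density using r_pos um by (subst (asm) integrable_density) (auto intro: less_imp_le)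
  obtain B where B: "\<And>x. x \<in> K \<Longrightarrow> norm x \<le> B" using compact_imp_bounded[OF K] unfolding bounded_iff by blast
  have KB: "K \<subseteq> cube B"
    unfolding mem_cube subset_iff using order_trans[OF component_le_norm_cart B] by blast
  let ?m = "q B ^ CARD('d)"
  have m: "0 < ?m" using q_pos by simp
  show "integrable lebesgue (\<lambda>x. indicator K x *\<^sub>R rep_ae_fun u x)"
  proof (rule Bochner_Integration.integrable_bound)
    show "integrable lebesgue (\<lambda>x. 1 / ?m * (r x * rep_ae_fun u x))" using i2 by (rule integrable_mult_right)
    show "(\<lambda>x. indicator K x *\<^sub>R rep_ae_fun u x) \<in> borel_measurable lebesgue"
      using um K by (intro borel_measurable_scaleR borel_measurable_indicator)
        (auto intro: lmeasurable_compact[THEN fmeasurableD])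
    show "AE x in lebesgue. norm (indicator K x *\<^sub>R rep_ae_fun u x) \<le> norm (1 / ?m * (r x * rep_ae_fun u x))"
    proof (rule AE_I2)
      fix x
      have "indicator K x \<le> 1 / ?m * r x"
        using r_ge[of x B] KB m r_pos[of x] by (cases "x \<in> K") (auto simp: field_simps)
      from mult_right_mono[OF this, of "\<bar>rep_ae_fun u x\<bar>"]
      show "norm (indicator K x *\<^sub>R rep_ae_fun u x) \<le> norm (1 / ?m * (r x * rep_ae_fun u x))"
        using m r_pos[of x] by (simp add: abs_mult)
    qed
  qed
qed

section \<open>The weighted Sobolev space as a normed space\<close>

definition G :: "'d ae_fun set" where "G = sobolev_space \<mu> k \<Lambda>"

definition nG :: "'d ae_fun \<Rightarrow> real" where "nG = sobolev_norm \<mu> k \<Lambda>"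

definition const_fun :: "real \<Rightarrow> 'd ae_fun" where "const_fun c = abs_ae_fun (\<lambda>_. c)"

lemma \<Lambda>_ge_1: "j \<le> k \<Longrightarrow> 1 \<le> \<Lambda> j"
  using \<Lambda> monotone_onD[OF \<Lambda>(1), of j k] by auto

text \<open>Order 0 is included, with u as its own derivative, because the sum in the Sobolev norm
  starts there.\<close>

lemma weak_deriv_G:
  assumes u: "u \<in> G" and s: "order_of s \<le> k"
  shows "has_weak_derivative s u (weak_deriv s u)" "weak_deriv s u \<in> Lp_space \<mu> (\<Lambda> (order_of s))"
proof -
  have u0: "u \<in> Lp_space \<mu> (\<Lambda> 0)" using u by (simp add: G_def sobolev_space_def)
  have "\<exists>v\<in>Lp_space \<mu> (\<Lambda> (order_of s)). has_weak_derivative s u v"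
  proof (cases "order_of s = 0")
    case True
    then have "has_weak_derivative s u u"
      using order_of_eq_0[OF True] has_weak_derivative_0[OF Lp_locally_integrable[OF u0 \<Lambda>_ge_1]] by simp
    then show ?thesis using u0 True by auto
  next
    case False
    then show ?thesis using u s by (auto simp: G_def sobolev_space_def)
  qed
  then obtain v where v: "v \<in> Lp_space \<mu> (\<Lambda> (order_of s))" "has_weak_derivative s u v" by blast
  then show "has_weak_derivative s u (weak_deriv s u)" "weak_deriv s u \<in> Lp_space \<mu> (\<Lambda> (order_of s))"
    using weak_deriv_eq[OF v(2)] by auto
qed

lemma weak_deriv_0_G: "u \<in> G \<Longrightarrow> weak_deriv (\<lambda>_. 0) u = u"
  using \<Lambda>_ge_1[of 0]
  by (intro weak_deriv_eq has_weak_derivative_0 Lp_locally_integrable[of _ "\<Lambda> 0"])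
    (auto simp: G_def sobolev_space_def)

lemma G_add: "u \<in> G \<Longrightarrow> v \<in> G \<Longrightarrow> u + v \<in> G"
proof -
  assume u: "u \<in> G" and v: "v \<in> G"
  have "u + v \<in> Lp_space \<mu> (\<Lambda> 0)" using u v \<Lambda>_ge_1[of 0] by (intro Lp_add) (auto simp: G_def sobolev_space_def)
  moreover have "\<exists>w\<in>Lp_space \<mu> (\<Lambda> (order_of s)). has_weak_derivative s (u + v) w" if s: "order_of s \<le> k" for s
    using weak_deriv_G[OF u s] weak_deriv_G[OF v s] \<Lambda>_ge_1[OF s]
    by (intro bexI[of _ "weak_deriv s u + weak_deriv s v"] has_weak_derivative_add Lp_add)
  ultimately show ?thesis by (auto simp: G_def sobolev_space_def)
qed

lemma G_scale: "u \<in> G \<Longrightarrow> c *\<^sub>R u \<in> G"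
proof -
  assume u: "u \<in> G"
  have "c *\<^sub>R u \<in> Lp_space \<mu> (\<Lambda> 0)" using u \<Lambda>_ge_1[of 0] by (intro Lp_scale) (auto simp: G_def sobolev_space_def)
  moreover have "\<exists>w\<in>Lp_space \<mu> (\<Lambda> (order_of s)). has_weak_derivative s (c *\<^sub>R u) w" if s: "order_of s \<le> k" for s
    using weak_deriv_G[OF u s] \<Lambda>_ge_1[OF s]
    by (intro bexI[of _ "c *\<^sub>R weak_deriv s u"] has_weak_derivative_scale Lp_scale)
  ultimately show ?thesis by (auto simp: G_def sobolev_space_def)
qed

lemma rep_const_fun: "AE x in \<mu>. rep_ae_fun (const_fun c) x = c"
  unfolding AE_\<mu> const_fun_def by (rule rep_abs_ae_fun)

lemma const_fun_measurable: "rep_ae_fun (const_fun c) \<in> borel_measurable \<mu>"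
  by (rule measurable_AE_\<mu>[OF _ AE_symmetric[OF rep_const_fun]]) simp

lemma const_fun_Lp: "const_fun c \<in> Lp_space \<mu> p"
proof -
  have ae: "AE x in \<mu>. \<bar>rep_ae_fun (const_fun c) x\<bar> powr p = \<bar>c\<bar> powr p"
    using rep_const_fun[of c] by eventually_elim simp
  have [measurable]: "rep_ae_fun (const_fun c) \<in> borel_measurable \<mu>" by (rule const_fun_measurable)
  have "integrable \<mu> (\<lambda>x. \<bar>rep_ae_fun (const_fun c) x\<bar> powr p)"
    by (rule integrable_cong_AE_imp[OF _ _ ae[THEN AE_symmetric]]) auto
  then show ?thesis by (simp add: Lp_space_iff const_fun_measurable)
qed

lemma const_fun_eq_scale: "const_fun c = c *\<^sub>R const_fun 1"
  unfolding const_fun_def by (simp add: scaleR_ae_fun.abs_eq)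

lemma const_fun_G: "const_fun c \<in> G"
proof -
  have "\<exists>w\<in>Lp_space \<mu> (\<Lambda> (order_of s)). has_weak_derivative s (const_fun c) w" if "1 \<le> order_of s" for s
    using has_weak_derivative_const[OF that, of c] const_fun_Lp[of 0]
    by (intro bexI[of _ 0]) (auto simp: const_fun_def zero_ae_fun.abs_eq)
  then show ?thesis using const_fun_Lp by (auto simp: G_def sobolev_space_def)
qed

lemma subspace_G: "subspace G"
  using G_add G_scale const_fun_G[of 0] by (auto simp: subspace_def const_fun_def zero_ae_fun.abs_eq)

lemma nG_eq: "nG u = (\<Sum>s | order_of s \<le> k. Lp_norm \<mu> (\<Lambda> (order_of s)) (weak_deriv s u) powr \<Lambda> 0) powr (1 / \<Lambda> 0)"
  by (simp add: nG_def sobolev_norm_def)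

lemma Lp_norm_le_nG:
  assumes s: "order_of s \<le> k"
  shows "Lp_norm \<mu> (\<Lambda> (order_of s)) (weak_deriv s u) \<le> nG u"
proof -
  have "Lp_norm \<mu> (\<Lambda> (order_of s)) (weak_deriv s u)
    = (Lp_norm \<mu> (\<Lambda> (order_of s)) (weak_deriv s u) powr \<Lambda> 0) powr (1 / \<Lambda> 0)"
    using \<Lambda>_ge_1[of 0] by (simp add: powr_powr Lp_norm_nonneg)
  also have "\<dots> \<le> nG u"
    unfolding nG_eq using s \<Lambda>_ge_1[of 0]
    by (intro powr_mono2 member_le_sum[of s "{s. order_of s \<le> k}"
        "\<lambda>s. Lp_norm \<mu> (\<Lambda> (order_of s)) (weak_deriv s u) powr \<Lambda> 0"]) (auto simp: finite_order_of_le)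
  finally show ?thesis .
qed

lemma nG_add:
  assumes u: "u \<in> G" and v: "v \<in> G"
  shows "nG (u + v) \<le> nG u + nG v"
proof -
  let ?S = "{s :: 'd \<Rightarrow> nat. order_of s \<le> k}" and ?L = "\<lambda>s u. Lp_norm \<mu> (\<Lambda> (order_of s)) (weak_deriv s u)"
  have "nG (u + v) \<le> (\<Sum>s\<in>?S. (?L s u + ?L s v) powr \<Lambda> 0) powr (1 / \<Lambda> 0)"
    unfolding nG_eq
  proof (intro powr_mono2 sum_mono sum_nonneg)
    fix s :: "'d \<Rightarrow> nat" assume "s \<in> ?S"
    then have s: "order_of s \<le> k" by simp
    have "weak_deriv s (u + v) = weak_deriv s u + weak_deriv s v"
      using weak_deriv_G[OF u s] weak_deriv_G[OF v s] by (intro weak_deriv_eq has_weak_derivative_add)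
    then show "?L s (u + v) \<le> ?L s u + ?L s v"
      using weak_deriv_G[OF u s] weak_deriv_G[OF v s] Lp_add(2) \<Lambda>_ge_1[OF s] by simp
  qed (use \<Lambda>_ge_1[of 0] Lp_norm_nonneg in auto)
  also have "\<dots> \<le> nG u + nG v"
    unfolding nG_eq using \<Lambda>_ge_1[of 0] by (intro Minkowski_sum finite_order_of_le Lp_norm_nonneg) simp
  finally show ?thesis .
qed

lemma nG_scale:
  assumes u: "u \<in> G"
  shows "nG (c *\<^sub>R u) = \<bar>c\<bar> * nG u"
proof -
  let ?S = "{s :: 'd \<Rightarrow> nat. order_of s \<le> k}" and ?L = "\<lambda>s u. Lp_norm \<mu> (\<Lambda> (order_of s)) (weak_deriv s u)"
  have eq: "?L s (c *\<^sub>R u) powr \<Lambda> 0 = \<bar>c\<bar> powr \<Lambda> 0 * ?L s u powr \<Lambda> 0" if "s \<in> ?S" for s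
  proof -
    have s: "order_of s \<le> k" using that by simp
    have "weak_deriv s (c *\<^sub>R u) = c *\<^sub>R weak_deriv s u"
      using weak_deriv_G[OF u s] by (intro weak_deriv_eq has_weak_derivative_scale)
    then show ?thesis
      using weak_deriv_G[OF u s] Lp_scale(2) \<Lambda>_ge_1[OF s] by (simp add: powr_mult Lp_norm_nonneg)
  qed
  have "nG (c *\<^sub>R u) = (\<bar>c\<bar> powr \<Lambda> 0 * (\<Sum>s\<in>?S. ?L s u powr \<Lambda> 0)) powr (1 / \<Lambda> 0)"
    unfolding nG_eq sum_distrib_left using eq by (intro arg_cong2[where f = "(powr)"] sum.cong) auto
  also have "\<dots> = \<bar>c\<bar> * nG u"
    unfolding nG_eq using \<Lambda>_ge_1[of 0] by (simp add: powr_mult powr_powr sum_nonneg)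
  finally show ?thesis .
qed

lemma Lp_norm_0_le_nG: "u \<in> G \<Longrightarrow> Lp_norm \<mu> (\<Lambda> 0) u \<le> nG u"
  using Lp_norm_le_nG[of "\<lambda>_. 0" u] by (simp add: order_of_0 weak_deriv_0_G)

lemma nG_eq_0:
  assumes "u \<in> G" "nG u = 0"
  shows "u = 0"
  using Lp_norm_0_le_nG[OF assms(1)] assms Lp_norm_nonneg[of "\<Lambda> 0" u] \<Lambda>_ge_1[of 0]
  by (intro Lp_norm_eq_0[of _ "\<Lambda> 0"]) (auto simp: G_def sobolev_space_def)

section \<open>Moments and uniform integrability on the unit ball of the Sobolev space\<close>

abbreviation N :: nat where "N \<equiv> smoothness_order t \<Lambda>"

text \<open>\<lceil>x\<rceil> - 1 is always less than x, so equality with \<Lambda> 0 is possible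
  only in the floor branch, whose condition is the conclusion of \<open>N_eq\<close>.\<close>

lemma N_ge_1: "1 \<le> N" and N_le: "real N \<le> \<Lambda> 0"
  and N_eq: "real N = \<Lambda> 0 \<Longrightarrow> 1 < t \<and> \<Lambda> 1 = \<Lambda> 0"
proof -
  have 1: "1 \<le> \<Lambda> 0" using \<Lambda>_ge_1 by simp
  show "1 \<le> N" "real N \<le> \<Lambda> 0" "real N = \<Lambda> 0 \<Longrightarrow> 1 < t \<and> \<Lambda> 1 = \<Lambda> 0"
    unfolding smoothness_order_def using \<Lambda>_0 1 by (auto split: if_splits) linarith+
qed

lemma powr_integral_le_1:
  assumes "u \<in> Lp_space \<mu> p" "1 \<le> p" "Lp_norm \<mu> p u \<le> 1"
  shows "(LINT x|\<mu>. \<bar>rep_ae_fun u x\<bar> powr p) \<le> 1"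
proof -
  have "Lp_norm \<mu> p u powr p \<le> 1 powr p" using assms Lp_norm_nonneg by (intro powr_mono2) auto
  then show ?thesis using Lp_norm_powr[OF assms(2), of u] by simp
qed

lemma G_Lp: "u \<in> G \<Longrightarrow> u \<in> Lp_space \<mu> (\<Lambda> 0)"
  by (simp add: G_def sobolev_space_def)

lemma G_measurable: "u \<in> G \<Longrightarrow> rep_ae_fun u \<in> borel_measurable \<mu>"
  using G_Lp by (simp add: Lp_space_iff)

text \<open>For large z the increment of \<theta> over a step y is (z + y)^t - z^t. It is at least y
  z^(t-1), which tends to infinity because t > 1.\<close>

lemma q_tail:
  assumes t: "1 < t" and y: "0 < y" and \<kappa>: "0 < \<kappa>"
  shows "\<exists>R\<ge>0. \<forall>z\<ge>R. q (z + y) \<le> \<kappa> * q z"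
proof -
  obtain zt c where zt: "zt \<ge> 0" "\<And>z. z \<ge> zt \<Longrightarrow> 0 < z \<Longrightarrow> \<theta> z = c + z powr t"
    using admissible unfolding admissible_potential_def by blast
  define L where "L = \<bar>ln \<kappa>\<bar> / y"
  \<comment> \<open>Large enough for the explicit form of \<theta> and for z^(t-1) \<ge> |ln
    \<kappa>| / y.\<close>
  define R where "R = Max {1, zt, L powr (1 / (t - 1))}"
  have R: "1 \<le> R" "zt \<le> R" "L powr (1 / (t - 1)) \<le> R" by (auto simp: R_def)
  have "q (z + y) \<le> \<kappa> * q z" if z: "R \<le> z" for z
  proof -
    have z0: "0 < z" "zt \<le> z" using z R by auto
    have "L = (L powr (1 / (t - 1))) powr (t - 1)" using t y by (simp add: L_def powr_powr)
    also have "\<dots> \<le> z powr (t - 1)" using z R t by (intro powr_mono2) auto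
    finally have "\<bar>ln \<kappa>\<bar> \<le> y * z powr (t - 1)" using y by (simp add: L_def field_simps)
    also have "\<dots> = (z + y) * z powr (t - 1) - z * z powr (t - 1)" by (simp add: algebra_simps)
    also have "\<dots> \<le> (z + y) * (z + y) powr (t - 1) - z * z powr (t - 1)"
      using z0 y t by (intro diff_mono mult_left_mono powr_mono2) auto
    also have "\<dots> = (z + y) powr t - z powr t"
      using z0 y by (simp add: powr_mult_base)
    also have "\<dots> = \<theta> (z + y) - \<theta> z" using zt(2)[of z] zt(2)[of "z + y"] z0 y by simp
    finally have "- ln \<kappa> \<le> \<theta> (z + y) - \<theta> z" by linarith
    then have "C - \<theta> (z + y) \<le> ln \<kappa> + (C - \<theta> z)" by simp
    then have "exp (C - \<theta> (z + y)) \<le> exp (ln \<kappa> + (C - \<theta> z))" by (subst exp_le_cancel_iff)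
    then show ?thesis using z0 y \<kappa> by (simp add: q_def exp_add)
  qed
  then show ?thesis using R by (intro exI[of _ R]) auto
qed

lemma power_le_one_plus_powr:
  fixes x :: real
  shows "\<bar>x\<bar> ^ N \<le> 1 + \<bar>x\<bar> powr \<Lambda> 0"
proof (cases "\<bar>x\<bar> \<le> 1")
  case True
  then show ?thesis by (simp add: power_le_one add_increasing2)
next
  case False
  then have "\<bar>x\<bar> ^ N = \<bar>x\<bar> powr real N" by (simp add: powr_realpow)
  also have "\<dots> \<le> \<bar>x\<bar> powr \<Lambda> 0" using False N_le by (intro powr_mono) auto
  finally show ?thesis by simp
qed

lemma G_powr_integral:
  assumes "u \<in> G" "nG u \<le> 1"
  shows "(LINT x|\<mu>. \<bar>rep_ae_fun u x\<bar> powr \<Lambda> 0) \<le> 1" "integrable \<mu> (\<lambda>x. \<bar>rep_ae_fun u x\<bar> powr \<Lambda> 0)"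
  using powr_integral_le_1[OF G_Lp \<Lambda>_ge_1[OF le0]] Lp_norm_0_le_nG G_Lp assms
  by (force simp: Lp_space_iff)+

lemma G_moments:
  assumes u: "u \<in> G" "nG u \<le> 1"
  shows "integrable \<mu> (\<lambda>x. \<bar>rep_ae_fun u x\<bar> ^ N)" "(LINT x|\<mu>. \<bar>rep_ae_fun u x\<bar> ^ N) \<le> 2"
proof -
  have [measurable]: "rep_ae_fun u \<in> borel_measurable \<mu>" by (rule G_measurable[OF u(1)])
  have i: "integrable \<mu> (\<lambda>x. 1 + \<bar>rep_ae_fun u x\<bar> powr \<Lambda> 0)" using G_powr_integral[OF u] by simp
  show int: "integrable \<mu> (\<lambda>x. \<bar>rep_ae_fun u x\<bar> ^ N)"
    using power_le_one_plus_powr by (intro Bochner_Integration.integrable_bound[OF i]) auto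
  have "(LINT x|\<mu>. \<bar>rep_ae_fun u x\<bar> ^ N) \<le> (LINT x|\<mu>. 1 + \<bar>rep_ae_fun u x\<bar> powr \<Lambda> 0)"
    using power_le_one_plus_powr by (intro integral_mono int i) auto
  also have "\<dots> \<le> 2" using G_powr_integral[OF u] by (simp add: prob_space)
  finally show "(LINT x|\<mu>. \<bar>rep_ae_fun u x\<bar> ^ N) \<le> 2" .
qed

text \<open>Below a threshold T the N-th power is at most T^N. Above it, it is at most T^(N -
  \<Lambda> 0) times the power of order \<Lambda> 0, whose integral is at most 1. A large T makes
  the second part small, and then a small L1 norm of g the first.\<close>

lemma uniformly_integrable_subcritical:
  assumes less: "real N < \<Lambda> 0" and \<epsilon>: "0 < \<epsilon>" and K: "0 \<le> K"
  shows "\<exists>\<delta>>0. \<forall>g\<in>borel_measurable \<mu>. (\<forall>x. \<bar>g x\<bar> \<le> K) \<and> (LINT x|\<mu>. \<bar>g x\<bar>) \<le> \<delta> \<longrightarrow>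
      (\<forall>u\<in>G. nG u \<le> 1 \<longrightarrow> (LINT x|\<mu>. \<bar>g x\<bar> * \<bar>rep_ae_fun u x\<bar> ^ N) \<le> \<epsilon>)"
proof -
  have "((\<lambda>T. K * T powr (real N - \<Lambda> 0)) \<longlongrightarrow> K * 0) at_top"
    using less by (intro tendsto_intros tendsto_neg_powr filterlim_ident) auto
  then have "\<forall>\<^sub>F T in at_top. K * T powr (real N - \<Lambda> 0) < \<epsilon> / 2"
    using \<epsilon> by (intro order_tendstoD(2)[of _ "K * 0"]) auto
  then have "\<forall>\<^sub>F T in at_top. 1 \<le> T \<and> K * T powr (real N - \<Lambda> 0) < \<epsilon> / 2"
    using eventually_ge_at_top[of 1] by eventually_elim simp
  then obtain T where T: "1 \<le> T" "K * T powr (real N - \<Lambda> 0) < \<epsilon> / 2"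
    using eventually_happens by fastforce
  have split: "\<bar>x\<bar> ^ N \<le> T ^ N + T powr (real N - \<Lambda> 0) * \<bar>x\<bar> powr \<Lambda> 0" for x :: real
  proof (cases "\<bar>x\<bar> \<le> T")
    case True
    then show ?thesis by (simp add: power_mono add_increasing2)
  next
    case False
    then have "\<bar>x\<bar> ^ N = \<bar>x\<bar> powr (real N - \<Lambda> 0) * \<bar>x\<bar> powr \<Lambda> 0"
      using T by (simp add: powr_realpow flip: powr_add)
    also have "\<dots> \<le> T powr (real N - \<Lambda> 0) * \<bar>x\<bar> powr \<Lambda> 0"
      using False T less by (intro mult_right_mono powr_mono2') auto
    finally show ?thesis using T by (simp add: add_increasing)
  qed
  show ?thesis
  proof (intro exI[of _ "\<epsilon> / (2 * T ^ N)"] conjI ballI impI)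
    show "0 < \<epsilon> / (2 * T ^ N)" using \<epsilon> T by simp
    fix g :: "real^'d \<Rightarrow> real" and u
    assume g[measurable]: "g \<in> borel_measurable \<mu>" and gK: "(\<forall>x. \<bar>g x\<bar> \<le> K) \<and> (LINT x|\<mu>. \<bar>g x\<bar>) \<le> \<epsilon> / (2 * T ^ N)"
      and u: "u \<in> G" "nG u \<le> 1"
    have [measurable]: "rep_ae_fun u \<in> borel_measurable \<mu>" by (rule G_measurable[OF u(1)])
    have gi: "integrable \<mu> (\<lambda>x. \<bar>g x\<bar>)" using gK by (intro integrable_const_bound[of _ K]) auto
    let ?b = "\<lambda>x. T ^ N * \<bar>g x\<bar> + (K * T powr (real N - \<Lambda> 0)) * \<bar>rep_ae_fun u x\<bar> powr \<Lambda> 0"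
    have bi: "integrable \<mu> ?b" using gi G_powr_integral[OF u] by simp
    have le: "\<bar>g x\<bar> * \<bar>rep_ae_fun u x\<bar> ^ N \<le> ?b x" for x
    proof -
      have "\<bar>g x\<bar> * \<bar>rep_ae_fun u x\<bar> ^ N \<le> \<bar>g x\<bar> * (T ^ N + T powr (real N - \<Lambda> 0) * \<bar>rep_ae_fun u x\<bar> powr \<Lambda> 0)"
        by (intro mult_left_mono split) simp
      also have "\<dots> = T ^ N * \<bar>g x\<bar> + \<bar>g x\<bar> * (T powr (real N - \<Lambda> 0) * \<bar>rep_ae_fun u x\<bar> powr \<Lambda> 0)"
        by (simp add: algebra_simps)
      also have "\<dots> \<le> T ^ N * \<bar>g x\<bar> + K * (T powr (real N - \<Lambda> 0) * \<bar>rep_ae_fun u x\<bar> powr \<Lambda> 0)"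
        using gK by (intro add_left_mono mult_right_mono) auto
      finally show ?thesis by (simp add: mult.assoc)
    qed
    have "(LINT x|\<mu>. \<bar>g x\<bar> * \<bar>rep_ae_fun u x\<bar> ^ N) \<le> (LINT x|\<mu>. ?b x)"
      using le order_trans[OF le abs_ge_self]
      by (intro integral_mono bi Bochner_Integration.integrable_bound[OF bi]) (auto simp: abs_mult)
    also have "\<dots> = T ^ N * (LINT x|\<mu>. \<bar>g x\<bar>) + (K * T powr (real N - \<Lambda> 0)) * (LINT x|\<mu>. \<bar>rep_ae_fun u x\<bar> powr \<Lambda> 0)"
      using gi G_powr_integral[OF u] by simp
    also have "\<dots> \<le> T ^ N * (\<epsilon> / (2 * T ^ N)) + (\<epsilon> / 2) * 1"
      using gK T \<epsilon> K G_powr_integral[OF u] by (intro add_mono mult_left_mono mult_mono) auto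
    also have "\<dots> = \<epsilon>" using T by simp
    finally show "(LINT x|\<mu>. \<bar>g x\<bar> * \<bar>rep_ae_fun u x\<bar> ^ N) \<le> \<epsilon>" .
  qed
qed

lemma borel_representative:
  assumes "f \<in> borel_measurable \<mu>"
  shows "\<exists>f'\<in>borel_measurable borel. AE x in lebesgue. f x = (f' x :: real)"
proof -
  from completion_ex_borel_measurable_real[OF assms[unfolded measurable_\<mu>]]
  obtain f' where "f' \<in> borel_measurable lborel" "AE x in lborel. f x = f' x" by blast
  then show ?thesis using AE_completion by (intro bexI[of _ f']) auto
qed

lemma nn_integral_powr_le_1:
  assumes u: "u \<in> Lp_space \<mu> p" "Lp_norm \<mu> p u \<le> 1" and p: "p = real N"
    and f: "f \<in> borel_measurable borel" "AE x in lebesgue. rep_ae_fun u x = f x"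
  shows "(\<integral>\<^sup>+x. ennreal (r x) * ennreal (\<bar>f x\<bar> ^ N) \<partial>lborel) \<le> 1"
proof -
  have p1: "1 \<le> p" using N_ge_1 p by simp
  have i: "integrable \<mu> (\<lambda>x. \<bar>rep_ae_fun u x\<bar> powr p)" using u by (simp add: Lp_space_iff)
  have "(\<integral>\<^sup>+x. ennreal (r x) * ennreal (\<bar>f x\<bar> ^ N) \<partial>lborel) = (\<integral>\<^sup>+x. ennreal (\<bar>f x\<bar> ^ N) \<partial>\<mu>)"
    using f by (subst nn_integral_\<mu>) auto
  also have "\<dots> = (\<integral>\<^sup>+x. ennreal (\<bar>rep_ae_fun u x\<bar> powr p) \<partial>\<mu>)"
  proof (rule nn_integral_cong_AE)
    have "AE x in \<mu>. rep_ae_fun u x = f x" unfolding AE_\<mu> by (rule f)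
    then show "AE x in \<mu>. ennreal (\<bar>f x\<bar> ^ N) = ennreal (\<bar>rep_ae_fun u x\<bar> powr p)"
      by eventually_elim (use N_ge_1 in \<open>simp add: p powr_realpow'\<close>)
  qed
  also have "\<dots> = ennreal (LINT x|\<mu>. \<bar>rep_ae_fun u x\<bar> powr p)"
    using i by (intro nn_integral_eq_integral) auto
  also have "\<dots> \<le> 1" using powr_integral_le_1[OF u(1) p1 u(2)] by (simp add: ennreal_le_1)
  finally show ?thesis .
qed

text \<open>\<open>weighted_uniform_integrability\<close>, applied to Borel representatives. The
  equality of \<Lambda> 1 and \<Lambda> 0 with N puts the function and its first weak derivatives
  into the unit ball of one and the same Lebesgue space.\<close>

lemma uniformly_integrable_critical:
  assumes eq: "real N = \<Lambda> 0" and \<epsilon>: "0 < \<epsilon>" and K: "0 \<le> K"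
  shows "\<exists>\<delta>>0. \<forall>g\<in>borel_measurable \<mu>. (\<forall>x. \<bar>g x\<bar> \<le> K) \<and> (LINT x|\<mu>. \<bar>g x\<bar>) \<le> \<delta> \<longrightarrow>
      (\<forall>u\<in>G. nG u \<le> 1 \<longrightarrow> (LINT x|\<mu>. \<bar>g x\<bar> * \<bar>rep_ae_fun u x\<bar> ^ N) \<le> \<epsilon>)"
proof -
  have crit: "1 < t" "\<Lambda> 1 = \<Lambda> 0" using N_eq[OF eq] by auto
  from weighted_uniform_integrability[OF q_tail[OF crit(1)] N_ge_1 K \<epsilon>, where 'd = 'd]
  obtain \<eta> where UI: "0 < \<eta> \<and> (\<forall>(g :: real^'d \<Rightarrow> ennreal) (h :: real^'d \<Rightarrow> real) (v :: 'd \<Rightarrow> real^'d \<Rightarrow> real).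
    g \<in> borel_measurable borel \<longrightarrow> h \<in> borel_measurable borel \<longrightarrow>
    (\<forall>i. v i \<in> borel_measurable borel) \<longrightarrow> (\<forall>i. weak_deriv_fun ((\<lambda>_. 0)(i := 1)) h (v i)) \<longrightarrow>
    (\<forall>x. g x \<le> ennreal K) \<longrightarrow> (\<integral>\<^sup>+x. g x * ennreal (r x) \<partial>lborel) \<le> ennreal \<eta> \<longrightarrow>
    (\<integral>\<^sup>+x. ennreal (r x) * ennreal (\<bar>h x\<bar> ^ N) \<partial>lborel) \<le> 1 \<longrightarrow>
    (\<forall>i. (\<integral>\<^sup>+x. ennreal (r x) * ennreal (\<bar>v i x\<bar> ^ N) \<partial>lborel) \<le> 1) \<longrightarrow>
    (\<integral>\<^sup>+x. g x * ennreal (r x) * ennreal (\<bar>h x\<bar> ^ N) \<partial>lborel) \<le> ennreal \<epsilon>)"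
    ..
  note \<eta> = UI[THEN conjunct1]
  show ?thesis
  proof (intro exI[of _ \<eta>] conjI ballI impI \<eta>)
    fix g :: "real^'d \<Rightarrow> real" and u
    assume g: "g \<in> borel_measurable \<mu>" and gK: "(\<forall>x. \<bar>g x\<bar> \<le> K) \<and> (LINT x|\<mu>. \<bar>g x\<bar>) \<le> \<eta>"
      and u: "u \<in> G" "nG u \<le> 1"
    obtain g' where g'[measurable]: "g' \<in> borel_measurable borel" and gg': "AE x in lebesgue. g x = g' x"
      using borel_representative[OF g] by blast
    obtain h where h[measurable]: "h \<in> borel_measurable borel" and uh: "AE x in lebesgue. rep_ae_fun u x = h x"
      using borel_representative[OF G_measurable[OF u(1)]] by blast
    have s: "order_of ((\<lambda>_. 0)(i := 1)) \<le> k" for i :: 'd using k order_of_single[of i] by simp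
    note wd = weak_deriv_G[OF u(1) s]
    have wdL: "weak_deriv ((\<lambda>_. 0)(i := 1)) u \<in> Lp_space \<mu> (real N)" for i
      using wd(2)[of i] crit eq order_of_single[of i] by simp
    have wdn: "Lp_norm \<mu> (real N) (weak_deriv ((\<lambda>_. 0)(i := 1)) u) \<le> 1" for i
      using Lp_norm_le_nG[OF s, of i u] u(2) crit eq order_of_single[of i] by simp
    have "\<exists>f\<in>borel_measurable borel. AE x in lebesgue. rep_ae_fun (weak_deriv ((\<lambda>_. 0)(i := 1)) u) x = f x" for i
      using wdL[of i] by (intro borel_representative) (simp add: Lp_space_iff)
    then obtain v where v: "\<And>i. v i \<in> borel_measurable borel"
      "\<And>i. AE x in lebesgue. rep_ae_fun (weak_deriv ((\<lambda>_. 0)(i := 1)) u) x = v i x" by metis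
    \<comment> \<open>The Borel representative obeys the bound K only almost everywhere; the cap
      restores it at every point.\<close>
    define g1 where "g1 x = min (ennreal K) (ennreal \<bar>g' x\<bar>)" for x
    have g1m[measurable]: "g1 \<in> borel_measurable borel" unfolding g1_def by measurable
    have g1: "AE x in \<mu>. g1 x = ennreal \<bar>g x\<bar>"
      unfolding AE_\<mu> using gg'
    proof eventually_elim
      case (elim x)
      have "\<bar>g x\<bar> \<le> K" using gK by blast
      then show ?case using elim by (simp add: g1_def min_absorb2 ennreal_leI)
    qed
    have "(\<integral>\<^sup>+x. g1 x * ennreal (r x) * ennreal (\<bar>h x\<bar> ^ N) \<partial>lborel) \<le> ennreal \<epsilon>"
    proof (rule UI[THEN conjunct2, rule_format, of g1 h v, OF g1m h])
      show "weak_deriv_fun ((\<lambda>_. 0)(i := 1)) h (v i)" for i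
        using wd(1)[of i] uh v(2) unfolding has_weak_derivative_iff by (blast intro: weak_deriv_fun_cong_AE)
      show "g1 x \<le> ennreal K" for x by (simp add: g1_def)
      have gi: "integrable \<mu> (\<lambda>x. \<bar>g x\<bar>)" using gK g by (intro integrable_const_bound[of _ K]) auto
      have "(\<integral>\<^sup>+x. g1 x * ennreal (r x) \<partial>lborel) = (\<integral>\<^sup>+x. g1 x \<partial>\<mu>)"
        by (subst nn_integral_\<mu>) (auto simp: mult.commute)
      also have "\<dots> = (\<integral>\<^sup>+x. ennreal \<bar>g x\<bar> \<partial>\<mu>)" by (rule nn_integral_cong_AE[OF g1])
      also have "\<dots> = ennreal (LINT x|\<mu>. \<bar>g x\<bar>)" using gi by (intro nn_integral_eq_integral) auto
      also have "\<dots> \<le> ennreal \<eta>" using gK by (intro ennreal_leI) simp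
      finally show "(\<integral>\<^sup>+x. g1 x * ennreal (r x) \<partial>lborel) \<le> ennreal \<eta>" .
      show "(\<integral>\<^sup>+x. ennreal (r x) * ennreal (\<bar>h x\<bar> ^ N) \<partial>lborel) \<le> 1"
        using G_Lp[OF u(1)] order_trans[OF Lp_norm_0_le_nG[OF u(1)] u(2)] uh h
        by (intro nn_integral_powr_le_1[where u = u and p = "\<Lambda> 0"]) (simp_all add: eq)
      show "(\<integral>\<^sup>+x. ennreal (r x) * ennreal (\<bar>v i x\<bar> ^ N) \<partial>lborel) \<le> 1" for i
        using nn_integral_powr_le_1[OF wdL wdn refl v] by blast
    qed (use v in auto)
    then have "(\<integral>\<^sup>+x. g1 x * ennreal (\<bar>h x\<bar> ^ N) \<partial>\<mu>) \<le> ennreal \<epsilon>"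
      by (subst nn_integral_\<mu>) (auto simp: ac_simps)
    also have "(\<integral>\<^sup>+x. g1 x * ennreal (\<bar>h x\<bar> ^ N) \<partial>\<mu>) = (\<integral>\<^sup>+x. ennreal (\<bar>g x\<bar> * \<bar>rep_ae_fun u x\<bar> ^ N) \<partial>\<mu>)"
    proof (rule nn_integral_cong_AE)
      have "AE x in \<mu>. rep_ae_fun u x = h x" unfolding AE_\<mu> by (rule uh)
      with g1 show "AE x in \<mu>. g1 x * ennreal (\<bar>h x\<bar> ^ N) = ennreal (\<bar>g x\<bar> * \<bar>rep_ae_fun u x\<bar> ^ N)"
        by eventually_elim (simp add: ennreal_mult)
    qed
    finally show "(LINT x|\<mu>. \<bar>g x\<bar> * \<bar>rep_ae_fun u x\<bar> ^ N) \<le> \<epsilon>"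
      using \<epsilon> by (intro integral_real_bounded) auto
  qed
qed

sublocale S: moment_space \<mu> G nG rep_ae_fun "const_fun 1" N
proof
  show "subspace G" by (rule subspace_G)
  show "0 \<le> nG u" for u by (simp add: nG_eq)
  show "u = 0" if "u \<in> G" "nG u = 0" for u using nG_eq_0 that by blast
  show "nG (u + v) \<le> nG u + nG v" if "u \<in> G" "v \<in> G" for u v using nG_add that by blast
  show "nG (c *\<^sub>R u) = \<bar>c\<bar> * nG u" if "u \<in> G" for u c using nG_scale that by blast
  show "rep_ae_fun u \<in> borel_measurable \<mu>" if "u \<in> G" for u using G_measurable that by blast
  show "AE x in \<mu>. rep_ae_fun (u + v) x = rep_ae_fun u x + rep_ae_fun v x" for u v by (rule rep_add_\<mu>)
  show "AE x in \<mu>. rep_ae_fun (c *\<^sub>R u) x = c * rep_ae_fun u x" for u c by (rule rep_scale_\<mu>)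
  show "const_fun 1 \<in> G" by (rule const_fun_G)
  show "AE x in \<mu>. rep_ae_fun (const_fun 1) x = 1" by (rule rep_const_fun)
  show "1 \<le> N" by (rule N_ge_1)
  show "\<exists>C. \<forall>u\<in>G. nG u \<le> 1 \<longrightarrow> integrable \<mu> (\<lambda>x. \<bar>rep_ae_fun u x\<bar> ^ N) \<and> (LINT x|\<mu>. \<bar>rep_ae_fun u x\<bar> ^ N) \<le> C"
    using G_moments by blast
  show "\<exists>\<delta>>0. \<forall>g\<in>borel_measurable \<mu>. (\<forall>x. \<bar>g x\<bar> \<le> K) \<and> (LINT x|\<mu>. \<bar>g x\<bar>) \<le> \<delta> \<longrightarrow>
      (\<forall>u\<in>G. nG u \<le> 1 \<longrightarrow> (LINT x|\<mu>. \<bar>g x\<bar> * \<bar>rep_ae_fun u x\<bar> ^ N) \<le> \<epsilon>)" if \<epsilon>: "0 < \<epsilon>" for \<epsilon> K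
  proof -
    \<comment> \<open>The locale admits every real K, whereas the two preceding lemmas are for
      nonnegative bounds.\<close>
    have "\<exists>\<delta>>0. \<forall>g\<in>borel_measurable \<mu>. (\<forall>x. \<bar>g x\<bar> \<le> max 0 K) \<and> (LINT x|\<mu>. \<bar>g x\<bar>) \<le> \<delta> \<longrightarrow>
      (\<forall>u\<in>G. nG u \<le> 1 \<longrightarrow> (LINT x|\<mu>. \<bar>g x\<bar> * \<bar>rep_ae_fun u x\<bar> ^ N) \<le> \<epsilon>)"
      using uniformly_integrable_subcritical[OF _ \<epsilon>] uniformly_integrable_critical[OF _ \<epsilon>] N_le
      by (cases "real N = \<Lambda> 0") auto
    then show ?thesis by (meson max.coboundedI2)
  qed
qed

end

section \<open>The charts\<close>

lemma C_map_cong: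
  assumes "C_map n E nE F nF f" "\<And>a. a \<in> E \<Longrightarrow> f a = g a"
  shows "C_map n E nE F nF g"
  using assms unfolding C_map_def by (simp cong: ball_cong_simp)

text \<open>The inclusion in charts is known to agree with the explicit map on the carrier only. A
  subspace contains a + h together with a and h, so the derivatives agree as well.\<close>

lemma immersion_cong:
  assumes f: "immersion E nE F nF f" and eq: "\<And>a. a \<in> E \<Longrightarrow> f a = g a" and E: "subspace E"
  shows "immersion E nE F nF g"
  unfolding immersion_def
proof
  fix a assume a: "a \<in> E"
  then obtain A where A: "has_frechet_derivative E nE nF f A a" "toplinear_iso_onto_image E nE F nF A"
    "closed_subspace_in F nF (A ` E)" "splits F nF (A ` E)" using f unfolding immersion_def by blast
  have "has_frechet_derivative E nE nF g A a"
    using A(1) eq a subspace_add[OF E a] unfolding has_frechet_derivative_def by simp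
  then show "\<exists>A. has_frechet_derivative E nE nF g A a \<and> toplinear_iso_onto_image E nE F nF A \<and>
    closed_subspace_in F nF (A ` E) \<and> splits F nF (A ` E)" using A by blast
qed

section \<open>The charts and their inverses\<close>

context reference_setting
begin

definition of_chart :: "'d ae_fun \<Rightarrow> (real^'d) measure" where
  "of_chart u = density \<mu> (\<lambda>x. ennreal (exp_d (rep_ae_fun u x)))"

lemma real_density_measurable: "real_density \<mu> P \<in> borel_measurable \<mu>"
  unfolding real_density_def[abs_def] by measurable

text \<open>The Radon-Nikodym derivative is finite almost everywhere because P is finite. The set
  where it vanishes is a null set of P, hence one of \<mu> by absolute continuity.\<close>

lemma equivalent_measure_density:
  assumes P: "sets P = sets \<mu>" "finite_measure P" "absolutely_continuous \<mu> P" "absolutely_continuous P \<mu>"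
  shows "AE x in \<mu>. 0 < real_density \<mu> P x"
    and "density \<mu> (\<lambda>x. ennreal (real_density \<mu> P x)) = P"
proof -
  have dens: "density \<mu> (RN_deriv \<mu> P) = P" using P by (intro density_RN_deriv) auto
  have fin: "AE x in \<mu>. RN_deriv \<mu> P x \<noteq> \<infinity>"
    using P by (intro RN_deriv_finite finite_measure.axioms(1))
  then have eq: "AE x in \<mu>. ennreal (real_density \<mu> P x) = RN_deriv \<mu> P x"
    by eventually_elim (simp add: real_density_def less_top)
  then have "density \<mu> (\<lambda>x. ennreal (real_density \<mu> P x)) = density \<mu> (RN_deriv \<mu> P)"
    by (intro density_cong) (auto intro: measurable_compose[OF real_density_measurable])
  then show "density \<mu> (\<lambda>x. ennreal (real_density \<mu> P x)) = P" using dens by simp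
  let ?Z = "{x \<in> space \<mu>. RN_deriv \<mu> P x = 0}"
  have Z: "?Z \<in> sets \<mu>" by measurable
  have "emeasure P ?Z = (\<integral>\<^sup>+x. RN_deriv \<mu> P x * indicator ?Z x \<partial>\<mu>)"
    using Z by (subst dens[symmetric], subst emeasure_density) auto
  also have "\<dots> = (\<integral>\<^sup>+x. 0 \<partial>\<mu>)" by (intro nn_integral_cong) (auto simp: indicator_def)
  finally have "?Z \<in> null_sets P" using Z P(1) by (simp add: null_sets_def)
  then have "?Z \<in> null_sets \<mu>" using P(4) by (auto simp: absolutely_continuous_def)
  then have "AE x in \<mu>. x \<notin> ?Z" by (rule AE_not_in)
  with fin AE_space show "AE x in \<mu>. 0 < real_density \<mu> P x"
    by eventually_elim (simp add: real_density_def enn2real_positive_iff less_top zero_less_iff_neq_zero)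
qed

lemma rep_chart: "AE x in \<mu>. rep_ae_fun (chart \<mu> P) x = log_d (real_density \<mu> P x)"
  unfolding AE_\<mu> chart_def by (rule rep_abs_ae_fun)

lemma exp_d_measurable: "u \<in> G \<Longrightarrow> (\<lambda>x. exp_d (rep_ae_fun u x)) \<in> borel_measurable \<mu>"
  using measurable_compose[OF G_measurable borel_measurable_exp_d] .

lemma finite_measures_chart:
  assumes P: "P \<in> finite_measures \<mu> G"
  shows "chart \<mu> P \<in> G" "of_chart (chart \<mu> P) = P"
    and "(LINT x|\<mu>. real_density \<mu> P x) = expectation (\<lambda>x. exp_d (rep_ae_fun (chart \<mu> P) x))"
proof -
  show u: "chart \<mu> P \<in> G" using P by (simp add: finite_measures_def)
  have pos: "AE x in \<mu>. 0 < real_density \<mu> P x" and d: "density \<mu> (\<lambda>x. ennreal (real_density \<mu> P x)) = P"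
    using P equivalent_measure_density[of P] by (auto simp: finite_measures_def)
  from rep_chart[of P] pos have eq: "AE x in \<mu>. exp_d (rep_ae_fun (chart \<mu> P) x) = real_density \<mu> P x"
    by eventually_elim (simp add: exp_d_log_d)
  have "of_chart (chart \<mu> P) = density \<mu> (\<lambda>x. ennreal (real_density \<mu> P x))"
    unfolding of_chart_def
  proof (rule density_cong)
    show "AE x in \<mu>. ennreal (exp_d (rep_ae_fun (chart \<mu> P) x)) = ennreal (real_density \<mu> P x)"
      using eq by eventually_elim simp
  qed (use measurable_compose[OF exp_d_measurable[OF u] measurable_ennreal]
      measurable_compose[OF real_density_measurable measurable_ennreal] in auto)
  then show "of_chart (chart \<mu> P) = P" using d by simp
  show "(LINT x|\<mu>. real_density \<mu> P x) = expectation (\<lambda>x. exp_d (rep_ae_fun (chart \<mu> P) x))"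
    using eq by (intro integral_cong_AE real_density_measurable exp_d_measurable u) (auto elim: eventually_mono)
qed

lemma of_chart_finite_measure:
  assumes u: "u \<in> G"
  shows "of_chart u \<in> finite_measures \<mu> G" "chart \<mu> (of_chart u) = u"
proof -
  let ?P = "of_chart u"
  have m: "(\<lambda>x. ennreal (exp_d (rep_ae_fun u x))) \<in> borel_measurable \<mu>"
    using measurable_compose[OF exp_d_measurable[OF u] measurable_ennreal] .
  have i: "integrable \<mu> (\<lambda>x. exp_d (rep_ae_fun u x))"
    using integrable_exp_d[OF S.integrable_rep[OF u]] .
  have "AE x in \<mu>. ennreal (exp_d (rep_ae_fun u x)) = RN_deriv \<mu> ?P x"
    by (rule RN_deriv_unique[OF m]) (simp add: of_chart_def)
  then have "AE x in \<mu>. log_d (real_density \<mu> ?P x) = rep_ae_fun u x"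
    by eventually_elim (metis enn2real_ennreal exp_d(1) exp_d(2) less_imp_le real_density_def)
  then have "AE x in lebesgue. log_d (real_density \<mu> ?P x) = rep_ae_fun u x" unfolding AE_\<mu> .
  then have "chart \<mu> ?P = abs_ae_fun (rep_ae_fun u)" unfolding chart_def by (rule abs_ae_fun_eqI)
  then show chart: "chart \<mu> ?P = u" by (simp add: abs_rep_ae_fun)
  have "finite_measure ?P"
  proof
    have "emeasure ?P (space ?P) = (\<integral>\<^sup>+x. ennreal (exp_d (rep_ae_fun u x)) \<partial>\<mu>)"
      unfolding of_chart_def using m by (subst emeasure_density) (auto intro!: nn_integral_cong)
    also have "\<dots> = ennreal (expectation (\<lambda>x. exp_d (rep_ae_fun u x)))"
      using i exp_d(1) by (intro nn_integral_eq_integral) (auto intro: less_imp_le)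
    finally show "emeasure ?P (space ?P) \<noteq> \<infinity>" by simp
  qed
  moreover have "absolutely_continuous \<mu> ?P"
    unfolding of_chart_def by (rule absolutely_continuousI_density[OF m])
  moreover have "absolutely_continuous ?P \<mu>"
    unfolding absolutely_continuous_def
  proof
    fix A assume "A \<in> null_sets ?P"
    then have "AE x in \<mu>. x \<in> A \<longrightarrow> ennreal (exp_d (rep_ae_fun u x)) = 0" "A \<in> sets \<mu>"
      unfolding of_chart_def using null_sets_density_iff[OF m] by auto
    moreover have "ennreal (exp_d y) \<noteq> 0" for y using exp_d(1)[of y] by simp
    ultimately show "A \<in> null_sets \<mu>" by (simp add: AE_iff_null_sets)
  qed
  moreover have "sets ?P = sets \<mu>" by (simp add: of_chart_def)
  ultimately show "?P \<in> finite_measures \<mu> G" using chart u by (simp add: finite_measures_def)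
qed

lemma bij_chart: "bij_betw (chart \<mu>) (finite_measures \<mu> G) G"
  by (rule bij_betw_byWitness[where f' = of_chart])
    (auto simp: finite_measures_chart of_chart_finite_measure)

lemma rep_add_const:
  assumes "u \<in> G"
  shows "AE x in \<mu>. rep_ae_fun (u + c *\<^sub>R const_fun 1) x = rep_ae_fun u x + c"
  using rep_add_\<mu>[of u "c *\<^sub>R const_fun 1"] rep_scale_\<mu>[of c "const_fun 1"] rep_const_fun[of 1]
  by eventually_elim simp

lemma expectation_exp_d_add_const:
  assumes u: "u \<in> G"
  shows "expectation (\<lambda>x. exp_d (rep_ae_fun (u + c *\<^sub>R const_fun 1) x)) = expectation (\<lambda>x. exp_d (rep_ae_fun u x + c))"
proof (rule integral_cong_AE)
  show "AE x in \<mu>. exp_d (rep_ae_fun (u + c *\<^sub>R const_fun 1) x) = exp_d (rep_ae_fun u x + c)"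
    using rep_add_const[OF u, of c] by eventually_elim simp
  show "(\<lambda>x. exp_d (rep_ae_fun (u + c *\<^sub>R const_fun 1) x)) \<in> borel_measurable \<mu>"
    by (intro exp_d_measurable G_add G_scale const_fun_G u)
  show "(\<lambda>x. exp_d (rep_ae_fun u x + c)) \<in> borel_measurable \<mu>"
    by (rule measurable_compose[OF borel_measurable_add[OF G_measurable[OF u] borel_measurable_const] borel_measurable_exp_d])
qed

lemma prob_measures_iff:
  "P \<in> prob_measures \<mu> G \<longleftrightarrow> P \<in> finite_measures \<mu> G \<and> expectation (\<lambda>x. exp_d (rep_ae_fun (chart \<mu> P) x)) = 1"
  using finite_measures_chart(3) by (auto simp: prob_measures_def)

lemma chart0_eq: "chart\<^sub>0 \<mu> P = S.centring (chart \<mu> P)"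
  unfolding chart\<^sub>0_def S.centring_def mean_def const_fun_def[symmetric] by (subst const_fun_eq_scale) simp

lemma centred_eq: "centred \<mu> G = S.G0"
  by (simp add: centred_def S.G0_def mean_def)

lemma inclusion_prob_measure:
  assumes a: "a \<in> S.G0"
  shows "of_chart (S.inclusion a) \<in> prob_measures \<mu> G" "chart\<^sub>0 \<mu> (of_chart (S.inclusion a)) = a"
proof -
  have aG: "a \<in> G" using a S.G0_subset by blast
  note i = S.inclusion_in[OF aG]
  have "expectation (\<lambda>x. exp_d (rep_ae_fun (S.inclusion a) x)) = 1"
    unfolding S.inclusion_def expectation_exp_d_add_const[OF aG] by (rule S.Z[OF aG])
  then show "of_chart (S.inclusion a) \<in> prob_measures \<mu> G"
    unfolding prob_measures_iff using of_chart_finite_measure[OF i] by simp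
  show "chart\<^sub>0 \<mu> (of_chart (S.inclusion a)) = a"
    unfolding chart0_eq of_chart_finite_measure(2)[OF i]
    using S.centring_add_one[OF aG] S.centring_G0[OF a] by (simp add: S.inclusion_def)
qed

text \<open>Adding the mean back to the centred chart recovers the chart of a density with total
  mass 1. By uniqueness of the normalising constant, the mean is the value of
  \<open>Z\<close>.\<close>

lemma inclusion_chart0:
  assumes P: "P \<in> prob_measures \<mu> G"
  shows "S.inclusion (chart\<^sub>0 \<mu> P) = chart \<mu> P"
proof -
  define u where "u = chart \<mu> P"
  have u: "u \<in> G" "expectation (\<lambda>x. exp_d (rep_ae_fun u x)) = 1"
    using P finite_measures_chart(1) by (auto simp: u_def prob_measures_iff)
  let ?m = "expectation (rep_ae_fun u)"
  have cG: "S.centring u \<in> G" using S.centring_in[OF u(1)] S.G0_subset by blast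
  have eq: "S.centring u + ?m *\<^sub>R const_fun 1 = u" by (simp add: S.centring_def)
  have "S.Z (S.centring u) = ?m"
    using expectation_exp_d_add_const[OF cG, of ?m] u(2) unfolding eq by (intro S.Z_unique[OF cG]) simp
  then show ?thesis unfolding chart0_eq u_def[symmetric] S.inclusion_def using eq by simp
qed

lemma bij_chart0: "bij_betw (chart\<^sub>0 \<mu>) (prob_measures \<mu> G) S.G0"
proof (rule bij_betw_byWitness[where f' = "\<lambda>a. of_chart (S.inclusion a)"])
  show "\<forall>P\<in>prob_measures \<mu> G. of_chart (S.inclusion (chart\<^sub>0 \<mu> P)) = P"
    using inclusion_chart0 finite_measures_chart(2) by (auto simp: prob_measures_iff)
  show "chart\<^sub>0 \<mu> ` prob_measures \<mu> G \<subseteq> S.G0"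
    using S.centring_in finite_measures_chart(1) by (auto simp: chart0_eq prob_measures_iff)
qed (use inclusion_prob_measure in auto)

lemma embedded: "embedded_submanifold N (prob_measures \<mu> G) (centred \<mu> G) nG (chart\<^sub>0 \<mu>)
    (finite_measures \<mu> G) G nG (chart \<mu>)"
proof -
  let ?\<rho> = "chart \<mu> \<circ> inv_into (prob_measures \<mu> G) (chart\<^sub>0 \<mu>)"
  have eq: "S.inclusion a = ?\<rho> a" if a: "a \<in> S.G0" for a
  proof -
    have "inv_into (prob_measures \<mu> G) (chart\<^sub>0 \<mu>) a = of_chart (S.inclusion a)"
      using bij_chart0 inclusion_prob_measure[OF a] by (intro inv_into_f_eq) (auto simp: bij_betw_def)
    then show ?thesis
      using of_chart_finite_measure(2)[OF S.inclusion_in, of a] a S.G0_subset by auto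
  qed
  have "C_map N S.G0 nG G nG ?\<rho>"
    by (rule C_map_cong[OF S.C_map_inclusion eq])
  moreover have "embedding_map (norm_topology S.G0 nG) (norm_topology G nG) ?\<rho>"
  proof (rule embedding_map_eq[OF S.embedding_map_inclusion])
    show "S.inclusion a = ?\<rho> a" if "a \<in> topspace (norm_topology S.G0 nG)" for a
      using that eq by (simp add: S.topspace_norm_topology[OF S.subspace_G0 S.G0_subset])
  qed
  moreover have "immersion S.G0 nG G nG ?\<rho>"
    by (rule immersion_cong[OF S.immersion_inclusion eq S.subspace_G0])
  moreover have "prob_measures \<mu> G \<subseteq> finite_measures \<mu> G" by (auto simp: prob_measures_def)
  ultimately show ?thesis
    unfolding embedded_submanifold_def Let_def centred_eq using bij_chart bij_chart0 by blast
qed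

end

theorem proposition6:
  fixes t C :: real and \<theta> :: "real \<Rightarrow> real" and k :: nat and \<Lambda> :: "nat \<Rightarrow> real"
    and \<mu> :: "(real^'d::finite) measure" and G :: "'d ae_fun set" and nG :: "'d ae_fun \<Rightarrow> real"
  assumes "0 < t" and "t \<le> 2"
    and "admissible_potential t \<theta>"
    and "(LINT z|lborel. exp (C - \<theta> \<bar>z\<bar>)) = 1"
    and "1 \<le> k"
    and "antimono_on {0..k} \<Lambda>" and "1 \<le> \<Lambda> k"
    and "\<Lambda> 0 > 1 \<or> (\<Lambda> 0 = 1 \<and> 1 < t \<and> t \<le> 2 \<and> \<Lambda> 1 = \<Lambda> 0)"
  defines "\<mu> \<equiv> reference_measure C \<theta>"
    and "G \<equiv> sobolev_space \<mu> k \<Lambda>"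
    and "nG \<equiv> sobolev_norm \<mu> k \<Lambda>"
  shows "embedded_submanifold (smoothness_order t \<Lambda>)
    (prob_measures \<mu> G) (centred \<mu> G) nG (chart\<^sub>0 \<mu>)
    (finite_measures \<mu> G) G nG (chart \<mu>)"
proof -
  interpret R: reference_setting t C \<theta> k \<Lambda> \<mu>
    by standard (use assms in auto)
  show ?thesis
    using R.embedded unfolding R.G_def R.nG_def G_def nG_def .
qed

end
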